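(* Let $d\in\mathbb{N}$ and let $\mathcal{H}$ be a second order differential expression with coefficients $A,b,c$ and constants $\vartheta_1\ge 1$, $\vartheta_2\ge 0$ as described in the context. Let $D_0,R\in(0,\infty)$, $\delta\in(0,2R)$, $K_V,\beta\in[0,\infty)$, and assume $$\epsilon_0:=1-33\,\mathrm{e}\,d\,R\,\vartheta_1^6\,\vartheta_2>0 .$$ Then there is a constant $C_{\mathrm{qUC}}>0$, depending only on $d,\vartheta_1,\vartheta_2,R,D_0,K_V,\|b\|_\infty,\|c\|_\infty,\delta,\beta$, such that for any open $\Omega\subset\mathbb{R}^d$, any $x\in\Omega$ and any measurable $\Theta\subset\Omega$ satisfying $$\Theta\subset\overline{B(x,R)}\setminus B(x,\delta/2)\quad\text{and}\quad B(x,2\mathrm{e}\vartheta_1R+2D_0)\subset\Omega,$$ any measurable $V:\Omega\to[-K_V,K_V]$, any $\zeta\in L^2(\Omega)$ and any $\psi\in W^{2,2}(\Omega)$ satisfying $$|\mathcal{H}\psi|\le|V\psi|+|\zeta|\ \text{ a.e. on }\Omega\qquad\text{and}\qquad\frac{\|\psi\|_\Omega^2}{\|\psi\|_\Theta^2}\le\beta,$$ we have $$\|\psi\|_{B(x,\delta)}^2+\delta^2\|\zeta\|_\Omega^2\ \ge\ C_{\mathrm{qUC}}\,\|\psi\|_\Theta^2 .$$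
   Context: The differential expression is $$\mathcal{H}u=-\operatorname{div}(A\nabla u)+b^{\mathrm T}\nabla u+cu=-\sum_{i,j=1}^d\partial_i(a^{ij}\partial_j u)+\sum_{i=1}^d b_i\partial_i u+cu,$$ where $A=(a^{ij})_{i,j=1}^d:\mathbb{R}^d\to\mathbb{R}^{d\times d}$, $b:\mathbb{R}^d\to\mathbb{C}^d$, $c:\mathbb{R}^d\to\mathbb{C}$, and $\partial_i$ is the $i$-th weak derivative. Standing assumptions: $a^{ij}\equiv a^{ji}$ for all $i,j$; $b,c\in L^\infty(\mathbb{R}^d)$; and for all $x,y,\xi\in\mathbb{R}^d$ $$\vartheta_1^{-1}|\xi|^2\le \xi^{\mathrm T}A(x)\xi\le\vartheta_1|\xi|^2,\qquad \|A(x)-A(y)\|_\infty\le\vartheta_2|x-y| ,$$ where $|\cdot|$ is the Euclidean norm and $\|M\|_\infty$ is the row sum norm of a matrix $M$. For functions, $\|\cdot\|_\infty$ is the $L^\infty$-norm. Function spaces consist of complex-valued functions. For measurable $\Gamma$, $\|\psi\|_\Gamma$ is the $L^2$-norm of $\psi$ over $\Gamma$. $B(x,\rho)$ is the open ball with center $x$ and radius $\rho$. *)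

theory Defs
  imports "HOL-Analysis.Analysis" "HOL-Probability.Essential_Supremum"
begin

definition row_sum_norm :: "real ^ 'n ^ 'm \<Rightarrow> real" where
  "row_sum_norm M = Max (range (\<lambda>i. \<Sum>j\<in>UNIV. \<bar>M $ i $ j\<bar>))"

definition in_Linf :: "('a::euclidean_space \<Rightarrow> 'b::real_normed_vector) \<Rightarrow> bool" where
  "in_Linf f \<longleftrightarrow> f \<in> borel_measurable lebesgue \<and> esssup lebesgue (\<lambda>x. ereal (norm (f x))) < \<infinity>"

text \<open>For vector-valued \<open>f\<close> the pointwise norm is the Euclidean one.\<close>

definition Linf_norm :: "('a::euclidean_space \<Rightarrow> 'b::real_normed_vector) \<Rightarrow> real" where
  "Linf_norm f = real_of_ereal (esssup lebesgue (\<lambda>x. ereal (norm (f x))))"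

definition in_L2 :: "'a::euclidean_space set \<Rightarrow> ('a \<Rightarrow> complex) \<Rightarrow> bool" where
  "in_L2 S f \<longleftrightarrow> f \<in> borel_measurable (lebesgue_on S)
     \<and> integrable (lebesgue_on S) (\<lambda>x. (cmod (f x))\<^sup>2)"

definition L2_norm :: "'a::euclidean_space set \<Rightarrow> ('a \<Rightarrow> complex) \<Rightarrow> real" where
  "L2_norm S f = sqrt (LINT x|lebesgue_on S. (cmod (f x))\<^sup>2)"

definition locally_integrable :: "'a::euclidean_space set \<Rightarrow> ('a \<Rightarrow> complex) \<Rightarrow> bool" where
  "locally_integrable \<Omega> f \<longleftrightarrow> (\<forall>K. compact K \<longrightarrow> K \<subseteq> \<Omega> \<longrightarrow> integrable (lebesgue_on K) f)"

definition partial_deriv :: "'n::finite \<Rightarrow> (real ^ 'n \<Rightarrow> complex) \<Rightarrow> real ^ 'n \<Rightarrow> complex" where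
  "partial_deriv i f x = frechet_derivative f (at x) (axis i 1)"

text \<open>
  Multi-indices are lists of coordinate directions: the list \<open>[i\<^sub>1, \<dots>, i\<^sub>m]\<close> stands for
  the operator \<open>\<partial>\<^bsub>i\<^sub>1\<^esub> \<dots> \<partial>\<^bsub>i\<^sub>m\<^esub>\<close>, of order \<open>m\<close>. On smooth functions the order of
  the entries is immaterial.
\<close>

definition iterated_partial ::
    "'n::finite list \<Rightarrow> (real ^ 'n \<Rightarrow> complex) \<Rightarrow> real ^ 'n \<Rightarrow> complex" where
  "iterated_partial \<alpha> f = foldr partial_deriv \<alpha> f"

text \<open>
  All iterated partial derivatives are (Frechet) differentiable everywhere, hence also
  continuous; this is the same as being of class \<open>C\<^sup>\<infinity>\<close>.
\<close>

definition smooth :: "(real ^ 'n::finite \<Rightarrow> complex) \<Rightarrow> bool" where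
  "smooth f \<longleftrightarrow> (\<forall>\<alpha> x. iterated_partial \<alpha> f differentiable (at x))"

definition test_function :: "(real ^ 'n::finite) set \<Rightarrow> (real ^ 'n \<Rightarrow> complex) \<Rightarrow> bool" where
  "test_function \<Omega> \<phi> \<longleftrightarrow> smooth \<phi> \<and> compact (closure {x. \<phi> x \<noteq> 0}) \<and> closure {x. \<phi> x \<noteq> 0} \<subseteq> \<Omega>"

definition has_weak_deriv ::
    "(real ^ 'n::finite) set \<Rightarrow> 'n list \<Rightarrow> (real ^ 'n \<Rightarrow> complex) \<Rightarrow> (real ^ 'n \<Rightarrow> complex) \<Rightarrow> bool" where
  "has_weak_deriv \<Omega> \<alpha> f g \<longleftrightarrow> locally_integrable \<Omega> f \<and> locally_integrable \<Omega> g \<and>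
     (\<forall>\<phi>. test_function \<Omega> \<phi> \<longrightarrow>
        (LINT x|lebesgue_on \<Omega>. f x * iterated_partial \<alpha> \<phi> x)
          = (-1) ^ length \<alpha> * (LINT x|lebesgue_on \<Omega>. g x * \<phi> x))"

text \<open>The Sobolev space \<open>W\<^sup>k\<^sup>,\<^sup>2(\<Omega>)\<close>.\<close>

definition in_W2 :: "nat \<Rightarrow> (real ^ 'n::finite) set \<Rightarrow> (real ^ 'n \<Rightarrow> complex) \<Rightarrow> bool" where
  "in_W2 k \<Omega> f \<longleftrightarrow> in_L2 \<Omega> f \<and>
     (\<forall>\<alpha>. length \<alpha> \<le> k \<longrightarrow> (\<exists>g. in_L2 \<Omega> g \<and> has_weak_deriv \<Omega> \<alpha> f g))"

text \<open>
  An arbitrary representative of the weak derivative \<open>\<partial>\<^sub>i f\<close> on \<open>\<Omega>\<close>, which for open \<open>\<Omega>\<close>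
  is unique up to null sets. It is meaningful only if the weak derivative exists, which is
  the case wherever it is applied below to \<open>f\<close> in \<open>W\<^sup>2\<^sup>,\<^sup>2(\<Omega>)\<close>, since the leading coefficients
  are bounded and Lipschitz.
\<close>

definition weak_partial ::
    "(real ^ 'n::finite) set \<Rightarrow> 'n \<Rightarrow> (real ^ 'n \<Rightarrow> complex) \<Rightarrow> real ^ 'n \<Rightarrow> complex" where
  "weak_partial \<Omega> i f = (SOME g. has_weak_deriv \<Omega> [i] f g)"

definition diff_expr ::
    "(real ^ 'n::finite) set \<Rightarrow> (real ^ 'n \<Rightarrow> real ^ 'n ^ 'n) \<Rightarrow> (real ^ 'n \<Rightarrow> complex ^ 'n)
      \<Rightarrow> (real ^ 'n \<Rightarrow> complex) \<Rightarrow> (real ^ 'n \<Rightarrow> complex) \<Rightarrow> real ^ 'n \<Rightarrow> complex" where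
  "diff_expr \<Omega> A b c u x =
     - (\<Sum>i\<in>UNIV. \<Sum>j\<in>UNIV.
          weak_partial \<Omega> i (\<lambda>y. complex_of_real (A y $ i $ j) * weak_partial \<Omega> j u y) x)
     + (\<Sum>i\<in>UNIV. b x $ i * weak_partial \<Omega> i u x) + c x * u x"

definition admissible_coeffs ::
    "real \<Rightarrow> real \<Rightarrow> (real ^ 'n::finite \<Rightarrow> real ^ 'n ^ 'n) \<Rightarrow> (real ^ 'n \<Rightarrow> complex ^ 'n)
      \<Rightarrow> (real ^ 'n \<Rightarrow> complex) \<Rightarrow> bool" where
  "admissible_coeffs \<theta>\<^sub>1 \<theta>\<^sub>2 A b c \<longleftrightarrow>
     (\<forall>x i j. A x $ i $ j = A x $ j $ i) \<and>
     (\<forall>x \<xi>. inverse \<theta>\<^sub>1 * (norm \<xi>)\<^sup>2 \<le> \<xi> \<bullet> (A x *v \<xi>) \<and> \<xi> \<bullet> (A x *v \<xi>) \<le> \<theta>\<^sub>1 * (norm \<xi>)\<^sup>2) \<and>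
     (\<forall>x y. row_sum_norm (A x - A y) \<le> \<theta>\<^sub>2 * norm (x - y)) \<and>
     in_Linf b \<and> in_Linf c"

end

theory Submission
  imports Defs
begin

text \<open>
  The heart is a Carleman estimate for \<open>\<Sum> a\<^sub>i\<^sub>j \<partial>\<^sub>i\<partial>\<^sub>j\<close> with weight \<open>exp (2 s exp (- l |x - c|\<^sup>2))\<close> on an
  annulus around the centre \<open>c\<close>, where taking \<open>l\<close> large makes the commutator positive because
  \<open>|x - c|\<close> is bounded below there. It is applied to \<open>\<psi>\<close> times
  a cutoff that equals \<open>1\<close> where \<open>\<delta>/2 \<le> |x - c| \<le> 3R/2\<close>. The inner commutator terms live in \<open>B(c, \<delta>/2)\<close>
  and, by the Caccioppoli inequality, are controlled by \<open>\<psi>\<close> on \<open>B(c, \<delta>)\<close> and by \<open>\<zeta>\<close>. The outer ones live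
  where the weight is smaller than anywhere on \<open>\<Theta>\<close>, so for large \<open>s\<close> the hypothesis
  \<open>\<parallel>\<psi>\<parallel>\<^sup>2 \<le> \<beta> \<parallel>\<psi>\<parallel>\<^sup>2\<^sub>\<Theta>\<close> lets them be absorbed; this fixes \<open>s\<close> and the constant. Both estimates are quadratic
  in the second-order jet of a smooth function and pass to \<open>W\<^sup>2\<^sup>,\<^sup>2\<close> by mollifying function and coefficients.
\<close>

section \<open>Functions with a given gradient\<close>

text \<open>The gradient of \<open>|x - c|\<^sup>2\<close> vanishes at the centre, so the commutator
  degenerates there and an inner cutoff is unavoidable. The weight decreases with the distance from
  \<open>c\<close>: it is largest on the inner shell, where this costs only a constant, and smallest
  on the outer one. Divergence form is traded for non-divergence form because the weak derivatives
  of the Lipschitz entries of \<open>A\<close> are bounded by \<open>\<theta>\<^sub>2\<close>; the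
  differential inequality then bounds the square of \<open>\<Sum> a\<^sub>i\<^sub>j
  \<partial>\<^sub>i\<partial>\<^sub>j \<psi>\<close> by \<open>Kc\<close> times the sum of
  \<open>|\<psi>|\<^sup>2\<close>, \<open>|\<nabla>\<psi>|\<^sup>2\<close> and
  \<open>|\<zeta>|\<^sup>2\<close>. On the annulus the factor \<open>s\<close> on the left of the
  Carleman estimate beats \<open>Kc\<close>. The constants are settled in the order:
  \<open>l\<close> from ellipticity, Lipschitz constant and radii, then a threshold for
  \<open>s\<close>, at last \<open>s\<close> itself from \<open>Kc\<close> and
  \<open>\<beta>\<close>. Only bounds on the coefficients and their first derivatives enter, and
  averaging preserves them, so one constant serves all mollified problems. The coefficients
  \<open>a\<close> being real, real and imaginary parts are treated separately and added.\<close>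

definition has_grad :: "(real ^ 'n::finite \<Rightarrow> real) \<Rightarrow> ('n \<Rightarrow> real ^ 'n \<Rightarrow> real) \<Rightarrow> bool" where
  "has_grad f F \<longleftrightarrow> (\<forall>x. (f has_derivative (\<lambda>h. \<Sum>i\<in>UNIV. F i x * h $ i)) (at x))"

named_theorems grad_intros

lemma has_grad_eq_rhs: "has_grad f F \<Longrightarrow> (\<And>i x. F i x = G i x) \<Longrightarrow> has_grad f G"
  unfolding has_grad_def by simp

lemma has_grad_const [grad_intros]: "has_grad (\<lambda>x. c) (\<lambda>i x. 0)"
  unfolding has_grad_def by simp

lemma has_grad_nth [grad_intros]: "has_grad (\<lambda>x::real^'n::finite. x $ j) (\<lambda>i x. if i = j then 1 else 0)"
proof -
  have "((\<lambda>x. x $ j) has_derivative (\<lambda>h. \<Sum>i\<in>UNIV. (if i = j then 1 else 0) * h $ i)) (at x)" for x :: "real^'n"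
    by (rule has_derivative_eq_rhs[OF bounded_linear.has_derivative[OF bounded_linear_vec_nth has_derivative_ident]])
       (auto simp: if_distrib[of "\<lambda>c. c * _"] cong: if_cong)
  then show ?thesis unfolding has_grad_def by simp
qed

lemma has_grad_add [grad_intros]:
  "has_grad f F \<Longrightarrow> has_grad g G \<Longrightarrow> has_grad (\<lambda>x. f x + g x) (\<lambda>i x. F i x + G i x)"
  unfolding has_grad_def
  by (auto intro!: has_derivative_eq_rhs[OF has_derivative_add] simp: sum.distrib algebra_simps)

lemma has_grad_mult [grad_intros]:
  "has_grad f F \<Longrightarrow> has_grad g G \<Longrightarrow> has_grad (\<lambda>x. f x * g x) (\<lambda>i x. F i x * g x + f x * G i x)"
  unfolding has_grad_def
  by (auto intro!: has_derivative_eq_rhs[OF has_derivative_mult]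
      simp: sum.distrib algebra_simps sum_distrib_left)

lemma has_grad_cmult [grad_intros]:
  "has_grad f F \<Longrightarrow> has_grad (\<lambda>x. c * f x) (\<lambda>i x. c * F i x)"
  by (rule has_grad_eq_rhs[OF has_grad_mult[OF has_grad_const]]) auto

lemma has_grad_minus [grad_intros]:
  "has_grad f F \<Longrightarrow> has_grad (\<lambda>x. - f x) (\<lambda>i x. - F i x)"
  using has_grad_cmult[of f F "-1"] by simp

lemma has_grad_diff [grad_intros]:
  "has_grad f F \<Longrightarrow> has_grad g G \<Longrightarrow> has_grad (\<lambda>x. f x - g x) (\<lambda>i x. F i x - G i x)"
  using has_grad_add[OF _ has_grad_minus, of f F g G] by simp

lemma has_grad_sum [grad_intros]:
  "(\<And>j. j \<in> S \<Longrightarrow> has_grad (f j) (F j)) \<Longrightarrow> has_grad (\<lambda>x. \<Sum>j\<in>S. f j x) (\<lambda>i x. \<Sum>j\<in>S. F j i x)"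
  by (induction S rule: infinite_finite_induct) (auto intro!: grad_intros)

lemma has_grad_compose:
  assumes "has_grad f F" "\<And>t. (g has_real_derivative g' t) (at t)"
  shows "has_grad (\<lambda>x. g (f x)) (\<lambda>i x. g' (f x) * F i x)"
  unfolding has_grad_def
proof
  fix x
  have f: "(f has_derivative (\<lambda>h. \<Sum>i\<in>UNIV. F i x * h $ i)) (at x)" using assms(1) by (simp add: has_grad_def)
  have "(g has_derivative (\<lambda>h. g' (f x) * h)) (at (f x))" using assms(2)[of "f x"]
    by (simp add: has_field_derivative_def)
  from has_derivative_compose[OF f this]
  show "((\<lambda>x. g (f x)) has_derivative (\<lambda>h. \<Sum>i\<in>UNIV. g' (f x) * F i x * h $ i)) (at x)"
    by (simp add: sum_distrib_left mult.assoc)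
qed

lemma has_grad_exp [grad_intros]:
  "has_grad f F \<Longrightarrow> has_grad (\<lambda>x. exp (f x)) (\<lambda>i x. exp (f x) * F i x)"
  by (rule has_grad_compose) (auto intro!: derivative_eq_intros)

lemma has_grad_power [grad_intros]:
  "has_grad f F \<Longrightarrow> has_grad (\<lambda>x. f x ^ n) (\<lambda>i x. real n * f x ^ (n - 1) * F i x)"
  by (rule has_grad_compose) (auto intro!: derivative_eq_intros)

lemma has_grad_axis:
  assumes "has_grad f F"
  shows "((\<lambda>t. f (x + t *\<^sub>R axis i 1)) has_real_derivative F i (x + t *\<^sub>R axis i 1)) (at t)"
proof -
  have f: "(f has_derivative (\<lambda>h. \<Sum>j\<in>UNIV. F j (x + t *\<^sub>R axis i 1) * h $ j)) (at (x + t *\<^sub>R axis i 1))"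
    using assms(1) by (simp add: has_grad_def)
  have "((\<lambda>t. x + t *\<^sub>R axis i 1) has_derivative (\<lambda>s. s *\<^sub>R axis i 1)) (at t)"
    by (auto intro!: derivative_eq_intros)
  from has_derivative_compose[OF this f]
  show ?thesis unfolding has_field_derivative_def
    by (rule has_derivative_eq_rhs)
      (auto simp: axis_def fun_eq_iff if_distrib mult.commute cong: if_cong)
qed

lemma has_grad_unique:
  assumes "has_grad f F" "has_grad f G" shows "F i x = G i x"
  using DERIV_unique[OF has_grad_axis[OF assms(1), where x=x and t=0 and i=i] has_grad_axis[OF assms(2), where x=x and t=0]]
  by simp

lemma has_grad_continuous: "has_grad f F \<Longrightarrow> continuous_on S f"
  unfolding has_grad_def
  by (meson has_derivative_continuous continuous_at_imp_continuous_on)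

lemma has_grad_measurable: "has_grad f F \<Longrightarrow> f \<in> borel_measurable borel"
  by (intro borel_measurable_continuous_onI has_grad_continuous)

lemma has_grad_zero_open:
  assumes "has_grad f F" "open S" "\<And>x. x \<in> S \<Longrightarrow> f x = 0" "x \<in> S"
  shows "F i x = 0"
proof -
  have "(f has_derivative (\<lambda>h. \<Sum>i\<in>UNIV. F i x * h $ i)) (at x)" using assms(1) by (simp add: has_grad_def)
  then have "((\<lambda>x. 0) has_derivative (\<lambda>h. \<Sum>i\<in>UNIV. F i x * h $ i)) (at x)"
    by (rule has_derivative_transform_within_open[OF _ assms(2)]) (use assms in auto)
  then have *: "(\<lambda>h. \<Sum>i\<in>UNIV. F i x * h $ i) = (\<lambda>h. 0)"
    using has_derivative_unique has_derivative_const by blast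
  have "(\<Sum>j\<in>UNIV. F j x * axis i 1 $ j) = 0" using fun_cong[OF *, of "axis i 1"] by simp
  then show ?thesis by (simp add: axis_def if_distrib cong: if_cong)
qed

lemma has_grad_zero_outside:
  assumes "has_grad f F" "\<And>x. norm (x - ctr) > r \<Longrightarrow> f x = 0" "norm (x - ctr) > r"
  shows "F i x = 0"
proof (rule has_grad_zero_open[OF assms(1)])
  show "open {x. norm (x - ctr) > r}" by (intro open_Collect_less continuous_intros)
qed (use assms in auto)

section \<open>Integration by parts for compactly supported functions\<close>

lemma integrable_compact_supp:
  fixes f :: "'a::euclidean_space \<Rightarrow> 'b::euclidean_space"
  assumes "continuous_on UNIV f" "\<And>x. norm (x - ctr) > r \<Longrightarrow> f x = 0"
  shows "integrable lborel f"
proof -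
  have "integrable lborel (\<lambda>x. indicator (cball ctr r) x *\<^sub>R f x)"
    by (rule borel_integrable_compact) (auto intro: continuous_on_subset[OF assms(1)])
  also have "(\<lambda>x. indicator (cball ctr r) x *\<^sub>R f x) = f"
    using assms(2) by (auto simp: fun_eq_iff indicator_def dist_norm norm_minus_commute)
  finally show ?thesis .
qed

lemma lborel_integral_translate:
  fixes f :: "'a::euclidean_space \<Rightarrow> 'b::euclidean_space"
  shows "(LINT x|lborel. f (x + a)) = (LINT x|lborel. f x)"
    and "integrable lborel (\<lambda>x. f (x + a)) \<longleftrightarrow> integrable lborel f"
proof -
  have *: "lborel = distr lborel borel (\<lambda>x. a + x)" using lborel_distr_plus[of a] by simp
  have m: "(\<lambda>x. f (x + a)) \<in> borel_measurable lborel \<longleftrightarrow> f \<in> borel_measurable lborel"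
  proof
    have p: "(\<lambda>x. x - a) \<in> borel_measurable borel" by simp
    assume "(\<lambda>x. f (x + a)) \<in> borel_measurable lborel"
    then have "(\<lambda>x. f (x + a)) \<in> borel_measurable borel" by simp
    from measurable_compose[OF p this] show "f \<in> borel_measurable lborel" by simp
  next
    have p: "(\<lambda>x. x + a) \<in> borel_measurable borel" by simp
    assume "f \<in> borel_measurable lborel"
    then have "f \<in> borel_measurable borel" by simp
    from measurable_compose[OF p this] show "(\<lambda>x. f (x + a)) \<in> borel_measurable lborel" by simp
  qed
  show 2: "integrable lborel (\<lambda>x. f (x + a)) \<longleftrightarrow> integrable lborel f"
  proof (cases "f \<in> borel_measurable lborel")
    case True
    then have "integrable (distr lborel borel (\<lambda>x. a + x)) f \<longleftrightarrow> integrable lborel (\<lambda>x. f (a + x))"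
      by (intro integrable_distr_eq) auto
    with * show ?thesis by (simp add: add.commute)
  next
    case False
    with m show ?thesis by (meson borel_measurable_integrable)
  qed
  show "(LINT x|lborel. f (x + a)) = (LINT x|lborel. f x)"
  proof (cases "f \<in> borel_measurable lborel")
    case True
    then have "integral\<^sup>L (distr lborel borel (\<lambda>x. a + x)) f = (LINT x|lborel. f (a + x))"
      by (intro integral_distr) auto
    with * show ?thesis by (simp add: add.commute)
  next
    case False
    with m 2 have "\<not> integrable lborel f" "\<not> integrable lborel (\<lambda>x. f (x + a))"
      by (auto dest: borel_measurable_integrable)
    then show ?thesis by (simp add: not_integrable_integral_eq)
  qed
qed

text \<open>Translation invariance makes every difference quotient \<open>D n\<close> integrate to
  zero. By the mean value theorem the quotients are bounded by a bound of \<open>F i\<close> and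
  live in a ball enlarged by one, the largest step, so dominated convergence carries the zero over
  to \<open>F i\<close>.\<close>

lemma integral_partial_eq_0:
  assumes F: "has_grad f F" and c: "continuous_on UNIV (F i)"
    and supp: "\<And>x. norm (x - ctr) > r \<Longrightarrow> f x = 0"
  shows "(LINT x|lborel. F i x) = 0"
proof -
  define D where "D n x = real (Suc n) * (f (x + inverse (real (Suc n)) *\<^sub>R axis i 1) - f x)" for n x
  have cf: "continuous_on UNIV f" using F by (rule has_grad_continuous)
  have z: "norm (x - ctr) > r \<Longrightarrow> F i x = 0" for x
    using has_grad_zero_outside[OF F supp] by blast
  have fint: "integrable lborel f" by (rule integrable_compact_supp[OF cf supp])
  have Dint: "(LINT x|lborel. D n x) = 0" for n
    using fint lborel_integral_translate[of f "inverse (real (Suc n)) *\<^sub>R axis i 1"]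
    unfolding D_def by simp
  obtain M where M: "\<And>x. \<bar>F i x\<bar> \<le> M" "M \<ge> 0"
  proof -
    have "compact (F i ` cball ctr r)" by (intro compact_continuous_image continuous_on_subset[OF c]) auto
    then obtain B where "\<forall>y\<in>F i ` cball ctr r. norm y \<le> B" using compact_imp_bounded bounded_iff by blast
    then have B: "\<bar>F i y\<bar> \<le> B" if "y \<in> cball ctr r" for y using that by auto
    have "\<bar>F i x\<bar> \<le> max B 0" for x
      using z[of x] B[of x] by (cases "norm (x - ctr) > r") (auto simp: dist_norm norm_minus_commute)
    then show ?thesis using that[of "max B 0"] by auto
  qed
  have mvt: "\<exists>\<xi>. D n x = F i (x + \<xi> *\<^sub>R axis i 1) \<and> 0 < \<xi> \<and> \<xi> < inverse (real (Suc n))" for n x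
  proof -
    have "\<exists>z>0. z < inverse (real (Suc n)) \<and>
        f (x + inverse (real (Suc n)) *\<^sub>R axis i 1) - f (x + 0 *\<^sub>R axis i 1) = (inverse (real (Suc n)) - 0) * F i (x + z *\<^sub>R axis i 1)"
      by (rule MVT2) (use has_grad_axis[OF F] in auto)
    then show ?thesis unfolding D_def by (auto simp: field_simps)
  qed
  have lim: "(\<lambda>n. D n x) \<longlonglongrightarrow> F i x" for x
  proof -
    have "((\<lambda>t. f (x + t *\<^sub>R axis i 1)) has_real_derivative F i (x + 0 *\<^sub>R axis i 1)) (at 0)"
      by (rule has_grad_axis[OF F])
    then have "((\<lambda>h. (f (x + h *\<^sub>R axis i 1) - f x) / h) \<longlongrightarrow> F i x) (at 0)"
      by (simp add: DERIV_def)
    moreover have "filterlim (\<lambda>n. inverse (real (Suc n))) (at 0) sequentially"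
      unfolding filterlim_at using LIMSEQ_inverse_real_of_nat by (auto simp: eventually_sequentially)
    ultimately have "((\<lambda>n. (f (x + inverse (real (Suc n)) *\<^sub>R axis i 1) - f x) / inverse (real (Suc n))) \<longlonglongrightarrow> F i x)"
      by (rule filterlim_compose)
    moreover have "(f (x + inverse (real (Suc n)) *\<^sub>R axis i 1) - f x) / inverse (real (Suc n)) = D n x" for n
      unfolding D_def by (simp add: field_simps)
    ultimately show ?thesis by simp
  qed
  have Dz: "D n x = 0" if "norm (x - ctr) > r + 1" for n x
  proof -
    obtain \<xi> where \<xi>: "D n x = F i (x + \<xi> *\<^sub>R axis i 1)" "0 < \<xi>" "\<xi> < inverse (real (Suc n))"
      using mvt by blast
    then have "\<xi> < 1" by (smt (verit) inverse_le_1_iff of_nat_Suc of_nat_0_le_iff)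
    have "norm (x - ctr) \<le> norm (x + \<xi> *\<^sub>R axis i 1 - ctr) + norm (\<xi> *\<^sub>R axis i (1::real) :: real^'a)"
      using norm_triangle_ineq4[of "x + \<xi> *\<^sub>R axis i 1 - ctr" "\<xi> *\<^sub>R axis i 1"] by simp
    then have "norm (x + \<xi> *\<^sub>R axis i 1 - ctr) > r" using that \<xi> \<open>\<xi> < 1\<close> by (simp add: norm_axis_1)
    then show ?thesis using z \<xi> by simp
  qed
  have "(\<lambda>n. LINT x|lborel. D n x) \<longlonglongrightarrow> (LINT x|lborel. F i x)"
  proof (rule integral_dominated_convergence[where w="\<lambda>x. indicator (cball ctr (r+1)) x *\<^sub>R M"])
    show "F i \<in> borel_measurable lborel" using c borel_measurable_continuous_onI by auto
    have [measurable]: "f \<in> borel_measurable borel" using F by (rule has_grad_measurable)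
    show "D n \<in> borel_measurable lborel" for n unfolding D_def by measurable
    show "integrable lborel (\<lambda>x. indicator (cball ctr (r+1)) x *\<^sub>R M)"
      by (rule borel_integrable_compact) auto
    show "AE x in lborel. (\<lambda>n. D n x) \<longlonglongrightarrow> F i x" using lim by simp
    show "AE x in lborel. norm (D n x) \<le> indicator (cball ctr (r + 1)) x *\<^sub>R M" for n
    proof (rule AE_I2)
      fix x
      obtain y where "D n x = F i y" using mvt by blast
      then have "\<bar>D n x\<bar> \<le> M" using M by simp
      then show "norm (D n x) \<le> indicator (cball ctr (r + 1)) x *\<^sub>R M"
        using Dz[of x n] by (cases "x \<in> cball ctr (r + 1)") (auto simp: dist_norm norm_minus_commute)
    qed
  qed
  with Dint have "(\<lambda>n. 0) \<longlonglongrightarrow> (LINT x|lborel. F i x)" by simp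
  then show ?thesis by (simp add: LIMSEQ_const_iff)
qed

text \<open>The divergence of the field \<open>f x * k i x\<close> integrates to zero. Compact
  support is asked of \<open>f\<close> alone, so that the fields \<open>k\<close> can be built from
  globally defined coefficients and weights.\<close>

lemma integral_by_parts:
  assumes F: "has_grad f F" and K: "\<And>i. has_grad (k i) (K i)"
    and cF: "\<And>i. continuous_on UNIV (F i)" and cK: "\<And>i. continuous_on UNIV (K i i)"
    and supp: "\<And>x. norm (x - ctr) > r \<Longrightarrow> f x = 0"
  shows "(LINT x|lborel. f x * (\<Sum>i\<in>UNIV. K i i x)) = - (LINT x|lborel. (\<Sum>i\<in>UNIV. F i x * k i x))"
    and "integrable lborel (\<lambda>x. f x * (\<Sum>i\<in>UNIV. K i i x))"
    and "integrable lborel (\<lambda>x. \<Sum>i\<in>UNIV. F i x * k i x)"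
proof -
  have cf: "continuous_on UNIV f" and ck: "\<And>i. continuous_on UNIV (k i)"
    using F K by (auto intro: has_grad_continuous)
  have z: "norm (x - ctr) > r \<Longrightarrow> F i x = 0" for x i
    using has_grad_zero_outside[OF F supp] by blast
  show 1: "integrable lborel (\<lambda>x. f x * (\<Sum>i\<in>UNIV. K i i x))"
    by (rule integrable_compact_supp[where ctr=ctr and r=r]) (auto intro!: continuous_intros cf cK supp)
  show 2: "integrable lborel (\<lambda>x. \<Sum>i\<in>UNIV. F i x * k i x)"
    by (rule integrable_compact_supp[where ctr=ctr and r=r]) (auto intro!: continuous_intros cF ck simp: z)
  have 3: "(LINT x|lborel. F i x * k i x + f x * K i i x) = 0" for i
    by (rule integral_partial_eq_0[where ctr=ctr and r=r, OF has_grad_mult[OF F K[of i]]])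
       (auto intro!: continuous_intros cF ck cf cK simp: supp)
  have 4: "integrable lborel (\<lambda>x. F i x * k i x + f x * K i i x)" for i
    by (rule integrable_compact_supp[where ctr=ctr and r=r])
       (auto intro!: continuous_intros cF ck cf cK simp: z supp)
  have "(LINT x|lborel. (\<Sum>i\<in>UNIV. F i x * k i x) + f x * (\<Sum>i\<in>UNIV. K i i x))
      = (LINT x|lborel. (\<Sum>i\<in>UNIV. F i x * k i x + f x * K i i x))"
    by (simp add: sum.distrib sum_distrib_left)
  also have "\<dots> = 0" using 3 4 by simp
  finally show "(LINT x|lborel. f x * (\<Sum>i\<in>UNIV. K i i x)) = - (LINT x|lborel. (\<Sum>i\<in>UNIV. F i x * k i x))"
    using 1 2 by simp
qed

section \<open>The Carleman estimate\<close>

text \<open>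
  With \<open>v = exp h \<cdot> u\<close> the conjugated operator \<open>exp h \<cdot> div (a \<nabla> (exp (- h) v))\<close> splits, up to lower order, into
  \<open>M1\<close> (essentially antisymmetric) and \<open>M2\<close> (symmetric); the cross term \<open>2 \<integral> M1 M2\<close> is the commutator that
  yields positivity. The extra multiple of \<open>v\<close> in \<open>M1\<close> makes the \<open>|\<nabla>v|\<^sup>2\<close> term of \<open>E\<close> positive as well.
\<close>

lemma carleman_identity:
  fixes a :: "'n::finite \<Rightarrow> 'n \<Rightarrow> real ^ 'n \<Rightarrow> real"
  assumes a: "\<And>i j. has_grad (a i j) (da i j)" "\<And>i j m. continuous_on UNIV (da i j m)"
      "\<And>i j x. a i j x = a j i x"
    and h: "has_grad h (\<lambda>i x. l * h x * g i x)"
    and g: "\<And>i. continuous_on UNIV (g i)"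
    and k: "\<And>i. has_grad (k i) (dk i)" "\<And>i j. continuous_on UNIV (dk i j)"
      "\<And>i x. k i x = (\<Sum>j\<in>UNIV. a i j x * g j x)"
    and G: "has_grad G dG" "\<And>i. continuous_on UNIV (dG i)"
      "\<And>x. G x = (\<Sum>i\<in>UNIV. k i x * g i x)"
    and v: "has_grad v V" "\<And>i. has_grad (V i) (H i)" "\<And>i j. continuous_on UNIV (H i j)"
      "\<And>i j x. H i j x = H j i x"
    and supp: "\<And>x. norm (x - ctr) > r \<Longrightarrow> v x = 0"
  defines "q \<equiv> \<lambda>i x. \<Sum>j\<in>UNIV. a i j x * V j x"
  defines "kV \<equiv> \<lambda>x. \<Sum>i\<in>UNIV. k i x * V i x"
  defines "Q \<equiv> \<lambda>x. \<Sum>i\<in>UNIV. V i x * q i x"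
  defines "dq \<equiv> \<lambda>i m x. \<Sum>j\<in>UNIV. da i j m x * V j x + a i j x * H j m x"
  defines "Lv \<equiv> \<lambda>x. \<Sum>i\<in>UNIV. dq i i x"
  defines "M1 \<equiv> \<lambda>x. - 2 * l * (h x * kV x) - 2 * l\<^sup>2 * (h x * G x * v x)"
  defines "M2 \<equiv> \<lambda>x. Lv x + l\<^sup>2 * (h x)\<^sup>2 * G x * v x"
  defines "E \<equiv> \<lambda>x. l ^ 4 * h x ^ 3 * (G x)\<^sup>2 * (v x)\<^sup>2
      + l ^ 3 * h x ^ 3 * (v x)\<^sup>2 * ((\<Sum>i\<in>UNIV. dG i x * k i x) + G x * (\<Sum>i\<in>UNIV. dk i i x))
      + l\<^sup>2 * h x * G x * Q x + 2 * l\<^sup>2 * h x * (kV x)\<^sup>2 + 2 * l ^ 3 * h x * G x * v x * kV x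
      + 2 * l\<^sup>2 * h x * v x * (\<Sum>i\<in>UNIV. dG i x * q i x)
      + l * h x * (2 * (\<Sum>i\<in>UNIV. \<Sum>j\<in>UNIV. dk j i x * V j x * q i x)
          - (\<Sum>m\<in>UNIV. \<Sum>i\<in>UNIV. \<Sum>j\<in>UNIV. k m x * da i j m x * V i x * V j x)
          - Q x * (\<Sum>i\<in>UNIV. dk i i x))"
  shows "(LINT x|lborel. M1 x * M2 x) = (LINT x|lborel. E x)"
    and "integrable lborel (\<lambda>x. M1 x * M2 x)" and "integrable lborel E"
proof -
  define dkV where "dkV m x = (\<Sum>i\<in>UNIV. dk i m x * V i x + k i x * H i m x)" for m x
  define dQ where "dQ m x = (\<Sum>i\<in>UNIV. H i m x * q i x + V i x * dq i m x)" for m x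
  define dM1 where "dM1 m x = - 2 * l * (l * h x * g m x * kV x + h x * dkV m x)
     - 2 * l\<^sup>2 * ((l * h x * g m x * G x + h x * dG m x) * v x + h x * G x * V m x)" for m x
  have q': "has_grad (q i) (dq i)" for i
    unfolding q_def dq_def by (intro has_grad_sum has_grad_mult a v)
  have kV': "has_grad kV dkV"
    unfolding kV_def dkV_def by (intro has_grad_sum has_grad_mult k v)
  have Q': "has_grad Q dQ"
    unfolding Q_def dQ_def by (intro has_grad_sum has_grad_mult q' v)
  have M1': "has_grad M1 dM1"
    unfolding M1_def dM1_def by (intro has_grad_diff has_grad_cmult has_grad_mult kV' h G v)
  note c0 = has_grad_continuous[OF a(1)] has_grad_continuous[OF h] has_grad_continuous[OF k(1)]
    has_grad_continuous[OF G(1)] has_grad_continuous[OF v(1)] has_grad_continuous[OF v(2)] g a(2) k(2) G(2) v(3)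
    has_grad_continuous[OF q'] has_grad_continuous[OF kV'] has_grad_continuous[OF Q'] has_grad_continuous[OF M1']
  have c1: "continuous_on UNIV (dq i m)" "continuous_on UNIV (dkV m)" for i m
    unfolding dq_def dkV_def by (intro continuous_intros c0)+
  have c2: "continuous_on UNIV (dQ m)" "continuous_on UNIV (dM1 m)" for m
    unfolding dQ_def dM1_def by (intro continuous_intros c0 c1)+
  have zV: "V i x = 0" if "norm (x - ctr) > r" for i x
    using has_grad_zero_outside[OF v(1) supp that] .
  have zkV: "kV x = 0" "Q x = 0" "q i x = 0" if "norm (x - ctr) > r" for x i
    using zV[OF that] by (simp_all add: kV_def Q_def q_def)
  have zM1: "M1 x = 0" if "norm (x - ctr) > r" for x
    using zkV[OF that] supp[OF that] by (simp add: M1_def)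

  \<comment> \<open>\<open>P1 + P1'\<close> is the divergence of \<open>M1 q\<close>. Replacing
    \<open>M1 * Lv\<close> by \<open>- P1'\<close> leaves second derivatives of \<open>v\<close>
    only in the combination \<open>k m * H i m * q i\<close>.\<close>
  define P1 where "P1 x = M1 x * (\<Sum>i\<in>UNIV. dq i i x)" for x
  define P1' where "P1' x = (\<Sum>i\<in>UNIV. dM1 i x * q i x)" for x
  have I1: "(LINT x|lborel. P1 x) = - (LINT x|lborel. P1' x)" "integrable lborel P1" "integrable lborel P1'"
    unfolding P1_def P1'_def
    using integral_by_parts[OF M1' q' c2(2) c1(1) zM1] by simp_all

  \<comment> \<open>Up to derivatives of \<open>a\<close>, the remaining Hessian terms are half the
    derivative of the quadratic form \<open>Q\<close> along \<open>k\<close>, so the divergence of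
    \<open>h Q k\<close> removes them. This costs one \<open>l\<^sup>2 * h * G * Q\<close> out of
    the two that the extra multiple of \<open>v\<close> in \<open>M1\<close> contributes.\<close>
  define K2 where "K2 i m x = l * h x * g m x * k i x + h x * dk i m x" for i m x
  have K2: "has_grad (\<lambda>x. h x * k i x) (K2 i)" for i
    unfolding K2_def by (intro has_grad_mult h k)
  have cK2: "continuous_on UNIV (K2 i m)" for i m
    unfolding K2_def by (intro continuous_intros c0)
  define P2 where "P2 x = Q x * (\<Sum>i\<in>UNIV. K2 i i x)" for x
  define P2' where "P2' x = (\<Sum>i\<in>UNIV. dQ i x * (h x * k i x))" for x
  have I2: "(LINT x|lborel. P2 x) = - (LINT x|lborel. P2' x)" "integrable lborel P2" "integrable lborel P2'"
    unfolding P2_def P2'_def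
    using integral_by_parts[OF Q' K2 c2(1) cK2 zkV(2)] by simp_all

  \<comment> \<open>\<open>2 * v * kV\<close> is the derivative of \<open>v\<^sup>2\<close> along
    \<open>k\<close>. The third divergence turns the product of the main parts into
    \<open>3 * l ^ 4 * h ^ 3 * G\<^sup>2 * v\<^sup>2\<close>, of which the extra multiple of
    \<open>v\<close> takes back two thirds; one third survives in \<open>E\<close>.\<close>
  define K3 where "K3 i m x = (real 3 * h x ^ (3 - 1) * (l * h x * g m x) * G x + h x ^ 3 * dG m x) * k i x
      + h x ^ 3 * G x * dk i m x" for i m x
  have K3: "has_grad (\<lambda>x. h x ^ 3 * G x * k i x) (K3 i)" for i
    unfolding K3_def by (intro has_grad_mult has_grad_power h k G)
  have cK3: "continuous_on UNIV (K3 i m)" for i m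
    unfolding K3_def by (intro continuous_intros c0)
  define P3 where "P3 x = (v x * v x) * (\<Sum>i\<in>UNIV. K3 i i x)" for x
  define P3' where "P3' x = (\<Sum>i\<in>UNIV. (V i x * v x + v x * V i x) * (h x ^ 3 * G x * k i x))" for x
  have "continuous_on UNIV (\<lambda>x. V i x * v x + v x * V i x)" for i
    by (intro continuous_intros c0)
  from integral_by_parts[OF has_grad_mult[OF v(1) v(1)] K3 this cK3, of r ctr]
  have I3: "(LINT x|lborel. P3 x) = - (LINT x|lborel. P3' x)" "integrable lborel P3" "integrable lborel P3'"
    unfolding P3_def P3'_def using supp by simp_all

  \<comment> \<open>Once the sums have names the identity is polynomial in finitely many numbers.
    \<open>S2\<close>, which carries the second derivatives of \<open>v\<close> left by
    \<open>P1'\<close>, cancels against \<open>P2'\<close>.\<close>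
  have pt: "M1 x * M2 x = E x + (P1 x + P1' x) + l * (P2 x + P2' x) - l ^ 3 * (P3 x + P3' x)" for x
  proof -
    define S1 where "S1 = (\<Sum>i\<in>UNIV. \<Sum>j\<in>UNIV. dk j i x * V j x * q i x)"
    define S2 where "S2 = (\<Sum>m\<in>UNIV. \<Sum>i\<in>UNIV. k m x * H i m x * q i x)"
    define T where "T = (\<Sum>m\<in>UNIV. \<Sum>i\<in>UNIV. \<Sum>j\<in>UNIV. k m x * da i j m x * V i x * V j x)"
    define D where "D = (\<Sum>i\<in>UNIV. dk i i x)"
    define dGq where "dGq = (\<Sum>i\<in>UNIV. dG i x * q i x)"
    define dGk where "dGk = (\<Sum>i\<in>UNIV. dG i x * k i x)"
    \<comment> \<open>Symmetry of \<open>a\<close> moves it from \<open>V\<close> onto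
      \<open>g\<close>.\<close>
    have gq: "(\<Sum>i\<in>UNIV. g i x * q i x) = kV x"
    proof -
      have "(\<Sum>i\<in>UNIV. g i x * q i x) = (\<Sum>i\<in>UNIV. \<Sum>j\<in>UNIV. g i x * a i j x * V j x)"
        unfolding q_def by (simp add: sum_distrib_left mult.assoc)
      also have "\<dots> = (\<Sum>j\<in>UNIV. \<Sum>i\<in>UNIV. g i x * a i j x * V j x)" by (rule sum.swap)
      also have "\<dots> = (\<Sum>j\<in>UNIV. \<Sum>i\<in>UNIV. a j i x * g i x * V j x)"
        by (intro sum.cong refl) (simp add: a(3) mult.commute)
      also have "\<dots> = kV x" unfolding kV_def k(3) by (simp add: sum_distrib_right)
      finally show ?thesis .
    qed
    have Vq: "(\<Sum>i\<in>UNIV. V i x * q i x) = Q x" unfolding Q_def ..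
    have gk: "(\<Sum>i\<in>UNIV. g i x * k i x) = G x" unfolding G(3) by (simp add: mult.commute)
    have dkVq: "(\<Sum>i\<in>UNIV. dkV i x * q i x) = S1 + S2"
    proof -
      have "(\<Sum>i\<in>UNIV. dkV i x * q i x)
        = (\<Sum>i\<in>UNIV. \<Sum>j\<in>UNIV. dk j i x * V j x * q i x + k j x * H j i x * q i x)"
        unfolding dkV_def by (simp add: sum_distrib_right distrib_right)
      also have "\<dots> = S1 + (\<Sum>i\<in>UNIV. \<Sum>j\<in>UNIV. k j x * H j i x * q i x)"
        unfolding S1_def by (simp add: sum.distrib)
      also have "(\<Sum>i\<in>UNIV. \<Sum>j\<in>UNIV. k j x * H j i x * q i x) = (\<Sum>j\<in>UNIV. \<Sum>i\<in>UNIV. k j x * H j i x * q i x)"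
        by (rule sum.swap)
      also have "\<dots> = S2" unfolding S2_def using v(4) by simp
      finally show ?thesis .
    qed
    have kdQ: "(\<Sum>m\<in>UNIV. dQ m x * k m x) = 2 * S2 + T"
    proof -
      have "(\<Sum>i\<in>UNIV. V i x * dq i m x) = (\<Sum>i\<in>UNIV. \<Sum>j\<in>UNIV. da i j m x * V i x * V j x) + (\<Sum>i\<in>UNIV. H i m x * q i x)" for m
      proof -
        have "(\<Sum>i\<in>UNIV. V i x * dq i m x) = (\<Sum>i\<in>UNIV. \<Sum>j\<in>UNIV. da i j m x * V i x * V j x) + (\<Sum>i\<in>UNIV. \<Sum>j\<in>UNIV. V i x * a i j x * H j m x)"
          unfolding dq_def by (simp add: sum_distrib_left sum.distrib algebra_simps)
        also have "(\<Sum>i\<in>UNIV. \<Sum>j\<in>UNIV. V i x * a i j x * H j m x) = (\<Sum>j\<in>UNIV. \<Sum>i\<in>UNIV. V i x * a i j x * H j m x)"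
          by (rule sum.swap)
        also have "\<dots> = (\<Sum>j\<in>UNIV. \<Sum>i\<in>UNIV. H j m x * (a j i x * V i x))"
          by (intro sum.cong refl) (simp add: a(3) mult.commute)
        also have "\<dots> = (\<Sum>i\<in>UNIV. H i m x * q i x)" unfolding q_def by (simp add: sum_distrib_left)
        finally show ?thesis .
      qed
      then have "dQ m x = 2 * (\<Sum>i\<in>UNIV. H i m x * q i x) + (\<Sum>i\<in>UNIV. \<Sum>j\<in>UNIV. da i j m x * V i x * V j x)" for m
        unfolding dQ_def by (simp add: sum.distrib)
      then have "(\<Sum>m\<in>UNIV. dQ m x * k m x) = (\<Sum>m\<in>UNIV. 2 * (\<Sum>i\<in>UNIV. k m x * H i m x * q i x)
          + (\<Sum>i\<in>UNIV. \<Sum>j\<in>UNIV. k m x * da i j m x * V i x * V j x))"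
        by (intro sum.cong refl) (simp add: distrib_left sum_distrib_left algebra_simps)
      then show ?thesis unfolding S2_def T_def by (simp add: sum.distrib sum_distrib_left)
    qed
    have p1': "P1' x = - 2 * l * (l * h x * kV x * kV x + h x * (S1 + S2))
      - 2 * l\<^sup>2 * (l * h x * kV x * G x * v x + h x * v x * dGq + h x * G x * Q x)"
    proof -
      have "P1' x = - 2 * l * (l * h x * kV x * (\<Sum>i\<in>UNIV. g i x * q i x) + h x * (\<Sum>i\<in>UNIV. dkV i x * q i x))
      - 2 * l\<^sup>2 * (l * h x * G x * v x * (\<Sum>i\<in>UNIV. g i x * q i x) + h x * v x * (\<Sum>i\<in>UNIV. dG i x * q i x) + h x * G x * (\<Sum>i\<in>UNIV. V i x * q i x))"
        unfolding P1'_def dM1_def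
        unfolding sum_distrib_left sum.distrib[symmetric] sum_subtractf[symmetric]
        by (intro sum.cong refl) algebra
      then show ?thesis unfolding gq dkVq Vq dGq_def[symmetric] by (simp add: algebra_simps)
    qed
    have p2: "P2 x = Q x * (l * h x * G x + h x * D)"
    proof -
      have "(\<Sum>i\<in>UNIV. K2 i i x) = l * h x * (\<Sum>i\<in>UNIV. g i x * k i x) + h x * (\<Sum>i\<in>UNIV. dk i i x)"
        unfolding K2_def sum_distrib_left sum.distrib[symmetric]
        by (intro sum.cong refl) algebra
      then show ?thesis unfolding P2_def gk D_def by simp
    qed
    have p2': "P2' x = h x * (2 * S2 + T)"
      unfolding P2'_def kdQ[symmetric] sum_distrib_left by (intro sum.cong refl) simp
    have p3: "P3 x = (v x)\<^sup>2 * (3 * l * h x ^ 3 * (G x)\<^sup>2 + h x ^ 3 * dGk + h x ^ 3 * G x * D)"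
    proof -
      have "(\<Sum>i\<in>UNIV. K3 i i x) = 3 * l * h x ^ 3 * G x * (\<Sum>i\<in>UNIV. g i x * k i x)
          + h x ^ 3 * (\<Sum>i\<in>UNIV. dG i x * k i x) + h x ^ 3 * G x * (\<Sum>i\<in>UNIV. dk i i x)"
        unfolding K3_def sum_distrib_left sum.distrib[symmetric]
        by (intro sum.cong refl) (simp add: algebra_simps power2_eq_square power3_eq_cube)
      then show ?thesis unfolding P3_def gk D_def dGk_def by (simp add: power2_eq_square)
    qed
    have p3': "P3' x = 2 * v x * h x ^ 3 * G x * kV x"
      unfolding P3'_def kV_def sum_distrib_left by (intro sum.cong refl) simp
    have p1: "P1 x = M1 x * Lv x" unfolding P1_def Lv_def ..
    have E: "E x = l ^ 4 * h x ^ 3 * (G x)\<^sup>2 * (v x)\<^sup>2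
      + l ^ 3 * h x ^ 3 * (v x)\<^sup>2 * (dGk + G x * D)
      + l\<^sup>2 * h x * G x * Q x + 2 * l\<^sup>2 * h x * (kV x)\<^sup>2 + 2 * l ^ 3 * h x * G x * v x * kV x
      + 2 * l\<^sup>2 * h x * v x * dGq
      + l * h x * (2 * S1 - T - Q x * D)"
      unfolding E_def S1_def T_def D_def dGq_def dGk_def ..
    show ?thesis unfolding E p1 p1' p2 p2' p3 p3' M2_def M1_def by algebra
  qed
  have iE: "integrable lborel E"
  proof (rule integrable_compact_supp[where ctr=ctr and r=r])
    show "continuous_on UNIV E" unfolding E_def by (intro continuous_intros c0)
    show "E x = 0" if "norm (x - ctr) > r" for x
      using zkV[OF that] supp[OF that] zV[OF that] by (simp add: E_def)
  qed
  show "integrable lborel (\<lambda>x. M1 x * M2 x)"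
    unfolding pt by (intro Bochner_Integration.integrable_add Bochner_Integration.integrable_diff integrable_mult_right I1 I2 I3 iE)
  have "(LINT x|lborel. M1 x * M2 x) = (LINT x|lborel. E x) + ((LINT x|lborel. P1 x) + (LINT x|lborel. P1' x))
      + l * ((LINT x|lborel. P2 x) + (LINT x|lborel. P2' x)) - l ^ 3 * ((LINT x|lborel. P3 x) + (LINT x|lborel. P3' x))"
    unfolding pt using I1 I2 I3 iE by simp
  then show "(LINT x|lborel. M1 x * M2 x) = (LINT x|lborel. E x)" using I1 I2 I3 by simp
  show "integrable lborel E" by fact
qed


text \<open>This is \<open>E\<close> at one point, with \<open>p\<close> in the role of the length
  of the gradient \<open>V\<close>. The leading terms are of size
  \<open>l ^ 4 * h ^ 3 * v\<^sup>2\<close> and \<open>l\<^sup>2 * h * p\<^sup>2\<close>. Half of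
  each pays for \<open>D1\<close> and \<open>B\<close>, which carry one power of \<open>l\<close>
  less. A quarter of each pays for the mixed terms in \<open>v\<close> and \<open>p\<close>, which
  carry one factor \<open>h\<close> where the geometric mean of the leading terms carries
  \<open>h\<^sup>2\<close>, so a large \<open>h\<close> suffices.\<close>

lemma carleman_pointwise_lower:
  fixes G0 K c l h v p G D1 kV dGq B Q :: real
  assumes pos: "0 < G0" "0 < c" "0 \<le> K" "1 \<le> l" "0 < h" "0 \<le> p"
    and l: "2 * K \<le> l * G0\<^sup>2" "2 * K \<le> l * (G0 * c)"
    and h: "16 * (K\<^sup>2 + K)\<^sup>2 / (G0 * c) \<le> h\<^sup>2 * G0\<^sup>2"
    and b: "G0 \<le> G" "G \<le> K" "\<bar>D1\<bar> \<le> K" "\<bar>kV\<bar> \<le> K * p" "\<bar>dGq\<bar> \<le> K * p" "\<bar>B\<bar> \<le> K * p\<^sup>2" "c * p\<^sup>2 \<le> Q"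
  shows "l ^ 4 * G0\<^sup>2 / 4 * (h ^ 3 * v\<^sup>2) + l\<^sup>2 * (G0 * c) / 4 * (h * p\<^sup>2)
    \<le> l ^ 4 * h ^ 3 * G\<^sup>2 * v\<^sup>2 + l ^ 3 * h ^ 3 * v\<^sup>2 * D1
      + l\<^sup>2 * h * G * Q + 2 * l\<^sup>2 * h * kV\<^sup>2 + 2 * l ^ 3 * h * G * v * kV
      + 2 * l\<^sup>2 * h * v * dGq + l * h * B"
proof -
  have t1: "l ^ 4 * G0\<^sup>2 / 2 * (h ^ 3 * v\<^sup>2) \<le> l ^ 4 * h ^ 3 * G\<^sup>2 * v\<^sup>2 + l ^ 3 * h ^ 3 * v\<^sup>2 * D1"
  proof -
    have "G0\<^sup>2 \<le> G\<^sup>2" using b(1) pos by (simp add: power_mono)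
    then have "l * G0\<^sup>2 \<le> l * G\<^sup>2" using pos by simp
    then have "l * G0\<^sup>2 / 2 \<le> l * G\<^sup>2 + D1" using l(1) b(3) by linarith
    then have "l ^ 3 * h ^ 3 * v\<^sup>2 * (l * G0\<^sup>2 / 2) \<le> l ^ 3 * h ^ 3 * v\<^sup>2 * (l * G\<^sup>2 + D1)"
      using pos by (intro mult_left_mono) auto
    then show ?thesis by (simp add: algebra_simps power4_eq_xxxx power3_eq_cube)
  qed
  have t2: "l\<^sup>2 * (G0 * c) / 2 * (h * p\<^sup>2) \<le> l\<^sup>2 * h * G * Q + l * h * B"
  proof -
    have "G0 * (c * p\<^sup>2) \<le> G * Q" using b pos by (intro mult_mono) auto
    then have 1: "l * (G0 * (c * p\<^sup>2)) \<le> l * (G * Q)" using pos by simp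
    have "2 * K * p\<^sup>2 \<le> l * (G0 * c) * p\<^sup>2" using l(2) by (intro mult_right_mono) auto
    then have "l * (G0 * c) * p\<^sup>2 / 2 \<le> l * (G * Q) + B" using 1 b(6) by (simp add: algebra_simps abs_le_iff)
    then have "l * h * (l * (G0 * c) * p\<^sup>2 / 2) \<le> l * h * (l * (G * Q) + B)"
      using pos by (intro mult_left_mono) auto
    then show ?thesis by (simp add: algebra_simps power2_eq_square)
  qed
  define M where "M = K\<^sup>2 + K"
  have M: "M \<ge> 0" using pos by (simp add: M_def)
  have t3: "\<bar>2 * l ^ 3 * h * G * v * kV + 2 * l\<^sup>2 * h * v * dGq\<bar> \<le> h * (2 * (l * p) * (l\<^sup>2 * M * \<bar>v\<bar>))"
  proof -
    have "\<bar>G * kV\<bar> \<le> K * (K * p)" unfolding abs_mult using b pos by (intro mult_mono) auto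
    then have 1: "l * \<bar>G * kV\<bar> \<le> l * (K\<^sup>2 * p)" using pos by (simp add: power2_eq_square mult.assoc)
    have "K * p \<le> l * (K * p)" using pos mult_right_mono[of 1 l "K * p"] by simp
    then have "\<bar>dGq\<bar> \<le> l * (K * p)" using b(5) by linarith
    then have 2: "\<bar>l * (G * kV) + dGq\<bar> \<le> l * (M * p)"
    proof -
      have "\<bar>l * (G * kV) + dGq\<bar> \<le> l * \<bar>G * kV\<bar> + \<bar>dGq\<bar>"
        using abs_triangle_ineq[of "l * (G * kV)" dGq] abs_mult[of l "G * kV"] pos by simp
      also have "\<dots> \<le> l * (K\<^sup>2 * p) + l * (K * p)" using 1 \<open>\<bar>dGq\<bar> \<le> l * (K * p)\<close> by linarith
      also have "\<dots> = l * (M * p)" by (simp add: M_def algebra_simps)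
      finally show ?thesis .
    qed
    have "2 * l ^ 3 * h * G * v * kV + 2 * l\<^sup>2 * h * v * dGq = 2 * l\<^sup>2 * h * v * (l * (G * kV) + dGq)"
      by (simp add: algebra_simps power2_eq_square power3_eq_cube)
    also have "\<bar>\<dots>\<bar> = 2 * l\<^sup>2 * h * \<bar>v\<bar> * \<bar>l * (G * kV) + dGq\<bar>" using pos by (simp add: abs_mult)
    also have "\<dots> \<le> 2 * l\<^sup>2 * h * \<bar>v\<bar> * (l * (M * p))" using pos 2 by (intro mult_left_mono) auto
    finally show ?thesis by (simp add: algebra_simps)
  qed
  have gc: "G0 * c > 0" using pos by simp
  have am: "2 * X * Y \<le> \<alpha> / 4 * X\<^sup>2 + 4 / \<alpha> * Y\<^sup>2" if "\<alpha> > 0" for X Y \<alpha> :: real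
  proof -
    have "0 \<le> (\<alpha> * X / 2 - 2 * Y)\<^sup>2 / \<alpha>" using that by simp
    also have "\<dots> = \<alpha> / 4 * X\<^sup>2 + 4 / \<alpha> * Y\<^sup>2 - 2 * X * Y" using that
      by (simp add: field_simps power2_eq_square)
    finally show ?thesis by simp
  qed
  \<comment> \<open>Young's inequality with parameter \<open>G0 * c\<close> charges the permitted
    quarter to \<open>p\<close>; what falls on \<open>v\<close> is controlled by the lower bound on
    \<open>h\<^sup>2\<close>.\<close>
  have t4: "2 * (l * p) * (l\<^sup>2 * M * \<bar>v\<bar>) \<le> (G0 * c) / 4 * (l * p)\<^sup>2 + l ^ 4 * (4 * M\<^sup>2 / (G0 * c)) * v\<^sup>2"
    using am[OF gc, of "l * p" "l\<^sup>2 * M * \<bar>v\<bar>"] by (simp add: power_mult_distrib power_mult[symmetric] algebra_simps)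
  have "4 * M\<^sup>2 / (G0 * c) \<le> h\<^sup>2 * G0\<^sup>2 / 4" using h unfolding M_def by simp
  then have "l ^ 4 * (4 * M\<^sup>2 / (G0 * c)) * v\<^sup>2 \<le> l ^ 4 * (h\<^sup>2 * G0\<^sup>2 / 4) * v\<^sup>2"
    by (intro mult_right_mono mult_left_mono) auto
  with t4 have "2 * (l * p) * (l\<^sup>2 * M * \<bar>v\<bar>) \<le> (G0 * c) / 4 * (l * p)\<^sup>2 + l ^ 4 * (h\<^sup>2 * G0\<^sup>2 / 4) * v\<^sup>2"
    by linarith
  then have "h * (2 * (l * p) * (l\<^sup>2 * M * \<bar>v\<bar>)) \<le> h * ((G0 * c) / 4 * (l * p)\<^sup>2 + l ^ 4 * (h\<^sup>2 * G0\<^sup>2 / 4) * v\<^sup>2)"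
    using pos by (intro mult_left_mono) auto
  also have "\<dots> = l ^ 4 * G0\<^sup>2 / 4 * (h ^ 3 * v\<^sup>2) + l\<^sup>2 * (G0 * c) / 4 * (h * p\<^sup>2)"
    by (simp add: algebra_simps power2_eq_square power3_eq_cube)
  finally have t5: "\<bar>2 * l ^ 3 * h * G * v * kV + 2 * l\<^sup>2 * h * v * dGq\<bar>
      \<le> l ^ 4 * G0\<^sup>2 / 4 * (h ^ 3 * v\<^sup>2) + l\<^sup>2 * (G0 * c) / 4 * (h * p\<^sup>2)" using t3 by linarith
  have t6: "0 \<le> 2 * l\<^sup>2 * h * kV\<^sup>2" using pos by simp
  show ?thesis using t1 t2 t5 t6 by linarith
qed

section \<open>The weighted estimate for functions supported in an annulus\<close>

definition jet :: "(real ^ 'n::finite \<Rightarrow> real) \<Rightarrow> ('n \<Rightarrow> real ^ 'n \<Rightarrow> real) \<Rightarrow> ('n \<Rightarrow> 'n \<Rightarrow> real ^ 'n \<Rightarrow> real) \<Rightarrow> bool" where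
  "jet u U UU \<longleftrightarrow> has_grad u U \<and> (\<forall>i. has_grad (U i) (UU i)) \<and> (\<forall>i j. continuous_on UNIV (UU i j))
     \<and> (\<forall>i j x. UU i j x = UU j i x)"

text \<open>The bounds are required on \<open>S\<close> only, because mollified coefficients inherit
  them on a smaller ball than the one on which they were cut off. \<open>t\<close> bounds single
  first derivatives, which is what a Lipschitz constant of the entries provides.\<close>

definition elliptic_coeffs :: "real \<Rightarrow> real \<Rightarrow> (real ^ 'n::finite) set \<Rightarrow> ('n \<Rightarrow> 'n \<Rightarrow> real ^ 'n \<Rightarrow> real)
     \<Rightarrow> ('n \<Rightarrow> 'n \<Rightarrow> 'n \<Rightarrow> real ^ 'n \<Rightarrow> real) \<Rightarrow> bool" where
  "elliptic_coeffs th t S a da \<longleftrightarrow> (\<forall>i j. has_grad (a i j) (da i j)) \<and> (\<forall>i j m. continuous_on UNIV (da i j m))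
     \<and> (\<forall>i j x. a i j x = a j i x)
     \<and> (\<forall>x\<in>S. \<forall>\<xi>. (\<Sum>i\<in>UNIV. (\<xi> i)\<^sup>2) / th \<le> (\<Sum>i\<in>UNIV. \<Sum>j\<in>UNIV. \<xi> i * a i j x * \<xi> j))
     \<and> (\<forall>x\<in>S. \<forall>i j. \<bar>a i j x\<bar> \<le> th) \<and> (\<forall>x\<in>S. \<forall>i j m. \<bar>da i j m x\<bar> \<le> t)"

text \<open>The square of \<open>exp h\<close> for
  \<open>h x = s * exp (- l * (norm (x - c))\<^sup>2)\<close>: weighted integrals of
  \<open>u\<^sup>2\<close> are plain integrals of \<open>v\<^sup>2\<close> with
  \<open>v = exp h * u\<close>.\<close>

definition wt :: "real \<Rightarrow> real \<Rightarrow> real ^ 'n::finite \<Rightarrow> real ^ 'n \<Rightarrow> real" where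
  "wt l s c x = exp (2 * (s * exp (- l * (norm (x - c))\<^sup>2)))"

lemma abs_sum_UNIV_le:
  fixes f :: "'n::finite \<Rightarrow> real"
  assumes "\<And>i. \<bar>f i\<bar> \<le> B"
  shows "\<bar>\<Sum>i\<in>UNIV. f i\<bar> \<le> real CARD('n) * B"
proof -
  have "\<bar>\<Sum>i\<in>UNIV. f i\<bar> \<le> (\<Sum>i\<in>UNIV. \<bar>f i\<bar>)" by (rule sum_abs)
  also have "\<dots> \<le> (\<Sum>i\<in>(UNIV::'n set). B)" by (intro sum_mono assms)
  finally show ?thesis by simp
qed

lemma norm_sq_vec: "(norm (x :: real ^ 'n::finite))\<^sup>2 = (\<Sum>i\<in>UNIV. (x $ i)\<^sup>2)"
  unfolding power2_norm_eq_inner inner_vec_def by (simp add: power2_eq_square)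

lemma has_grad_norm_sq [grad_intros]:
  "has_grad (\<lambda>x. (norm (x - c))\<^sup>2) (\<lambda>i x. 2 * (x - c) $ i)"
  unfolding norm_sq_vec vector_minus_component
  by (rule has_grad_eq_rhs, (rule grad_intros)+)
     (auto simp: if_distrib[of "\<lambda>c. _ * c"] cong: if_cong)

lemma double_sum_linear:
  fixes f g :: "'n::finite \<Rightarrow> 'n \<Rightarrow> real"
  shows "(\<Sum>i\<in>UNIV. \<Sum>j\<in>UNIV. f i j + g i j) = (\<Sum>i\<in>UNIV. \<Sum>j\<in>UNIV. f i j) + (\<Sum>i\<in>UNIV. \<Sum>j\<in>UNIV. g i j)"
    and "(\<Sum>i\<in>UNIV. \<Sum>j\<in>UNIV. f i j - g i j) = (\<Sum>i\<in>UNIV. \<Sum>j\<in>UNIV. f i j) - (\<Sum>i\<in>UNIV. \<Sum>j\<in>UNIV. g i j)"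
    and "(\<Sum>i\<in>UNIV. \<Sum>j\<in>UNIV. c * f i j) = c * (\<Sum>i\<in>UNIV. \<Sum>j\<in>UNIV. f i j)"
  by (simp_all add: sum.distrib sum_subtractf sum_distrib_left)

lemma jetD:
  assumes "jet u U UU"
  shows "has_grad u U" "has_grad (U i) (UU i)" "continuous_on S (UU i j)" "UU i j x = UU j i x"
    "continuous_on S u" "continuous_on S (U i)"
  using assms unfolding jet_def by (auto intro: continuous_on_subset has_grad_continuous)

lemma abs_le_sqrt_sum:
  fixes V :: "'n::finite \<Rightarrow> real"
  shows "\<bar>V i\<bar> \<le> sqrt (\<Sum>i\<in>UNIV. (V i)\<^sup>2)"
proof -
  have "(V i)\<^sup>2 \<le> (\<Sum>i\<in>UNIV. (V i)\<^sup>2)" by (rule member_le_sum) auto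
  then show ?thesis by (metis real_sqrt_abs real_sqrt_le_iff)
qed

text \<open>After conjugation by \<open>exp h\<close>, \<open>carleman_identity\<close> produces the
  integral of \<open>E\<close>, and \<open>carleman_pointwise_lower\<close> makes \<open>E\<close>
  positive. The gradient of \<open>h\<close> is \<open>l * h * g\<close> with \<open>g\<close>
  vanishing at the centre, so the support condition at \<open>r0\<close> is what bounds
  \<open>G\<close> from below. All constants precede the centre, the coefficients and the
  function.\<close>

lemma carleman:
  fixes th t r0 r1 :: real
  assumes th: "th \<ge> 1" and t: "t \<ge> 0" and r: "0 < r0" "r0 < r1"
  shows "\<exists>l>0. \<exists>C>0. \<exists>s0\<ge>1. \<forall>ctr (a :: 'n::finite \<Rightarrow> 'n \<Rightarrow> real ^ 'n \<Rightarrow> real) da u U UU s.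
     elliptic_coeffs th t (cball ctr r1) a da \<longrightarrow> jet u U UU \<longrightarrow>
     (\<forall>x. norm (x - ctr) < r0 \<or> norm (x - ctr) > r1 \<longrightarrow> u x = 0) \<longrightarrow> s \<ge> s0 \<longrightarrow>
     s * (LINT x|lborel. ((u x)\<^sup>2 + (\<Sum>i\<in>UNIV. (U i x)\<^sup>2)) * wt l s ctr x)
       \<le> C * (LINT x|lborel. (\<Sum>i\<in>UNIV. \<Sum>j\<in>UNIV. a i j x * UU i j x)\<^sup>2 * wt l s ctr x)"
proof -
  define N where "N = real CARD('n)"
  have N: "N \<ge> 1" unfolding N_def by (simp add: Suc_leI)
  \<comment> \<open>\<open>\<gamma>\<close> bounds the entries of \<open>g\<close> on the ball;
    \<open>k1\<close> to \<open>k4\<close> bound \<open>k\<close>, \<open>dk\<close>,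
    \<open>G\<close>, \<open>dG\<close>, and \<open>k5\<close> bounds \<open>q\<close> relative to
    the length of \<open>V\<close>.\<close>
  define \<gamma> where "\<gamma> = 2 * r1"
  define k1 where "k1 = N * (th * \<gamma>)"
  define k2 where "k2 = N * (t * \<gamma> + th * 2)"
  define k3 where "k3 = N * (k1 * \<gamma>)"
  define k4 where "k4 = N * (k2 * \<gamma> + k1 * 2)"
  define k5 where "k5 = N * th"
  have nn: "N \<ge> 0" "th \<ge> 0" "\<gamma> \<ge> 0" "k1 \<ge> 0" "k2 \<ge> 0" "k3 \<ge> 0" "k4 \<ge> 0" "k5 \<ge> 0"
    using N th t r unfolding \<gamma>_def k1_def k2_def k3_def k4_def k5_def by auto
  \<comment> \<open>One number for all lower-order quantities: the summands bound, in this order,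
    \<open>G\<close>, \<open>D1\<close>, \<open>kV\<close>, the sum of \<open>dG * q\<close>,
    \<open>B\<close>, and the sums \<open>adg\<close> and \<open>dV\<close> in the
    remainder.\<close>
  define K where "K = k3 + (N * (k4 * k1) + k3 * (N * k2)) + N * k1 + N * (k4 * k5)
    + (2 * (N * (N * (k2 * k5))) + N * (N * (N * (k1 * t))) + N * k5 * (N * k2)) + N * (N * (th * 2)) + N * (N * t)"
  have Kge: "k3 \<le> K" "N * (k4 * k1) + k3 * (N * k2) \<le> K" "N * k1 \<le> K" "N * (k4 * k5) \<le> K"
    "2 * (N * (N * (k2 * k5))) + N * (N * (N * (k1 * t))) + N * k5 * (N * k2) \<le> K" "N * (N * (th * 2)) \<le> K"
    "N * (N * t) \<le> K" and K: "K \<ge> 0"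
  proof -
    have "0 \<le> N * (k4 * k1)" "0 \<le> k3 * (N * k2)" "0 \<le> N * k1" "0 \<le> N * (k4 * k5)" "0 \<le> N * (N * (k2 * k5))"
      "0 \<le> N * (N * (N * (k1 * t)))" "0 \<le> N * k5 * (N * k2)" "0 \<le> N * (N * (th * 2))" "0 \<le> N * (N * t)"
      using nn t by auto
    then show "k3 \<le> K" "N * (k4 * k1) + k3 * (N * k2) \<le> K" "N * k1 \<le> K" "N * (k4 * k5) \<le> K"
      "2 * (N * (N * (k2 * k5))) + N * (N * (N * (k1 * t))) + N * k5 * (N * k2) \<le> K" "N * (N * (th * 2)) \<le> K"
      "N * (N * t) \<le> K" "K \<ge> 0"
      unfolding K_def using nn by linarith+
  qed
  define G0 where "G0 = (2 * r0)\<^sup>2 / th"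
  define c where "c = 1 / th"
  have G0: "G0 > 0" and c: "c > 0" using th r unfolding G0_def c_def by auto
  \<comment> \<open>Large enough for both conditions on \<open>l\<close> in
    \<open>carleman_pointwise_lower\<close>; from here on \<open>l\<close> is fixed and only
    \<open>s\<close> grows.\<close>
  define l where "l = 1 + 2 * K / G0\<^sup>2 + 2 * K / (G0 * c)"
  have l1: "l \<ge> 1" using K G0 c unfolding l_def by simp
  have l2: "2 * K \<le> l * G0\<^sup>2" "2 * K \<le> l * (G0 * c)"
  proof -
    have "2 * K / G0\<^sup>2 \<le> l" "2 * K / (G0 * c) \<le> l" using K G0 c unfolding l_def by simp_all
    then show "2 * K \<le> l * G0\<^sup>2" "2 * K \<le> l * (G0 * c)"
      using G0 c by (simp_all add: divide_le_eq)
  qed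
  define c1 where "c1 = min (l ^ 4 * G0\<^sup>2 / 4) (l\<^sup>2 * (G0 * c) / 4)"
  have c1: "c1 > 0" "c1 \<le> l ^ 4 * G0\<^sup>2 / 4" "c1 \<le> l\<^sup>2 * (G0 * c) / 4" using l1 G0 c unfolding c1_def by auto
  define K3 where "K3 = 8 * l ^ 4 * K\<^sup>2 + 2 * K\<^sup>2"
  have K3: "K3 \<ge> 0" unfolding K3_def by simp
  \<comment> \<open>The least value of \<open>h / s\<close> on the ball of radius \<open>r1\<close>,
    so that \<open>s \<ge> s0\<close> forces \<open>h \<ge> h0\<close> there.\<close>
  define m where "m = exp (- l * r1\<^sup>2)"
  have m: "m > 0" "m \<le> 1" unfolding m_def using l1 by auto
  \<comment> \<open>The second summand lets half of the positive term absorb the square of the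
    remainder, the third is the condition on \<open>h\<close> in the pointwise bound, and the 1
    allows lower powers of \<open>h\<close> to be raised.\<close>
  define h0 where "h0 = 1 + 2 * K3 / c1 + 16 * (K\<^sup>2 + K)\<^sup>2 / (G0 * c) / G0\<^sup>2"
  have h0: "h0 \<ge> 1" "2 * K3 / c1 \<le> h0" "16 * (K\<^sup>2 + K)\<^sup>2 / (G0 * c) / G0\<^sup>2 \<le> h0"
    using K3 c1 G0 c unfolding h0_def by simp_all
  define s0 where "s0 = 1 + h0 / m"
  have s0: "s0 \<ge> 1" using h0 m unfolding s0_def by simp
  \<comment> \<open>The price for returning from \<open>v\<close> and its gradient to
    \<open>u\<close> and its gradient, and for replacing \<open>h\<close> by
    \<open>s * m\<close>.\<close>
  define C' where "C' = (2 + 2 * N * l\<^sup>2 * \<gamma>\<^sup>2) / m"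
  have C': "C' > 0" unfolding C'_def using m N by (intro divide_pos_pos add_pos_nonneg) auto
  define C where "C = C' * (2 / c1)"
  have C: "C > 0" unfolding C_def using C' c1 by simp
  have main: "s * (LINT x|lborel. ((u x)\<^sup>2 + (\<Sum>i\<in>UNIV. (U i x)\<^sup>2)) * wt l s ctr x)
       \<le> C * (LINT x|lborel. (\<Sum>i\<in>UNIV. \<Sum>j\<in>UNIV. a i j x * UU i j x)\<^sup>2 * wt l s ctr x)"
    if co: "elliptic_coeffs th t (cball ctr r1) a da" and J: "jet u U UU"
      and sup: "\<forall>x. norm (x - ctr) < r0 \<or> norm (x - ctr) > r1 \<longrightarrow> u x = 0" and s: "s \<ge> s0"
    for ctr and a :: "'n \<Rightarrow> 'n \<Rightarrow> real ^ 'n \<Rightarrow> real" and da u U UU s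
  proof -
    define h where "h x = s * exp (- l * (norm (x - ctr))\<^sup>2)" for x :: "real ^ 'n"
    define g where "g i x = - 2 * (x - ctr) $ i" for i and x :: "real ^ 'n"
    define dg where "dg i j = (if i = j then - 2 else 0 :: real)" for i j :: 'n
    define k where "k i x = (\<Sum>j\<in>UNIV. a i j x * g j x)" for i x
    define dk where "dk i m x = (\<Sum>j\<in>UNIV. da i j m x * g j x + a i j x * dg j m)" for i m x
    define G where "G x = (\<Sum>i\<in>UNIV. k i x * g i x)" for x
    define dG where "dG m x = (\<Sum>i\<in>UNIV. dk i m x * g i x + k i x * dg i m)" for m x
    have ga: "has_grad (a i j) (da i j)" and cda: "continuous_on UNIV (da i j n)" and syma: "a i j x = a j i x" for i j n x
      using co unfolding elliptic_coeffs_def by auto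
    have gh: "has_grad h (\<lambda>i x. l * h x * g i x)"
      unfolding h_def g_def by (rule has_grad_eq_rhs, (rule grad_intros)+) (simp add: algebra_simps)
    have gg: "has_grad (g i) (\<lambda>m x. dg i m)" for i
      unfolding g_def dg_def vector_minus_component by (rule has_grad_eq_rhs, (rule grad_intros)+) simp
    have gk: "has_grad (k i) (dk i)" for i unfolding k_def dk_def by (intro has_grad_sum has_grad_mult ga gg)
    have gG: "has_grad G dG" unfolding G_def dG_def by (intro has_grad_sum has_grad_mult gk gg)
    note cont = cda has_grad_continuous[OF ga] has_grad_continuous[OF gh] has_grad_continuous[OF gg]
      has_grad_continuous[OF gk] has_grad_continuous[OF gG] jetD[OF J]
    have cdk: "continuous_on UNIV (dk i j)" for i j unfolding dk_def by (intro continuous_intros cont)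
    have cdG: "continuous_on UNIV (dG i)" for i unfolding dG_def by (intro continuous_intros cont cdk)
    define v where "v x = exp (h x) * u x" for x
    define V where "V i x = exp (h x) * (l * h x * g i x) * u x + exp (h x) * U i x" for i x
    define H where "H i j x = exp (h x) * (l * h x * g j x) * (l * h x * g i x * u x + U i x)
      + exp (h x) * ((l * (l * h x * g j x) * g i x + l * h x * dg i j) * u x + l * h x * g i x * U j x + UU i j x)" for i j x
    have gv: "has_grad v V" unfolding v_def V_def
      by (intro has_grad_mult has_grad_exp gh jetD[OF J])
    have gV: "has_grad (V i) (H i)" for i unfolding V_def
      by (rule has_grad_eq_rhs, (rule has_grad_mult has_grad_add has_grad_exp has_grad_cmult gh gg jetD[OF J])+)
         (simp add: H_def algebra_simps)
    have cH: "continuous_on UNIV (H i j)" for i j unfolding H_def by (intro continuous_intros cont)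
    have symH: "H i j x = H j i x" for i j x
      unfolding H_def using jetD(4)[OF J, of i j x] by (simp add: dg_def algebra_simps)
    have supv: "norm (x - ctr) > r1 \<Longrightarrow> v x = 0" for x using sup by (simp add: v_def)
    define q where "q i x = (\<Sum>j\<in>UNIV. a i j x * V j x)" for i x
    define kV where "kV x = (\<Sum>i\<in>UNIV. k i x * V i x)" for x
    define Q where "Q x = (\<Sum>i\<in>UNIV. V i x * q i x)" for x
    define Lv where "Lv x = (\<Sum>i\<in>UNIV. \<Sum>j\<in>UNIV. da i j i x * V j x + a i j x * H j i x)" for x
    define M1 where "M1 x = - 2 * l * (h x * kV x) - 2 * l\<^sup>2 * (h x * G x * v x)" for x
    define M2 where "M2 x = Lv x + l\<^sup>2 * (h x)\<^sup>2 * G x * v x" for x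
    define D1 where "D1 x = (\<Sum>i\<in>UNIV. dG i x * k i x) + G x * (\<Sum>i\<in>UNIV. dk i i x)" for x
    define B where "B x = 2 * (\<Sum>i\<in>UNIV. \<Sum>j\<in>UNIV. dk j i x * V j x * q i x)
          - (\<Sum>m\<in>UNIV. \<Sum>i\<in>UNIV. \<Sum>j\<in>UNIV. k m x * da i j m x * V i x * V j x)
          - Q x * (\<Sum>i\<in>UNIV. dk i i x)" for x
    define E where "E x = l ^ 4 * h x ^ 3 * (G x)\<^sup>2 * (v x)\<^sup>2
      + l ^ 3 * h x ^ 3 * (v x)\<^sup>2 * D1 x
      + l\<^sup>2 * h x * G x * Q x + 2 * l\<^sup>2 * h x * (kV x)\<^sup>2 + 2 * l ^ 3 * h x * G x * v x * kV x
      + 2 * l\<^sup>2 * h x * v x * (\<Sum>i\<in>UNIV. dG i x * q i x)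
      + l * h x * B x" for x
    note id = carleman_identity[OF ga cda syma gh has_grad_continuous[OF gg] gk cdk k_def gG cdG G_def gv gV cH symH supv,
      folded q_def, folded kV_def Q_def Lv_def, folded M1_def M2_def]
    have id: "(LINT x|lborel. M1 x * M2 x) = (LINT x|lborel. E x)" "integrable lborel (\<lambda>x. M1 x * M2 x)" "integrable lborel E"
      unfolding E_def B_def D1_def using id[of r1 ctr] by simp_all
    define P where "P x = (\<Sum>i\<in>UNIV. \<Sum>j\<in>UNIV. a i j x * UU i j x)" for x
    define X where "X x = exp (h x) * P x" for x
    define p where "p x = sqrt (\<Sum>i\<in>UNIV. (V i x)\<^sup>2)" for x
    have p2: "(p x)\<^sup>2 = (\<Sum>i\<in>UNIV. (V i x)\<^sup>2)" for x unfolding p_def by (simp add: sum_nonneg)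
    have p0: "p x \<ge> 0" for x unfolding p_def by (simp add: sum_nonneg)
    define W where "W x = h x ^ 3 * (v x)\<^sup>2 + h x * (p x)\<^sup>2" for x
    have spos: "s > 0" using s s0 by simp
    have hpos: "h x > 0" for x unfolding h_def using spos by simp
    have out: "u x = 0 \<and> (\<forall>i. U i x = 0)" if "norm (x - ctr) < r0 \<or> norm (x - ctr) > r1" for x
    proof -
      have "open {x. norm (x - ctr) < r0 \<or> norm (x - ctr) > r1}"
        by (intro open_Collect_disj open_Collect_less continuous_intros)
      from has_grad_zero_open[OF jetD(1)[OF J] this] show ?thesis using sup that by auto
    qed
    have hlow: "s * m \<le> h x" if "norm (x - ctr) \<le> r1" for x
    proof -
      have "(norm (x - ctr))\<^sup>2 \<le> r1\<^sup>2" using that by (simp add: power_mono)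
      then have "l * (norm (x - ctr))\<^sup>2 \<le> l * r1\<^sup>2" using l1 by simp
      then show ?thesis unfolding h_def m_def using spos by simp
    qed
    have hge: "h0 \<le> h x" if "norm (x - ctr) \<le> r1" for x
    proof -
      have "h0 / m \<le> s" using s unfolding s0_def by simp
      then have "h0 \<le> s * m" using m by (simp add: divide_le_eq)
      then show ?thesis using hlow[OF that] by simp
    qed
    \<comment> \<open>\<open>E\<close> and \<open>M1 * M2\<close> have the same integral, so
      integrating this leaves only \<open>W\<close> and \<open>X\<^sup>2\<close>.\<close>
    have pt: "c1 / 2 * W x \<le> E x - M1 x * M2 x + (X x)\<^sup>2" for x
    proof (cases "norm (x - ctr) < r0 \<or> norm (x - ctr) > r1")
      case True
      from out[OF this] have "v x = 0" "\<forall>i. V i x = 0" by (auto simp: v_def V_def)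
      then show ?thesis
        by (simp add: W_def p_def E_def M1_def B_def kV_def Q_def q_def)
    next
      case False
      then have nx: "r0 \<le> norm (x - ctr)" "norm (x - ctr) \<le> r1" by auto
      then have xb: "x \<in> cball ctr r1" by (simp add: dist_norm norm_minus_commute)
      have ba: "\<bar>a i j x\<bar> \<le> th" and bda: "\<bar>da i j n x\<bar> \<le> t" for i j n
        using co xb unfolding elliptic_coeffs_def by auto
      have ell: "(\<Sum>i\<in>UNIV. (\<xi> i)\<^sup>2) / th \<le> (\<Sum>i\<in>UNIV. \<Sum>j\<in>UNIV. \<xi> i * a i j x * \<xi> j)" for \<xi>
        using co xb unfolding elliptic_coeffs_def by auto
      have quad: "(\<Sum>i\<in>UNIV. \<xi> i * (\<Sum>j\<in>UNIV. a i j x * \<xi> j)) = (\<Sum>i\<in>UNIV. \<Sum>j\<in>UNIV. \<xi> i * a i j x * \<xi> j)" for \<xi>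
        by (simp add: sum_distrib_left mult.assoc)
      have bg: "\<bar>g i x\<bar> \<le> \<gamma>" for i
        using component_le_norm_cart[of "x - ctr" i] nx unfolding g_def \<gamma>_def by (simp add: abs_mult)
      have bdg: "\<bar>dg i j\<bar> \<le> 2" for i j unfolding dg_def by simp
      have bk: "\<bar>k i x\<bar> \<le> k1" for i unfolding k_def k1_def N_def
        by (rule abs_sum_UNIV_le) (unfold abs_mult, intro mult_mono ba bg, use nn in auto)
      have bdk: "\<bar>dk i n x\<bar> \<le> k2" for i n unfolding dk_def k2_def N_def
        by (rule abs_sum_UNIV_le, rule order_trans[OF abs_triangle_ineq], unfold abs_mult)
           (intro add_mono mult_mono ba bg bda bdg, use nn t in auto)
      have bG: "\<bar>G x\<bar> \<le> k3" unfolding G_def k3_def N_def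
        by (rule abs_sum_UNIV_le) (unfold abs_mult, intro mult_mono bk bg, use nn in auto)
      have bdG: "\<bar>dG n x\<bar> \<le> k4" for n unfolding dG_def k4_def N_def
        by (rule abs_sum_UNIV_le, rule order_trans[OF abs_triangle_ineq], unfold abs_mult)
           (intro add_mono mult_mono bk bg bdk bdg, use nn t in auto)
      have bV: "\<bar>V i x\<bar> \<le> p x" for i unfolding p_def by (rule abs_le_sqrt_sum)
      have bq: "\<bar>q i x\<bar> \<le> k5 * p x" for i unfolding q_def k5_def N_def mult.assoc
        by (rule abs_sum_UNIV_le) (unfold abs_mult, intro mult_mono ba bV, use nn in auto)
      have bkV: "\<bar>kV x\<bar> \<le> N * (k1 * p x)" unfolding kV_def N_def
        by (rule abs_sum_UNIV_le) (unfold abs_mult, intro mult_mono bk bV, use nn in auto)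
      have bdGq: "\<bar>\<Sum>i\<in>UNIV. dG i x * q i x\<bar> \<le> N * (k4 * (k5 * p x))" unfolding N_def
        by (rule abs_sum_UNIV_le) (unfold abs_mult, intro mult_mono bdG bq, use nn in auto)
      have bQ: "\<bar>Q x\<bar> \<le> N * (p x * (k5 * p x))" unfolding Q_def N_def
        by (rule abs_sum_UNIV_le) (unfold abs_mult, intro mult_mono bV bq, use p0 in auto)
      have bD: "\<bar>\<Sum>i\<in>UNIV. dk i i x\<bar> \<le> N * k2" unfolding N_def
        by (rule abs_sum_UNIV_le) (rule bdk)
      have bdGk: "\<bar>\<Sum>i\<in>UNIV. dG i x * k i x\<bar> \<le> N * (k4 * k1)" unfolding N_def
        by (rule abs_sum_UNIV_le) (unfold abs_mult, intro mult_mono bdG bk, use nn in auto)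
      have bD1: "\<bar>D1 x\<bar> \<le> K"
      proof -
        have "\<bar>G x * (\<Sum>i\<in>UNIV. dk i i x)\<bar> \<le> k3 * (N * k2)" unfolding abs_mult
          by (intro mult_mono bG bD) (use nn in auto)
        then have "\<bar>D1 x\<bar> \<le> N * (k4 * k1) + k3 * (N * k2)" unfolding D1_def using bdGk by linarith
        then show ?thesis using Kge(2) by linarith
      qed
      have bB: "\<bar>B x\<bar> \<le> K * (p x)\<^sup>2"
      proof -
        have 1: "\<bar>\<Sum>i\<in>UNIV. \<Sum>j\<in>UNIV. dk j i x * V j x * q i x\<bar> \<le> N * (N * (k2 * p x * (k5 * p x)))"
          unfolding N_def
          by (rule abs_sum_UNIV_le, rule abs_sum_UNIV_le) (unfold abs_mult, intro mult_mono bdk bV bq, use p0 nn in auto)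
        have 2: "\<bar>\<Sum>n\<in>UNIV. \<Sum>i\<in>UNIV. \<Sum>j\<in>UNIV. k n x * da i j n x * V i x * V j x\<bar> \<le> N * (N * (N * (k1 * t * p x * p x)))"
          unfolding N_def
          by (rule abs_sum_UNIV_le, rule abs_sum_UNIV_le, rule abs_sum_UNIV_le)
             (unfold abs_mult, intro mult_mono bk bda bV, use p0 nn t in auto)
        have 3: "\<bar>Q x * (\<Sum>i\<in>UNIV. dk i i x)\<bar> \<le> N * (p x * (k5 * p x)) * (N * k2)"
          unfolding abs_mult by (intro mult_mono bQ bD) (use p0 nn in auto)
        have "\<bar>B x\<bar> \<le> 2 * (N * (N * (k2 * p x * (k5 * p x)))) + N * (N * (N * (k1 * t * p x * p x))) + N * (p x * (k5 * p x)) * (N * k2)"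
          unfolding B_def using 1 2 3 by linarith
        also have "\<dots> = (2 * (N * (N * (k2 * k5))) + N * (N * (N * (k1 * t))) + N * k5 * (N * k2)) * (p x)\<^sup>2"
          by (simp add: algebra_simps power2_eq_square)
        also have "\<dots> \<le> K * (p x)\<^sup>2" using Kge(5) by (intro mult_right_mono) auto
        finally show ?thesis .
      qed
      have GG: "G0 \<le> G x"
      proof -
        have "(2 * r0)\<^sup>2 \<le> (2 * norm (x - ctr))\<^sup>2" using nx r by (intro power_mono) auto
        also have "\<dots> = (\<Sum>i\<in>UNIV. (g i x)\<^sup>2)"
          unfolding g_def power_mult_distrib norm_sq_vec by (simp add: sum_distrib_left)
        finally have "G0 \<le> (\<Sum>i\<in>UNIV. (g i x)\<^sup>2) / th" unfolding G0_def using th by (simp add: divide_right_mono)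
        also have "\<dots> \<le> G x" using ell[of "\<lambda>i. g i x"] unfolding quad[symmetric] G_def k_def by (simp add: mult.commute)
        finally show ?thesis .
      qed
      have QQ: "c * (p x)\<^sup>2 \<le> Q x"
        using ell[of "\<lambda>i. V i x"] unfolding quad[symmetric] Q_def q_def c_def p2 by simp
      have hx: "h0 \<le> h x" using hge nx by simp
      then have h1: "h x \<ge> 1" using h0 by simp
      have hh: "16 * (K\<^sup>2 + K)\<^sup>2 / (G0 * c) \<le> (h x)\<^sup>2 * G0\<^sup>2"
      proof -
        have "16 * (K\<^sup>2 + K)\<^sup>2 / (G0 * c) / G0\<^sup>2 \<le> h x" using h0(3) hx by linarith
        also have "\<dots> \<le> (h x)\<^sup>2" using h1 by (simp add: power2_eq_square)
        finally show ?thesis by (rule iffD1[OF pos_divide_le_eq, rotated]) (use G0 in simp)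
      qed
      have le': "N * (k1 * p x) \<le> K * p x" "N * (k4 * (k5 * p x)) \<le> K * p x"
        using mult_right_mono[OF Kge(3) p0[of x]] mult_right_mono[OF Kge(4) p0[of x]] by (simp_all add: mult.assoc)
      have "l ^ 4 * G0\<^sup>2 / 4 * (h x ^ 3 * (v x)\<^sup>2) + l\<^sup>2 * (G0 * c) / 4 * (h x * (p x)\<^sup>2) \<le> E x"
        unfolding E_def
        by (rule carleman_pointwise_lower[OF G0 c K l1 hpos p0 l2 hh GG])
           (use bG Kge(1) bD1 bkV bdGq bB QQ le' in linarith)+
      moreover have "c1 * W x \<le> l ^ 4 * G0\<^sup>2 / 4 * (h x ^ 3 * (v x)\<^sup>2) + l\<^sup>2 * (G0 * c) / 4 * (h x * (p x)\<^sup>2)"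
        unfolding W_def distrib_left using c1 hpos[of x] by (intro add_mono mult_right_mono) auto
      ultimately have EW: "c1 * W x \<le> E x" by linarith
      define dV where "dV = (\<Sum>i\<in>UNIV. \<Sum>j\<in>UNIV. da i j i x * V j x)"
      define adg where "adg = (\<Sum>i\<in>UNIV. \<Sum>j\<in>UNIV. a i j x * dg i j)"
      define aH where "aH = (\<Sum>i\<in>UNIV. \<Sum>j\<in>UNIV. a i j x * H i j x)"
      \<comment> \<open>\<open>X\<close> is the conjugated operator in non-divergence form, while
        \<open>M1 + M2\<close> contains the divergence form and the extra multiple of
        \<open>v\<close>; \<open>Rem\<close> is the difference. Its square is at most
        \<open>K3 * (h\<^sup>2 * v\<^sup>2 + p\<^sup>2)\<close>, one factor \<open>h\<close> below
        \<open>W\<close>.\<close>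
      define Rem where "Rem = l\<^sup>2 * h x * G x * v x - l * h x * v x * adg - dV"
      have Xeq: "X x = M1 x + M2 x + Rem"
      proof -
        have eUU: "exp (h x) * UU i j x = H i j x - l * h x * (g j x * V i x) - l * h x * (g i x * V j x)
           + (l\<^sup>2 * (h x)\<^sup>2 - l\<^sup>2 * h x) * v x * (g i x * g j x) - l * h x * v x * dg i j" for i j
          unfolding H_def V_def v_def by (simp add: algebra_simps power2_eq_square)
        have "X x = (\<Sum>i\<in>UNIV. \<Sum>j\<in>UNIV. a i j x * (exp (h x) * UU i j x))"
          unfolding X_def P_def sum_distrib_left by (intro sum.cong refl) simp
        also have "\<dots> = (\<Sum>i\<in>UNIV. \<Sum>j\<in>UNIV. a i j x * H i j x - l * h x * (a i j x * g j x * V i x) - l * h x * (a i j x * g i x * V j x)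
           + (l\<^sup>2 * (h x)\<^sup>2 - l\<^sup>2 * h x) * v x * (a i j x * g j x * g i x) - l * h x * v x * (a i j x * dg i j))"
          unfolding eUU by (intro sum.cong refl) (simp add: algebra_simps)
        also have "\<dots> = aH - l * h x * (\<Sum>i\<in>UNIV. \<Sum>j\<in>UNIV. a i j x * g j x * V i x) - l * h x * (\<Sum>i\<in>UNIV. \<Sum>j\<in>UNIV. a i j x * g i x * V j x)
           + (l\<^sup>2 * (h x)\<^sup>2 - l\<^sup>2 * h x) * v x * (\<Sum>i\<in>UNIV. \<Sum>j\<in>UNIV. a i j x * g j x * g i x) - l * h x * v x * adg"
          unfolding aH_def adg_def by (simp only: double_sum_linear)
        also have "(\<Sum>i\<in>UNIV. \<Sum>j\<in>UNIV. a i j x * g j x * V i x) = kV x"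
          unfolding kV_def k_def by (simp add: sum_distrib_right)
        also have "(\<Sum>i\<in>UNIV. \<Sum>j\<in>UNIV. a i j x * g i x * V j x) = kV x"
        proof -
          have "(\<Sum>i\<in>UNIV. \<Sum>j\<in>UNIV. a i j x * g i x * V j x) = (\<Sum>j\<in>UNIV. \<Sum>i\<in>UNIV. a i j x * g i x * V j x)"
            by (rule sum.swap)
          then show ?thesis unfolding kV_def k_def by (simp add: sum_distrib_right syma[of _ _ x])
        qed
        also have "(\<Sum>i\<in>UNIV. \<Sum>j\<in>UNIV. a i j x * g j x * g i x) = G x"
          unfolding G_def k_def by (simp add: sum_distrib_right)
        finally have X1: "X x = aH - l * h x * kV x - l * h x * kV x + (l\<^sup>2 * (h x)\<^sup>2 - l\<^sup>2 * h x) * v x * G x - l * h x * v x * adg" .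
        have "Lv x = dV + aH"
          unfolding Lv_def dV_def aH_def by (simp add: sum.distrib symH[of _ _ x])
        then show ?thesis unfolding X1 M1_def M2_def Rem_def by (simp add: algebra_simps)
      qed
      have badg: "\<bar>adg\<bar> \<le> K"
      proof -
        have "\<bar>adg\<bar> \<le> N * (N * (th * 2))" unfolding adg_def N_def
          by (rule abs_sum_UNIV_le, rule abs_sum_UNIV_le) (unfold abs_mult, intro mult_mono ba bdg, use nn in auto)
        then show ?thesis using Kge(6) by linarith
      qed
      have bdV: "\<bar>dV\<bar> \<le> K * p x"
      proof -
        have "\<bar>dV\<bar> \<le> N * (N * (t * p x))" unfolding dV_def N_def
          by (rule abs_sum_UNIV_le, rule abs_sum_UNIV_le) (unfold abs_mult, intro mult_mono bda bV, use t in auto)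
        also have "\<dots> = N * (N * t) * p x" by simp
        also have "\<dots> \<le> K * p x" using Kge(7) p0[of x] by (intro mult_right_mono) auto
        finally show ?thesis .
      qed
      have bRem: "Rem\<^sup>2 \<le> K3 * ((h x)\<^sup>2 * (v x)\<^sup>2 + (p x)\<^sup>2)"
      proof -
        have 1: "\<bar>l\<^sup>2 * h x * G x * v x\<bar> \<le> l\<^sup>2 * h x * K * \<bar>v x\<bar>"
          unfolding abs_mult using bG Kge(1) hpos[of x] l1 by (intro mult_mono) auto
        have 2: "\<bar>l * h x * v x * adg\<bar> \<le> l\<^sup>2 * h x * \<bar>v x\<bar> * K"
          unfolding abs_mult using badg hpos[of x] l1 K by (intro mult_mono) (auto simp: power2_eq_square)
        have "\<bar>Rem\<bar> \<le> 2 * (l\<^sup>2 * h x * K * \<bar>v x\<bar>) + K * p x"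
          unfolding Rem_def using 1 2 bdV by (simp add: mult.commute mult.left_commute)
        then have "Rem\<^sup>2 \<le> (2 * (l\<^sup>2 * h x * K * \<bar>v x\<bar>) + K * p x)\<^sup>2"
          by (metis abs_ge_zero power2_abs power_mono)
        also have "\<dots> \<le> 2 * (2 * (l\<^sup>2 * h x * K * \<bar>v x\<bar>))\<^sup>2 + 2 * (K * p x)\<^sup>2"
          using sum_squares_bound[of "2 * (l\<^sup>2 * h x * K * \<bar>v x\<bar>)" "K * p x"] by (simp add: power2_sum)
        also have "\<dots> = 8 * l ^ 4 * K\<^sup>2 * ((h x)\<^sup>2 * (v x)\<^sup>2) + 2 * K\<^sup>2 * (p x)\<^sup>2"
          by (simp add: power_mult_distrib power_mult[symmetric])
        also have "\<dots> \<le> K3 * ((h x)\<^sup>2 * (v x)\<^sup>2 + (p x)\<^sup>2)"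
          unfolding K3_def distrib_left distrib_right by (simp add: power_mult_distrib)
        finally show ?thesis .
      qed
      have "Rem\<^sup>2 \<le> c1 / 2 * W x"
      proof -
        have "2 * K3 / c1 \<le> h x" using h0(2) hx by linarith
        then have "K3 \<le> c1 / 2 * h x" using c1(1) by (simp add: divide_le_eq mult.commute)
        then have "K3 * ((h x)\<^sup>2 * (v x)\<^sup>2 + (p x)\<^sup>2) \<le> c1 / 2 * h x * ((h x)\<^sup>2 * (v x)\<^sup>2 + (p x)\<^sup>2)"
          by (intro mult_right_mono) auto
        also have "\<dots> = c1 / 2 * W x" unfolding W_def by (simp add: algebra_simps power2_eq_square power3_eq_cube)
        finally show ?thesis using bRem by linarith
      qed
      moreover have "M1 x * M2 x \<le> (X x)\<^sup>2 + Rem\<^sup>2"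
      proof -
        \<comment> \<open>Since \<open>M1 + M2 = X - Rem\<close>, expanding gives
          \<open>2 * M1 * M2 \<le> 2 * X\<^sup>2 + 2 * Rem\<^sup>2\<close>; the squares of
          \<open>M1\<close> and \<open>M2\<close> are simply discarded.\<close>
        have "0 \<le> (M1 x)\<^sup>2 + (M2 x)\<^sup>2 + (X x + Rem)\<^sup>2" by simp
        moreover have "(M1 x + M2 x)\<^sup>2 = (X x - Rem)\<^sup>2" using Xeq by simp
        ultimately show ?thesis by (simp add: power2_sum power2_diff)
      qed
      ultimately show ?thesis using EW by linarith
    qed
    have cv: "continuous_on UNIV v" "continuous_on UNIV (V i)" for i
      using gv gV by (auto intro: has_grad_continuous)
    have cp2: "continuous_on UNIV (\<lambda>x. (p x)\<^sup>2)" unfolding p2 by (intro continuous_intros cv)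
    have zV: "v x = 0" "p x = 0" "u x = 0" "U i x = 0" "UU i j x = 0" if "norm (x - ctr) > r1" for x i j
    proof -
      show "v x = 0" "p x = 0" "u x = 0" "U i x = 0" using out[of x] that by (auto simp: v_def p_def V_def)
      show "UU i j x = 0" using has_grad_zero_outside[OF jetD(2)[OF J] _ that] out by blast
    qed
    have iW: "integrable lborel W"
      by (rule integrable_compact_supp[where ctr=ctr and r=r1])
         (auto simp: W_def zV intro!: continuous_intros has_grad_continuous[OF gh] cv cp2)
    have iX: "integrable lborel (\<lambda>x. (X x)\<^sup>2)"
      by (rule integrable_compact_supp[where ctr=ctr and r=r1])
         (auto simp: X_def P_def zV intro!: continuous_intros cont)
    have i1: "c1 / 2 * (LINT x|lborel. W x) \<le> (LINT x|lborel. (X x)\<^sup>2)"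
    proof -
      have "(LINT x|lborel. c1 / 2 * W x) \<le> (LINT x|lborel. E x - M1 x * M2 x + (X x)\<^sup>2)"
        by (rule integral_mono) (use iW iX id pt in auto)
      also have "\<dots> = (LINT x|lborel. (X x)\<^sup>2)" using id iX by simp
      finally show ?thesis by simp
    qed
    define wu where "wu x = ((u x)\<^sup>2 + (\<Sum>i\<in>UNIV. (U i x)\<^sup>2)) * wt l s ctr x" for x
    have wteq: "wt l s ctr x = (exp (h x))\<^sup>2" for x
      unfolding wt_def h_def by (simp add: exp_double[symmetric] mult.commute)
    have iwu: "integrable lborel wu"
      by (rule integrable_compact_supp[where ctr=ctr and r=r1])
         (auto simp: wu_def wteq zV intro!: continuous_intros cont)
    \<comment> \<open>\<open>exp h * U i\<close> is \<open>V i\<close> minus the part in which the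
      exponential is differentiated. With \<open>h \<ge> 1\<close> all powers of \<open>h\<close>
      fit into \<open>W\<close>, and one factor \<open>h\<close> is spent on
      \<open>s * m \<le> h\<close>.\<close>
    have pt2: "s * wu x \<le> C' * W x" for x
    proof (cases "norm (x - ctr) \<le> r1")
      case False
      then show ?thesis by (simp add: wu_def W_def zV)
    next
      case True
      have h1: "h x \<ge> 1" using hge[OF True] h0(1) by simp
      have bg: "\<bar>g i x\<bar> \<le> \<gamma>" for i
        using component_le_norm_cart[of "x - ctr" i] True unfolding g_def \<gamma>_def by (simp add: abs_mult)
      have "(exp (h x) * U i x)\<^sup>2 \<le> 2 * (V i x)\<^sup>2 + 2 * (l\<^sup>2 * \<gamma>\<^sup>2 * ((h x)\<^sup>2 * (v x)\<^sup>2))" for i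
      proof -
        have e: "exp (h x) * U i x = V i x - l * h x * g i x * v x" unfolding V_def v_def by simp
        have "(l * h x * g i x * v x)\<^sup>2 \<le> l\<^sup>2 * \<gamma>\<^sup>2 * ((h x)\<^sup>2 * (v x)\<^sup>2)"
        proof -
          have "(g i x)\<^sup>2 \<le> \<gamma>\<^sup>2" using bg[of i] by (metis abs_ge_zero power2_abs power_mono)
          then have "(l\<^sup>2 * ((h x)\<^sup>2 * (v x)\<^sup>2)) * (g i x)\<^sup>2 \<le> (l\<^sup>2 * ((h x)\<^sup>2 * (v x)\<^sup>2)) * \<gamma>\<^sup>2" by (intro mult_left_mono) auto
          then show ?thesis by (simp add: power_mult_distrib algebra_simps)
        qed
        moreover have "(V i x - l * h x * g i x * v x)\<^sup>2 \<le> 2 * (V i x)\<^sup>2 + 2 * (l * h x * g i x * v x)\<^sup>2"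
          using sum_squares_bound[of "V i x" "- (l * h x * g i x * v x)"] by (simp add: power2_diff)
        ultimately show ?thesis unfolding e by linarith
      qed
      then have "(\<Sum>i\<in>UNIV. (exp (h x) * U i x)\<^sup>2) \<le> (\<Sum>i\<in>UNIV. 2 * (V i x)\<^sup>2 + 2 * (l\<^sup>2 * \<gamma>\<^sup>2 * ((h x)\<^sup>2 * (v x)\<^sup>2)))"
        by (rule sum_mono)
      also have "\<dots> = 2 * (p x)\<^sup>2 + N * (2 * (l\<^sup>2 * \<gamma>\<^sup>2 * ((h x)\<^sup>2 * (v x)\<^sup>2)))"
        unfolding p2 N_def by (simp add: sum.distrib sum_distrib_left)
      finally have "wu x \<le> (v x)\<^sup>2 + 2 * (p x)\<^sup>2 + N * (2 * (l\<^sup>2 * \<gamma>\<^sup>2 * ((h x)\<^sup>2 * (v x)\<^sup>2)))"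
        unfolding wu_def wteq v_def by (simp add: power_mult_distrib sum_distrib_left algebra_simps)
      then have "h x * wu x \<le> h x * ((v x)\<^sup>2 + 2 * (p x)\<^sup>2 + N * (2 * (l\<^sup>2 * \<gamma>\<^sup>2 * ((h x)\<^sup>2 * (v x)\<^sup>2))))"
        using h1 by (intro mult_left_mono) auto
      also have "\<dots> = h x * (v x)\<^sup>2 + 2 * (h x * (p x)\<^sup>2) + 2 * N * l\<^sup>2 * \<gamma>\<^sup>2 * (h x ^ 3 * (v x)\<^sup>2)"
        by (simp add: algebra_simps power2_eq_square power3_eq_cube)
      also have "\<dots> \<le> 2 * W x + 2 * N * l\<^sup>2 * \<gamma>\<^sup>2 * W x"
      proof -
        have "h x * 1 \<le> h x * (h x)\<^sup>2" using h1 by (intro mult_left_mono) auto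
        then have "h x * (v x)\<^sup>2 \<le> h x ^ 3 * (v x)\<^sup>2" by (intro mult_right_mono) (auto simp: power3_eq_cube power2_eq_square)
        moreover have "0 \<le> h x ^ 3 * (v x)\<^sup>2" "0 \<le> h x * (p x)\<^sup>2" using hpos[of x] by simp_all
        moreover have "2 * N * l\<^sup>2 * \<gamma>\<^sup>2 * (h x ^ 3 * (v x)\<^sup>2) \<le> 2 * N * l\<^sup>2 * \<gamma>\<^sup>2 * W x"
          using nn hpos[of x] unfolding W_def by (intro mult_left_mono) auto
        ultimately have "h x * (v x)\<^sup>2 + 2 * (h x * (p x)\<^sup>2) \<le> 2 * W x"
          "2 * N * l\<^sup>2 * \<gamma>\<^sup>2 * (h x ^ 3 * (v x)\<^sup>2) \<le> 2 * N * l\<^sup>2 * \<gamma>\<^sup>2 * W x"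
          unfolding W_def by auto
        then show ?thesis by (rule add_mono)
      qed
      finally have a: "h x * wu x \<le> (2 + 2 * N * l\<^sup>2 * \<gamma>\<^sup>2) * W x" by (simp add: distrib_right)
      have "0 \<le> wu x" unfolding wu_def wteq by (simp add: sum_nonneg)
      then have "s * m * wu x \<le> h x * wu x" using hlow[OF True] by (intro mult_right_mono)
      with a have "s * m * wu x \<le> (2 + 2 * N * l\<^sup>2 * \<gamma>\<^sup>2) * W x" by linarith
      then show ?thesis unfolding C'_def using m by (simp add: field_simps)
    qed
    have "(LINT x|lborel. s * wu x) \<le> (LINT x|lborel. C' * W x)"
      by (rule integral_mono) (use iwu iW pt2 in auto)
    then have "s * (LINT x|lborel. wu x) \<le> C' * (LINT x|lborel. W x)" by simp
    also have "\<dots> = C * (c1 / 2 * (LINT x|lborel. W x))" unfolding C_def using c1 by simp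
    also have "\<dots> \<le> C * (LINT x|lborel. (X x)\<^sup>2)" using i1 C by (intro mult_left_mono) auto
    also have "(\<lambda>x. (X x)\<^sup>2) = (\<lambda>x. (\<Sum>i\<in>UNIV. \<Sum>j\<in>UNIV. a i j x * UU i j x)\<^sup>2 * wt l s ctr x)"
      unfolding X_def P_def wteq by (simp add: power_mult_distrib mult.commute)
    finally show ?thesis unfolding wu_def .
  qed
  show ?thesis using main C s0 l1 by (intro exI[of _ l] conjI exI[of _ C] exI[of _ s0]) auto
qed

section \<open>Cutoff functions and the Caccioppoli inequality\<close>

lemma max0_power_deriv:
  "((\<lambda>t. max 0 t ^ Suc (Suc n)) has_real_derivative real (Suc (Suc n)) * max 0 t ^ Suc n) (at (t::real))"
proof -
  consider "t > 0" | "t < 0" | "t = 0" by linarith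
  then show ?thesis
  proof cases
    case 1
    have "((\<lambda>t. t ^ Suc (Suc n)) has_real_derivative real (Suc (Suc n)) * max 0 t ^ Suc n) (at t)"
      using 1 by (auto intro!: derivative_eq_intros simp del: power_Suc)
    then show ?thesis
      by (rule DERIV_cong_ev[THEN iffD1, rotated -1, OF _ refl])
         (use 1 in \<open>auto intro!: eventually_mono[OF eventually_gt_at_top] simp: eventually_nhds intro: exI[of _ "{0<..}"]\<close>)
  next
    case 2
    have "((\<lambda>t::real. 0) has_real_derivative real (Suc (Suc n)) * max 0 t ^ Suc n) (at t)"
      using 2 by (auto simp: max_def)
    then show ?thesis
      by (rule DERIV_cong_ev[THEN iffD1, rotated -1, OF _ refl])
         (use 2 in \<open>auto simp: eventually_nhds max_def intro: exI[of _ "{..<0}"]\<close>)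
  next
    case 3
    have "((\<lambda>h::real. max 0 h ^ Suc (Suc n) / h) \<longlongrightarrow> 0) (at 0)"
    proof (rule Lim_null_comparison)
      show "\<forall>\<^sub>F h in at 0. norm (max 0 h ^ Suc (Suc n) / h) \<le> \<bar>h\<bar> ^ Suc n"
      proof (rule always_eventually, rule allI)
        fix h :: real
        show "norm (max 0 h ^ Suc (Suc n) / h) \<le> \<bar>h\<bar> ^ Suc n"
        proof (cases "h > 0")
          case False
          then have "max 0 h ^ Suc (Suc n) = 0" by simp
          then show ?thesis by (simp del: power_Suc)
        qed simp
      qed
      show "((\<lambda>h::real. \<bar>h\<bar> ^ Suc n) \<longlongrightarrow> 0) (at 0)" by (auto intro!: tendsto_eq_intros)
    qed
    then show ?thesis using 3 by (simp add: DERIV_def)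
  qed
qed

text \<open>Cubes of positive parts are twice continuously differentiable, so nesting one for each
  end of the interval gives a C2 step in closed form. Two derivatives are all that a
  \<open>jet\<close> asks for.\<close>

definition sstep :: "real \<Rightarrow> real" where "sstep t = 1 - max 0 (1 - max 0 t ^ 3) ^ 3"

lemma sstep:
  "0 \<le> sstep t" "sstep t \<le> 1" "t \<le> 0 \<Longrightarrow> sstep t = 0" "t \<ge> 1 \<Longrightarrow> sstep t = 1"
proof -
  have "max 0 (1 - max 0 t ^ 3) \<le> 1" by simp
  then show "0 \<le> sstep t" unfolding sstep_def by (simp add: power_le_one)
  show "sstep t \<le> 1" unfolding sstep_def by simp
  show "t \<le> 0 \<Longrightarrow> sstep t = 0" unfolding sstep_def by (simp add: max_def)
  assume "t \<ge> 1"
  then have "max 0 t ^ 3 \<ge> 1" by (simp add: max_def)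
  then show "sstep t = 1" unfolding sstep_def by (simp add: max_def)
qed

definition sstep1 :: "real \<Rightarrow> real" where
  "sstep1 t = 9 * (max 0 (1 - max 0 t ^ 3))\<^sup>2 * (max 0 t)\<^sup>2"

definition sstep2 :: "real \<Rightarrow> real" where
  "sstep2 t = 18 * (max 0 (1 - max 0 t ^ 3))\<^sup>2 * max 0 t - 54 * max 0 (1 - max 0 t ^ 3) * max 0 t ^ 4"

lemma sstep_deriv: "(sstep has_real_derivative sstep1 t) (at t)" "(sstep1 has_real_derivative sstep2 t) (at t)"
proof -
  have a: "((\<lambda>t. max 0 t ^ 3) has_real_derivative 3 * (max 0 t)\<^sup>2) (at t)" for t :: real
    using max0_power_deriv[of 1 t] unfolding numeral_3_eq_3 numeral_2_eq_2 One_nat_def by (simp del: power_Suc)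
  have b: "((\<lambda>t. (max 0 t)\<^sup>2) has_real_derivative 2 * max 0 t) (at t)" for t :: real
    using max0_power_deriv[of 0 t] unfolding numeral_2_eq_2 by (simp del: power_Suc)
  have d: "((\<lambda>t. 1 - max 0 t ^ 3) has_real_derivative - (3 * (max 0 t)\<^sup>2)) (at t)" for t :: real
    by (rule DERIV_cong[OF DERIV_diff[OF DERIV_const a]]) simp
  show "(sstep has_real_derivative sstep1 t) (at t)"
    unfolding sstep_def[abs_def] sstep1_def
    by (rule DERIV_cong[OF DERIV_diff[OF DERIV_const DERIV_chain2[OF a d]]]) simp
  show "(sstep1 has_real_derivative sstep2 t) (at t)"
    unfolding sstep1_def[abs_def] sstep2_def
    by (rule DERIV_cong[OF DERIV_mult[OF DERIV_cmult[OF DERIV_chain2[OF b d]] b]])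
       (simp add: algebra_simps power4_eq_xxxx power2_eq_square)
qed

lemma sstep2_continuous: "continuous_on UNIV sstep2"
  unfolding sstep2_def[abs_def] by (intro continuous_intros)

text \<open>Composing with the squared distance, not the distance, keeps the cutoff twice
  differentiable at the centre. \<open>M\<close> sees only \<open>f'\<close> and \<open>f''\<close>
  on the interval from 0 to \<open>\<omega>\<^sup>2\<close>, hence is common to all centres.\<close>

lemma radial_cutoff:
  fixes f f' f'' :: "real \<Rightarrow> real"
  assumes f: "\<And>t. (f has_real_derivative f' t) (at t)" "\<And>t. (f' has_real_derivative f'' t) (at t)"
    "continuous_on UNIV f''" and z: "\<And>t. t \<ge> \<omega>\<^sup>2 \<Longrightarrow> f t = 0" and w: "\<omega> > 0"
  shows "\<exists>M\<ge>0. \<forall>ctr :: real ^ 'n::finite. \<exists>D DD. jet (\<lambda>x. f ((norm (x - ctr))\<^sup>2)) D DD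
    \<and> (\<forall>i x. \<bar>D i x\<bar> \<le> M) \<and> (\<forall>i j x. \<bar>DD i j x\<bar> \<le> M)"
proof -
  have cf': "continuous_on UNIV f'" using f(2) by (meson DERIV_isCont continuous_at_imp_continuous_on)
  have cp: "compact (f' ` {0..\<omega>\<^sup>2})" "compact (f'' ` {0..\<omega>\<^sup>2})"
    by (intro compact_continuous_image continuous_on_subset[OF cf'] continuous_on_subset[OF f(3)]; simp)+
  obtain B1 where "\<forall>y\<in>f' ` {0..\<omega>\<^sup>2}. \<bar>y\<bar> \<le> B1"
    using compact_imp_bounded[OF cp(1)] unfolding bounded_real by blast
  moreover obtain B2 where "\<forall>y\<in>f'' ` {0..\<omega>\<^sup>2}. \<bar>y\<bar> \<le> B2"
    using compact_imp_bounded[OF cp(2)] unfolding bounded_real by blast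
  ultimately have B: "\<And>t. t \<in> {0..\<omega>\<^sup>2} \<Longrightarrow> \<bar>f' t\<bar> \<le> B1" "\<And>t. t \<in> {0..\<omega>\<^sup>2} \<Longrightarrow> \<bar>f'' t\<bar> \<le> B2"
    by auto
  have B0: "B1 \<ge> 0" "B2 \<ge> 0" using B[of 0] by auto
  define M where "M = B1 * (2 * \<omega>) + B2 * (2 * \<omega>) * (2 * \<omega>) + B1 * 2"
  have M: "M \<ge> 0" unfolding M_def using B0 w by auto
  have "\<exists>D DD. jet (\<lambda>x. f ((norm (x - ctr))\<^sup>2)) D DD
    \<and> (\<forall>i x. \<bar>D i x\<bar> \<le> M) \<and> (\<forall>i j x. \<bar>DD i j x\<bar> \<le> M)" for ctr :: "real ^ 'n"
  proof -
    define D where "D i x = f' ((norm (x - ctr))\<^sup>2) * (2 * (x - ctr) $ i)" for i x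
    define DD where "DD i j x = f'' ((norm (x - ctr))\<^sup>2) * (2 * (x - ctr) $ j) * (2 * (x - ctr) $ i)
      + f' ((norm (x - ctr))\<^sup>2) * (if i = j then 2 else 0)" for i j x
    have gf: "has_grad (\<lambda>x. f ((norm (x - ctr))\<^sup>2)) D"
      unfolding D_def by (rule has_grad_compose[OF has_grad_norm_sq f(1)])
    have gD: "has_grad (D i) (DD i)" for i
      unfolding D_def DD_def
      by (rule has_grad_eq_rhs, rule has_grad_mult, rule has_grad_compose[OF has_grad_norm_sq f(2)],
          unfold vector_minus_component, (rule grad_intros)+) auto
    have cDD: "continuous_on UNIV (DD i j)" for i j
      unfolding DD_def by (intro continuous_intros continuous_on_compose2[OF f(3)] continuous_on_compose2[OF cf']) auto
    have jt: "jet (\<lambda>x. f ((norm (x - ctr))\<^sup>2)) D DD"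
      unfolding jet_def using gf gD cDD by (auto simp: DD_def)
    have z1: "D i x = 0" if "norm (x - ctr) > \<omega>" for i x
      by (rule has_grad_zero_outside[OF gf _ that]) (use z w in \<open>auto intro!: power_mono\<close>)
    have z2: "DD i j x = 0" if "norm (x - ctr) > \<omega>" for i j x
      by (rule has_grad_zero_outside[OF gD _ that]) (use z1 in auto)
    have in': "(norm (x - ctr))\<^sup>2 \<in> {0..\<omega>\<^sup>2}" if "norm (x - ctr) \<le> \<omega>" for x
      using that w by (auto intro: power_mono)
    have cmp: "\<bar>2 * (x - ctr) $ i\<bar> \<le> 2 * \<omega>" if "norm (x - ctr) \<le> \<omega>" for x i
      using component_le_norm_cart[of "x - ctr" i] that by (simp add: abs_mult)
    have b1: "\<bar>D i x\<bar> \<le> M" for i x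
    proof (cases "norm (x - ctr) > \<omega>")
      case False
      then have n: "norm (x - ctr) \<le> \<omega>" by simp
      have "\<bar>D i x\<bar> \<le> B1 * (2 * \<omega>)" unfolding D_def abs_mult[of "f' _"]
        by (intro mult_mono B in' cmp n) (use B0 in auto)
      also have "\<dots> \<le> M" unfolding M_def using B0 w by simp
      finally show ?thesis .
    qed (use z1 M in auto)
    have b2: "\<bar>DD i j x\<bar> \<le> M" for i j x
    proof (cases "norm (x - ctr) > \<omega>")
      case False
      then have n: "norm (x - ctr) \<le> \<omega>" by simp
      have "\<bar>DD i j x\<bar> \<le> B2 * (2 * \<omega>) * (2 * \<omega>) + B1 * 2" unfolding DD_def
        by (rule order_trans[OF abs_triangle_ineq], unfold abs_mult[of "f' _"] abs_mult[of "f'' _"] abs_mult[of "f'' _ * _"])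
           (intro add_mono mult_mono B in' cmp n, use B0 w in auto)
      also have "\<dots> \<le> M" unfolding M_def using B0 w by simp
      finally show ?thesis .
    qed (use z2 M in auto)
    show ?thesis using jt b1 b2 by blast
  qed
  then show ?thesis using M by blast
qed

lemma ball_cutoff:
  assumes "0 < r" "r < r'"
  shows "\<exists>M\<ge>0. \<forall>ctr :: real ^ 'n::finite. \<exists>\<eta> D DD. jet \<eta> D DD
    \<and> (\<forall>i x. \<bar>D i x\<bar> \<le> M) \<and> (\<forall>i j x. \<bar>DD i j x\<bar> \<le> M) \<and> (\<forall>x. 0 \<le> \<eta> x \<and> \<eta> x \<le> 1)
    \<and> (\<forall>x. norm (x - ctr) \<le> r \<longrightarrow> \<eta> x = 1) \<and> (\<forall>x. norm (x - ctr) \<ge> r' \<longrightarrow> \<eta> x = 0)"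
proof -
  \<comment> \<open>Scales \<open>r'\<^sup>2 - t\<close> so that the step rises from 0 at
    \<open>t = r'\<^sup>2\<close> to 1 at \<open>t = r\<^sup>2\<close>.\<close>
  define w where "w = 1 / (r'\<^sup>2 - r\<^sup>2)"
  have w: "w > 0" unfolding w_def using assms by (simp add: power_strict_mono)
  have "r'\<^sup>2 - r\<^sup>2 > 0" using assms by (simp add: power_strict_mono)
  define f where "f t = sstep ((r'\<^sup>2 - t) * w)" for t
  define f' where "f' t = sstep1 ((r'\<^sup>2 - t) * w) * (- w)" for t
  define f'' where "f'' t = sstep2 ((r'\<^sup>2 - t) * w) * (- w) * (- w)" for t
  have lin: "((\<lambda>t. (r'\<^sup>2 - t) * w) has_real_derivative - w) (at t)" for t
    by (auto intro!: derivative_eq_intros)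
  have 1: "(f has_real_derivative f' t) (at t)" for t
    unfolding f_def[abs_def] f'_def by (rule DERIV_chain2[OF sstep_deriv(1) lin])
  have 2: "(f' has_real_derivative f'' t) (at t)" for t
    unfolding f'_def[abs_def] f''_def by (rule DERIV_cmult_right[OF DERIV_chain2[OF sstep_deriv(2) lin]])
  have 3: "continuous_on UNIV f''" unfolding f''_def[abs_def]
    by (intro continuous_intros continuous_on_compose2[OF sstep2_continuous]) auto
  have 4: "f t = 0" if "t \<ge> r'\<^sup>2" for t unfolding f_def using that w
    by (intro sstep(3)) (auto simp: mult_nonpos_nonneg)
  have 5: "f t = 1" if "t \<le> r\<^sup>2" for t unfolding f_def
  proof (rule sstep(4))
    have "(r'\<^sup>2 - r\<^sup>2) * w \<le> (r'\<^sup>2 - t) * w" using that w by (intro mult_right_mono) auto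
    then show "1 \<le> (r'\<^sup>2 - t) * w" unfolding w_def using \<open>r'\<^sup>2 - r\<^sup>2 > 0\<close> by simp
  qed
  have "r' > 0" using assms by simp
  from radial_cutoff[OF 1 2 3 4 this, where ?'n='n]
  obtain M where M: "M \<ge> 0" "\<forall>ctr :: real ^ 'n. \<exists>D DD. jet (\<lambda>x. f ((norm (x - ctr))\<^sup>2)) D DD
    \<and> (\<forall>i x. \<bar>D i x\<bar> \<le> M) \<and> (\<forall>i j x. \<bar>DD i j x\<bar> \<le> M)" by blast
  show ?thesis
  proof (intro exI[of _ M] conjI M(1) allI)
    fix ctr :: "real ^ 'n"
    from M(2) obtain D DD where D: "jet (\<lambda>x. f ((norm (x - ctr))\<^sup>2)) D DD"
      "\<forall>i x. \<bar>D i x\<bar> \<le> M" "\<forall>i j x. \<bar>DD i j x\<bar> \<le> M" by blast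
    have "(norm (x - ctr))\<^sup>2 \<le> r\<^sup>2" if "norm (x - ctr) \<le> r" for x using that by (simp add: power_mono)
    moreover have "(norm (x - ctr))\<^sup>2 \<ge> r'\<^sup>2" if "norm (x - ctr) \<ge> r'" for x
      using that assms by (intro power_mono) auto
    moreover have "0 \<le> f t \<and> f t \<le> 1" for t unfolding f_def using sstep by auto
    ultimately show "\<exists>\<eta> D DD. jet \<eta> D DD
    \<and> (\<forall>i x. \<bar>D i x\<bar> \<le> M) \<and> (\<forall>i j x. \<bar>DD i j x\<bar> \<le> M) \<and> (\<forall>x. 0 \<le> \<eta> x \<and> \<eta> x \<le> 1)
    \<and> (\<forall>x. norm (x - ctr) \<le> r \<longrightarrow> \<eta> x = 1) \<and> (\<forall>x. norm (x - ctr) \<ge> r' \<longrightarrow> \<eta> x = 0)"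
      using D 4 5 by (intro exI[of _ "\<lambda>x. f ((norm (x - ctr))\<^sup>2)"] exI[of _ D] exI[of _ DD]) auto
  qed
qed

lemma jet_mult:
  assumes "jet f F FF" "jet g G GG"
  shows "jet (\<lambda>x. f x * g x) (\<lambda>i x. F i x * g x + f x * G i x)
    (\<lambda>i j x. FF i j x * g x + F i x * G j x + F j x * G i x + f x * GG i j x)"
  unfolding jet_def
proof (intro conjI allI)
  show "has_grad (\<lambda>x. f x * g x) (\<lambda>i x. F i x * g x + f x * G i x)"
    by (intro has_grad_mult jetD[OF assms(1)] jetD[OF assms(2)])
  show "has_grad (\<lambda>x. F i x * g x + f x * G i x) (\<lambda>j x. FF i j x * g x + F i x * G j x + F j x * G i x + f x * GG i j x)" for i
    by (rule has_grad_eq_rhs, (rule has_grad_add has_grad_mult jetD(1,2)[OF assms(1)] jetD(1,2)[OF assms(2)])+) auto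
  show "continuous_on UNIV (\<lambda>x. FF i j x * g x + F i x * G j x + F j x * G i x + f x * GG i j x)" for i j
    by (intro continuous_intros jetD[OF assms(1)] jetD[OF assms(2)])
  show "FF i j x * g x + F i x * G j x + F j x * G i x + f x * GG i j x
    = FF j i x * g x + F j x * G i x + F i x * G j x + f x * GG j i x" for i j x
    using jetD(4)[OF assms(1), of i j x] jetD(4)[OF assms(2), of i j x] by simp
qed

lemma jet_one_minus:
  assumes "jet f F FF"
  shows "jet (\<lambda>x. 1 - f x) (\<lambda>i x. - F i x) (\<lambda>i j x. - FF i j x)"
  unfolding jet_def
proof (intro conjI allI)
  show "has_grad (\<lambda>x. 1 - f x) (\<lambda>i x. - F i x)"
    using has_grad_diff[OF has_grad_const jetD(1)[OF assms], of 1] by simp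
  show "has_grad (\<lambda>x. - F i x) (\<lambda>j x. - FF i j x)" for i by (intro has_grad_minus jetD[OF assms])
  show "continuous_on UNIV (\<lambda>x. - FF i j x)" for i j by (intro continuous_intros jetD[OF assms])
  show "- FF i j x = - FF j i x" for i j x using jetD(4)[OF assms, of i j x] by simp
qed

text \<open>The product of a ball cutoff for the outer radii with one minus a ball cutoff for the
  inner radii. The summand \<open>2 * (M1 * M2)\<close> of the bound comes from the mixed first
  derivatives in the Hessian of the product.\<close>

lemma annulus_cutoff:
  assumes "0 < r0" "r0 < r1" "r1 < r2" "r2 < r3"
  shows "\<exists>M\<ge>0. \<forall>ctr :: real ^ 'n::finite. \<exists>\<eta> D DD. jet \<eta> D DD
    \<and> (\<forall>i x. \<bar>D i x\<bar> \<le> M) \<and> (\<forall>i j x. \<bar>DD i j x\<bar> \<le> M) \<and> (\<forall>x. 0 \<le> \<eta> x \<and> \<eta> x \<le> 1)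
    \<and> (\<forall>x. r1 \<le> norm (x - ctr) \<longrightarrow> norm (x - ctr) \<le> r2 \<longrightarrow> \<eta> x = 1)
    \<and> (\<forall>x. norm (x - ctr) \<le> r0 \<or> norm (x - ctr) \<ge> r3 \<longrightarrow> \<eta> x = 0)"
proof -
  obtain M1 where M1: "M1 \<ge> 0" "\<forall>ctr :: real ^ 'n. \<exists>\<eta> D DD. jet \<eta> D DD
    \<and> (\<forall>i x. \<bar>D i x\<bar> \<le> M1) \<and> (\<forall>i j x. \<bar>DD i j x\<bar> \<le> M1) \<and> (\<forall>x. 0 \<le> \<eta> x \<and> \<eta> x \<le> 1)
    \<and> (\<forall>x. norm (x - ctr) \<le> r0 \<longrightarrow> \<eta> x = 1) \<and> (\<forall>x. norm (x - ctr) \<ge> r1 \<longrightarrow> \<eta> x = 0)"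
    using ball_cutoff[of r0 r1, where ?'n='n] assms by blast
  obtain M2 where M2: "M2 \<ge> 0" "\<forall>ctr :: real ^ 'n. \<exists>\<eta> D DD. jet \<eta> D DD
    \<and> (\<forall>i x. \<bar>D i x\<bar> \<le> M2) \<and> (\<forall>i j x. \<bar>DD i j x\<bar> \<le> M2) \<and> (\<forall>x. 0 \<le> \<eta> x \<and> \<eta> x \<le> 1)
    \<and> (\<forall>x. norm (x - ctr) \<le> r2 \<longrightarrow> \<eta> x = 1) \<and> (\<forall>x. norm (x - ctr) \<ge> r3 \<longrightarrow> \<eta> x = 0)"
    using ball_cutoff[of r2 r3, where ?'n='n] assms by fastforce
  define M where "M = M1 + M2 + 2 * (M1 * M2)"
  have "M1 + M2 \<le> M" using M1(1) M2(1) unfolding M_def by simp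
  show ?thesis
  proof (intro exI[of _ M] conjI allI)
    show "M \<ge> 0" using M1(1) M2(1) unfolding M_def by simp
    fix ctr :: "real ^ 'n"
    obtain f F FF where f: "jet f F FF" "\<forall>i x. \<bar>F i x\<bar> \<le> M1" "\<forall>i j x. \<bar>FF i j x\<bar> \<le> M1" "\<forall>x. 0 \<le> f x \<and> f x \<le> 1"
       "\<forall>x. norm (x - ctr) \<le> r0 \<longrightarrow> f x = 1" "\<forall>x. norm (x - ctr) \<ge> r1 \<longrightarrow> f x = 0" using M1(2) by blast
    obtain g G GG where g: "jet g G GG" "\<forall>i x. \<bar>G i x\<bar> \<le> M2" "\<forall>i j x. \<bar>GG i j x\<bar> \<le> M2" "\<forall>x. 0 \<le> g x \<and> g x \<le> 1"
       "\<forall>x. norm (x - ctr) \<le> r2 \<longrightarrow> g x = 1" "\<forall>x. norm (x - ctr) \<ge> r3 \<longrightarrow> g x = 0" using M2(2) by blast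
    note j = jet_mult[OF jet_one_minus[OF f(1)] g(1)]
    have f01: "\<bar>1 - f x\<bar> \<le> 1" and g01: "\<bar>g x\<bar> \<le> 1" for x using f(4) g(4) by (auto simp: abs_le_iff)
    have b1: "\<bar>- F i x * g x + (1 - f x) * G i x\<bar> \<le> M" for i x
    proof -
      have "\<bar>- F i x * g x + (1 - f x) * G i x\<bar> \<le> M1 * 1 + 1 * M2"
        by (rule order_trans[OF abs_triangle_ineq], unfold abs_mult, intro add_mono mult_mono f01 g01)
           (use f g M1(1) in auto)
      then show ?thesis using \<open>M1 + M2 \<le> M\<close> by simp
    qed
    have b2: "\<bar>- FF i j x * g x + - F i x * G j x + - F j x * G i x + (1 - f x) * GG i j x\<bar> \<le> M" for i j x
    proof -
      have "\<bar>FF i j x * g x\<bar> \<le> M1 * 1" "\<bar>F i x * G j x\<bar> \<le> M1 * M2" "\<bar>F j x * G i x\<bar> \<le> M1 * M2" "\<bar>(1 - f x) * GG i j x\<bar> \<le> 1 * M2"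
        unfolding abs_mult by (intro mult_mono f01 g01; use f g M1(1) in auto)+
      then show ?thesis unfolding M_def by (simp add: abs_le_iff)
    qed
    have f01': "0 \<le> (1 - f x) * g x \<and> (1 - f x) * g x \<le> 1" for x
      using f(4) g(4) by (auto intro!: mult_le_one)
    show "\<exists>\<eta> D DD. jet \<eta> D DD
    \<and> (\<forall>i x. \<bar>D i x\<bar> \<le> M) \<and> (\<forall>i j x. \<bar>DD i j x\<bar> \<le> M) \<and> (\<forall>x. 0 \<le> \<eta> x \<and> \<eta> x \<le> 1)
    \<and> (\<forall>x. r1 \<le> norm (x - ctr) \<longrightarrow> norm (x - ctr) \<le> r2 \<longrightarrow> \<eta> x = 1)
    \<and> (\<forall>x. norm (x - ctr) \<le> r0 \<or> norm (x - ctr) \<ge> r3 \<longrightarrow> \<eta> x = 0)"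
      by ((rule exI)+, rule conjI[OF j]) (use b1 b2 f01' f g in auto)
  qed
qed


section \<open>Localisation of the Carleman estimate by a cutoff\<close>

definition ann :: "real ^ 'n::finite \<Rightarrow> real \<Rightarrow> real \<Rightarrow> (real ^ 'n) set" where
  "ann c r r' = {x. r \<le> norm (x - c) \<and> norm (x - c) \<le> r'}"

lemma ann_compact: "compact (ann c r r')"
proof -
  have "closed (ann c r r')" unfolding ann_def
    by (intro closed_Collect_conj closed_Collect_le continuous_intros)
  moreover have "ann c r r' \<subseteq> cball c r'" unfolding ann_def by (auto simp: dist_norm norm_minus_commute)
  ultimately show ?thesis by (meson bounded_cball bounded_subset compact_eq_bounded_closed)
qed

lemma integrable_indicator_continuous:
  fixes f :: "'a::euclidean_space \<Rightarrow> real"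
  assumes "continuous_on UNIV f" "compact S"
  shows "integrable lborel (\<lambda>x. indicator S x * f x)"
  using borel_integrable_compact[OF assms(2), of f] continuous_on_subset[OF assms(1)] by simp

lemma wt_continuous: "continuous_on S (wt l s c)"
  unfolding wt_def[abs_def] by (intro continuous_intros)

lemma wt_pos: "wt l s c x > 0" unfolding wt_def by simp

text \<open>The Carleman estimate for \<open>\<eta> * f\<close>. Where \<open>\<eta>\<close> is
  constantly 1 the operator sees \<open>f\<close> itself; derivatives of \<open>\<eta>\<close> only
  produce terms of order zero and one on the two shells. The right-hand side keeps the shells
  separate because the weight has to be estimated differently on each.\<close>

lemma carleman_cutoff:
  fixes th t r0 r1 r2 r3 :: real
  assumes th: "th \<ge> 1" and t: "t \<ge> 0" and r: "0 < r0" "r0 < r1" "r1 < r2" "r2 < r3"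
  shows "\<exists>l>0. \<exists>C>0. \<exists>s0\<ge>1. \<forall>ctr (a :: 'n::finite \<Rightarrow> 'n \<Rightarrow> real ^ 'n \<Rightarrow> real) da f F FF s.
     elliptic_coeffs th t (cball ctr r3) a da \<longrightarrow> jet f F FF \<longrightarrow> s \<ge> s0 \<longrightarrow>
     s * (LINT x|lborel. indicator (ann ctr r1 r2) x * (((f x)\<^sup>2 + (\<Sum>i\<in>UNIV. (F i x)\<^sup>2)) * wt l s ctr x))
       \<le> C * (LINT x|lborel. indicator (ann ctr r1 r2) x * ((\<Sum>i\<in>UNIV. \<Sum>j\<in>UNIV. a i j x * FF i j x)\<^sup>2 * wt l s ctr x)
          + (indicator (ann ctr r0 r1) x + indicator (ann ctr r2 r3) x) *
             (((f x)\<^sup>2 + (\<Sum>i\<in>UNIV. (F i x)\<^sup>2) + (\<Sum>i\<in>UNIV. \<Sum>j\<in>UNIV. a i j x * FF i j x)\<^sup>2) * wt l s ctr x))"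
proof -
  \<comment> \<open>The cutoff is 1 on an open neighbourhood of the closed annulus from
    \<open>r1\<close> to \<open>r2\<close>, so its derivatives vanish there up to and including the
    boundary.\<close>
  define r1' where "r1' = (r0 + r1) / 2"
  define r2' where "r2' = (r2 + r3) / 2"
  have r': "r0 < r1'" "r1' < r1" "r2 < r2'" "r2' < r3" "r1' < r2'" unfolding r1'_def r2'_def using r by auto
  obtain M where M: "M \<ge> 0" "\<forall>ctr :: real ^ 'n. \<exists>\<eta> D DD. jet \<eta> D DD
    \<and> (\<forall>i x. \<bar>D i x\<bar> \<le> M) \<and> (\<forall>i j x. \<bar>DD i j x\<bar> \<le> M) \<and> (\<forall>x. 0 \<le> \<eta> x \<and> \<eta> x \<le> 1)
    \<and> (\<forall>x. r1' \<le> norm (x - ctr) \<longrightarrow> norm (x - ctr) \<le> r2' \<longrightarrow> \<eta> x = 1)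
    \<and> (\<forall>x. norm (x - ctr) \<le> r0 \<or> norm (x - ctr) \<ge> r3 \<longrightarrow> \<eta> x = 0)"
    using annulus_cutoff[OF r(1) r'(1) r'(5) r'(4), where ?'n='n] by blast
  have r03: "r0 < r3" using r by simp
  obtain l C s0 where lC: "l > 0" "C > 0" "s0 \<ge> 1" and Ca: "\<forall>ctr (a :: 'n::finite \<Rightarrow> 'n \<Rightarrow> real ^ 'n \<Rightarrow> real) da u U UU s.
     elliptic_coeffs th t (cball ctr r3) a da \<longrightarrow> jet u U UU \<longrightarrow>
     (\<forall>x. norm (x - ctr) < r0 \<or> norm (x - ctr) > r3 \<longrightarrow> u x = 0) \<longrightarrow> s \<ge> s0 \<longrightarrow>
     s * (LINT x|lborel. ((u x)\<^sup>2 + (\<Sum>i\<in>UNIV. (U i x)\<^sup>2)) * wt l s ctr x)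
       \<le> C * (LINT x|lborel. (\<Sum>i\<in>UNIV. \<Sum>j\<in>UNIV. a i j x * UU i j x)\<^sup>2 * wt l s ctr x)"
    using carleman[OF th t r(1) r03, where ?'n='n] by (elim exE conjE) (rule that)
  note Ca = Ca[rule_format]
  define N where "N = real CARD('n)"
  define A where "A = N * (N * (th * M))"
  have A: "A \<ge> 0" unfolding A_def N_def using th M by simp
  \<comment> \<open>From the square of a sum of three terms, the middle one being
    \<open>2 * A * sqrt p2\<close>, whence \<open>3 * 4 * A\<^sup>2\<close>; the extra 3 covers the
    second-order term.\<close>
  define C2 where "C2 = 3 + 12 * A\<^sup>2"
  have C2: "C2 > 0" unfolding C2_def by (simp add: add_pos_nonneg)
  have main: "s * (LINT x|lborel. indicator (ann ctr r1 r2) x * (((f x)\<^sup>2 + (\<Sum>i\<in>UNIV. (F i x)\<^sup>2)) * wt l s ctr x))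
       \<le> C * C2 * (LINT x|lborel. indicator (ann ctr r1 r2) x * ((\<Sum>i\<in>UNIV. \<Sum>j\<in>UNIV. a i j x * FF i j x)\<^sup>2 * wt l s ctr x)
          + (indicator (ann ctr r0 r1) x + indicator (ann ctr r2 r3) x) *
             (((f x)\<^sup>2 + (\<Sum>i\<in>UNIV. (F i x)\<^sup>2) + (\<Sum>i\<in>UNIV. \<Sum>j\<in>UNIV. a i j x * FF i j x)\<^sup>2) * wt l s ctr x))"
    if co: "elliptic_coeffs th t (cball ctr r3) a da" and J: "jet f F FF" and s: "s \<ge> s0"
    for ctr and a :: "'n::finite \<Rightarrow> 'n \<Rightarrow> real ^ 'n \<Rightarrow> real" and da f F FF s
  proof -
    obtain \<eta> D DD where e: "jet \<eta> D DD" "\<forall>i x. \<bar>D i x\<bar> \<le> M" "\<forall>i j x. \<bar>DD i j x\<bar> \<le> M" "\<forall>x. 0 \<le> \<eta> x \<and> \<eta> x \<le> 1"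
      "\<forall>x. r1' \<le> norm (x - ctr) \<longrightarrow> norm (x - ctr) \<le> r2' \<longrightarrow> \<eta> x = 1"
      "\<forall>x. norm (x - ctr) \<le> r0 \<or> norm (x - ctr) \<ge> r3 \<longrightarrow> \<eta> x = 0" using M(2) by blast
    define u where "u x = \<eta> x * f x" for x
    define U where "U i x = D i x * f x + \<eta> x * F i x" for i x
    define UU where "UU i j x = DD i j x * f x + D i x * F j x + D j x * F i x + \<eta> x * FF i j x" for i j x
    have Ju: "jet u U UU" unfolding u_def[abs_def] U_def[abs_def] UU_def[abs_def] by (rule jet_mult[OF e(1) J])
    define P where "P x = (\<Sum>i\<in>UNIV. \<Sum>j\<in>UNIV. a i j x * FF i j x)" for x
    define Pu where "Pu x = (\<Sum>i\<in>UNIV. \<Sum>j\<in>UNIV. a i j x * UU i j x)" for x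
    define p2 where "p2 x = (\<Sum>i\<in>UNIV. (F i x)\<^sup>2)" for x
    have p2: "p2 x \<ge> 0" for x unfolding p2_def by (simp add: sum_nonneg)
    have sup: "\<forall>x. norm (x - ctr) < r0 \<or> norm (x - ctr) > r3 \<longrightarrow> u x = 0" using e(6) unfolding u_def by auto
    have ca: "continuous_on UNIV (a i j)" for i j using co unfolding elliptic_coeffs_def by (blast intro: has_grad_continuous)
    have cP: "continuous_on UNIV P" "continuous_on UNIV Pu" "continuous_on UNIV p2"
      unfolding P_def[abs_def] Pu_def[abs_def] p2_def[abs_def] by (intro continuous_intros ca jetD[OF J] jetD[OF Ju])+
    have inE: "D i x = 0 \<and> DD i j x = 0 \<and> \<eta> x = 1" if "x \<in> ann ctr r1 r2" for i j x
    proof -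
      have x: "r1' < norm (x - ctr)" "norm (x - ctr) < r2'" using that r' unfolding ann_def by auto
      have op: "open {x. r1' < norm (x - ctr) \<and> norm (x - ctr) < r2'}"
        by (intro open_Collect_conj open_Collect_less continuous_intros)
      have "has_grad (\<lambda>x. \<eta> x - 1) D"
        using has_grad_diff[OF jetD(1)[OF e(1)] has_grad_const[of 1]] by simp
      from has_grad_zero_open[OF this op] e(5) have d: "D i y = 0" if "r1' < norm (y - ctr)" "norm (y - ctr) < r2'" for i y
        using that by auto
      from has_grad_zero_open[OF jetD(2)[OF e(1)] op] d x have "DD i j x = 0" by auto
      then show ?thesis using d[OF x] e(5) x by auto
    qed
    have out: "UU i j x = 0" if "norm (x - ctr) < r0 \<or> norm (x - ctr) > r3" for i j x
    proof -
      have op: "open {x. norm (x - ctr) < r0 \<or> norm (x - ctr) > r3}"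
        by (intro open_Collect_disj open_Collect_less continuous_intros)
      from has_grad_zero_open[OF jetD(1)[OF Ju] op] sup have "U i y = 0" if "norm (y - ctr) < r0 \<or> norm (y - ctr) > r3" for i y
        using that by auto
      with has_grad_zero_open[OF jetD(2)[OF Ju] op] that show ?thesis by auto
    qed
    define RH where "RH x = indicator (ann ctr r1 r2) x * ((P x)\<^sup>2 * wt l s ctr x)
          + (indicator (ann ctr r0 r1) x + indicator (ann ctr r2 r3) x) * (((f x)\<^sup>2 + p2 x + (P x)\<^sup>2) * wt l s ctr x)" for x
    have cr: "(Pu x)\<^sup>2 \<le> C2 * ((f x)\<^sup>2 + p2 x + (P x)\<^sup>2)" if x: "x \<in> cball ctr r3" for x
    proof -
      have ba: "\<bar>a i j x\<bar> \<le> th" for i j using co x unfolding elliptic_coeffs_def by auto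
      have bF: "\<bar>F i x\<bar> \<le> sqrt (p2 x)" for i unfolding p2_def by (rule abs_le_sqrt_sum)
      have "Pu x = (\<Sum>i\<in>UNIV. \<Sum>j\<in>UNIV. a i j x * DD i j x) * f x + (\<Sum>i\<in>UNIV. \<Sum>j\<in>UNIV. a i j x * (D i x * F j x + D j x * F i x)) + \<eta> x * P x"
        unfolding Pu_def UU_def P_def sum_distrib_left sum_distrib_right sum.distrib[symmetric]
        by (intro sum.cong refl) (simp add: algebra_simps)
      moreover have "\<bar>(\<Sum>i\<in>UNIV. \<Sum>j\<in>UNIV. a i j x * DD i j x) * f x\<bar> \<le> A * \<bar>f x\<bar>"
      proof -
        have "\<bar>\<Sum>i\<in>UNIV. \<Sum>j\<in>UNIV. a i j x * DD i j x\<bar> \<le> A" unfolding A_def N_def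
          by (rule abs_sum_UNIV_le, rule abs_sum_UNIV_le) (unfold abs_mult, intro mult_mono ba, use e(3) th in auto)
        then show ?thesis unfolding abs_mult by (intro mult_right_mono) auto
      qed
      moreover have "\<bar>\<Sum>i\<in>UNIV. \<Sum>j\<in>UNIV. a i j x * (D i x * F j x + D j x * F i x)\<bar> \<le> 2 * (A * sqrt (p2 x))"
      proof -
        have "\<bar>D i x * F j x + D j x * F i x\<bar> \<le> M * sqrt (p2 x) + M * sqrt (p2 x)" for i j
          by (rule order_trans[OF abs_triangle_ineq], unfold abs_mult, intro add_mono mult_mono bF) (use e(2) M p2 in auto)
        then have "\<bar>\<Sum>i\<in>UNIV. \<Sum>j\<in>UNIV. a i j x * (D i x * F j x + D j x * F i x)\<bar> \<le> N * (N * (th * (M * sqrt (p2 x) + M * sqrt (p2 x))))"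
          unfolding N_def by (intro abs_sum_UNIV_le, unfold abs_mult, intro mult_mono ba) (use th in auto)
        then show ?thesis unfolding A_def by (simp add: algebra_simps)
      qed
      moreover have "\<bar>\<eta> x * P x\<bar> \<le> \<bar>P x\<bar>" using e(4) by (simp add: abs_mult mult_left_le_one_le)
      ultimately have "\<bar>Pu x\<bar> \<le> A * \<bar>f x\<bar> + 2 * (A * sqrt (p2 x)) + \<bar>P x\<bar>" by linarith
      then have "(Pu x)\<^sup>2 \<le> (A * \<bar>f x\<bar> + 2 * (A * sqrt (p2 x)) + \<bar>P x\<bar>)\<^sup>2"
        by (metis abs_ge_zero power2_abs power_mono)
      also have "\<dots> \<le> 3 * (A * \<bar>f x\<bar>)\<^sup>2 + 3 * (2 * (A * sqrt (p2 x)))\<^sup>2 + 3 * \<bar>P x\<bar>\<^sup>2"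
      proof -
        have "(X + Y + Z)\<^sup>2 \<le> 3 * X\<^sup>2 + 3 * Y\<^sup>2 + 3 * Z\<^sup>2" for X Y Z :: real
        proof -
          have "0 \<le> (X - Y)\<^sup>2 + (Y - Z)\<^sup>2 + (X - Z)\<^sup>2" by simp
          then show ?thesis by (simp add: power2_eq_square algebra_simps)
        qed
        then show ?thesis .
      qed
      also have "\<dots> = 3 * A\<^sup>2 * (f x)\<^sup>2 + 12 * A\<^sup>2 * p2 x + 3 * (P x)\<^sup>2"
        using p2[of x] by (simp add: power_mult_distrib)
      also have "\<dots> \<le> C2 * (f x)\<^sup>2 + C2 * p2 x + C2 * (P x)\<^sup>2"
        unfolding C2_def by (intro add_mono mult_right_mono p2) auto
      finally show ?thesis by (simp add: algebra_simps)
    qed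
    have RH0: "RH x \<ge> 0" for x unfolding RH_def using p2[of x] wt_pos[of l s ctr x]
      by (intro add_nonneg_nonneg mult_nonneg_nonneg) auto
    have pt: "(Pu x)\<^sup>2 * wt l s ctr x \<le> C2 * RH x" for x
    proof -
      consider "x \<in> ann ctr r1 r2" | "x \<notin> ann ctr r1 r2" "x \<in> ann ctr r0 r1 \<union> ann ctr r2 r3"
        | "norm (x - ctr) < r0 \<or> norm (x - ctr) > r3" unfolding ann_def by fastforce
      then show ?thesis
      proof cases
        case 1
        have "Pu x = P x" unfolding Pu_def UU_def P_def using inE[OF 1] by simp
        moreover have "(P x)\<^sup>2 * wt l s ctr x \<le> RH x" unfolding RH_def using 1 p2[of x] wt_pos[of l s ctr x] by simp
        moreover have "1 * RH x \<le> C2 * RH x" using RH0 unfolding C2_def by (intro mult_right_mono) auto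
        ultimately show ?thesis by simp
      next
        case 2
        then have "x \<in> cball ctr r3" using r unfolding ann_def by (auto simp: dist_norm norm_minus_commute)
        from cr[OF this] have "(Pu x)\<^sup>2 * wt l s ctr x \<le> C2 * (((f x)\<^sup>2 + p2 x + (P x)\<^sup>2) * wt l s ctr x)"
          using wt_pos[of l s ctr x] by simp
        moreover have "((f x)\<^sup>2 + p2 x + (P x)\<^sup>2) * wt l s ctr x \<le> RH x"
          using 2 p2[of x] wt_pos[of l s ctr x] unfolding RH_def
          by (auto simp: indicator_def intro!: mult_nonneg_nonneg add_nonneg_nonneg)
        ultimately show ?thesis using C2 by (meson less_eq_real_def mult_left_mono order_trans)
      next
        case 3
        then have "Pu x = 0" unfolding Pu_def using out by simp
        then show ?thesis using RH0 C2 by simp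
      qed
    qed
    have iRH: "integrable lborel RH"
    proof -
      have 1: "integrable lborel (\<lambda>x. indicator (ann ctr r r') x * ((P x)\<^sup>2 * wt l s ctr x))" for r r'
        by (intro integrable_indicator_continuous ann_compact continuous_intros cP wt_continuous)
      have 2: "integrable lborel (\<lambda>x. indicator (ann ctr r r') x * (((f x)\<^sup>2 + p2 x + (P x)\<^sup>2) * wt l s ctr x))" for r r'
        by (intro integrable_indicator_continuous ann_compact continuous_intros cP wt_continuous jetD[OF J])
      show ?thesis unfolding RH_def distrib_right[of "indicator _ _ :: real"]
        by (intro Bochner_Integration.integrable_add 1 2)
    qed
    have iPu: "integrable lborel (\<lambda>x. (Pu x)\<^sup>2 * wt l s ctr x)"
      by (rule integrable_compact_supp[where ctr=ctr and r=r3])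
         (use out in \<open>auto simp: Pu_def intro!: continuous_intros cP(2)[unfolded Pu_def[abs_def]] wt_continuous ca jetD[OF Ju]\<close>)
    have ul: "U i x = 0 \<and> u x = 0" if "norm (x - ctr) > r3" for i x
      using has_grad_zero_outside[OF jetD(1)[OF Ju] _ that] sup that by blast
    have ile: "integrable lborel (\<lambda>x. ((u x)\<^sup>2 + (\<Sum>i\<in>UNIV. (U i x)\<^sup>2)) * wt l s ctr x)"
      by (rule integrable_compact_supp[where ctr=ctr and r=r3])
         (use ul in \<open>auto intro!: continuous_intros wt_continuous jetD[OF Ju]\<close>)
    have ilf: "integrable lborel (\<lambda>x. indicator (ann ctr r1 r2) x * (((f x)\<^sup>2 + (\<Sum>i\<in>UNIV. (F i x)\<^sup>2)) * wt l s ctr x))"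
      by (intro integrable_indicator_continuous ann_compact continuous_intros wt_continuous jetD[OF J])
    have "(LINT x|lborel. indicator (ann ctr r1 r2) x * (((f x)\<^sup>2 + (\<Sum>i\<in>UNIV. (F i x)\<^sup>2)) * wt l s ctr x))
       \<le> (LINT x|lborel. ((u x)\<^sup>2 + (\<Sum>i\<in>UNIV. (U i x)\<^sup>2)) * wt l s ctr x)"
    proof (rule integral_mono[OF ilf ile])
      fix x
      show "indicator (ann ctr r1 r2) x * (((f x)\<^sup>2 + (\<Sum>i\<in>UNIV. (F i x)\<^sup>2)) * wt l s ctr x) \<le> ((u x)\<^sup>2 + (\<Sum>i\<in>UNIV. (U i x)\<^sup>2)) * wt l s ctr x"
      proof (cases "x \<in> ann ctr r1 r2")
        case True
        then show ?thesis unfolding u_def U_def using inE[OF True] by simp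
      next
        case False
        then show ?thesis using wt_pos[of l s ctr x] by (simp add: sum_nonneg)
      qed
    qed
    then have "s * (LINT x|lborel. indicator (ann ctr r1 r2) x * (((f x)\<^sup>2 + (\<Sum>i\<in>UNIV. (F i x)\<^sup>2)) * wt l s ctr x))
       \<le> s * (LINT x|lborel. ((u x)\<^sup>2 + (\<Sum>i\<in>UNIV. (U i x)\<^sup>2)) * wt l s ctr x)"
      using s lC by (intro mult_left_mono) auto
    also have "\<dots> \<le> C * (LINT x|lborel. (Pu x)\<^sup>2 * wt l s ctr x)"
      unfolding Pu_def by (rule Ca[OF co Ju _ s]) (use sup in blast)
    also have "(LINT x|lborel. (Pu x)\<^sup>2 * wt l s ctr x) \<le> (LINT x|lborel. C2 * RH x)"
      by (rule integral_mono) (use iPu iRH pt in auto)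
    finally have "s * (LINT x|lborel. indicator (ann ctr r1 r2) x * (((f x)\<^sup>2 + (\<Sum>i\<in>UNIV. (F i x)\<^sup>2)) * wt l s ctr x))
      \<le> C * C2 * (LINT x|lborel. RH x)" using lC by simp
    then show ?thesis unfolding RH_def P_def p2_def .
  qed
  show ?thesis
    using main lC C2 by (intro exI[of _ l] conjI exI[of _ "C * C2"] exI[of _ s0]) auto
qed

text \<open>Testing the divergence of \<open>a\<close> times the gradient against
  \<open>\<eta>\<^sup>2 * f\<close> yields \<open>\<eta>\<^sup>2\<close> times the quadratic form
  and products that Young's inequality splits. The cutoff is exported and weighs the gradient and
  the second-order term alike, and \<open>\<kappa>\<close> is free: thus the second-order term can
  be absorbed once the differential inequality bounds it.\<close>

lemma caccioppoli:
  fixes th t r r' \<kappa> :: real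
  assumes th: "th \<ge> 1" and t: "t \<ge> 0" and r: "0 < r" "r < r'" and k: "\<kappa> > 0"
  shows "\<exists>C>0. \<forall>ctr :: real ^ 'n::finite. \<exists>\<eta>. continuous_on UNIV \<eta> \<and> (\<forall>x. 0 \<le> \<eta> x \<and> \<eta> x \<le> 1)
     \<and> (\<forall>x. norm (x - ctr) \<le> r \<longrightarrow> \<eta> x = 1) \<and> (\<forall>x. norm (x - ctr) \<ge> r' \<longrightarrow> \<eta> x = 0) \<and>
     (\<forall>(a :: 'n \<Rightarrow> 'n \<Rightarrow> real ^ 'n \<Rightarrow> real) da f F FF. elliptic_coeffs th t (cball ctr r') a da \<longrightarrow> jet f F FF \<longrightarrow>
      (LINT x|lborel. (\<eta> x)\<^sup>2 * (\<Sum>i\<in>UNIV. (F i x)\<^sup>2))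
       \<le> C * (LINT x|lborel. indicator (cball ctr r') x * (f x)\<^sup>2)
         + \<kappa> * (LINT x|lborel. (\<eta> x)\<^sup>2 * (\<Sum>i\<in>UNIV. \<Sum>j\<in>UNIV. a i j x * FF i j x)\<^sup>2))"
proof -
  obtain M where M: "M \<ge> 0" "\<forall>ctr :: real ^ 'n. \<exists>\<eta> D DD. jet \<eta> D DD
    \<and> (\<forall>i x. \<bar>D i x\<bar> \<le> M) \<and> (\<forall>i j x. \<bar>DD i j x\<bar> \<le> M) \<and> (\<forall>x. 0 \<le> \<eta> x \<and> \<eta> x \<le> 1)
    \<and> (\<forall>x. norm (x - ctr) \<le> r \<longrightarrow> \<eta> x = 1) \<and> (\<forall>x. norm (x - ctr) \<ge> r' \<longrightarrow> \<eta> x = 0)"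
    using ball_cutoff[OF r, where ?'n='n] by blast
  define N where "N = real CARD('n)"
  define K where "K = N * (N * t)"
  define L where "L = N * (M * (N * th))"
  have KL: "K \<ge> 0" "L \<ge> 0" unfolding K_def L_def N_def using th t M by auto
  \<comment> \<open>The pointwise inequality is multiplied by \<open>2 * th\<close> in the end,
    hence the division here. \<open>C'\<close> below adds up the coefficients of
    \<open>f\<^sup>2\<close> in \<open>y1\<close>, \<open>y2\<close> and \<open>y3\<close>.\<close>
  define k' where "k' = \<kappa> / (2 * th)"
  have k': "k' > 0" unfolding k'_def using k th by simp
  define C' where "C' = 1 / (4 * k') + th * K\<^sup>2 + 4 * th * L\<^sup>2"
  have C': "C' > 0" unfolding C'_def using k' th by (intro add_pos_nonneg) auto
  have main: "(LINT x|lborel. (\<eta> x)\<^sup>2 * (\<Sum>i\<in>UNIV. (F i x)\<^sup>2))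
       \<le> 2 * th * C' * (LINT x|lborel. indicator (cball ctr r') x * (f x)\<^sup>2)
         + \<kappa> * (LINT x|lborel. (\<eta> x)\<^sup>2 * (\<Sum>i\<in>UNIV. \<Sum>j\<in>UNIV. a i j x * FF i j x)\<^sup>2)"
    if e: "jet \<eta> D DD" "\<forall>i x. \<bar>D i x\<bar> \<le> M" "\<forall>x. 0 \<le> \<eta> x \<and> \<eta> x \<le> 1" "\<forall>x. norm (x - ctr) \<ge> r' \<longrightarrow> \<eta> x = 0"
    and co: "elliptic_coeffs th t (cball ctr r') a da" and J: "jet f F FF"
    for ctr \<eta> D DD and a :: "'n \<Rightarrow> 'n \<Rightarrow> real ^ 'n \<Rightarrow> real" and da f F FF
  proof -
    have ga: "has_grad (a i j) (da i j)" and cda: "continuous_on UNIV (da i j n)" for i j n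
      using co unfolding elliptic_coeffs_def by auto
    note ca = has_grad_continuous[OF ga]
    define q where "q i x = (\<Sum>j\<in>UNIV. a i j x * F j x)" for i x
    define dq where "dq i n x = (\<Sum>j\<in>UNIV. da i j n x * F j x + a i j x * FF j n x)" for i n x
    have gq: "has_grad (q i) (dq i)" for i unfolding q_def dq_def
      by (intro has_grad_sum has_grad_mult ga jetD[OF J])
    have cdq: "continuous_on UNIV (dq i n)" for i n unfolding dq_def by (intro continuous_intros ca cda jetD[OF J])
    define w where "w x = \<eta> x * \<eta> x * f x" for x
    define W where "W i x = (D i x * \<eta> x + \<eta> x * D i x) * f x + \<eta> x * \<eta> x * F i x" for i x
    have gw: "has_grad w W" unfolding w_def[abs_def] W_def[abs_def] by (intro has_grad_mult jetD[OF e(1)] jetD[OF J])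
    have cW: "continuous_on UNIV (W i)" for i unfolding W_def by (intro continuous_intros jetD[OF e(1)] jetD[OF J])
    have zw: "w x = 0" if "norm (x - ctr) > r'" for x using e(4) that unfolding w_def by auto
    define P where "P x = (\<Sum>i\<in>UNIV. \<Sum>j\<in>UNIV. a i j x * FF i j x)" for x
    define p2 where "p2 x = (\<Sum>i\<in>UNIV. (F i x)\<^sup>2)" for x
    have p2: "p2 x \<ge> 0" for x unfolding p2_def by (simp add: sum_nonneg)
    define I1 where "I1 x = w x * (\<Sum>i\<in>UNIV. dq i i x)" for x
    define I2 where "I2 x = (\<Sum>i\<in>UNIV. W i x * q i x)" for x
    have I: "(LINT x|lborel. I1 x) = - (LINT x|lborel. I2 x)" "integrable lborel I1" "integrable lborel I2"
      unfolding I1_def I2_def using integral_by_parts[OF gw gq cW cdq zw] by simp_all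
    have pt: "(\<eta> x)\<^sup>2 * p2 x / (2 * th) \<le> I1 x + I2 x + C' * (indicator (cball ctr r') x * (f x)\<^sup>2) + k' * ((\<eta> x)\<^sup>2 * (P x)\<^sup>2)" for x
    proof (cases "x \<in> cball ctr r'")
      case False
      then have "norm (x - ctr) > r'" by (simp add: dist_norm norm_minus_commute)
      then have "\<eta> x = 0" using e(4) by auto
      then show ?thesis using False by (simp add: I1_def I2_def w_def W_def)
    next
      case True
      define p where "p = sqrt (p2 x)"
      have p: "p \<ge> 0" "p\<^sup>2 = p2 x" unfolding p_def using p2 by simp_all
      have ba: "\<bar>a i j x\<bar> \<le> th" and bda: "\<bar>da i j n x\<bar> \<le> t" for i j n
        using co True unfolding elliptic_coeffs_def by auto
      have ell: "p2 x / th \<le> (\<Sum>i\<in>UNIV. \<Sum>j\<in>UNIV. F i x * a i j x * F j x)"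
        using co True unfolding elliptic_coeffs_def p2_def by (auto dest!: spec[of _ "\<lambda>i. F i x"])
      have bF: "\<bar>F i x\<bar> \<le> p" for i unfolding p_def p2_def by (rule abs_le_sqrt_sum)
      have bq: "\<bar>q i x\<bar> \<le> N * (th * p)" for i unfolding q_def N_def
        by (rule abs_sum_UNIV_le) (unfold abs_mult, intro mult_mono ba bF, use th in auto)
      define dV where "dV = (\<Sum>i\<in>UNIV. \<Sum>j\<in>UNIV. da i j i x * F j x)"
      have bdV: "\<bar>dV\<bar> \<le> K * p"
      proof -
        have "\<bar>dV\<bar> \<le> N * (N * (t * p))" unfolding dV_def N_def
          by (rule abs_sum_UNIV_le, rule abs_sum_UNIV_le) (unfold abs_mult, intro mult_mono bda bF, use t in auto)
        then show ?thesis unfolding K_def by simp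
      qed
      define Dq where "Dq = (\<Sum>i\<in>UNIV. D i x * q i x)"
      have bDq: "\<bar>Dq\<bar> \<le> L * p"
      proof -
        have "\<bar>Dq\<bar> \<le> N * (M * (N * (th * p)))" unfolding Dq_def N_def
          by (rule abs_sum_UNIV_le) (unfold abs_mult, intro mult_mono bq[unfolded N_def], use e(2) M in auto)
        then show ?thesis unfolding L_def by simp
      qed
      have FFs: "(\<Sum>i\<in>UNIV. \<Sum>j\<in>UNIV. a i j x * FF j i x) = P x"
        unfolding P_def using jetD(4)[OF J, of _ _ x] by simp
      have i1: "I1 x = (\<eta> x)\<^sup>2 * f x * (dV + P x)"
        unfolding I1_def dq_def w_def dV_def FFs[symmetric] by (simp add: sum.distrib power2_eq_square)
      have i2: "I2 x = 2 * \<eta> x * f x * Dq + (\<eta> x)\<^sup>2 * (\<Sum>i\<in>UNIV. \<Sum>j\<in>UNIV. F i x * a i j x * F j x)"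
      proof -
        have "I2 x = (\<Sum>i\<in>UNIV. 2 * \<eta> x * f x * (D i x * q i x) + (\<eta> x)\<^sup>2 * (F i x * q i x))"
          unfolding I2_def W_def by (intro sum.cong refl) (simp add: algebra_simps power2_eq_square)
        also have "\<dots> = 2 * \<eta> x * f x * Dq + (\<eta> x)\<^sup>2 * (\<Sum>i\<in>UNIV. F i x * q i x)"
          unfolding Dq_def by (simp add: sum.distrib sum_distrib_left)
        finally show ?thesis unfolding q_def by (simp add: sum_distrib_left mult.assoc)
      qed
      have young: "2 * X * Y \<le> \<alpha> * X\<^sup>2 + Y\<^sup>2 / \<alpha>" if "\<alpha> > 0" for X Y \<alpha> :: real
      proof -
        have "0 \<le> (\<alpha> * X - Y)\<^sup>2 / \<alpha>" using that by simp
        also have "\<dots> = \<alpha> * X\<^sup>2 + Y\<^sup>2 / \<alpha> - 2 * X * Y" using that by (simp add: field_simps power2_eq_square)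
        finally show ?thesis by simp
      qed
      have e01: "0 \<le> \<eta> x" "(\<eta> x)\<^sup>2 \<le> 1" using e(3) by (auto simp: power_le_one)
      have y1: "- ((\<eta> x)\<^sup>2 * f x * P x) \<le> k' * ((\<eta> x)\<^sup>2 * (P x)\<^sup>2) + 1 / (4 * k') * (f x)\<^sup>2"
      proof -
        have "2 * (\<eta> x * P x) * (- (\<eta> x * f x) / 2) \<le> k' * (\<eta> x * P x)\<^sup>2 + (- (\<eta> x * f x) / 2)\<^sup>2 / k'" by (rule young[OF k'])
        also have "(- (\<eta> x * f x) / 2)\<^sup>2 / k' = 1 / (4 * k') * ((\<eta> x)\<^sup>2 * (f x)\<^sup>2)"
          using k' by (simp add: field_simps power2_eq_square)
        also have "\<dots> \<le> 1 / (4 * k') * (1 * (f x)\<^sup>2)" using k' e01 by (intro mult_left_mono mult_right_mono) auto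
        finally show ?thesis by (simp add: power2_eq_square algebra_simps)
      qed
      have y2: "- ((\<eta> x)\<^sup>2 * f x * dV) \<le> (\<eta> x)\<^sup>2 * p2 x / (4 * th) + th * K\<^sup>2 * (f x)\<^sup>2"
      proof -
        have "- ((\<eta> x)\<^sup>2 * f x * dV) \<le> (\<eta> x)\<^sup>2 * \<bar>f x\<bar> * \<bar>dV\<bar>"
          by (metis abs_ge_minus_self abs_mult abs_power2)
        also have "\<dots> \<le> (\<eta> x)\<^sup>2 * \<bar>f x\<bar> * (K * p)" using bdV by (intro mult_left_mono) auto
        also have "\<dots> = 2 * (\<eta> x * p) * (\<eta> x * (K * \<bar>f x\<bar>) / 2)" by (simp add: power2_eq_square)
        also have "\<dots> \<le> 1 / (4 * th) * (\<eta> x * p)\<^sup>2 + (\<eta> x * (K * \<bar>f x\<bar>) / 2)\<^sup>2 / (1 / (4 * th))"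
          by (rule young) (use th in auto)
        also have "\<dots> = (\<eta> x)\<^sup>2 * p2 x / (4 * th) + th * K\<^sup>2 * ((\<eta> x)\<^sup>2 * (f x)\<^sup>2)"
          unfolding p(2)[symmetric] by (simp add: power_mult_distrib field_simps)
        also have "\<dots> \<le> (\<eta> x)\<^sup>2 * p2 x / (4 * th) + th * K\<^sup>2 * (1 * (f x)\<^sup>2)"
          using e01 th by (intro add_left_mono mult_left_mono mult_right_mono) auto
        finally show ?thesis by simp
      qed
      have y3: "- (2 * \<eta> x * f x * Dq) \<le> (\<eta> x)\<^sup>2 * p2 x / (4 * th) + 4 * th * L\<^sup>2 * (f x)\<^sup>2"
      proof -
        have "- (2 * \<eta> x * f x * Dq) \<le> 2 * \<eta> x * \<bar>f x\<bar> * \<bar>Dq\<bar>"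
          using abs_ge_minus_self[of "2 * \<eta> x * f x * Dq"] e01 by (simp add: abs_mult)
        also have "\<dots> \<le> 2 * \<eta> x * \<bar>f x\<bar> * (L * p)" using bDq e01 by (intro mult_left_mono) auto
        also have "\<dots> = 2 * (\<eta> x * p) * (L * \<bar>f x\<bar>)" by simp
        also have "\<dots> \<le> 1 / (4 * th) * (\<eta> x * p)\<^sup>2 + (L * \<bar>f x\<bar>)\<^sup>2 / (1 / (4 * th))"
          by (rule young) (use th in auto)
        also have "\<dots> = (\<eta> x)\<^sup>2 * p2 x / (4 * th) + 4 * th * L\<^sup>2 * (f x)\<^sup>2"
          unfolding p(2)[symmetric] by (simp add: power_mult_distrib field_simps)
        finally show ?thesis .
      qed
      \<comment> \<open>Ellipticity supplies \<open>\<eta>\<^sup>2 * p2 / th\<close>;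
        \<open>y2\<close> and \<open>y3\<close> consume a quarter of it each, and half remains for
        the claim.\<close>
      have y4: "(\<eta> x)\<^sup>2 * (p2 x / th) \<le> (\<eta> x)\<^sup>2 * (\<Sum>i\<in>UNIV. \<Sum>j\<in>UNIV. F i x * a i j x * F j x)"
        using ell by (intro mult_left_mono) auto
      have y5: "(\<eta> x)\<^sup>2 * (p2 x / th) = (\<eta> x)\<^sup>2 * p2 x / (2 * th) + (\<eta> x)\<^sup>2 * p2 x / (4 * th) + (\<eta> x)\<^sup>2 * p2 x / (4 * th)"
        using th by (simp add: field_simps)
      have "C' * (indicator (cball ctr r') x * (f x)\<^sup>2) = 1 / (4 * k') * (f x)\<^sup>2 + th * K\<^sup>2 * (f x)\<^sup>2 + 4 * th * L\<^sup>2 * (f x)\<^sup>2"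
        using True unfolding C'_def by (simp add: distrib_right)
      then show ?thesis unfolding i1 i2 distrib_left using y1 y2 y3 y4 y5 by linarith
    qed
    have cP: "continuous_on UNIV P" "continuous_on UNIV p2"
      unfolding P_def[abs_def] p2_def[abs_def] by (intro continuous_intros ca jetD[OF J])+
    have iP: "integrable lborel (\<lambda>x. (\<eta> x)\<^sup>2 * (P x)\<^sup>2)" "integrable lborel (\<lambda>x. (\<eta> x)\<^sup>2 * p2 x)"
      by (rule integrable_compact_supp[where ctr=ctr and r=r'];
          use e(4) in \<open>auto intro!: continuous_intros cP jetD[OF e(1)]\<close>)+
    have if': "integrable lborel (\<lambda>x. indicator (cball ctr r') x * (f x)\<^sup>2)"
      by (intro integrable_indicator_continuous continuous_intros jetD[OF J]) auto
    have "(LINT x|lborel. (\<eta> x)\<^sup>2 * p2 x / (2 * th)) \<le> (LINT x|lborel. I1 x + I2 x + C' * (indicator (cball ctr r') x * (f x)\<^sup>2) + k' * ((\<eta> x)\<^sup>2 * (P x)\<^sup>2))"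
      by (rule integral_mono) (use iP if' I pt in auto)
    also have "\<dots> = C' * (LINT x|lborel. indicator (cball ctr r') x * (f x)\<^sup>2) + k' * (LINT x|lborel. (\<eta> x)\<^sup>2 * (P x)\<^sup>2)"
      using I iP if' by simp
    finally have "(LINT x|lborel. (\<eta> x)\<^sup>2 * p2 x) / (2 * th) \<le> C' * (LINT x|lborel. indicator (cball ctr r') x * (f x)\<^sup>2) + k' * (LINT x|lborel. (\<eta> x)\<^sup>2 * (P x)\<^sup>2)"
      by simp
    then have "(LINT x|lborel. (\<eta> x)\<^sup>2 * p2 x) \<le> 2 * th * (C' * (LINT x|lborel. indicator (cball ctr r') x * (f x)\<^sup>2) + k' * (LINT x|lborel. (\<eta> x)\<^sup>2 * (P x)\<^sup>2))"
      using th by (simp add: pos_divide_le_eq mult.commute)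
    also have "\<dots> = 2 * th * C' * (LINT x|lborel. indicator (cball ctr r') x * (f x)\<^sup>2) + \<kappa> * (LINT x|lborel. (\<eta> x)\<^sup>2 * (P x)\<^sup>2)"
      unfolding k'_def using th by (simp add: distrib_left)
    finally show ?thesis unfolding P_def p2_def .
  qed
  have "\<exists>\<eta>. continuous_on UNIV \<eta> \<and> (\<forall>x. 0 \<le> \<eta> x \<and> \<eta> x \<le> 1)
     \<and> (\<forall>x. norm (x - ctr) \<le> r \<longrightarrow> \<eta> x = 1) \<and> (\<forall>x. norm (x - ctr) \<ge> r' \<longrightarrow> \<eta> x = 0) \<and>
     (\<forall>(a :: 'n \<Rightarrow> 'n \<Rightarrow> real ^ 'n \<Rightarrow> real) da f F FF. elliptic_coeffs th t (cball ctr r') a da \<longrightarrow> jet f F FF \<longrightarrow>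
      (LINT x|lborel. (\<eta> x)\<^sup>2 * (\<Sum>i\<in>UNIV. (F i x)\<^sup>2))
       \<le> 2 * th * C' * (LINT x|lborel. indicator (cball ctr r') x * (f x)\<^sup>2)
         + \<kappa> * (LINT x|lborel. (\<eta> x)\<^sup>2 * (\<Sum>i\<in>UNIV. \<Sum>j\<in>UNIV. a i j x * FF i j x)\<^sup>2))" for ctr :: "real ^ 'n"
  proof -
    obtain \<eta> D DD where e: "jet \<eta> D DD" "\<forall>i x. \<bar>D i x\<bar> \<le> M" "\<forall>x. 0 \<le> \<eta> x \<and> \<eta> x \<le> 1"
      "\<forall>x. norm (x - ctr) \<le> r \<longrightarrow> \<eta> x = 1" "\<forall>x. norm (x - ctr) \<ge> r' \<longrightarrow> \<eta> x = 0" using M(2) by blast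
    show ?thesis
      by (rule exI[of _ \<eta>], intro conjI allI impI main[OF e(1-3,5)]) (use e(3-5) jetD(5)[OF e(1)] in auto)
  qed
  moreover have "2 * th * C' > 0" using th C' by simp
  ultimately show ?thesis by blast
qed

section \<open>Mollification\<close>

text \<open>\<open>flat 0\<close> is the standard function that is flat at the origin. The powers of
  \<open>inverse t\<close> make the family closed under differentiation up to linear combinations,
  so all derivatives are covered by one formula.\<close>

definition flat :: "nat \<Rightarrow> real \<Rightarrow> real" where
  "flat k t = (if t \<le> 0 then 0 else exp (- inverse t) * inverse t ^ k)"

lemma flat_nonneg: "flat k t \<ge> 0" unfolding flat_def by simp

lemma flat_tendsto_0: "(flat k \<longlongrightarrow> 0) (at 0)"
proof (rule filterlim_split_at)
  show "(flat k \<longlongrightarrow> 0) (at_left 0)"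
    by (rule tendsto_eventually) (auto simp: flat_def eventually_at_left_field intro!: exI[of _ "-1"])
  have "((\<lambda>t. (inverse t) ^ k / exp (inverse t)) \<longlongrightarrow> (0::real)) (at_right 0)"
    by (rule filterlim_compose[OF tendsto_power_div_exp_0 filterlim_inverse_at_top_right])
  then show "(flat k \<longlongrightarrow> 0) (at_right 0)"
    by (rule Lim_transform_eventually)
       (auto simp: flat_def exp_minus field_simps eventually_at_right_field intro!: exI[of _ 1])
qed

lemma flat_deriv: "(flat k has_real_derivative flat (k + 2) t - real k * flat (k + 1) t) (at t)"
proof -
  consider "t > 0" | "t < 0" | "t = 0" by linarith
  then show ?thesis
  proof cases
    case 1
    have e: "flat (k + 2) t - real k * flat (k + 1) t
      = exp (- inverse t) * (inverse t)\<^sup>2 * inverse t ^ k + exp (- inverse t) * (real k * inverse t ^ (k - 1) * - ((inverse t)\<^sup>2))"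
      using 1 by (cases k) (simp_all add: flat_def algebra_simps power2_eq_square)
    have "((\<lambda>t. exp (- inverse t) * inverse t ^ k) has_real_derivative flat (k + 2) t - real k * flat (k + 1) t) (at t)"
      unfolding e using 1 by (auto intro!: derivative_eq_intros simp: power2_eq_square)
    then show ?thesis
      by (rule DERIV_cong_ev[THEN iffD1, rotated -1, OF _ refl])
         (use 1 in \<open>auto simp: eventually_nhds flat_def intro: exI[of _ "{0<..}"]\<close>)
  next
    case 2
    have "((\<lambda>t::real. 0) has_real_derivative flat (k + 2) t - real k * flat (k + 1) t) (at t)"
      using 2 by (simp add: flat_def)
    then show ?thesis
      by (rule DERIV_cong_ev[THEN iffD1, rotated -1, OF _ refl])
         (use 2 in \<open>auto simp: eventually_nhds flat_def intro: exI[of _ "{..<0}"]\<close>)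
  next
    case 3
    \<comment> \<open>At the origin the difference quotient is again a member of the family, so
      differentiability reduces to the limit \<open>flat_tendsto_0\<close>.\<close>
    have "flat k h / h = flat (k + 1) h" for h by (simp add: flat_def field_simps)
    moreover have "flat k 0 = 0" for k by (simp add: flat_def)
    ultimately show ?thesis using 3 flat_tendsto_0[of "k + 1"] by (simp add: DERIV_def)
  qed
qed

text \<open>An algebra of functions closed under partial derivatives, which makes the smoothness of the
  standard bump function an immediate coinduction.\<close>

inductive bumpy :: "(real ^ 'n::finite \<Rightarrow> real) \<Rightarrow> bool" where
  bumpy_const: "bumpy (\<lambda>x. c)"
| bumpy_flat: "bumpy (\<lambda>x. flat k (\<alpha> * x $ i + \<beta>))"
| bumpy_add: "bumpy f \<Longrightarrow> bumpy g \<Longrightarrow> bumpy (\<lambda>x. f x + g x)"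
| bumpy_mult: "bumpy f \<Longrightarrow> bumpy g \<Longrightarrow> bumpy (\<lambda>x. f x * g x)"

lemma bumpy_prod: "(\<And>j. j \<in> S \<Longrightarrow> bumpy (f j)) \<Longrightarrow> bumpy (\<lambda>x. \<Prod>j\<in>S. f j x)"
  by (induction S rule: infinite_finite_induct) (auto intro: bumpy.intros)

lemma bumpy_reflect: "bumpy f \<Longrightarrow> bumpy (\<lambda>y. f (x - y))"
proof (induction rule: bumpy.induct)
  case (bumpy_flat k \<alpha> i \<beta>)
  have "bumpy (\<lambda>y. flat k ((- \<alpha>) * y $ i + (\<alpha> * x $ i + \<beta>)))" by (rule bumpy.bumpy_flat)
  then show ?case by (simp add: algebra_simps)
qed (auto intro: bumpy.intros)

text \<open>Symmetry of the Hessian travels along the induction: in each case the second derivatives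
  are explicit expressions in which the two indices can be exchanged.\<close>

lemma bumpy_jet:
  "bumpy f \<Longrightarrow> \<exists>F FF. has_grad f F \<and> (\<forall>i. bumpy (F i)) \<and> (\<forall>i. has_grad (F i) (FF i)) \<and> (\<forall>i j. bumpy (FF i j))
     \<and> (\<forall>i j x. FF i j x = FF j i x)"
proof (induction rule: bumpy.induct)
  case (bumpy_const c)
  show ?case
    by (rule exI[of _ "\<lambda>i x. 0"], rule exI[of _ "\<lambda>i j x. 0"]) (auto intro: bumpy.intros has_grad_const)
next
  case (bumpy_flat k \<alpha> i \<beta>)
  define d where "d = (\<lambda>j::'a. if j = i then \<alpha> else 0)"
  have lin: "has_grad (\<lambda>x::real^'a. \<alpha> * x $ i + \<beta>) (\<lambda>j x. d j)"
    by (rule has_grad_eq_rhs, (rule grad_intros)+) (simp add: d_def)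
  have 1: "has_grad (\<lambda>x::real^'a. flat k (\<alpha> * x $ i + \<beta>)) (\<lambda>j x. d j * (flat (k + 2) (\<alpha> * x $ i + \<beta>) + (- real k) * flat (k + 1) (\<alpha> * x $ i + \<beta>)))" for k
    by (rule has_grad_eq_rhs[OF has_grad_compose[OF lin flat_deriv]]) simp
  have b: "bumpy (\<lambda>x::real^'a. d j * (flat (k + 2) (\<alpha> * x $ i + \<beta>) + (- real k) * flat (k + 1) (\<alpha> * x $ i + \<beta>)))" for j k
    by (intro bumpy.intros)
  show ?case
  proof (intro exI conjI allI)
    show "has_grad (\<lambda>x::real^'a. flat k (\<alpha> * x $ i + \<beta>)) (\<lambda>j x. d j * (flat (k + 2) (\<alpha> * x $ i + \<beta>) + (- real k) * flat (k + 1) (\<alpha> * x $ i + \<beta>)))" by (rule 1)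
    show "bumpy (\<lambda>x::real^'a. d j * (flat (k + 2) (\<alpha> * x $ i + \<beta>) + (- real k) * flat (k + 1) (\<alpha> * x $ i + \<beta>)))" for j by (rule b)
    show "has_grad (\<lambda>x::real^'a. d j * (flat (k + 2) (\<alpha> * x $ i + \<beta>) + (- real k) * flat (k + 1) (\<alpha> * x $ i + \<beta>)))
      ((\<lambda>j m x. d j * (d m * (flat (k + 2 + 2) (\<alpha> * x $ i + \<beta>) + (- real (k + 2)) * flat (k + 2 + 1) (\<alpha> * x $ i + \<beta>))
       + (- real k) * (d m * (flat (k + 1 + 2) (\<alpha> * x $ i + \<beta>) + (- real (k + 1)) * flat (k + 1 + 1) (\<alpha> * x $ i + \<beta>))))) j)" for j
      by (intro has_grad_cmult has_grad_add 1)
  qed ((intro bumpy.intros | simp add: algebra_simps)+)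
next
  case (bumpy_add f g)
  then obtain F FF G GG where f: "has_grad f F" "\<forall>i. bumpy (F i)" "\<forall>i. has_grad (F i) (FF i)" "\<forall>i j. bumpy (FF i j)"
     "\<forall>i j x. FF i j x = FF j i x" and g: "has_grad g G" "\<forall>i. bumpy (G i)" "\<forall>i. has_grad (G i) (GG i)" "\<forall>i j. bumpy (GG i j)"
     "\<forall>i j x. GG i j x = GG j i x" by blast
  show ?case
    by (rule exI[of _ "\<lambda>i x. F i x + G i x"], rule exI[of _ "\<lambda>i j x. FF i j x + GG i j x"])
       (use f g in \<open>auto intro: bumpy.intros has_grad_add\<close>)
next
  case (bumpy_mult f g)
  then obtain F FF G GG where f: "has_grad f F" "\<forall>i. bumpy (F i)" "\<forall>i. has_grad (F i) (FF i)" "\<forall>i j. bumpy (FF i j)"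
     "\<forall>i j x. FF i j x = FF j i x" and g: "has_grad g G" "\<forall>i. bumpy (G i)" "\<forall>i. has_grad (G i) (GG i)" "\<forall>i j. bumpy (GG i j)"
     "\<forall>i j x. GG i j x = GG j i x" by blast
  show ?case
  proof (rule exI[of _ "\<lambda>i x. F i x * g x + f x * G i x"],
     rule exI[of _ "\<lambda>i j x. (FF i j x * g x + F i x * G j x) + (F j x * G i x + f x * GG i j x)"], intro conjI allI)
    show "has_grad (\<lambda>x. F i x * g x + f x * G i x) (\<lambda>j x. (FF i j x * g x + F i x * G j x) + (F j x * G i x + f x * GG i j x))" for i
      by (intro has_grad_add has_grad_mult f(1) g(1) f(3)[rule_format] g(3)[rule_format])
  qed (use f g bumpy_mult in \<open>auto intro!: bumpy.intros has_grad_mult\<close>)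
qed

lemma bumpy_grad:
  assumes "bumpy f" "has_grad f F" shows "bumpy (F i)"
proof -
  obtain G where "has_grad f G" "bumpy (G i)" using bumpy_jet[OF assms(1)] by blast
  moreover have "F i = G i" using has_grad_unique[OF assms(2)] calculation by blast
  ultimately show ?thesis by simp
qed

lemma bumpy_continuous: "bumpy f \<Longrightarrow> continuous_on S f"
  using bumpy_jet has_grad_continuous by blast

text \<open>As a greatest fixed point, this contains every function lying in some class closed under
  partial derivatives. Smoothness of a bump and of a mollified function is then one coinduction
  each, with no induction over the order.\<close>

coinductive smooth_fn :: "(real ^ 'n::finite \<Rightarrow> real) \<Rightarrow> bool" where
  "has_grad f F \<Longrightarrow> (\<And>i. smooth_fn (F i)) \<Longrightarrow> smooth_fn f"

lemma bumpy_smooth_fn: "bumpy f \<Longrightarrow> smooth_fn f"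
proof (coinduction arbitrary: f rule: smooth_fn.coinduct)
  case smooth_fn
  then show ?case using bumpy_jet[OF smooth_fn] by blast
qed

lemma smooth_fn_continuous: "smooth_fn f \<Longrightarrow> continuous_on S f"
  by (erule smooth_fn.cases) (auto intro: has_grad_continuous)

lemma partial_deriv_of_real:
  assumes "has_grad f F"
  shows "(\<lambda>x. complex_of_real (f x)) differentiable (at x)"
    and "partial_deriv i (\<lambda>x. complex_of_real (f x)) = (\<lambda>x. complex_of_real (F i x))"
proof -
  have d: "((\<lambda>x. complex_of_real (f x)) has_derivative (\<lambda>h. complex_of_real (\<Sum>j\<in>UNIV. F j x * h $ j))) (at x)" for x
    using assms unfolding has_grad_def by (intro has_derivative_of_real) blast
  then show "(\<lambda>x. complex_of_real (f x)) differentiable (at x)" unfolding differentiable_def by blast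
  show "partial_deriv i (\<lambda>x. complex_of_real (f x)) = (\<lambda>x. complex_of_real (F i x))"
  proof
    fix x
    have "frechet_derivative (\<lambda>x. complex_of_real (f x)) (at x) = (\<lambda>h. complex_of_real (\<Sum>j\<in>UNIV. F j x * h $ j))"
      using frechet_derivative_at[OF d] by simp
    then show "partial_deriv i (\<lambda>x. complex_of_real (f x)) x = complex_of_real (F i x)"
      unfolding partial_deriv_def by (simp add: axis_def if_distrib cong: if_cong)
  qed
qed

lemma smooth_fn_of_real:
  assumes "smooth_fn f" shows "smooth (\<lambda>x. complex_of_real (f x))"
proof -
  have "\<exists>g. smooth_fn g \<and> iterated_partial \<alpha> (\<lambda>x. complex_of_real (f x)) = (\<lambda>x. complex_of_real (g x))" for \<alpha>
  proof (induction \<alpha>)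
    case Nil
    then show ?case using assms by (auto simp: iterated_partial_def)
  next
    case (Cons i \<alpha>)
    then obtain g where g: "smooth_fn g" "iterated_partial \<alpha> (\<lambda>x. complex_of_real (f x)) = (\<lambda>x. complex_of_real (g x))" by blast
    from g(1) obtain G where G: "has_grad g G" "\<And>i. smooth_fn (G i)" by (auto elim: smooth_fn.cases)
    have "iterated_partial (i # \<alpha>) (\<lambda>x. complex_of_real (f x)) = (\<lambda>x. complex_of_real (G i x))"
      using g(2) partial_deriv_of_real(2)[OF G(1)] by (simp add: iterated_partial_def)
    then show ?case using G(2) by blast
  qed
  then show ?thesis unfolding smooth_def
    by (metis partial_deriv_of_real(1) smooth_fn.cases)
qed

lemma smooth_differentiable: "smooth f \<Longrightarrow> f differentiable (at x)"
  unfolding smooth_def by (metis iterated_partial_def foldr_Nil id_apply)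

lemma smooth_partial_deriv: "smooth f \<Longrightarrow> smooth (partial_deriv i f)"
proof -
  have "iterated_partial \<alpha> (partial_deriv i f) = iterated_partial (\<alpha> @ [i]) f" for \<alpha>
    by (simp add: iterated_partial_def)
  then show "smooth f \<Longrightarrow> smooth (partial_deriv i f)" unfolding smooth_def by simp
qed

section \<open>Convolution with compactly supported kernels\<close>

lemma compact_supp_bounded:
  fixes r :: "real ^ 'n::finite \<Rightarrow> real"
  assumes "continuous_on UNIV r" "\<And>x. norm x > \<rho> \<Longrightarrow> r x = 0"
  obtains M where "M \<ge> 0" "\<And>x. \<bar>r x\<bar> \<le> M"
proof -
  have "compact (r ` cball 0 \<rho>)" by (intro compact_continuous_image continuous_on_subset[OF assms(1)]) auto
  then obtain B where B: "\<forall>y\<in>r ` cball 0 \<rho>. \<bar>y\<bar> \<le> B" using compact_imp_bounded bounded_real by blast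
  have "\<bar>r x\<bar> \<le> max B 0" for x
    using assms(2)[of x] bspec[OF B, of "r x"] by (cases "norm x > \<rho>") auto
  then show ?thesis using that[of "max B 0"] by auto
qed

lemma compact_supp_uniformly_continuous:
  fixes r :: "real ^ 'n::finite \<Rightarrow> real"
  assumes c: "continuous_on UNIV r" and z: "\<And>x. norm x > \<rho> \<Longrightarrow> r x = 0" and e: "e > 0"
  obtains d where "d > 0" "\<And>x y. norm (x - y) < d \<Longrightarrow> \<bar>r x - r y\<bar> < e"
proof -
  \<comment> \<open>The radius grows by one and \<open>d\<close> is capped by one: two points closer
    than that either both lie in this ball or both lie where \<open>r\<close> vanishes.\<close>
  have "uniformly_continuous_on (cball 0 (\<rho> + 1)) r"
    by (intro compact_uniformly_continuous continuous_on_subset[OF c]) auto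
  then obtain d where d: "d > 0" "\<And>x y. x \<in> cball 0 (\<rho> + 1) \<Longrightarrow> y \<in> cball 0 (\<rho> + 1) \<Longrightarrow> dist y x < d \<Longrightarrow> dist (r y) (r x) < e"
    unfolding uniformly_continuous_on_def using e by meson
  show ?thesis
  proof (rule that[of "min d 1"])
    fix x y :: "real ^ 'n"
    assume xy: "norm (x - y) < min d 1"
    have t: "norm x \<le> norm y + norm (x - y)" "norm y \<le> norm x + norm (x - y)"
      using norm_triangle_sub[of x y] norm_triangle_sub[of y x] by (auto simp: norm_minus_commute)
    show "\<bar>r x - r y\<bar> < e"
    proof (cases "norm x \<le> \<rho> \<or> norm y \<le> \<rho>")
      case True
      then have "x \<in> cball 0 (\<rho> + 1)" "y \<in> cball 0 (\<rho> + 1)" using t xy by auto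
      then show ?thesis using d(2)[of y x] xy by (simp add: dist_norm)
    next
      case False
      then show ?thesis using z[of x] z[of y] e by simp
    qed
  qed (use d in auto)
qed

definition conv :: "(real ^ 'n::finite \<Rightarrow> real) \<Rightarrow> (real ^ 'n \<Rightarrow> real) \<Rightarrow> real ^ 'n \<Rightarrow> real" where
  "conv r f x = (LINT y|lborel. r (x - y) * f y)"

lemma integrable_bounded_mult:
  fixes f :: "real ^ 'n::finite \<Rightarrow> real"
  assumes "integrable lborel f" "g \<in> borel_measurable borel" "\<And>x. \<bar>g x\<bar> \<le> M"
  shows "integrable lborel (\<lambda>x. g x * f x)"
proof (rule Bochner_Integration.integrable_bound[where f="\<lambda>x. M * f x"])
  show "integrable lborel (\<lambda>x. M * f x)" using assms(1) by simp
  show "(\<lambda>x. g x * f x) \<in> borel_measurable lborel" using assms by measurable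
  have "M \<ge> 0" using assms(3)[of undefined] by linarith
  then show "AE x in lborel. norm (g x * f x) \<le> norm (M * f x)"
    using assms(3) by (auto simp: abs_mult intro!: mult_right_mono)
qed

lemma conv_integrable:
  fixes r :: "real ^ 'n::finite \<Rightarrow> real"
  assumes "continuous_on UNIV r" "\<And>x. norm x > \<rho> \<Longrightarrow> r x = 0" "integrable lborel f"
  shows "integrable lborel (\<lambda>y. r (x - y) * f y)"
proof -
  obtain M where M: "\<And>x. \<bar>r x\<bar> \<le> M" using compact_supp_bounded[OF assms(1,2)] by blast
  have "continuous_on UNIV (\<lambda>y. r (x - y))"
    by (rule continuous_on_compose2[OF assms(1)]) (auto intro: continuous_intros)
  then show ?thesis
    by (intro integrable_bounded_mult[OF assms(3), of _ M] M borel_measurable_continuous_onI)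
qed

lemma has_grad_line:
  assumes "has_grad r R"
  shows "((\<lambda>t. r (z + t *\<^sub>R h)) has_real_derivative (\<Sum>i\<in>UNIV. R i (z + t *\<^sub>R h) * h $ i)) (at t)"
proof -
  have f: "(r has_derivative (\<lambda>k. \<Sum>j\<in>UNIV. R j (z + t *\<^sub>R h) * k $ j)) (at (z + t *\<^sub>R h))"
    using assms by (simp add: has_grad_def)
  have "((\<lambda>t. z + t *\<^sub>R h) has_derivative (\<lambda>s. s *\<^sub>R h)) (at t)"
    by (auto intro!: derivative_eq_intros)
  from has_derivative_compose[OF this f]
  show ?thesis unfolding has_field_derivative_def
    by (rule has_derivative_eq_rhs) (simp add: fun_eq_iff sum_distrib_left ac_simps)
qed

text \<open>The partial derivatives are continuous with compact support, hence uniformly continuous,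
  and the mean value theorem makes the first-order remainder uniform in \<open>z\<close>. This
  uniformity is what permits differentiating a convolution whose other factor is merely
  integrable.\<close>

lemma has_grad_uniform:
  fixes r :: "real ^ 'n::finite \<Rightarrow> real"
  assumes r: "has_grad r R" "\<And>i. continuous_on UNIV (R i)" "\<And>x. norm x > \<rho> \<Longrightarrow> r x = 0" and e: "e > 0"
  obtains d where "d > 0" "\<And>z h. norm h < d \<Longrightarrow> \<bar>r (z + h) - r z - (\<Sum>i\<in>UNIV. R i z * h $ i)\<bar> \<le> e * norm h"
proof -
  have z: "norm x > \<rho> \<Longrightarrow> R i x = 0" for x i
    using has_grad_zero_outside[OF r(1), of \<rho> 0 x i] r(3) by simp
  define N where "N = real CARD('n)"
  have N: "N > 0" unfolding N_def by simp
  then have eN: "e / N > 0" using e by simp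
  have "\<exists>d>0. \<forall>x y. norm (x - y) < d \<longrightarrow> \<bar>R i x - R i y\<bar> < e / N" for i
    by (rule compact_supp_uniformly_continuous[OF r(2)[of i] z[where i=i] eN]) blast+
  then obtain D where D: "\<And>i. D i > 0" "\<And>i x y. norm (x - y) < D i \<Longrightarrow> \<bar>R i x - R i y\<bar> < e / N" by metis
  define d where "d = Min (range D)"
  have d: "d > 0" "\<And>i. d \<le> D i" unfolding d_def using D(1) by (auto simp: Min_gr_iff)
  show ?thesis
  proof (rule that[OF d(1)])
    fix z h :: "real ^ 'n" assume h: "norm h < d"
    have "\<exists>\<xi>>0. \<xi> < 1 \<and> r (z + 1 *\<^sub>R h) - r (z + 0 *\<^sub>R h) = (1 - 0) * (\<Sum>i\<in>UNIV. R i (z + \<xi> *\<^sub>R h) * h $ i)"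
      by (rule MVT2) (use has_grad_line[OF r(1)] in auto)
    then obtain \<xi> where \<xi>: "0 < \<xi>" "\<xi> < 1" "r (z + h) - r z = (\<Sum>i\<in>UNIV. R i (z + \<xi> *\<^sub>R h) * h $ i)" by auto
    have "norm (\<xi> *\<^sub>R h) \<le> norm h" using \<xi> by (simp add: mult_left_le_one_le)
    then have "norm ((z + \<xi> *\<^sub>R h) - z) < D i" for i using h d(2)[of i] by simp
    then have Ri: "\<bar>R i (z + \<xi> *\<^sub>R h) - R i z\<bar> \<le> e / N" for i using D(2) less_imp_le by blast
    have "r (z + h) - r z - (\<Sum>i\<in>UNIV. R i z * h $ i) = (\<Sum>i\<in>UNIV. (R i (z + \<xi> *\<^sub>R h) - R i z) * h $ i)"
      unfolding \<xi>(3) by (simp add: sum_subtractf left_diff_distrib)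
    also have "\<bar>\<dots>\<bar> \<le> N * (e / N * norm h)" unfolding N_def
      by (rule abs_sum_UNIV_le) (unfold abs_mult, intro mult_mono Ri[unfolded N_def] component_le_norm_cart, use e in auto)
    finally show "\<bar>r (z + h) - r z - (\<Sum>i\<in>UNIV. R i z * h $ i)\<bar> \<le> e * norm h" using N by simp
  qed
qed

lemma conv_has_grad:
  fixes r :: "real ^ 'n::finite \<Rightarrow> real"
  assumes r: "has_grad r R" "\<And>i. continuous_on UNIV (R i)" "\<And>x. norm x > \<rho> \<Longrightarrow> r x = 0"
    and f: "integrable lborel f"
  shows "has_grad (conv r f) (\<lambda>i. conv (R i) f)"
  unfolding has_grad_def
proof
  fix x
  have z: "norm x > \<rho> \<Longrightarrow> R i x = 0" for x i
    using has_grad_zero_outside[OF r(1), of \<rho> 0 x i] r(3) by simp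
  note ir = conv_integrable[OF has_grad_continuous[OF r(1)] r(3) f]
  note iR = conv_integrable[OF r(2) z f]
  define A where "A = (LINT y|lborel. \<bar>f y\<bar>)"
  have A: "A \<ge> 0" unfolding A_def by simp
  show "(conv r f has_derivative (\<lambda>h. \<Sum>i\<in>UNIV. conv (R i) f x * h $ i)) (at x)"
    unfolding has_derivative_at_alt
  proof (intro conjI allI impI)
    show "bounded_linear (\<lambda>h. \<Sum>i\<in>UNIV. conv (R i) f x * h $ i)"
      by (intro bounded_linear_sum bounded_linear_compose[OF bounded_linear_mult_right bounded_linear_vec_nth])
    fix e :: real assume e: "e > 0"
    \<comment> \<open>\<open>A\<close> is the L1 norm of \<open>f\<close>; the added 1 covers the
      case \<open>A = 0\<close>.\<close>
    then have "e / (A + 1) > 0" using A by simp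
    from has_grad_uniform[OF r this] obtain d where d: "d > 0"
      "\<And>z h. norm h < d \<Longrightarrow> \<bar>r (z + h) - r z - (\<Sum>i\<in>UNIV. R i z * h $ i)\<bar> \<le> e / (A + 1) * norm h" by blast
    have "norm (conv r f y - conv r f x - (\<Sum>i\<in>UNIV. conv (R i) f x * (y - x) $ i)) \<le> e * norm (y - x)"
      if y: "norm (y - x) < d" for y
    proof -
      define G where "G w = r (y - w) - r (x - w) - (\<Sum>i\<in>UNIV. R i (x - w) * (y - x) $ i)" for w
      have G: "\<bar>G w\<bar> \<le> e / (A + 1) * norm (y - x)" for w
        using d(2)[OF y, of "x - w"] unfolding G_def by (simp add: algebra_simps)
      have iR': "integrable lborel (\<lambda>w. R i (x - w) * c * f w)" for i c
      proof -
        have "integrable lborel (\<lambda>w. c * (R i (x - w) * f w))" by (intro integrable_mult_right iR)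
        then show ?thesis by (simp add: ac_simps)
      qed
      have iG: "integrable lborel (\<lambda>w. G w * f w)" unfolding G_def left_diff_distrib sum_distrib_right
        by (intro Bochner_Integration.integrable_diff ir Bochner_Integration.integrable_sum iR')
      have "conv r f y - conv r f x - (\<Sum>i\<in>UNIV. conv (R i) f x * (y - x) $ i) = (LINT w|lborel. G w * f w)"
      proof -
        define S where "S w = (\<Sum>i\<in>UNIV. (R i (x - w) * f w) * (y - x) $ i)" for w
        have 1: "(\<Sum>i\<in>UNIV. conv (R i) f x * (y - x) $ i) = (LINT w|lborel. S w)"
          unfolding conv_def S_def by (subst Bochner_Integration.integral_sum) (use iR in auto)
        have 2: "integrable lborel S" unfolding S_def using iR by auto
        have "G w * f w = r (y - w) * f w - r (x - w) * f w - S w" for w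
          unfolding G_def S_def left_diff_distrib sum_distrib_right by (simp add: ac_simps)
        then show ?thesis unfolding 1 unfolding conv_def using ir 2 by simp
      qed
      also have "norm \<dots> \<le> (LINT w|lborel. norm (G w * f w))" by (rule integral_norm_bound)
      also have "\<dots> \<le> (LINT w|lborel. e / (A + 1) * norm (y - x) * \<bar>f w\<bar>)"
      proof (intro integral_mono integrable_norm iG integrable_mult_right integrable_abs f)
        show "norm (G w * f w) \<le> e / (A + 1) * norm (y - x) * \<bar>f w\<bar>" for w
          unfolding real_norm_def abs_mult by (intro mult_right_mono G abs_ge_zero)
      qed
      also have "\<dots> = e / (A + 1) * norm (y - x) * A" unfolding A_def by simp
      also have "\<dots> = (A / (A + 1)) * (e * norm (y - x))" by simp
      also have "\<dots> \<le> 1 * (e * norm (y - x))" using A e by (intro mult_right_mono) auto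
      finally show ?thesis by simp
    qed
    then show "\<exists>d>0. \<forall>y. norm (y - x) < d \<longrightarrow> norm (conv r f y - conv r f x - (\<Sum>i\<in>UNIV. conv (R i) f x * (y - x) $ i)) \<le> e * norm (y - x)"
      using d(1) by blast
  qed
qed

text \<open>Every derivative falls on the kernel, which stays bumpy with the same support. The
  coinduction invariant therefore speaks of functions equal to the convolution of \<open>f\<close>
  with some such kernel.\<close>

lemma conv_smooth_fn:
  assumes "bumpy r" "\<And>x. norm x > \<rho> \<Longrightarrow> r x = 0" "integrable lborel f"
  shows "smooth_fn (conv r f)"
proof -
  have "\<exists>r'. conv r f = conv r' f \<and> bumpy r' \<and> (\<forall>x. norm x > \<rho> \<longrightarrow> r' x = 0)" using assms by blast
  then show ?thesis
  proof (coinduction arbitrary: r rule: smooth_fn.coinduct)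
    case smooth_fn
    then obtain r' where r': "conv r f = conv r' f" "bumpy r'" "\<forall>x. norm x > \<rho> \<longrightarrow> r' x = 0" by blast
    from bumpy_jet[OF r'(2)] obtain R where R: "has_grad r' R" "\<forall>i. bumpy (R i)" by blast
    have "R i x = 0" if "norm x > \<rho>" for i x
      using has_grad_zero_outside[OF R(1), of \<rho> 0 x i] r'(3) that by simp
    moreover have "has_grad (conv r' f) (\<lambda>i. conv (R i) f)"
      by (rule conv_has_grad[OF R(1) _ _ assms(3)]) (use R r'(3) bumpy_continuous in auto)
    ultimately show ?case unfolding r'(1) using R(2) by blast
  qed
qed

text \<open>Gradients are unique, so the given \<open>R\<close> and \<open>RR\<close> must be the
  bumpy ones with symmetric Hessian.\<close>

lemma conv_jet:
  assumes "bumpy r" "\<And>x. norm x > \<rho> \<Longrightarrow> r x = 0" "integrable lborel f" "has_grad r R" "\<And>i. has_grad (R i) (RR i)"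
  shows "jet (conv r f) (\<lambda>i. conv (R i) f) (\<lambda>i j. conv (RR i j) f)"
proof -
  from bumpy_jet[OF assms(1)] obtain S SS where S: "has_grad r S" "\<forall>i. bumpy (S i)" "\<forall>i. has_grad (S i) (SS i)"
    "\<forall>i j. bumpy (SS i j)" "\<forall>i j x. SS i j x = SS j i x" by blast
  have RS: "R = S" using has_grad_unique[OF assms(4) S(1)] by blast
  have RR: "RR = SS" using has_grad_unique[OF assms(5)] S(3) unfolding RS by blast
  have z: "S i x = 0" if "norm x > \<rho>" for i x
    using has_grad_zero_outside[OF S(1), of \<rho> 0 x i] assms(2) that by simp
  have zz: "SS i j x = 0" if "norm x > \<rho>" for i j x
    using has_grad_zero_outside[OF S(3)[rule_format, of i], where ctr=0 and r=\<rho> and x=x] z that by simp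
  have g2: "has_grad (conv (S i) f) (\<lambda>j. conv (SS i j) f)" for i
    by (rule conv_has_grad[OF _ _ z assms(3)]) (use S in \<open>auto intro: bumpy_continuous\<close>)
  have "smooth_fn (conv (SS i j) f)" for i j by (rule conv_smooth_fn[OF _ zz assms(3)]) (use S in auto)
  then have "continuous_on UNIV (conv (SS i j) f)" for i j
    by (rule smooth_fn_continuous)
  moreover have "conv (SS i j) f = conv (SS j i) f" for i j
    using S(5) by (simp add: conv_def fun_eq_iff)
  moreover have "has_grad (conv r f) (\<lambda>i. conv (S i) f)"
    by (rule conv_has_grad[OF S(1) _ assms(2,3)]) (use S in \<open>auto intro: bumpy_continuous\<close>)
  ultimately show ?thesis unfolding jet_def RS RR using g2 by metis
qed

lemma AE_zero_open_empty:
  assumes "AE x in lborel. x \<notin> S" "open S" shows "S = {}"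
proof -
  have "negligible S"
    using assms by (auto simp: negligible_iff_null_sets AE_iff_null_sets[symmetric] eventually_mono
        intro!: null_sets_completionI dest: AE_iff_null_sets[THEN iffD2, rotated])
  then show ?thesis using open_not_negligible[OF assms(2)] by blast
qed

text \<open>A product over the coordinates of even flat bumps, supported in a cube. It is positive
  at the origin and continuous, so its integral is nonzero and can be normalised.\<close>

lemma mollifier_exists:
  fixes \<epsilon> :: real assumes "\<epsilon> > 0"
  shows "\<exists>r :: real ^ 'n::finite \<Rightarrow> real. bumpy r \<and> (\<forall>x. r x \<ge> 0) \<and> (\<forall>x. norm x > \<epsilon> \<longrightarrow> r x = 0)
    \<and> (\<forall>x. r (- x) = r x) \<and> (LINT x|lborel. r x) = 1"
proof -
  \<comment> \<open>The cube has half-width \<open>1 / m\<close>, that is \<open>\<epsilon>\<close>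
    over the dimension; it lies in the ball of radius \<open>\<epsilon>\<close> because the
    Euclidean norm is at most the sum of the absolute coordinates.\<close>
  define m where "m = real CARD('n) / \<epsilon>"
  have m: "m > 0" unfolding m_def using assms by simp
  define p where "p x = (\<Prod>i\<in>UNIV. flat 0 ((- m) * x $ i + 1) * flat 0 (m * x $ i + 1))" for x :: "real ^ 'n"
  have bp: "bumpy p" unfolding p_def[abs_def] by (intro bumpy_prod bumpy.intros)
  have p0: "p x \<ge> 0" for x unfolding p_def by (intro prod_nonneg mult_nonneg_nonneg flat_nonneg ballI)
  have pe: "p (- x) = p x" for x unfolding p_def by (intro prod.cong refl) (simp add: mult.commute)
  have pz: "p x = 0" if "norm x > \<epsilon>" for x
  proof -
    have "\<exists>i. \<bar>x $ i\<bar> \<ge> 1 / m"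
    proof (rule ccontr)
      assume "\<not> ?thesis"
      then have "\<bar>x $ i\<bar> \<le> 1 / m" for i by (metis linear)
      then have "(\<Sum>i\<in>UNIV. \<bar>x $ i\<bar>) \<le> (\<Sum>i\<in>(UNIV::'n set). 1 / m)" by (intro sum_mono)
      also have "\<dots> = \<epsilon>" unfolding m_def using assms by simp
      finally show False using that norm_le_l1_cart[of x] by simp
    qed
    then obtain i where "\<bar>x $ i\<bar> \<ge> 1 / m" by blast
    then have "m * \<bar>x $ i\<bar> \<ge> 1" using m by (simp add: field_simps)
    then have "(- m) * x $ i + 1 \<le> 0 \<or> m * x $ i + 1 \<le> 0" by (auto simp: abs_if split: if_splits)
    then have "flat 0 ((- m) * x $ i + 1) * flat 0 (m * x $ i + 1) = 0" by (auto simp: flat_def)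
    then show ?thesis unfolding p_def by (intro prod_zero) auto
  qed
  have cp: "continuous_on UNIV p" by (rule bumpy_continuous[OF bp])
  have ip: "integrable lborel p"
    by (rule integrable_compact_supp[where ctr=0 and r=\<epsilon>]) (use cp pz in auto)
  define I where "I = (LINT x|lborel. p x)"
  have "I \<noteq> 0"
  proof
    assume "I = 0"
    then have "AE x in lborel. p x = 0" unfolding I_def
      using integral_nonneg_eq_0_iff_AE[OF ip] p0 by simp
    then have "AE x in lborel. x \<notin> {x. 0 < p x}" by auto
    moreover have "open {x. 0 < p x}" by (intro open_Collect_less continuous_intros cp)
    ultimately have "{x. 0 < p x} = {}" by (rule AE_zero_open_empty)
    moreover have "p 0 > 0" unfolding p_def by (intro prod_pos) (simp add: flat_def)
    ultimately show False by blast
  qed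
  show ?thesis
  proof (intro exI[of _ "\<lambda>x. inverse I * p x"] conjI allI impI)
    show "bumpy (\<lambda>x. inverse I * p x)" by (intro bumpy.intros bp)
    have "I \<ge> 0" unfolding I_def using p0 by simp
    then show "inverse I * p x \<ge> 0" for x using p0 by simp
    show "(LINT x|lborel. inverse I * p x) = 1" using \<open>I \<noteq> 0\<close> unfolding I_def by simp
  qed (use pz pe in auto)
qed

section \<open>Continuity of translations in L1 and L2\<close>

definition translation_cont :: "('a::euclidean_space \<Rightarrow> real) \<Rightarrow> bool" where
  "translation_cont f \<longleftrightarrow> (\<forall>Z. Z \<longlonglongrightarrow> 0 \<longrightarrow> (\<lambda>n. LINT x|lborel. \<bar>f (x + Z n) - f x\<bar>) \<longlonglongrightarrow> 0)"

lemma integrable_translate: "integrable lborel f \<Longrightarrow> integrable lborel (\<lambda>x. f (x + a))"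
  for f :: "'a::euclidean_space \<Rightarrow> 'b::euclidean_space"
  by (simp add: lborel_integral_translate(2))

text \<open>The approximation error enters twice, for \<open>f\<close> and for its translate, and is
  the same both times by translation invariance.\<close>

lemma translation_cont_approx:
  assumes f: "integrable lborel f"
    and ex: "\<And>e. e > 0 \<Longrightarrow> \<exists>g. integrable lborel g \<and> translation_cont g \<and> (LINT x|lborel. \<bar>f x - g x\<bar>) \<le> e"
  shows "translation_cont f"
  unfolding translation_cont_def
proof (intro allI impI LIMSEQ_I)
  fix Z :: "nat \<Rightarrow> 'a" and e :: real assume Z: "Z \<longlonglongrightarrow> 0" and e: "e > 0"
  then have "e / 4 > 0" by simp
  from ex[OF this] obtain g where g: "integrable lborel g" "translation_cont g" "(LINT x|lborel. \<bar>f x - g x\<bar>) \<le> e / 4" by blast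
  from g(2) Z have "(\<lambda>n. LINT x|lborel. \<bar>g (x + Z n) - g x\<bar>) \<longlonglongrightarrow> 0" unfolding translation_cont_def by blast
  then obtain n0 where n0: "\<And>n. n \<ge> n0 \<Longrightarrow> (LINT x|lborel. \<bar>g (x + Z n) - g x\<bar>) < e / 4"
    using \<open>e / 4 > 0\<close> LIMSEQ_D[of _ 0 "e / 4"] by fastforce
  have "norm ((LINT x|lborel. \<bar>f (x + Z n) - f x\<bar>) - 0) < e" if "n \<ge> n0" for n
  proof -
    note i = f g(1) integrable_translate[OF f, of "Z n"] integrable_translate[OF g(1), of "Z n"]
    have fg: "integrable lborel (\<lambda>x. \<bar>f x - g x\<bar>)" using i by auto
    have fg': "integrable lborel (\<lambda>x. \<bar>f (x + Z n) - g (x + Z n)\<bar>)" using i by auto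
    have "(LINT x|lborel. \<bar>f (x + Z n) - f x\<bar>)
      \<le> (LINT x|lborel. \<bar>f (x + Z n) - g (x + Z n)\<bar> + \<bar>g (x + Z n) - g x\<bar> + \<bar>f x - g x\<bar>)"
      by (rule integral_mono) (use i fg fg' in auto)
    also have "\<dots> = (LINT x|lborel. \<bar>f (x + Z n) - g (x + Z n)\<bar>) + (LINT x|lborel. \<bar>g (x + Z n) - g x\<bar>) + (LINT x|lborel. \<bar>f x - g x\<bar>)"
      using i fg fg' by simp
    also have "(LINT x|lborel. \<bar>f (x + Z n) - g (x + Z n)\<bar>) = (LINT x|lborel. \<bar>f x - g x\<bar>)"
      by (rule lborel_integral_translate(1))
    finally have "(LINT x|lborel. \<bar>f (x + Z n) - f x\<bar>) < e" using g(3) n0[OF that] e by linarith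
    moreover have "0 \<le> (LINT x|lborel. \<bar>f (x + Z n) - f x\<bar>)" by simp
    ultimately show ?thesis by simp
  qed
  then show "\<exists>n0. \<forall>n\<ge>n0. norm ((LINT x|lborel. \<bar>f (x + Z n) - f x\<bar>) - 0) < e" by blast
qed

text \<open>The L1 distance between the indicator and its translate is twice the measure of
  \<open>U\<close> minus twice the measure of the overlap. Since \<open>U\<close> is open, the
  overlap converges pointwise on \<open>U\<close>, and dominated convergence applies.\<close>

lemma translation_cont_open:
  fixes U :: "'a::euclidean_space set"
  assumes U: "open U" "emeasure lborel U < \<infinity>"
  shows "translation_cont (\<lambda>x. indicator U x * c)"
  unfolding translation_cont_def
proof (intro allI impI)
  fix Z :: "nat \<Rightarrow> 'a" assume Z: "Z \<longlonglongrightarrow> 0"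
  let ?I = "indicator U :: 'a \<Rightarrow> real"
  have iU: "integrable lborel ?I" using U by (simp add: integrable_indicator_iff)
  have [measurable]: "U \<in> sets borel" using U by simp
  have "(\<lambda>n. LINT x|lborel. ?I x * ?I (x + Z n)) \<longlonglongrightarrow> (LINT x|lborel. ?I x)"
  proof (rule integral_dominated_convergence[where w="?I"])
    show "AE x in lborel. (\<lambda>n. ?I x * ?I (x + Z n)) \<longlonglongrightarrow> ?I x"
    proof (rule AE_I2)
      fix x
      show "(\<lambda>n. ?I x * ?I (x + Z n)) \<longlonglongrightarrow> ?I x"
      proof (cases "x \<in> U")
        case True
        have "(\<lambda>n. x + Z n) \<longlonglongrightarrow> x + 0" by (intro tendsto_intros Z)
        then have "eventually (\<lambda>n. x + Z n \<in> U) sequentially"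
          using topological_tendstoD[OF _ U(1)] True by fastforce
        then have "eventually (\<lambda>n. ?I x * ?I (x + Z n) = ?I x) sequentially"
          by eventually_elim (use True in simp)
        then show ?thesis by (rule tendsto_eventually)
      qed simp
    qed
    show "integrable lborel ?I" by fact
    show "(\<lambda>x. ?I x * ?I (x + Z n)) \<in> borel_measurable lborel" for n by measurable
    show "?I \<in> borel_measurable lborel" by measurable
    show "AE x in lborel. norm (?I x * ?I (x + Z n)) \<le> ?I x" for n
      by (auto simp: indicator_def)
  qed
  then have "(\<lambda>n. 2 * (LINT x|lborel. ?I x) - 2 * (LINT x|lborel. ?I x * ?I (x + Z n))) \<longlonglongrightarrow>
     2 * (LINT x|lborel. ?I x) - 2 * (LINT x|lborel. ?I x)"
    by (intro tendsto_intros)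
  moreover have "2 * (LINT x|lborel. ?I x) - 2 * (LINT x|lborel. ?I x * ?I (x + Z n)) = (LINT x|lborel. \<bar>?I (x + Z n) - ?I x\<bar>)" for n
  proof -
    have eq: "\<bar>?I (x + Z n) - ?I x\<bar> = ?I (x + Z n) + ?I x - 2 * (?I x * ?I (x + Z n))" for x
      by (auto simp: indicator_def)
    have i2: "integrable lborel (\<lambda>x. ?I x * ?I (x + Z n))"
      by (rule Bochner_Integration.integrable_bound[OF iU]) (auto simp: indicator_def)
    show ?thesis unfolding eq
      using iU integrable_translate[OF iU, of "Z n"] i2 lborel_integral_translate(1)[of ?I "Z n"] by simp
  qed
  ultimately have "(\<lambda>n. LINT x|lborel. \<bar>?I (x + Z n) - ?I x\<bar>) \<longlonglongrightarrow> 0" by simp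
  then have "(\<lambda>n. \<bar>c\<bar> * (LINT x|lborel. \<bar>?I (x + Z n) - ?I x\<bar>)) \<longlonglongrightarrow> \<bar>c\<bar> * 0" by (intro tendsto_intros)
  moreover have "\<bar>c\<bar> * (LINT x|lborel. \<bar>?I (x + Z n) - ?I x\<bar>) = (LINT x|lborel. \<bar>?I (x + Z n) * c - ?I x * c\<bar>)" for n
  proof -
    have "\<bar>?I (x + Z n) * c - ?I x * c\<bar> = \<bar>c\<bar> * \<bar>?I (x + Z n) - ?I x\<bar>" for x
      unfolding left_diff_distrib[symmetric] abs_mult by (rule mult.commute)
    then show ?thesis by simp
  qed
  ultimately show "(\<lambda>n. LINT x|lborel. \<bar>?I (x + Z n) * c - ?I x * c\<bar>) \<longlonglongrightarrow> 0" by simp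
qed

text \<open>Induction over integrable functions: outer regularity reduces Borel sets to open ones,
  and in the limit case the simple functions satisfy \<open>|s i| \<le> 2 * |f|\<close>, which
  explains the majorant \<open>3 * |f|\<close>.\<close>

lemma translation_cont_integrable:
  fixes f :: "'a::euclidean_space \<Rightarrow> real"
  assumes "integrable lborel f" shows "translation_cont f"
  using assms
proof (induction rule: integrable_induct)
  case (base A c)
  have A: "A \<in> sets borel" using base by simp
  have iA: "integrable lborel (\<lambda>x. indicator A x *\<^sub>R c)" using base by (auto simp: integrable_indicator_iff)
  show ?case
  proof (rule translation_cont_approx[OF iA])
    fix e :: real assume e: "e > 0"
    define e' where "e' = e / (\<bar>c\<bar> + 1)"
    have e': "e' > 0" unfolding e'_def using e by (simp add: add_nonneg_pos)
    obtain U where U: "open U" "A \<subseteq> U" "emeasure lborel (U - A) < e'"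
      using outer_regular_lborel[OF A e'] by blast
    have "emeasure lborel U = emeasure lborel A + emeasure lborel (U - A)"
      using U A by (metis Diff_partition Diff_disjoint borel_open plus_emeasure sets.Diff sets_lborel)
    moreover have "emeasure lborel (U - A) < \<infinity>" using U(3) by (rule order.strict_trans) simp
    ultimately have fin: "emeasure lborel U < \<infinity>" using base(2) by simp
    have iU: "integrable lborel (\<lambda>x. indicator U x * c)" using fin U(1) by (auto simp: integrable_indicator_iff)
    have mU: "measure lborel (U - A) \<le> e'"
      using U(3) e' by (simp add: measure_def enn2real_leI)
    have "(LINT x|lborel. \<bar>indicator A x *\<^sub>R c - indicator U x * c\<bar>) = (LINT x|lborel. indicator (U - A) x * \<bar>c\<bar>)"
      using U(2) by (intro Bochner_Integration.integral_cong refl) (auto simp: indicator_def)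
    also have "\<dots> = measure lborel (U - A) * \<bar>c\<bar>" by simp
    also have "\<dots> \<le> e' * \<bar>c\<bar>" using mU by (intro mult_right_mono) auto
    also have "\<dots> = e * (\<bar>c\<bar> / (\<bar>c\<bar> + 1))" unfolding e'_def by simp
    also have "\<dots> \<le> e * 1" using e by (intro mult_left_mono) auto
    finally show "\<exists>g. integrable lborel g \<and> translation_cont g \<and> (LINT x|lborel. \<bar>indicator A x *\<^sub>R c - g x\<bar>) \<le> e"
      using iU translation_cont_open[OF U(1) fin, of c] by auto
  qed
next
  case (add f g)
  show ?case unfolding translation_cont_def
  proof (intro allI impI)
    fix Z :: "nat \<Rightarrow> 'a" assume Z: "Z \<longlonglongrightarrow> 0"
    have "(\<lambda>n. (LINT x|lborel. \<bar>f (x + Z n) - f x\<bar>) + (LINT x|lborel. \<bar>g (x + Z n) - g x\<bar>)) \<longlonglongrightarrow> 0 + 0"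
      using add Z unfolding translation_cont_def by (intro tendsto_add) blast+
    then have l: "(\<lambda>n. (LINT x|lborel. \<bar>f (x + Z n) - f x\<bar>) + (LINT x|lborel. \<bar>g (x + Z n) - g x\<bar>)) \<longlonglongrightarrow> 0" by simp
    show "(\<lambda>n. LINT x|lborel. \<bar>(f (x + Z n) + g (x + Z n)) - (f x + g x)\<bar>) \<longlonglongrightarrow> 0"
    proof (rule Lim_null_comparison[OF always_eventually l], intro allI)
      fix n
      note i = add.hyps integrable_translate[OF add.hyps(1), of "Z n"] integrable_translate[OF add.hyps(2), of "Z n"]
      have "(LINT x|lborel. \<bar>(f (x + Z n) + g (x + Z n)) - (f x + g x)\<bar>) \<le> (LINT x|lborel. \<bar>f (x + Z n) - f x\<bar> + \<bar>g (x + Z n) - g x\<bar>)"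
        by (rule integral_mono) (use i in auto)
      also have "\<dots> = (LINT x|lborel. \<bar>f (x + Z n) - f x\<bar>) + (LINT x|lborel. \<bar>g (x + Z n) - g x\<bar>)" using i by simp
      finally show "norm (LINT x|lborel. \<bar>(f (x + Z n) + g (x + Z n)) - (f x + g x)\<bar>)
        \<le> (LINT x|lborel. \<bar>f (x + Z n) - f x\<bar>) + (LINT x|lborel. \<bar>g (x + Z n) - g x\<bar>)" by simp
    qed
  qed
next
  case (lim f s)
  show ?case
  proof (rule translation_cont_approx[OF lim.hyps(4)])
    fix e :: real assume e: "e > 0"
    have "(\<lambda>i. LINT x|lborel. \<bar>f x - s i x\<bar>) \<longlonglongrightarrow> (LINT x|(lborel :: 'a measure). 0)"
    proof (rule integral_dominated_convergence[where w="\<lambda>x. 3 * \<bar>f x\<bar>"])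
      show "AE x in lborel. (\<lambda>i. \<bar>f x - s i x\<bar>) \<longlonglongrightarrow> 0"
      proof (rule AE_I2)
        fix x
        have "(\<lambda>i. s i x) \<longlonglongrightarrow> f x" using lim.hyps(2) by simp
        then have "(\<lambda>i. \<bar>f x - s i x\<bar>) \<longlonglongrightarrow> \<bar>f x - f x\<bar>" by (intro tendsto_intros)
        then show "(\<lambda>i. \<bar>f x - s i x\<bar>) \<longlonglongrightarrow> 0" by simp
      qed
      show "AE x in lborel. norm \<bar>f x - s i x\<bar> \<le> 3 * \<bar>f x\<bar>" for i
      proof (rule AE_I2)
        fix x
        have "\<bar>s i x\<bar> \<le> 2 * \<bar>f x\<bar>" using lim.hyps(3)[of x i] by simp
        then show "norm \<bar>f x - s i x\<bar> \<le> 3 * \<bar>f x\<bar>" by simp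
      qed
    qed (use lim in auto)
    then have "(\<lambda>i. LINT x|lborel. \<bar>f x - s i x\<bar>) \<longlonglongrightarrow> 0" by simp
    from LIMSEQ_D[OF this e] obtain i where "(LINT x|lborel. \<bar>f x - s i x\<bar>) < e" by fastforce
    then show "\<exists>g. integrable lborel g \<and> translation_cont g \<and> (LINT x|lborel. \<bar>f x - g x\<bar>) \<le> e"
      using lim.hyps(1) lim.IH by (intro exI[of _ "s i"]) auto
  qed
qed

lemma sequential_eps_delta:
  fixes T :: "'a::euclidean_space \<Rightarrow> real"
  assumes "\<And>Z. Z \<longlonglongrightarrow> 0 \<Longrightarrow> (\<lambda>n. T (Z n)) \<longlonglongrightarrow> 0" "e > 0"
  obtains d where "d > 0" "\<And>z. norm z < d \<Longrightarrow> \<bar>T z\<bar> < e"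
proof -
  have "T 0 = 0" using assms(1)[of "\<lambda>n. 0"] by (simp add: LIMSEQ_const_iff)
  then have "isCont T 0" unfolding continuous_at_sequentially comp_def using assms(1) by simp
  then show ?thesis using that assms(2) \<open>T 0 = 0\<close> unfolding continuous_at_eps_delta dist_norm by force
qed

lemma translation_L1:
  fixes f :: "'a::euclidean_space \<Rightarrow> real"
  assumes f: "integrable lborel f" and e: "e > 0"
  obtains d where "d > 0" "\<And>z. norm z < d \<Longrightarrow> (LINT x|lborel. \<bar>f (x + z) - f x\<bar>) < e"
proof -
  have "(\<lambda>n. LINT x|lborel. \<bar>f (x + Z n) - f x\<bar>) \<longlonglongrightarrow> 0" if "Z \<longlonglongrightarrow> 0" for Z
    using translation_cont_integrable[OF f] that unfolding translation_cont_def by blast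
  from sequential_eps_delta[of "\<lambda>z. LINT x|lborel. \<bar>f (x + z) - f x\<bar>", OF this e] that
  show ?thesis by (metis abs_less_iff)
qed

text \<open>The signed square sends square integrable functions to integrable ones. Through this
  inequality translation continuity in L1, applied to the signed square of a function, yields it in
  L2 for the function itself.\<close>

lemma square_diff_le: "(a - b)\<^sup>2 \<le> 2 * \<bar>a * \<bar>a\<bar> - b * \<bar>b\<bar>\<bar>" for a b :: real
proof -
  have same: "(a - b)\<^sup>2 \<le> 2 * \<bar>a * a - b * b\<bar>" if "a \<ge> 0" "b \<ge> 0" for a b :: real
  proof -
    have "(a - b)\<^sup>2 = \<bar>a - b\<bar> * \<bar>a - b\<bar>" by (simp add: power2_eq_square)
    also have "\<dots> \<le> \<bar>a - b\<bar> * (a + b)" using that by (intro mult_left_mono) auto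
    also have "\<dots> = \<bar>a * a - b * b\<bar>" using that by (simp add: square_diff_square_factored abs_mult mult.commute)
    also have "\<dots> \<le> 2 * \<bar>a * a - b * b\<bar>" by simp
    finally show ?thesis .
  qed
  have opp: "(a - b)\<^sup>2 \<le> 2 * \<bar>a * a + b * b\<bar>" for a b :: real
    using sum_squares_bound[of a "- b"] by (simp add: power2_eq_square algebra_simps)
  consider "a \<ge> 0" "b \<ge> 0" | "a < 0" "b < 0" | "a \<ge> 0" "b < 0" | "a < 0" "b \<ge> 0" by linarith
  then show ?thesis
  proof cases
    case 2
    have "(- a - - b)\<^sup>2 = (a - b)\<^sup>2" by (simp add: power2_commute)
    moreover have "\<bar>a * \<bar>a\<bar> - b * \<bar>b\<bar>\<bar> = \<bar>- a * - a - - b * - b\<bar>"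
      using 2 by (simp add: abs_minus_commute)
    ultimately show ?thesis using same[of "- a" "- b"] 2 by simp
  next
    case 4
    have "\<bar>a * \<bar>a\<bar> - b * \<bar>b\<bar>\<bar> = \<bar>- (a * a + b * b)\<bar>" using 4 by simp
    then show ?thesis using opp[of a b] unfolding abs_minus_cancel by simp
  qed (use same[of a b] opp[of a b] in simp_all)
qed

lemma translation_L2:
  fixes f :: "'a::euclidean_space \<Rightarrow> real"
  assumes f: "f \<in> borel_measurable borel" "integrable lborel (\<lambda>x. (f x)\<^sup>2)" and e: "e > 0"
  obtains d where "d > 0" "\<And>z. norm z < d \<Longrightarrow> integrable lborel (\<lambda>x. (f (x + z) - f x)\<^sup>2) \<and> (LINT x|lborel. (f (x + z) - f x)\<^sup>2) < e"
proof -
  define F where "F x = f x * \<bar>f x\<bar>" for x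
  have [measurable]: "f \<in> borel_measurable borel" by fact
  have F: "integrable lborel F"
    by (rule Bochner_Integration.integrable_bound[OF f(2)]) (auto simp: F_def[abs_def] abs_mult power2_eq_square)
  from translation_L1[OF F, of "e / 2"] e obtain d where d: "d > 0" "\<And>z. norm z < d \<Longrightarrow> (LINT x|lborel. \<bar>F (x + z) - F x\<bar>) < e / 2" by auto
  show ?thesis
  proof (rule that[OF d(1)])
    fix z :: 'a assume z: "norm z < d"
    have i: "integrable lborel (\<lambda>x. 2 * \<bar>F (x + z) - F x\<bar>)" using F integrable_translate[OF F, of z] by auto
    have le: "(f (x + z) - f x)\<^sup>2 \<le> 2 * \<bar>F (x + z) - F x\<bar>" for x unfolding F_def by (rule square_diff_le)
    have i2: "integrable lborel (\<lambda>x. (f (x + z) - f x)\<^sup>2)"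
      by (rule Bochner_Integration.integrable_bound[OF i]) (use le in auto)
    moreover have "(LINT x|lborel. (f (x + z) - f x)\<^sup>2) \<le> (LINT x|lborel. 2 * \<bar>F (x + z) - F x\<bar>)"
      by (rule integral_mono[OF i2 i le])
    ultimately show "integrable lborel (\<lambda>x. (f (x + z) - f x)\<^sup>2) \<and> (LINT x|lborel. (f (x + z) - f x)\<^sup>2) < e"
      using d(2)[OF z] by simp
  qed
qed

section \<open>Approximation by mollifiers\<close>

definition mollifier :: "real \<Rightarrow> (real ^ 'n::finite \<Rightarrow> real) \<Rightarrow> bool" where
  "mollifier \<epsilon> r \<longleftrightarrow> bumpy r \<and> (\<forall>x. r x \<ge> 0) \<and> (\<forall>x. norm x > \<epsilon> \<longrightarrow> r x = 0)
    \<and> (\<forall>x. r (- x) = r x) \<and> (LINT x|lborel. r x) = 1"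

lemma mollifierD:
  assumes "mollifier \<epsilon> r"
  shows "bumpy r" "r x \<ge> 0" "norm x > \<epsilon> \<Longrightarrow> r x = 0" "r (- x) = r x" "(LINT x|lborel. r x) = 1"
    "continuous_on S r" "integrable lborel r" "r \<in> borel_measurable borel"
proof -
  show a: "bumpy r" "r x \<ge> 0" "norm x > \<epsilon> \<Longrightarrow> r x = 0" "r (- x) = r x" "(LINT x|lborel. r x) = 1" for x
    using assms unfolding mollifier_def by auto
  show c: "continuous_on S r" for S using a(1) by (rule bumpy_continuous)
  \<comment> \<open>A function that is not integrable has integral 0 by convention, so the value 1
    implies integrability.\<close>
  show "integrable lborel r" using a(5) not_integrable_integral_eq by fastforce
  show "r \<in> borel_measurable borel" by (rule borel_measurable_continuous_onI[OF c])
qed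

lemma mollifier_times_integrable:
  assumes "mollifier \<epsilon> r" "integrable lborel g"
  shows "integrable lborel (\<lambda>z. r z * g z)"
proof -
  have "\<And>x. norm x > \<epsilon> \<Longrightarrow> r x = 0" using mollifierD(3)[OF assms(1)] .
  from compact_supp_bounded[OF mollifierD(6)[OF assms(1)] this] obtain M where "\<And>x. \<bar>r x\<bar> \<le> M" by blast
  then show ?thesis by (intro integrable_bounded_mult assms mollifierD(8)[OF assms(1)])
qed

text \<open>Evenness of the kernel turns the convolution into an average of the values
  \<open>f (x + z)\<close>, the form in which mollification errors are averages of translation
  errors.\<close>

lemma conv_shift:
  assumes r: "mollifier \<epsilon> r"
  shows "conv r f x = (LINT z|lborel. r z * f (x + z))"
proof -
  have "conv r f x = (LINT z|lborel. r (x - (z + x)) * f (z + x))"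
    unfolding conv_def by (rule lborel_integral_translate(1)[symmetric])
  also have "\<dots> = (LINT z|lborel. r z * f (x + z))" using mollifierD(4)[OF r] by (simp add: add.commute)
  finally show ?thesis .
qed

lemma conv_diff_eq:
  assumes r: "mollifier \<epsilon> r" and f: "integrable lborel f"
  shows "conv r f x - f x = (LINT z|lborel. r z * (f (x + z) - f x))"
proof -
  have "integrable lborel (\<lambda>z. f (x + z))" using integrable_translate[OF f, of x] by (simp add: add.commute)
  from mollifier_times_integrable[OF r this] show ?thesis
    unfolding conv_shift[OF r] right_diff_distrib using mollifierD(5,7)[OF r] by simp
qed

text \<open>\<open>\<Phi>\<close> will be the absolute value or the square. Jensen's inequality,
  supplied as a premise, takes \<open>\<Phi>\<close> under the average, and Tonelli then reduces the
  mollification error to translation errors for shifts within the support of the kernel.\<close>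

lemma conv_close:
  fixes f :: "real ^ 'n::finite \<Rightarrow> real" and \<Phi> :: "real \<Rightarrow> real"
  assumes r: "mollifier \<epsilon> r" and f: "integrable lborel f"
    and P: "\<Phi> \<in> borel_measurable borel" "\<And>t. \<Phi> t \<ge> 0"
    and J: "\<And>x. integrable lborel (\<lambda>z. r z * \<Phi> (f (x + z) - f x))"
      "\<And>x. \<Phi> (conv r f x - f x) \<le> (LINT z|lborel. r z * \<Phi> (f (x + z) - f x))"
    and T: "\<And>z. norm z \<le> \<epsilon> \<Longrightarrow> (\<integral>\<^sup>+x. ennreal (\<Phi> (f (x + z) - f x)) \<partial>lborel) \<le> ennreal e"
  shows "(\<integral>\<^sup>+x. ennreal (\<Phi> (conv r f x - f x)) \<partial>lborel) \<le> ennreal e"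
proof -
  have [measurable]: "f \<in> borel_measurable borel" using f by auto
  note [measurable] = P(1) mollifierD(8)[OF r]
  have "(\<integral>\<^sup>+x. ennreal (\<Phi> (conv r f x - f x)) \<partial>lborel) \<le> (\<integral>\<^sup>+x. ennreal (LINT z|lborel. r z * \<Phi> (f (x + z) - f x)) \<partial>lborel)"
    using J(2) by (intro nn_integral_mono ennreal_leI)
  also have "\<dots> = (\<integral>\<^sup>+x. \<integral>\<^sup>+z. ennreal (r z * \<Phi> (f (x + z) - f x)) \<partial>lborel \<partial>lborel)"
    using J(1) P(2) mollifierD(2)[OF r] by (intro nn_integral_cong) (simp add: nn_integral_eq_integral)
  also have "\<dots> = (\<integral>\<^sup>+z. \<integral>\<^sup>+x. ennreal (r z * \<Phi> (f (x + z) - f x)) \<partial>lborel \<partial>lborel)"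
    by (rule lborel_pair.Fubini'[symmetric]) measurable
  also have "\<dots> \<le> (\<integral>\<^sup>+z. ennreal e * ennreal (r z) \<partial>lborel)"
  proof (rule nn_integral_mono)
    fix z
    have "(\<integral>\<^sup>+x. ennreal (r z * \<Phi> (f (x + z) - f x)) \<partial>lborel) = ennreal (r z) * (\<integral>\<^sup>+x. ennreal (\<Phi> (f (x + z) - f x)) \<partial>lborel)"
      using mollifierD(2)[OF r] P(2) by (simp add: ennreal_mult nn_integral_cmult)
    also have "\<dots> \<le> ennreal e * ennreal (r z)"
    proof (cases "norm z \<le> \<epsilon>")
      case True
      then show ?thesis using T[OF True] by (subst mult.commute) (rule mult_right_mono, auto)
    next
      case False
      then show ?thesis using mollifierD(3)[OF r] by simp
    qed
    finally show "(\<integral>\<^sup>+x. ennreal (r z * \<Phi> (f (x + z) - f x)) \<partial>lborel) \<le> ennreal e * ennreal (r z)" .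
  qed
  also have "\<dots> = ennreal e * (\<integral>\<^sup>+z. ennreal (r z) \<partial>lborel)" by (simp add: nn_integral_cmult)
  also have "(\<integral>\<^sup>+z. ennreal (r z) \<partial>lborel) = 1"
    using nn_integral_eq_integral[OF mollifierD(7)[OF r]] mollifierD(2,5)[OF r] by simp
  finally show ?thesis by simp
qed

lemma conv_measurable:
  assumes "mollifier \<epsilon> r" "integrable lborel f" shows "conv r f \<in> borel_measurable borel"
  using conv_smooth_fn[OF mollifierD(1)[OF assms(1)] mollifierD(3)[OF assms(1)] assms(2)]
  by (intro borel_measurable_continuous_onI smooth_fn_continuous)

lemma conv_L1_close:
  fixes f :: "real ^ 'n::finite \<Rightarrow> real"
  assumes f: "integrable lborel f" and e: "e > 0"
  obtains d where "d > 0" "\<And>r \<epsilon>. mollifier \<epsilon> r \<Longrightarrow> \<epsilon> < d \<Longrightarrow> integrable lborel (\<lambda>x. \<bar>conv r f x - f x\<bar>) \<and> (LINT x|lborel. \<bar>conv r f x - f x\<bar>) \<le> e"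
proof -
  from translation_L1[OF f e] obtain d where d: "d > 0" "\<And>z. norm z < d \<Longrightarrow> (LINT x|lborel. \<bar>f (x + z) - f x\<bar>) < e" by blast
  show ?thesis
  proof (rule that[OF d(1)])
    fix r :: "real ^ 'n \<Rightarrow> real" and \<epsilon> :: real assume r: "mollifier \<epsilon> r" and "\<epsilon> < d"
    have i1: "integrable lborel (\<lambda>z. r z * (f (x + z) - f x))" for x
    proof -
      have "integrable lborel (\<lambda>z. f (x + z))" using integrable_translate[OF f, of x] by (simp add: add.commute)
      from mollifier_times_integrable[OF r this] mollifierD(7)[OF r] show ?thesis by (simp add: right_diff_distrib)
    qed
    have eq: "r z * \<bar>f (x + z) - f x\<bar> = \<bar>r z * (f (x + z) - f x)\<bar>" for x z
      using mollifierD(2)[OF r] by (simp add: abs_mult)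
    have "(\<integral>\<^sup>+x. ennreal \<bar>conv r f x - f x\<bar> \<partial>lborel) \<le> ennreal e"
    proof (rule conv_close[OF r f])
      show "integrable lborel (\<lambda>z. r z * \<bar>f (x + z) - f x\<bar>)" for x unfolding eq using i1 by simp
      show "\<bar>conv r f x - f x\<bar> \<le> (LINT z|lborel. r z * \<bar>f (x + z) - f x\<bar>)" for x
        unfolding eq conv_diff_eq[OF r f] by (rule integral_abs_bound)
      fix z :: "real ^ 'n" assume "norm z \<le> \<epsilon>"
      then have z: "norm z < d" using \<open>\<epsilon> < d\<close> by simp
      have "integrable lborel (\<lambda>x. \<bar>f (x + z) - f x\<bar>)" using f integrable_translate[OF f, of z] by auto
      then have "(\<integral>\<^sup>+x. ennreal \<bar>f (x + z) - f x\<bar> \<partial>lborel) = ennreal (LINT x|lborel. \<bar>f (x + z) - f x\<bar>)"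
        by (intro nn_integral_eq_integral) auto
      then show "(\<integral>\<^sup>+x. ennreal \<bar>f (x + z) - f x\<bar> \<partial>lborel) \<le> ennreal e" using d(2)[OF z] by (simp add: ennreal_leI)
    qed auto
    moreover have [measurable]: "conv r f \<in> borel_measurable borel" "f \<in> borel_measurable borel"
      using conv_measurable[OF r f] f by auto
    ultimately have i: "integrable lborel (\<lambda>x. \<bar>conv r f x - f x\<bar>)"
      by (intro integrableI_nonneg) (auto intro: order.strict_trans1)
    moreover have "(LINT x|lborel. \<bar>conv r f x - f x\<bar>) \<le> e"
      using \<open>(\<integral>\<^sup>+x. ennreal \<bar>conv r f x - f x\<bar> \<partial>lborel) \<le> ennreal e\<close> nn_integral_eq_integral[OF i] e
      by (simp add: ennreal_le_iff)
    ultimately show "integrable lborel (\<lambda>x. \<bar>conv r f x - f x\<bar>) \<and> (LINT x|lborel. \<bar>conv r f x - f x\<bar>) \<le> e" by blast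
  qed
qed

lemma conv_L2_close:
  fixes f :: "real ^ 'n::finite \<Rightarrow> real"
  assumes f: "integrable lborel f" "integrable lborel (\<lambda>x. (f x)\<^sup>2)" and e: "e > 0"
  obtains d where "d > 0" "\<And>r \<epsilon>. mollifier \<epsilon> r \<Longrightarrow> \<epsilon> < d \<Longrightarrow> integrable lborel (\<lambda>x. (conv r f x - f x)\<^sup>2) \<and> (LINT x|lborel. (conv r f x - f x)\<^sup>2) \<le> e"
proof -
  have [measurable]: "f \<in> borel_measurable borel" using f by auto
  from translation_L2[OF _ f(2) e] obtain d where d: "d > 0" "\<And>z. norm z < d \<Longrightarrow> integrable lborel (\<lambda>x. (f (x + z) - f x)\<^sup>2) \<and> (LINT x|lborel. (f (x + z) - f x)\<^sup>2) < e" by auto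
  show ?thesis
  proof (rule that[OF d(1)])
    fix r :: "real ^ 'n \<Rightarrow> real" and \<epsilon> :: real assume r: "mollifier \<epsilon> r" and "\<epsilon> < d"
    have tr: "integrable lborel (\<lambda>z. f (x + z))" "integrable lborel (\<lambda>z. (f (x + z))\<^sup>2)" for x
      using integrable_translate[OF f(1), of x] integrable_translate[OF f(2), of x] by (simp_all add: add.commute)
    have i1: "integrable lborel (\<lambda>z. r z * (f (x + z) - f x))" for x
      using mollifier_times_integrable[OF r tr(1)] mollifierD(7)[OF r] by (simp add: right_diff_distrib)
    have i2: "integrable lborel (\<lambda>z. r z * (f (x + z) - f x)\<^sup>2)" for x
    proof -
      have "r z * (f (x + z) - f x)\<^sup>2 = r z * (f (x + z))\<^sup>2 - 2 * f x * (r z * f (x + z)) + (f x)\<^sup>2 * r z" for z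
        by (simp add: power2_diff algebra_simps)
      then show ?thesis using mollifier_times_integrable[OF r tr(1)[of x]] mollifier_times_integrable[OF r tr(2)[of x]] mollifierD(7)[OF r]
        by simp
    qed
    have "(\<integral>\<^sup>+x. ennreal ((conv r f x - f x)\<^sup>2) \<partial>lborel) \<le> ennreal e"
    proof (rule conv_close[OF r f(1)])
      show "integrable lborel (\<lambda>z. r z * (f (x + z) - f x)\<^sup>2)" for x by (rule i2)
      show "(conv r f x - f x)\<^sup>2 \<le> (LINT z|lborel. r z * (f (x + z) - f x)\<^sup>2)" for x
      proof -
        define m where "m = conv r f x - f x"
        \<comment> \<open>Jensen for the square is the nonnegativity of a variance: \<open>m\<close>
          is the mean of \<open>f (x + z) - f x\<close> under the probability density
          \<open>r\<close>.\<close>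
        have "0 \<le> (LINT z|lborel. r z * (f (x + z) - f x - m)\<^sup>2)"
          using mollifierD(2)[OF r] by simp
        also have "\<dots> = (LINT z|lborel. r z * (f (x + z) - f x)\<^sup>2 - 2 * m * (r z * (f (x + z) - f x)) + m\<^sup>2 * r z)"
          by (intro Bochner_Integration.integral_cong refl) (simp add: power2_eq_square algebra_simps)
        also have "\<dots> = (LINT z|lborel. r z * (f (x + z) - f x)\<^sup>2) - 2 * m * (LINT z|lborel. r z * (f (x + z) - f x)) + m\<^sup>2 * (LINT z|lborel. r z)"
          using i1[of x] i2[of x] mollifierD(7)[OF r] by simp
        also have "\<dots> = (LINT z|lborel. r z * (f (x + z) - f x)\<^sup>2) - m\<^sup>2"
          using conv_diff_eq[OF r f(1), of x] mollifierD(5)[OF r] unfolding m_def by (simp add: power2_eq_square)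
        finally show ?thesis unfolding m_def by simp
      qed
      fix z :: "real ^ 'n" assume "norm z \<le> \<epsilon>"
      then have z: "norm z < d" using \<open>\<epsilon> < d\<close> by simp
      then have "(\<integral>\<^sup>+x. ennreal ((f (x + z) - f x)\<^sup>2) \<partial>lborel) = ennreal (LINT x|lborel. (f (x + z) - f x)\<^sup>2)"
        using d(2) by (intro nn_integral_eq_integral) auto
      then show "(\<integral>\<^sup>+x. ennreal ((f (x + z) - f x)\<^sup>2) \<partial>lborel) \<le> ennreal e" using d(2)[OF z] by (simp add: ennreal_leI)
    qed auto
    moreover have [measurable]: "conv r f \<in> borel_measurable borel"
      using conv_measurable[OF r f(1)] .
    ultimately have i: "integrable lborel (\<lambda>x. (conv r f x - f x)\<^sup>2)"
      by (intro integrableI_nonneg) (auto intro: order.strict_trans1)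
    moreover have "(LINT x|lborel. (conv r f x - f x)\<^sup>2) \<le> e"
      using \<open>(\<integral>\<^sup>+x. ennreal ((conv r f x - f x)\<^sup>2) \<partial>lborel) \<le> ennreal e\<close> nn_integral_eq_integral[OF i] e
      by (simp add: ennreal_le_iff)
    ultimately show "integrable lborel (\<lambda>x. (conv r f x - f x)\<^sup>2) \<and> (LINT x|lborel. (conv r f x - f x)\<^sup>2) \<le> e" by blast
  qed
qed

section \<open>Weak derivatives\<close>

lemma compact_nbhd:
  fixes S :: "'a::euclidean_space set"
  assumes "open \<Omega>" "compact S" "S \<subseteq> \<Omega>"
  obtains K e where "compact K" "K \<subseteq> \<Omega>" "e > 0" "\<And>x. x \<in> S \<Longrightarrow> cball x e \<subseteq> K"
proof -
  from open_Union_compact_subsets[OF assms(1)] obtain C where C: "\<And>n. compact (C n)" "\<And>n. C n \<subseteq> \<Omega>"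
    "\<And>n. C n \<subseteq> interior (C (Suc n))" "\<And>K. \<lbrakk>compact K; K \<subseteq> \<Omega>\<rbrakk> \<Longrightarrow> \<exists>N. \<forall>n\<ge>N. K \<subseteq> (C n :: 'a set)" by metis
  from C(4)[OF assms(2,3)] obtain N where "S \<subseteq> C N" by blast
  then have "S \<subseteq> interior (C (Suc N))" using C(3) by blast
  from compact_subset_open_imp_cball_epsilon_subset[OF assms(2) open_interior this]
  obtain e where "e > 0" "(\<Union>x\<in>S. cball x e) \<subseteq> interior (C (Suc N))" by blast
  then show ?thesis using that[OF C(1) C(2), of e "Suc N"] interior_subset by blast
qed

lemma lebesgue_sets_compact: "compact (S :: 'a::euclidean_space set) \<Longrightarrow> S \<inter> space lebesgue \<in> sets lebesgue"
  by (simp add: compact_imp_closed)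

text \<open>Weak derivatives are defined through the completed measure, whereas Fubini needs Borel functions.\<close>

lemma borel_rep_exists:
  fixes f :: "'a::euclidean_space \<Rightarrow> complex"
  assumes "compact K" "integrable (lebesgue_on K) f"
  shows "\<exists>f0. integrable lborel f0 \<and> (AE x in lborel. x \<in> K \<longrightarrow> f0 x = f x) \<and> (\<forall>x. x \<notin> K \<longrightarrow> f0 x = 0)"
proof -
  have [measurable]: "K \<in> sets borel" using assms(1) by (simp add: compact_imp_closed)
  have i: "integrable lebesgue (\<lambda>x. indicator K x *\<^sub>R f x)"
    using assms by (subst integrable_restrict_space[symmetric]) (auto simp: lebesgue_sets_compact)
  have m0: "(\<lambda>x. indicator K x *\<^sub>R f x) \<in> borel_measurable lebesgue" using i by (rule borel_measurable_integrable)
  have "(\<lambda>x. Re (indicator K x *\<^sub>R f x)) \<in> borel_measurable lebesgue" "(\<lambda>x. Im (indicator K x *\<^sub>R f x)) \<in> borel_measurable lebesgue"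
    by (rule measurable_compose[OF m0], rule borel_measurable_continuous_onI, intro continuous_intros)+
  from this[THEN completion_ex_borel_measurable_real] obtain p q
    where pq: "p \<in> borel_measurable lborel" "AE x in lborel. Re (indicator K x *\<^sub>R f x) = p x"
      "q \<in> borel_measurable lborel" "AE x in lborel. Im (indicator K x *\<^sub>R f x) = q x" by blast
  note [measurable] = pq(1,3)
  define f0 where "f0 x = indicator K x *\<^sub>R (complex_of_real (p x) + \<i> * complex_of_real (q x))" for x
  have m: "f0 \<in> borel_measurable lborel" unfolding f0_def[abs_def] by measurable
  have ae: "AE x in lborel. indicator K x *\<^sub>R f x = f0 x"
    using pq(2,4)
  proof eventually_elim
    case (elim x)
    then show ?case unfolding f0_def by (auto simp: indicator_def complex_eq_iff split: if_splits)
  qed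
  then have ae': "AE x in lebesgue. indicator K x *\<^sub>R f x = f0 x" by (rule AE_completion)
  have "integrable lebesgue f0"
    by (rule integrable_cong_AE_imp[OF i measurable_completion[OF m]]) (use ae' in eventually_elim, simp)
  then have "integrable lborel f0" using integrable_completion[OF m] by simp
  moreover have "AE x in lborel. x \<in> K \<longrightarrow> f0 x = f x" using ae by eventually_elim (auto simp: indicator_def)
  moreover have "\<forall>x. x \<notin> K \<longrightarrow> f0 x = 0" by (simp add: f0_def)
  ultimately show ?thesis by blast
qed

definition borel_rep :: "'a::euclidean_space set \<Rightarrow> ('a \<Rightarrow> complex) \<Rightarrow> ('a \<Rightarrow> complex) \<Rightarrow> bool" where
  "borel_rep K f f0 \<longleftrightarrow> integrable lborel f0 \<and> (AE x in lborel. x \<in> K \<longrightarrow> f0 x = f x) \<and> (\<forall>x. x \<notin> K \<longrightarrow> f0 x = 0)"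

lemma locally_integrable_rep:
  assumes "locally_integrable \<Omega> f" "compact K" "K \<subseteq> \<Omega>"
  obtains f0 where "borel_rep K f f0"
  using borel_rep_exists[OF assms(2), of f] assms unfolding locally_integrable_def borel_rep_def by blast

text \<open>The integrand vanishes off \<open>K\<close>, and on \<open>K\<close> the representative
  differs from \<open>f\<close> by a null set only; so the restriction to \<open>\<Omega>\<close>
  and the completion can both be dropped.\<close>

lemma borel_rep_integral:
  fixes f :: "'a::euclidean_space \<Rightarrow> complex"
  assumes r: "borel_rep K f f0" and K: "compact K" "K \<subseteq> \<Omega>" and O: "open \<Omega>"
    and li: "locally_integrable \<Omega> f"
    and p: "\<psi> \<in> borel_measurable borel" "\<And>x. x \<notin> K \<Longrightarrow> \<psi> x = 0"
  shows "(LINT x|lebesgue_on \<Omega>. f x * \<psi> x) = (LINT x|lborel. f0 x * \<psi> x)"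
proof -
  have "(LINT x|lebesgue_on \<Omega>. f x * \<psi> x) = (LINT x|lebesgue. indicator \<Omega> x *\<^sub>R (f x * \<psi> x))"
    using O by (simp add: integral_restrict_space)
  also have "\<dots> = (LINT x|lebesgue. (indicator K x *\<^sub>R f x) * \<psi> x)"
    using K p(2) by (intro Bochner_Integration.integral_cong refl) (auto simp: indicator_def)
  also have "\<dots> = (LINT x|lebesgue. f0 x * \<psi> x)"
  proof (rule integral_cong_AE)
    have "integrable lebesgue (\<lambda>x. indicator K x *\<^sub>R f x)"
      using li K unfolding locally_integrable_def
      by (subst integrable_restrict_space[symmetric]) (use lebesgue_sets_compact[OF K(1)] in auto)
    then have [measurable]: "(\<lambda>x. indicator K x *\<^sub>R f x) \<in> borel_measurable lebesgue" by auto
    have [measurable]: "\<psi> \<in> borel_measurable lebesgue" using p(1) by (simp add: measurable_completion)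
    have [measurable]: "f0 \<in> borel_measurable lebesgue" using r unfolding borel_rep_def
      by (auto intro: measurable_completion)
    show "(\<lambda>x. (indicator K x *\<^sub>R f x) * \<psi> x) \<in> borel_measurable lebesgue" by measurable
    show "(\<lambda>x. f0 x * \<psi> x) \<in> borel_measurable lebesgue" by measurable
    have "AE x in lborel. x \<in> K \<longrightarrow> f0 x = f x" using r unfolding borel_rep_def by blast
    then have "AE x in lebesgue. x \<in> K \<longrightarrow> f0 x = f x" by (rule AE_completion)
    then show "AE x in lebesgue. (indicator K x *\<^sub>R f x) * \<psi> x = f0 x * \<psi> x"
      by eventually_elim (use p(2) in \<open>auto simp: indicator_def\<close>)
  qed
  also have "\<dots> = (LINT x|lborel. f0 x * \<psi> x)"
    using r p(1) unfolding borel_rep_def by (intro integral_completion) auto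
  finally show ?thesis .
qed

lemma has_weak_derivD:
  assumes "has_weak_deriv \<Omega> \<alpha> f g" "test_function \<Omega> \<phi>"
  shows "(LINT x|lebesgue_on \<Omega>. f x * iterated_partial \<alpha> \<phi> x) = (-1) ^ length \<alpha> * (LINT x|lebesgue_on \<Omega>. g x * \<phi> x)"
  using assms unfolding has_weak_deriv_def by blast

lemma has_grad_reflect:
  assumes "has_grad r R" shows "has_grad (\<lambda>y. r (x - y)) (\<lambda>i y. - R i (x - y))"
  unfolding has_grad_def
proof
  fix y
  have f: "(r has_derivative (\<lambda>h. \<Sum>i\<in>UNIV. R i (x - y) * h $ i)) (at (x - y))"
    using assms by (simp add: has_grad_def)
  have "((\<lambda>y. x - y) has_derivative (\<lambda>h. - h)) (at y)" by (auto intro!: derivative_eq_intros)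
  from has_derivative_compose[OF this f]
  show "((\<lambda>y. r (x - y)) has_derivative (\<lambda>h. \<Sum>i\<in>UNIV. - R i (x - y) * h $ i)) (at y)"
    by (simp add: sum_negf)
qed

lemma test_function_bump:
  assumes b: "bumpy r" "\<And>z. norm z > \<epsilon> \<Longrightarrow> r z = 0" and x: "cball x \<epsilon> \<subseteq> \<Omega>"
  shows "test_function \<Omega> (\<lambda>y. complex_of_real (r (x - y)))"
proof -
  have "{y. complex_of_real (r (x - y)) \<noteq> 0} \<subseteq> cball x \<epsilon>"
    using b(2) by (auto simp: dist_norm) (meson linorder_not_le)
  then have s: "closure {y. complex_of_real (r (x - y)) \<noteq> 0} \<subseteq> cball x \<epsilon>"
    by (intro closure_minimal) auto
  then have "compact (closure {y. complex_of_real (r (x - y)) \<noteq> 0})"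
    by (meson bounded_cball bounded_subset closed_closure compact_eq_bounded_closed)
  then show ?thesis unfolding test_function_def
    using s x smooth_fn_of_real[OF bumpy_smooth_fn[OF bumpy_reflect[OF b(1)]]] by auto
qed

lemma integral_conv:
  fixes f0 :: "real ^ 'n::finite \<Rightarrow> complex"
  assumes f0: "integrable lborel f0" and s: "continuous_on UNIV s" "\<And>z. norm z > \<epsilon> \<Longrightarrow> s z = 0"
  shows "Re (LINT y|lborel. f0 y * complex_of_real (s (x - y))) = conv s (\<lambda>y. Re (f0 y)) x"
    and "Im (LINT y|lborel. f0 y * complex_of_real (s (x - y))) = conv s (\<lambda>y. Im (f0 y)) x"
proof -
  obtain M where M: "\<And>x. \<bar>s x\<bar> \<le> M" using compact_supp_bounded[OF s] by blast
  have c: "continuous_on UNIV (\<lambda>y. s (x - y))"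
    by (rule continuous_on_compose2[OF s(1)]) (auto intro: continuous_intros)
  have [measurable]: "f0 \<in> borel_measurable borel" using f0 by auto
  have [measurable]: "(\<lambda>y. s (x - y)) \<in> borel_measurable borel" using c by (rule borel_measurable_continuous_onI)
  have i: "integrable lborel (\<lambda>y. f0 y * complex_of_real (s (x - y)))"
  proof (rule Bochner_Integration.integrable_bound[where f="\<lambda>y. M * norm (f0 y)"])
    show "integrable lborel (\<lambda>y. M * norm (f0 y))" using f0 by auto
    show "AE y in lborel. norm (f0 y * complex_of_real (s (x - y))) \<le> norm (M * norm (f0 y))"
    proof (rule AE_I2)
      fix y
      have "norm (f0 y) * \<bar>s (x - y)\<bar> \<le> norm (f0 y) * M" by (intro mult_left_mono M) auto
      also have "\<dots> \<le> \<bar>M * norm (f0 y)\<bar>" by (simp add: mult.commute)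
      finally show "norm (f0 y * complex_of_real (s (x - y))) \<le> norm (M * norm (f0 y))" by (simp add: norm_mult)
    qed
  qed measurable
  show "Re (LINT y|lborel. f0 y * complex_of_real (s (x - y))) = conv s (\<lambda>y. Re (f0 y)) x"
    unfolding conv_def by (subst integral_Re[OF i, symmetric]) (simp add: mult.commute)
  show "Im (LINT y|lborel. f0 y * complex_of_real (s (x - y))) = conv s (\<lambda>y. Im (f0 y)) x"
    unfolding conv_def by (subst integral_Im[OF i, symmetric]) (simp add: mult.commute)
qed

lemma complex_of_real_borel: "s \<in> borel_measurable borel \<Longrightarrow> (\<lambda>x. complex_of_real (s x)) \<in> borel_measurable borel"
  by measurable

text \<open>Testing a weak derivative against a translated mollifier moves the derivative of the
  mollified function onto the weak derivative.\<close>

lemma weak_deriv_conv: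
  assumes w: "has_weak_deriv \<Omega> \<alpha> f g" and O: "open \<Omega>" and K: "compact K" "K \<subseteq> \<Omega>"
    and f0: "borel_rep K f f0" and g0: "borel_rep K g g0"
    and b: "bumpy r" "\<And>z. norm z > \<epsilon> \<Longrightarrow> r z = 0" and x: "cball x \<epsilon> \<subseteq> K"
    and s: "continuous_on UNIV s" "\<And>z. norm z > \<epsilon> \<Longrightarrow> s z = 0"
      "iterated_partial \<alpha> (\<lambda>y. complex_of_real (r (x - y))) = (\<lambda>y. (-1) ^ length \<alpha> * complex_of_real (s (x - y)))"
  shows "conv s (\<lambda>y. Re (f0 y)) x = conv r (\<lambda>y. Re (g0 y)) x"
    and "conv s (\<lambda>y. Im (f0 y)) x = conv r (\<lambda>y. Im (g0 y)) x"
proof -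
  have li: "locally_integrable \<Omega> f" "locally_integrable \<Omega> g" using w unfolding has_weak_deriv_def by auto
  have t: "test_function \<Omega> (\<lambda>y. complex_of_real (r (x - y)))"
    using test_function_bump[OF b] x K by blast
  have cr: "continuous_on UNIV r" using b(1) by (rule bumpy_continuous)
  have m: "(\<lambda>y. complex_of_real (u (x - y))) \<in> borel_measurable borel" if "continuous_on UNIV u" for u :: "real^'a \<Rightarrow> real"
    by (intro complex_of_real_borel borel_measurable_continuous_onI continuous_on_compose2[OF that]) (auto intro: continuous_intros)
  have z: "complex_of_real (u (x - y)) = 0" if "\<And>z. norm z > \<epsilon> \<Longrightarrow> u z = 0" "y \<notin> K" for u :: "real^'a \<Rightarrow> real" and y
    using that x by (auto simp: subset_iff dist_norm not_le[symmetric])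
  have zs: "complex_of_real (s (x - y)) = 0" and zr: "complex_of_real (r (x - y)) = 0" if "y \<notin> K" for y
    using z[of s] z[of r] s(2) b(2) that by blast+
  have "(LINT y|lebesgue_on \<Omega>. f y * iterated_partial \<alpha> (\<lambda>y. complex_of_real (r (x - y))) y)
      = (-1) ^ length \<alpha> * (LINT y|lebesgue_on \<Omega>. g y * complex_of_real (r (x - y)))"
    using w t unfolding has_weak_deriv_def by blast
  \<comment> \<open>The reflection in \<open>r (x - y)\<close> yields one sign per derivative, which
    cancels the sign in the definition of a weak derivative.\<close>
  also have "(LINT y|lebesgue_on \<Omega>. f y * iterated_partial \<alpha> (\<lambda>y. complex_of_real (r (x - y))) y)
    = (-1) ^ length \<alpha> * (LINT y|lebesgue_on \<Omega>. f y * complex_of_real (s (x - y)))"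
    unfolding s(3) mult.left_commute[of "f _"] by (rule integral_mult_right_zero)
  finally have "(LINT y|lebesgue_on \<Omega>. f y * complex_of_real (s (x - y))) = (LINT y|lebesgue_on \<Omega>. g y * complex_of_real (r (x - y)))"
    by simp
  also have "(LINT y|lebesgue_on \<Omega>. f y * complex_of_real (s (x - y))) = (LINT y|lborel. f0 y * complex_of_real (s (x - y)))"
    by (rule borel_rep_integral[OF f0 K O li(1) m[OF s(1)] zs])
  also have "(LINT y|lebesgue_on \<Omega>. g y * complex_of_real (r (x - y))) = (LINT y|lborel. g0 y * complex_of_real (r (x - y)))"
    by (rule borel_rep_integral[OF g0 K O li(2) m[OF cr] zr])
  finally have e: "(LINT y|lborel. f0 y * complex_of_real (s (x - y))) = (LINT y|lborel. g0 y * complex_of_real (r (x - y)))" .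
  have i: "integrable lborel f0" "integrable lborel g0" using f0 g0 unfolding borel_rep_def by auto
  show "conv s (\<lambda>y. Re (f0 y)) x = conv r (\<lambda>y. Re (g0 y)) x"
    using integral_conv(1)[OF i(1) s(1,2), where x=x] integral_conv(1)[OF i(2) cr b(2), where x=x] e by simp
  show "conv s (\<lambda>y. Im (f0 y)) x = conv r (\<lambda>y. Im (g0 y)) x"
    using integral_conv(2)[OF i(1) s(1,2), where x=x] integral_conv(2)[OF i(2) cr b(2), where x=x] e by simp
qed

text \<open>The list \<open>[i, j]\<close> is folded from the right, so direction \<open>j\<close>
  is differentiated first; hence the index order \<open>RR j i\<close>. Two reflections of sign
  cancel.\<close>

lemma iterated_partial_reflect:
  assumes "has_grad r R" "\<And>i. has_grad (R i) (RR i)"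
  shows "iterated_partial [] (\<lambda>y. complex_of_real (r (x - y))) = (\<lambda>y. complex_of_real (r (x - y)))"
    and "iterated_partial [i] (\<lambda>y. complex_of_real (r (x - y))) = (\<lambda>y. - complex_of_real (R i (x - y)))"
    and "iterated_partial [i, j] (\<lambda>y. complex_of_real (r (x - y))) = (\<lambda>y. complex_of_real (RR j i (x - y)))"
proof -
  show "iterated_partial [] (\<lambda>y. complex_of_real (r (x - y))) = (\<lambda>y. complex_of_real (r (x - y)))"
    by (simp add: iterated_partial_def)
  have 1: "partial_deriv i (\<lambda>y. complex_of_real (r (x - y))) = (\<lambda>y. complex_of_real (- R i (x - y)))" for i
    using partial_deriv_of_real(2)[OF has_grad_reflect[OF assms(1)]] by simp
  then show "iterated_partial [i] (\<lambda>y. complex_of_real (r (x - y))) = (\<lambda>y. - complex_of_real (R i (x - y)))"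
    by (simp add: iterated_partial_def)
  have "partial_deriv i (\<lambda>y. complex_of_real (- R j (x - y))) = (\<lambda>y. complex_of_real (RR j i (x - y)))"
    using partial_deriv_of_real(2)[OF has_grad_minus[OF has_grad_reflect[OF assms(2)[of j]]]] by simp
  then show "iterated_partial [i, j] (\<lambda>y. complex_of_real (r (x - y))) = (\<lambda>y. complex_of_real (RR j i (x - y)))"
    using 1 by (simp add: iterated_partial_def)
qed

text \<open>The fundamental lemma of the calculus of variations by mollification: on a compact set
  the difference of the two derivatives is annihilated by all small mollifiers, yet it is their
  limit in L1. Exhausting \<open>\<Omega>\<close> by countably many compact sets finishes the
  argument.\<close>

lemma weak_deriv_unique:
  assumes w: "has_weak_deriv \<Omega> \<alpha> f g" "has_weak_deriv \<Omega> \<alpha> f h" and O: "open \<Omega>"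
  shows "AE x in lborel. x \<in> \<Omega> \<longrightarrow> g x = h x"
proof -
  have li: "locally_integrable \<Omega> g" "locally_integrable \<Omega> h" using w unfolding has_weak_deriv_def by auto
  have loc: "AE x in lborel. x \<in> C \<longrightarrow> g x = h x" if C: "compact C" "C \<subseteq> \<Omega>" for C
  proof -
    from compact_nbhd[OF O C] obtain K e where K: "compact K" "K \<subseteq> \<Omega>" "e > 0" "\<And>x. x \<in> C \<Longrightarrow> cball x e \<subseteq> K" by blast
    obtain g0 where g0: "borel_rep K g g0" using locally_integrable_rep[OF li(1) K(1,2)] .
    obtain h0 where h0: "borel_rep K h h0" using locally_integrable_rep[OF li(2) K(1,2)] .
    have ig: "integrable lborel g0" "integrable lborel h0" using g0 h0 unfolding borel_rep_def by auto
    define d where "d y = g0 y - h0 y" for y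
    have id: "integrable lborel d" unfolding d_def using ig by auto
    have conv0: "conv r (\<lambda>y. Re (d y)) x = 0 \<and> conv r (\<lambda>y. Im (d y)) x = 0"
      if r: "mollifier \<epsilon> r" "\<epsilon> < e" and x: "x \<in> C" for r \<epsilon> x
    proof -
      have z: "norm z > \<epsilon> \<Longrightarrow> r z = 0" for z using mollifierD(3)[OF r(1)] .
      have ball: "cball x \<epsilon> \<subseteq> K" using K(4)[OF x] r(2) by (meson less_imp_le order_trans subset_cball)
      have t: "test_function \<Omega> (\<lambda>y. complex_of_real (r (x - y)))"
        using test_function_bump[OF mollifierD(1)[OF r(1)] z] ball K by blast
      have e': "(-1) ^ length \<alpha> * (LINT y|lebesgue_on \<Omega>. g y * complex_of_real (r (x - y))) = (-1) ^ length \<alpha> * (LINT y|lebesgue_on \<Omega>. h y * complex_of_real (r (x - y)))"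
        by (rule trans[OF has_weak_derivD[OF w(1) t, symmetric] has_weak_derivD[OF w(2) t]])
      have m: "(\<lambda>y. complex_of_real (r (x - y))) \<in> borel_measurable borel"
        by (intro complex_of_real_borel borel_measurable_continuous_onI continuous_on_compose2[OF mollifierD(6)[OF r(1)]])
          (auto intro: continuous_intros)
      have z': "complex_of_real (r (x - y)) = 0" if "y \<notin> K" for y
        using that ball z by (auto simp: subset_iff dist_norm not_le[symmetric])
      have "(LINT y|lborel. g0 y * complex_of_real (r (x - y))) = (LINT y|lborel. h0 y * complex_of_real (r (x - y)))"
        using borel_rep_integral[OF g0 K(1,2) O li(1) m z'] borel_rep_integral[OF h0 K(1,2) O li(2) m z'] e' by simp
      then have "conv r (\<lambda>y. Re (g0 y)) x = conv r (\<lambda>y. Re (h0 y)) x" "conv r (\<lambda>y. Im (g0 y)) x = conv r (\<lambda>y. Im (h0 y)) x"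
        using integral_conv[OF ig(1) mollifierD(6)[OF r(1)] z, where x=x] integral_conv[OF ig(2) mollifierD(6)[OF r(1)] z, where x=x] by simp_all
      moreover have "conv r (\<lambda>y. Re (d y)) x = conv r (\<lambda>y. Re (g0 y)) x - conv r (\<lambda>y. Re (h0 y)) x"
        "conv r (\<lambda>y. Im (d y)) x = conv r (\<lambda>y. Im (g0 y)) x - conv r (\<lambda>y. Im (h0 y)) x"
        unfolding conv_def d_def using conv_integrable[OF mollifierD(6)[OF r(1)] z, where x=x] ig by (simp_all add: right_diff_distrib)
      ultimately show ?thesis by simp
    qed
    have zero: "AE x in lborel. x \<in> C \<longrightarrow> u x = 0"
      if u: "integrable lborel u" and c0: "\<And>r \<epsilon> x. mollifier \<epsilon> r \<Longrightarrow> \<epsilon> < e \<Longrightarrow> x \<in> C \<Longrightarrow> conv r u x = 0" for u :: "real ^ 'a \<Rightarrow> real"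
    proof -
      have [measurable]: "C \<in> sets borel" using C by (simp add: compact_imp_closed)
      have iu: "integrable lborel (\<lambda>x. indicator C x * \<bar>u x\<bar>)"
        by (rule Bochner_Integration.integrable_bound[OF u]) (use u in \<open>auto simp: indicator_def\<close>)
      have le: "(LINT x|lborel. indicator C x * \<bar>u x\<bar>) \<le> e'" if "e' > 0" for e'
      proof -
        from conv_L1_close[OF u that] obtain d where d: "d > 0" "\<And>r \<epsilon>. mollifier \<epsilon> r \<Longrightarrow> \<epsilon> < d \<Longrightarrow> integrable lborel (\<lambda>x. \<bar>conv r u x - u x\<bar>) \<and> (LINT x|lborel. \<bar>conv r u x - u x\<bar>) \<le> e'" by blast
        define \<epsilon> where "\<epsilon> = min d e / 2"
        have ep: "\<epsilon> > 0" "\<epsilon> < d" "\<epsilon> < e" unfolding \<epsilon>_def using d(1) K(3) by auto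
        obtain r :: "real ^ 'a \<Rightarrow> real" where r: "mollifier \<epsilon> r"
          using mollifier_exists[OF ep(1)] unfolding mollifier_def by blast
        \<comment> \<open>On \<open>C\<close> the mollification vanishes, so there
          \<open>|u|\<close> is itself the mollification error.\<close>
        have "(LINT x|lborel. indicator C x * \<bar>u x\<bar>) \<le> (LINT x|lborel. \<bar>conv r u x - u x\<bar>)"
        proof (rule integral_mono[OF iu])
          show "integrable lborel (\<lambda>x. \<bar>conv r u x - u x\<bar>)" using d(2)[OF r ep(2)] by blast
          show "indicator C x * \<bar>u x\<bar> \<le> \<bar>conv r u x - u x\<bar>" for x
            using c0[OF r ep(3), of x] by (cases "x \<in> C") simp_all
        qed
        then show ?thesis using d(2)[OF r ep(2)] by linarith
      qed
      have "(LINT x|lborel. indicator C x * \<bar>u x\<bar>) \<le> 0"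
        by (rule field_le_epsilon) (use le in simp)
      moreover have "0 \<le> (LINT x|lborel. indicator C x * \<bar>u x\<bar>)"
        by (rule Bochner_Integration.integral_nonneg) simp
      ultimately have "(LINT x|lborel. indicator C x * \<bar>u x\<bar>) = 0" by (rule antisym)
      then have "AE x in lborel. indicator C x * \<bar>u x\<bar> = 0"
        using integral_nonneg_eq_0_iff_AE[OF iu] by simp
      then show ?thesis by eventually_elim (auto simp: indicator_def split: if_splits)
    qed
    have "AE x in lborel. x \<in> C \<longrightarrow> Re (d x) = 0" "AE x in lborel. x \<in> C \<longrightarrow> Im (d x) = 0"
      using zero[of "\<lambda>y. Re (d y)"] zero[of "\<lambda>y. Im (d y)"] conv0 id by auto
    moreover have "AE x in lborel. x \<in> K \<longrightarrow> g0 x = g x" "AE x in lborel. x \<in> K \<longrightarrow> h0 x = h x"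
      using g0 h0 unfolding borel_rep_def by auto
    ultimately show ?thesis
    proof eventually_elim
      case (elim x)
      have "x \<in> C \<Longrightarrow> x \<in> K" using K(3,4) by (meson centre_in_cball less_imp_le subsetD)
      then show ?case using elim unfolding d_def by (auto simp: complex_eq_iff)
    qed
  qed
  from open_Union_compact_subsets[OF O] obtain C :: "nat \<Rightarrow> (real ^ 'a) set"
    where C: "\<And>n. compact (C n)" "\<And>n. C n \<subseteq> \<Omega>" "\<Union>(range C) = \<Omega>" by metis
  have "AE x in lborel. \<forall>n::nat. x \<in> C n \<longrightarrow> g x = h x" unfolding AE_all_countable using loc C(1,2) by blast
  then show ?thesis by eventually_elim (use C(3) in blast)
qed

section \<open>Weak derivatives of Lipschitz functions and the product rule\<close>

definition test_pair :: "'n::finite \<Rightarrow> (real ^ 'n \<Rightarrow> real) \<Rightarrow> (real ^ 'n \<Rightarrow> real) \<Rightarrow> bool" where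
  "test_pair i \<phi> \<phi>' \<longleftrightarrow> (\<exists>\<Phi> \<rho>. has_grad \<phi> \<Phi> \<and> \<phi>' = \<Phi> i \<and> continuous_on UNIV (\<Phi> i) \<and> (\<forall>x. norm x > \<rho> \<longrightarrow> \<phi> x = 0))"

lemma test_pair_integrable:
  fixes a :: "real ^ 'n::finite \<Rightarrow> real"
  assumes "test_pair i \<phi> \<phi>'" "continuous_on UNIV a"
  shows "integrable lborel (\<lambda>x. a x * \<phi> x)" "integrable lborel (\<lambda>x. a x * \<phi>' x)"
proof -
  obtain \<Phi> \<rho> where P: "has_grad \<phi> \<Phi>" "\<phi>' = \<Phi> i" "continuous_on UNIV (\<Phi> i)" "\<And>x. norm x > \<rho> \<Longrightarrow> \<phi> x = 0"
    using assms(1) unfolding test_pair_def by blast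
  have z: "\<Phi> i x = 0" if "norm x > \<rho>" for x
    using has_grad_zero_outside[OF P(1), where ctr=0 and r=\<rho> and x=x] P(4) that by simp
  show "integrable lborel (\<lambda>x. a x * \<phi> x)"
    by (rule integrable_compact_supp[where ctr=0 and r=\<rho>])
       (use P z in \<open>auto intro!: continuous_intros assms has_grad_continuous[OF P(1)]\<close>)
  show "integrable lborel (\<lambda>x. a x * \<phi>' x)"
    by (rule integrable_compact_supp[where ctr=0 and r=\<rho>])
       (use P z in \<open>auto intro!: continuous_intros assms\<close>)
qed

text \<open>Translation invariance moves the backward quotient of \<open>a\<close> onto a forward
  quotient of \<open>\<phi>\<close>, with a change of sign. The forward quotients converge boundedly
  to \<open>\<phi>'\<close> inside a fixed ball, where the continuous \<open>a\<close> is
  bounded.\<close>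

lemma difference_quotient_weak_limit:
  fixes a :: "real ^ 'n::finite \<Rightarrow> real"
  assumes a: "continuous_on UNIV a" and T: "test_pair i \<phi> \<phi>'"
  defines "D \<equiv> \<lambda>n x. real (Suc n) * (a x - a (x - inverse (real (Suc n)) *\<^sub>R axis i 1))"
  shows "(\<lambda>n. LINT x|lborel. D n x * \<phi> x) \<longlonglongrightarrow> - (LINT x|lborel. a x * \<phi>' x)"
proof -
  obtain \<Phi> r where P: "has_grad \<phi> \<Phi>" "\<phi>' = \<Phi> i" "continuous_on UNIV (\<Phi> i)" "\<And>x. norm x > r \<Longrightarrow> \<phi> x = 0"
    using T unfolding test_pair_def by blast
  have z: "\<Phi> i x = 0" if "norm x > r" for x
    using has_grad_zero_outside[OF P(1), where ctr=0 and r=r and x=x] P(4) that by simp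
  define Q where "Q n x = real (Suc n) * (\<phi> (x + inverse (real (Suc n)) *\<^sub>R axis i 1) - \<phi> x)" for n x
  have c\<phi>: "continuous_on UNIV \<phi>" using P(1) by (rule has_grad_continuous)
  obtain M where M: "\<And>x. \<bar>\<Phi> i x\<bar> \<le> M" "M \<ge> 0" using compact_supp_bounded[OF P(3) z] by metis
  have mvt: "\<exists>\<xi>. Q n x = \<Phi> i (x + \<xi> *\<^sub>R axis i 1) \<and> 0 < \<xi> \<and> \<xi> < inverse (real (Suc n))" for n x
  proof -
    have "\<exists>z>0. z < inverse (real (Suc n)) \<and>
        \<phi> (x + inverse (real (Suc n)) *\<^sub>R axis i 1) - \<phi> (x + 0 *\<^sub>R axis i 1) = (inverse (real (Suc n)) - 0) * \<Phi> i (x + z *\<^sub>R axis i 1)"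
      by (rule MVT2) (use has_grad_axis[OF P(1)] in auto)
    then show ?thesis unfolding Q_def by (auto simp: field_simps)
  qed
  have lim: "(\<lambda>n. Q n x) \<longlonglongrightarrow> \<Phi> i x" for x
  proof -
    have "((\<lambda>t. \<phi> (x + t *\<^sub>R axis i 1)) has_real_derivative \<Phi> i (x + 0 *\<^sub>R axis i 1)) (at 0)"
      by (rule has_grad_axis[OF P(1)])
    then have "((\<lambda>h. (\<phi> (x + h *\<^sub>R axis i 1) - \<phi> x) / h) \<longlongrightarrow> \<Phi> i x) (at 0)"
      by (simp add: DERIV_def)
    moreover have "filterlim (\<lambda>n. inverse (real (Suc n))) (at 0) sequentially"
      unfolding filterlim_at using LIMSEQ_inverse_real_of_nat by (auto simp: eventually_sequentially)
    ultimately have "((\<lambda>n. (\<phi> (x + inverse (real (Suc n)) *\<^sub>R axis i 1) - \<phi> x) / inverse (real (Suc n))) \<longlonglongrightarrow> \<Phi> i x)"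
      by (rule filterlim_compose)
    moreover have "(\<phi> (x + inverse (real (Suc n)) *\<^sub>R axis i 1) - \<phi> x) / inverse (real (Suc n)) = Q n x" for n
      unfolding Q_def by (simp add: field_simps)
    ultimately show ?thesis by simp
  qed
  have Qz: "Q n x = 0" if "norm x > r + 1" for n x
  proof -
    obtain \<xi> where \<xi>: "Q n x = \<Phi> i (x + \<xi> *\<^sub>R axis i 1)" "0 < \<xi>" "\<xi> < inverse (real (Suc n))"
      using mvt by blast
    then have "\<xi> < 1" by (smt (verit) inverse_le_1_iff of_nat_Suc of_nat_0_le_iff)
    have "norm x \<le> norm (x + \<xi> *\<^sub>R axis i 1) + norm (\<xi> *\<^sub>R axis i (1::real) :: real^'n)"
      using norm_triangle_ineq4[of "x + \<xi> *\<^sub>R axis i 1" "\<xi> *\<^sub>R axis i 1"] by simp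
    then have "norm (x + \<xi> *\<^sub>R axis i 1) > r" using that \<xi> \<open>\<xi> < 1\<close> by (simp add: norm_axis_1)
    then show ?thesis using z \<xi> by simp
  qed
  obtain A where A: "\<And>x. x \<in> cball 0 (r + 1) \<Longrightarrow> \<bar>a x\<bar> \<le> A" "A \<ge> 0"
  proof -
    have "compact (a ` cball 0 (r + 1))" by (intro compact_continuous_image continuous_on_subset[OF a]) auto
    then obtain B where B: "\<forall>y\<in>a ` cball 0 (r + 1). \<bar>y\<bar> \<le> B" using compact_imp_bounded bounded_real by blast
    have "\<bar>a x\<bar> \<le> max B 0" if "x \<in> cball 0 (r + 1)" for x
      using bspec[OF B imageI[OF that]] by simp
    then show ?thesis by (rule that[of "max B 0"]) auto
  qed
  have l: "(\<lambda>n. LINT x|lborel. a x * Q n x) \<longlonglongrightarrow> (LINT x|lborel. a x * \<Phi> i x)"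
  proof (rule integral_dominated_convergence[where w="\<lambda>x. indicator (cball 0 (r+1)) x *\<^sub>R (A * M)"])
    have [measurable]: "a \<in> borel_measurable borel" "\<phi> \<in> borel_measurable borel" "\<Phi> i \<in> borel_measurable borel"
      using a c\<phi> P(3) by (auto intro: borel_measurable_continuous_onI)
    show "(\<lambda>x. a x * \<Phi> i x) \<in> borel_measurable lborel" by measurable
    show "(\<lambda>x. a x * Q n x) \<in> borel_measurable lborel" for n unfolding Q_def by measurable
    show "integrable lborel (\<lambda>x::real^'n. indicator (cball 0 (r+1)) x *\<^sub>R (A * M))"
      by (rule borel_integrable_compact) auto
    show "AE x in lborel. (\<lambda>n. a x * Q n x) \<longlonglongrightarrow> a x * \<Phi> i x" by (intro AE_I2 tendsto_mult_left lim)
    show "AE x in lborel. norm (a x * Q n x) \<le> indicator (cball 0 (r + 1)) x *\<^sub>R (A * M)" for n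
    proof (rule AE_I2)
      fix x
      obtain y where "Q n x = \<Phi> i y" using mvt by blast
      then have q: "\<bar>Q n x\<bar> \<le> M" using M by simp
      show "norm (a x * Q n x) \<le> indicator (cball 0 (r + 1)) x *\<^sub>R (A * M)"
      proof (cases "x \<in> cball 0 (r + 1)")
        case True
        have "\<bar>a x\<bar> * \<bar>Q n x\<bar> \<le> A * M" using A(1)[OF True] q A(2) by (intro mult_mono) auto
        then show ?thesis using True by (simp add: abs_mult)
      next
        case False
        then show ?thesis using Qz[of x n] by auto
      qed
    qed
  qed
  have "(LINT x|lborel. D n x * \<phi> x) = - (LINT x|lborel. a x * Q n x)" for n
  proof -
    define h :: "real ^ 'n" where "h = inverse (real (Suc n)) *\<^sub>R axis i 1"
    have i1: "integrable lborel (\<lambda>x. a x * \<phi> x)" using test_pair_integrable[OF T a] by blast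
    have i2: "integrable lborel (\<lambda>x. a x * \<phi> (x + h))"
    proof (rule integrable_compact_supp[where ctr="- h" and r=r])
      show "continuous_on UNIV (\<lambda>x. a x * \<phi> (x + h))"
        by (intro continuous_intros a continuous_on_compose2[OF c\<phi>]) auto
      show "a x * \<phi> (x + h) = 0" if "norm (x - - h) > r" for x using P(4)[of "x + h"] that by simp
    qed
    have e: "(LINT x|lborel. a (x - h) * \<phi> x) = (LINT x|lborel. a x * \<phi> (x + h))"
      using lborel_integral_translate(1)[of "\<lambda>x. a (x - h) * \<phi> x" h] by simp
    have i3: "integrable lborel (\<lambda>x. a (x - h) * \<phi> x)"
      using lborel_integral_translate(2)[of "\<lambda>x. a (x - h) * \<phi> x" h] i2 by simp
    have "(LINT x|lborel. D n x * \<phi> x) = (LINT x|lborel. real (Suc n) * (a x * \<phi> x - a (x - h) * \<phi> x))"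
      unfolding D_def h_def by (intro Bochner_Integration.integral_cong refl) (simp add: algebra_simps)
    also have "\<dots> = real (Suc n) * ((LINT x|lborel. a x * \<phi> x) - (LINT x|lborel. a x * \<phi> (x + h)))"
      using i1 i3 e by simp
    also have "\<dots> = (LINT x|lborel. real (Suc n) * (a x * \<phi> x - a x * \<phi> (x + h)))" using i1 i2 by simp
    also have "\<dots> = (LINT x|lborel. - (a x * Q n x))"
      unfolding Q_def h_def by (intro Bochner_Integration.integral_cong refl) (simp add: algebra_simps)
    finally show ?thesis by simp
  qed
  then show ?thesis using tendsto_minus[OF l] P(2) by simp
qed

text \<open>The weak derivative of a Lipschitz function is found as a strong limit of elements of minimal
  weighted norm in the decreasing convex sets \<open>K n\<close> spanned by the tails of the difference
  quotients; the parallelogram law makes such minimizers a Cauchy sequence.\<close>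

lemma lipschitz_weak_deriv:
  fixes a :: "real ^ 'n::finite \<Rightarrow> real"
  assumes lip: "\<And>x y. \<bar>a x - a y\<bar> \<le> L * norm (x - y)"
  shows "\<exists>g. g \<in> borel_measurable borel \<and> (\<forall>x. \<bar>g x\<bar> \<le> L) \<and>
    (\<forall>\<phi> \<phi>'. test_pair i \<phi> \<phi>' \<longrightarrow> (LINT x|lborel. a x * \<phi>' x) = - (LINT x|lborel. g x * \<phi> x))"
proof -
  have ca: "continuous_on UNIV a"
  proof -
    have "L \<ge> 0" using lip[of "axis i 1" 0] by (simp add: norm_axis_1)
    then have "L-lipschitz_on UNIV a" using lip by (auto intro!: lipschitz_onI simp: dist_norm)
    then show ?thesis by (rule lipschitz_on_continuous_on)
  qed
  have L: "L \<ge> 0" using lip[of "axis i 1" 0] by (simp add: norm_axis_1)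
  define D where "D n x = real (Suc n) * (a x - a (x - inverse (real (Suc n)) *\<^sub>R axis i 1))" for n x
  have [measurable]: "a \<in> borel_measurable borel" using ca by (rule borel_measurable_continuous_onI)
  have Dm: "D n \<in> borel_measurable borel" for n unfolding D_def by measurable
  have Db: "\<bar>D n x\<bar> \<le> L" for n x
  proof -
    have "\<bar>a x - a (x - inverse (real (Suc n)) *\<^sub>R axis i 1)\<bar> \<le> L * inverse (real (Suc n))"
      using lip[of x "x - inverse (real (Suc n)) *\<^sub>R axis i 1"] by (simp add: norm_axis_1)
    then have "real (Suc n) * \<bar>a x - a (x - inverse (real (Suc n)) *\<^sub>R axis i 1)\<bar> \<le> real (Suc n) * (L * inverse (real (Suc n)))"
      by (intro mult_left_mono) auto
    also have "\<dots> = L" by (simp del: of_nat_Suc)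
    finally show ?thesis unfolding D_def abs_mult by simp
  qed
  define t where "t \<phi>' = (LINT x|lborel. a x * \<phi>' x)" for \<phi>'
  have lim: "(\<lambda>n. LINT x|lborel. D n x * \<phi> x) \<longlonglongrightarrow> - t \<phi>'" if "test_pair i \<phi> \<phi>'" for \<phi> \<phi>'
    using difference_quotient_weak_limit[OF ca that] unfolding D_def t_def .
  have ip: "integrable lborel \<phi>" if "test_pair i \<phi> \<phi>'" for \<phi> \<phi>'
    using test_pair_integrable(1)[OF that continuous_on_const[of UNIV 1]] by simp
  have ifp: "integrable lborel (\<lambda>x. f x * \<phi> x)" if "test_pair i \<phi> \<phi>'" "f \<in> borel_measurable borel" "\<And>x. \<bar>f x\<bar> \<le> L" for f \<phi> \<phi>'
    by (rule integrable_bounded_mult[OF ip[OF that(1)] that(2,3)])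

  \<comment> \<open>A strictly positive integrable weight puts all bounded functions into one
    weighted L2 space; the quotients \<open>D n\<close> need not be square integrable over the whole
    space without it.\<close>
  obtain w0 :: "real ^ 'n \<Rightarrow> ennreal" where w0: "w0 \<in> borel_measurable lborel" "integral\<^sup>N lborel w0 \<noteq> \<infinity>" "\<And>x. 0 < w0 x \<and> w0 x < \<infinity>"
    using sigma_finite_measure.Ex_finite_integrable_function[OF sigma_finite_lborel] by auto
  define w where "w x = enn2real (w0 x)" for x
  have wpos: "w x > 0" for x unfolding w_def using w0(3)[of x] by (simp add: enn2real_positive_iff)
  have [measurable]: "w \<in> borel_measurable borel" unfolding w_def[abs_def] using w0(1) by simp
  have iw: "integrable lborel w"
  proof (rule integrableI_nonneg)
    have "ennreal (w x) = w0 x" for x unfolding w_def using w0(3)[of x] by (simp add: ennreal_enn2real)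
    then show "(\<integral>\<^sup>+x. ennreal (w x) \<partial>lborel) < \<infinity>" using w0(2) by (simp add: less_top)
  qed (use wpos less_imp_le in auto)
  define W where "W = (LINT x|lborel. w x)"
  have W0: "W \<ge> 0" unfolding W_def by (intro Bochner_Integration.integral_nonneg less_imp_le[OF wpos])

  \<comment> \<open>In place of explicit convex combinations, \<open>K n\<close> consists of the
    functions bounded by \<open>L\<close> that obey every estimate of this form common to the tail
    \<open>D m\<close>, \<open>m \<ge> n\<close>. It is convex by inspection, and any sequence with
    \<open>F n\<close> in \<open>K n\<close> inherits the weak limit of the quotients.\<close>
  define K where "K n = {f. f \<in> borel_measurable borel \<and> (\<forall>x. \<bar>f x\<bar> \<le> L) \<and>
     (\<forall>\<phi> \<phi>' e. test_pair i \<phi> \<phi>' \<longrightarrow> (\<forall>m\<ge>n. \<bar>(LINT x|lborel. D m x * \<phi> x) + t \<phi>'\<bar> \<le> e) \<longrightarrow> \<bar>(LINT x|lborel. f x * \<phi> x) + t \<phi>'\<bar> \<le> e)}" for n :: nat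
  have KD: "D n \<in> K n" for n unfolding K_def using Dm Db by auto
  have Kmono: "K m \<subseteq> K n" if "n \<le> m" for n m unfolding K_def using that by auto
  have Kb: "f \<in> borel_measurable borel" "\<bar>f x\<bar> \<le> L" if "f \<in> K n" for f n x using that unfolding K_def by auto
  have Kconv: "(\<lambda>x. (f x + g x) / 2) \<in> K n" if f: "f \<in> K n" and g: "g \<in> K n" for f g n
    unfolding K_def
  proof (intro CollectI conjI allI impI)
    have [measurable]: "f \<in> borel_measurable borel" "g \<in> borel_measurable borel" using Kb f g by auto
    show "(\<lambda>x. (f x + g x) / 2) \<in> borel_measurable borel" by measurable
    show "\<bar>(f x + g x) / 2\<bar> \<le> L" for x using Kb(2)[OF f, of x] Kb(2)[OF g, of x] by (simp add: abs_le_iff)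
    fix \<phi> \<phi>' e assume T: "test_pair i \<phi> \<phi>'" and e: "\<forall>m\<ge>n. \<bar>(LINT x|lborel. D m x * \<phi> x) + t \<phi>'\<bar> \<le> e"
    have "\<bar>(LINT x|lborel. f x * \<phi> x) + t \<phi>'\<bar> \<le> e" "\<bar>(LINT x|lborel. g x * \<phi> x) + t \<phi>'\<bar> \<le> e"
      using f g T e unfolding K_def by blast+
    moreover have "(LINT x|lborel. (f x + g x) / 2 * \<phi> x) = ((LINT x|lborel. f x * \<phi> x) + (LINT x|lborel. g x * \<phi> x)) / 2"
    proof -
      have "(LINT x|lborel. (f x + g x) / 2 * \<phi> x) = (LINT x|lborel. (f x * \<phi> x + g x * \<phi> x) / 2)"
        by (intro Bochner_Integration.integral_cong refl) (simp add: algebra_simps)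
      then show ?thesis using ifp[OF T Kb[OF f]] ifp[OF T Kb[OF g]] by simp
    qed
    ultimately show "\<bar>(LINT x|lborel. (f x + g x) / 2 * \<phi> x) + t \<phi>'\<bar> \<le> e" by (simp add: abs_le_iff field_simps)
  qed
  define I where "I f = (LINT x|lborel. w x * (f x)\<^sup>2)" for f
  have iI: "integrable lborel (\<lambda>x. w x * (f x)\<^sup>2)" if "f \<in> borel_measurable borel" "\<And>x. \<bar>f x\<bar> \<le> B" for f B
  proof (rule Bochner_Integration.integrable_bound[where f="\<lambda>x. B\<^sup>2 * w x"])
    show "integrable lborel (\<lambda>x. B\<^sup>2 * w x)" using iw by simp
    show "(\<lambda>x. w x * (f x)\<^sup>2) \<in> borel_measurable lborel" using that(1) by measurable
    show "AE x in lborel. norm (w x * (f x)\<^sup>2) \<le> norm (B\<^sup>2 * w x)"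
    proof (rule AE_I2)
      fix x
      have "(f x)\<^sup>2 \<le> B\<^sup>2" using that(2)[of x] by (metis abs_ge_zero power2_abs power_mono)
      then show "norm (w x * (f x)\<^sup>2) \<le> norm (B\<^sup>2 * w x)" using wpos[of x] by (simp add: abs_mult)
    qed
  qed
  have I0: "I f \<ge> 0" for f unfolding I_def by (intro Bochner_Integration.integral_nonneg mult_nonneg_nonneg less_imp_le[OF wpos] zero_le_power2)
  have IL: "I f \<le> L\<^sup>2 * W" if "f \<in> K n" for f n
  proof -
    have "I f \<le> (LINT x|lborel. L\<^sup>2 * w x)" unfolding I_def
    proof (rule integral_mono[OF iI[OF Kb[OF that]]])
      show "integrable lborel (\<lambda>x. L\<^sup>2 * w x)" using iw by simp
      fix x
      have "(f x)\<^sup>2 \<le> L\<^sup>2" using Kb(2)[OF that, of x] by (metis abs_ge_zero power2_abs power_mono)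
      then show "w x * (f x)\<^sup>2 \<le> L\<^sup>2 * w x" using wpos[of x] by simp
    qed
    then show ?thesis unfolding W_def by simp
  qed
  define m where "m n = Inf (I ` K n)" for n
  have bb: "bdd_below (I ` K n)" for n using I0 by (auto intro!: bdd_belowI)
  have ne: "I ` K n \<noteq> {}" for n using KD by auto
  have mle: "m n \<le> I f" if "f \<in> K n" for f n unfolding m_def using that bb by (intro cInf_lower) auto
  have mmono: "m n \<le> m k" if "n \<le> k" for n k
    unfolding m_def by (rule cInf_superset_mono[OF ne bb]) (use Kmono[OF that] in blast)
  have mub: "m n \<le> L\<^sup>2 * W" for n using mle[OF KD] IL[OF KD] by (rule order_trans)
  have "\<exists>f. f \<in> K n \<and> I f < m n + inverse (real (Suc n))" for n
    using cInf_lessD[OF ne, of n "m n + inverse (real (Suc n))"] unfolding m_def by auto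
  then obtain F where F: "\<And>n. F n \<in> K n" "\<And>n. I (F n) < m n + inverse (real (Suc n))" by metis
  have Fm: "F n \<in> borel_measurable borel" and Fb: "\<bar>F n x\<bar> \<le> L" for n x using Kb F(1) by blast+
  note [measurable] = Fm
  have "incseq m" using mmono by (simp add: incseq_def)
  then obtain m0 where "m \<longlonglongrightarrow> m0"
    using incseq_convergent[of m "L\<^sup>2 * W"] mub by metis
  then have "Cauchy m" by (rule LIMSEQ_imp_Cauchy)
  \<comment> \<open>The midpoint of \<open>F n\<close> and \<open>F k\<close> lies in
    \<open>K n\<close>, so its energy is at least \<open>m n\<close>; the near-minimality of both
    functions bounds the rest.\<close>
  have par: "(LINT x|lborel. w x * (F n x - F k x)\<^sup>2) \<le> 2 * (m k - m n) + 4 * inverse (real (Suc n))" if nk: "n \<le> k" for n k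
  proof -
    have Fk: "F k \<in> K n" using F(1) Kmono[OF nk] by blast
    have c: "m n \<le> I (\<lambda>x. (F n x + F k x) / 2)" by (rule mle[OF Kconv[OF F(1) Fk]])
    have id: "w x * (F n x - F k x)\<^sup>2 = 2 * (w x * (F n x)\<^sup>2) + 2 * (w x * (F k x)\<^sup>2) - 4 * (w x * ((F n x + F k x) / 2)\<^sup>2)" for x
      by (simp add: power2_eq_square field_simps)
    have "(LINT x|lborel. w x * (F n x - F k x)\<^sup>2) = 2 * I (F n) + 2 * I (F k) - 4 * I (\<lambda>x. (F n x + F k x) / 2)"
      unfolding id I_def using iI[OF Fm Fb] iI[OF Kb[OF Kconv[OF F(1) Fk]]] by simp
    also have "\<dots> \<le> 2 * (m n + inverse (real (Suc n))) + 2 * (m k + inverse (real (Suc k))) - 4 * m n"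
      by (intro diff_mono add_mono mult_left_mono c less_imp_le[OF F(2)]) auto
    also have "\<dots> \<le> 2 * (m k - m n) + 4 * inverse (real (Suc n))"
    proof -
      have "inverse (real (Suc k)) \<le> inverse (real (Suc n))" using nk by (intro le_imp_inverse_le) auto
      moreover have "2 * (A + p) + 2 * (B + q) - 4 * A \<le> 2 * (B - A) + 4 * p" if "q \<le> p" for A B p q :: real
        using that by simp
      ultimately show ?thesis by blast
    qed
    finally show ?thesis .
  qed
  have iwF: "integrable lborel (\<lambda>x. w x * F n x)" for n
    using integrable_bounded_mult[OF iw Fm Fb] by (simp add: mult.commute)
  have iwd: "integrable lborel (\<lambda>x. w x * \<bar>F n x - F k x\<bar>)" for n k
  proof -
    have "integrable lborel (\<lambda>x. \<bar>w x * F n x - w x * F k x\<bar>)" using iwF by auto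
    moreover have "\<bar>w x * F n x - w x * F k x\<bar> = w x * \<bar>F n x - F k x\<bar>" for x
      using wpos[of x] by (simp add: right_diff_distrib[symmetric] abs_mult)
    ultimately show ?thesis by simp
  qed
  \<comment> \<open>Passage from weighted L2 to weighted L1 distance, in order to extract a
    subsequence converging almost everywhere; \<open>\<eta>\<close> balances the total weight
    \<open>W\<close> against the L2 distance.\<close>
  have small: "(LINT x|lborel. w x * \<bar>F n x - F k x\<bar>) \<le> \<eta> * W + (LINT x|lborel. w x * (F n x - F k x)\<^sup>2) / \<eta>" if "\<eta> > 0" for n k \<eta>
  proof -
    have i2: "integrable lborel (\<lambda>x. w x * (F n x - F k x)\<^sup>2)"
    proof (rule iI[where B="2 * L"])
      show "\<bar>F n x - F k x\<bar> \<le> 2 * L" for x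
        using abs_triangle_ineq4[of "F n x" "F k x"] Fb[of n x] Fb[of k x] by linarith
    qed measurable
    have "(LINT x|lborel. w x * \<bar>F n x - F k x\<bar>) \<le> (LINT x|lborel. \<eta> * w x + (w x * (F n x - F k x)\<^sup>2) / \<eta>)"
    proof (rule integral_mono[OF iwd])
      show "integrable lborel (\<lambda>x. \<eta> * w x + (w x * (F n x - F k x)\<^sup>2) / \<eta>)" using iw i2 by auto
      fix x
      have "0 \<le> (\<bar>F n x - F k x\<bar> - \<eta>)\<^sup>2 + \<eta> * \<bar>F n x - F k x\<bar>" using that by simp
      also have "\<dots> = (F n x - F k x)\<^sup>2 + \<eta>\<^sup>2 - \<eta> * \<bar>F n x - F k x\<bar>" by (simp add: power2_diff)
      finally have "\<eta> * \<bar>F n x - F k x\<bar> \<le> (F n x - F k x)\<^sup>2 + \<eta>\<^sup>2" by simp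
      then have "\<bar>F n x - F k x\<bar> \<le> \<eta> + (F n x - F k x)\<^sup>2 / \<eta>" using that by (simp add: field_simps power2_eq_square)
      then have "w x * \<bar>F n x - F k x\<bar> \<le> w x * (\<eta> + (F n x - F k x)\<^sup>2 / \<eta>)" using wpos[of x] by simp
      then show "w x * \<bar>F n x - F k x\<bar> \<le> \<eta> * w x + (w x * (F n x - F k x)\<^sup>2) / \<eta>" by (simp add: algebra_simps)
    qed
    also have "\<dots> = \<eta> * W + (LINT x|lborel. w x * (F n x - F k x)\<^sup>2) / \<eta>" unfolding W_def using iw i2 by simp
    finally show ?thesis .
  qed
  have cau: "\<exists>N. \<forall>n\<ge>N. \<forall>k\<ge>N. (LINT x|lborel. norm (w x * F n x - w x * F k x)) < e" if e: "e > 0" for e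
  proof -
    \<comment> \<open>The first summand of \<open>small\<close> receives a quarter of
      \<open>e\<close>, and \<open>\<delta>\<close> makes the second at most
      \<open>6 * e / 16\<close>.\<close>
    define \<eta> where "\<eta> = e / (4 * (W + 1))"
    have h: "\<eta> > 0" "\<eta> * W \<le> e / 4" unfolding \<eta>_def using e W0 by (auto simp: field_simps)
    define \<delta> where "\<delta> = \<eta> * e / 16"
    have d: "\<delta> > 0" unfolding \<delta>_def using h e by simp
    obtain N1 where N1: "\<And>n k. n \<ge> N1 \<Longrightarrow> k \<ge> N1 \<Longrightarrow> \<bar>m n - m k\<bar> < \<delta>"
      using \<open>Cauchy m\<close> d unfolding Cauchy_def dist_real_def by blast
    obtain N2 where N2: "\<And>n. n \<ge> N2 \<Longrightarrow> inverse (real (Suc n)) < \<delta>"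
      using LIMSEQ_D[OF LIMSEQ_inverse_real_of_nat d] by auto
    have main: "(LINT x|lborel. w x * \<bar>F n x - F k x\<bar>) < e" if "n \<ge> max N1 N2" "n \<le> k" for n k
    proof -
      have "(LINT x|lborel. w x * (F n x - F k x)\<^sup>2) \<le> 2 * \<delta> + 4 * \<delta>"
      proof -
        have "2 * (m k - m n) + 4 * inverse (real (Suc n)) \<le> 2 * \<delta> + 4 * \<delta>"
          using N1[of k n] that by (intro add_mono mult_left_mono less_imp_le[OF N2]) (auto simp: abs_less_iff)
        then show ?thesis using par[OF that(2)] by (rule order_trans[rotated])
      qed
      then have "(LINT x|lborel. w x * (F n x - F k x)\<^sup>2) / \<eta> \<le> 6 * \<delta> / \<eta>" using h by (simp add: divide_right_mono)
      also have "\<dots> = 6 * e / 16" unfolding \<delta>_def using h by simp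
      finally show ?thesis using small[OF h(1), of n k] h(2) e by linarith
    qed
    have eq: "norm (w x * F n x - w x * F k x) = w x * \<bar>F n x - F k x\<bar>" for n k x
      using wpos[of x] by (simp add: right_diff_distrib[symmetric] abs_mult)
    show ?thesis unfolding eq
    proof (intro exI[of _ "max N1 N2"] allI impI)
      fix n k assume nk: "max N1 N2 \<le> n" "max N1 N2 \<le> k"
      show "(LINT x|lborel. w x * \<bar>F n x - F k x\<bar>) < e"
      proof (cases "n \<le> k")
        case True
        then show ?thesis using main nk by blast
      next
        case False
        then have "(LINT x|lborel. w x * \<bar>F k x - F n x\<bar>) < e" using main[of k n] nk by simp
        then show ?thesis by (simp add: abs_minus_commute)
      qed
    qed
  qed
  obtain r where r: "strict_mono r" "AE x in lborel. Cauchy (\<lambda>j. w x * F (r j) x)"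
    using cauchy_L1_AE_cauchy_subseq[OF iwF cau] by blast
  \<comment> \<open>The truncation gives the bound \<open>L\<close> at every point, also where the
    limit does not exist, and changes nothing where the sequence converges.\<close>
  define g where "g x = max (- L) (min L (lim (\<lambda>j. F (r j) x)))" for x
  have gm: "g \<in> borel_measurable borel" unfolding g_def[abs_def] by measurable
  have gb: "\<bar>g x\<bar> \<le> L" for x unfolding g_def using L by auto
  have gl: "AE x in lborel. (\<lambda>j. F (r j) x) \<longlonglongrightarrow> g x"
    using r(2)
  proof eventually_elim
    case (elim x)
    then have "convergent (\<lambda>j. w x * F (r j) x)" by (rule Cauchy_convergent)
    then obtain l where "(\<lambda>j. w x * F (r j) x) \<longlonglongrightarrow> l" unfolding convergent_def by blast
    then have "(\<lambda>j. w x * F (r j) x / w x) \<longlonglongrightarrow> l / w x" by (intro tendsto_divide) (use wpos[of x] in auto)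
    then have 1: "(\<lambda>j. F (r j) x) \<longlonglongrightarrow> l / w x" using wpos[of x] by simp
    then have "(\<lambda>j. max (- L) (min L (F (r j) x))) \<longlonglongrightarrow> max (- L) (min L (l / w x))" by (intro tendsto_intros)
    moreover have "max (- L) (min L (F (r j) x)) = F (r j) x" for j using Fb[of "r j" x] by auto
    moreover have "lim (\<lambda>j. F (r j) x) = l / w x" using 1 by (rule limI)
    ultimately show ?case unfolding g_def by simp
  qed
  have "(LINT x|lborel. a x * \<phi>' x) = - (LINT x|lborel. g x * \<phi> x)" if T: "test_pair i \<phi> \<phi>'" for \<phi> \<phi>'
  proof -
    have [measurable]: "\<phi> \<in> borel_measurable borel" using ip[OF T] by auto
    have 1: "(\<lambda>j. LINT x|lborel. F (r j) x * \<phi> x) \<longlonglongrightarrow> (LINT x|lborel. g x * \<phi> x)"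
    proof (rule integral_dominated_convergence[where w="\<lambda>x. L * \<bar>\<phi> x\<bar>"])
      show "(\<lambda>x. g x * \<phi> x) \<in> borel_measurable lborel" using gm by measurable
      show "(\<lambda>x. F (r j) x * \<phi> x) \<in> borel_measurable lborel" for j by measurable
      show "integrable lborel (\<lambda>x. L * \<bar>\<phi> x\<bar>)" using ip[OF T] by auto
      show "AE x in lborel. (\<lambda>j. F (r j) x * \<phi> x) \<longlonglongrightarrow> g x * \<phi> x"
        using gl by eventually_elim (intro tendsto_intros)
      show "AE x in lborel. norm (F (r j) x * \<phi> x) \<le> L * \<bar>\<phi> x\<bar>" for j
        using Fb by (auto simp: abs_mult intro!: mult_right_mono)
    qed
    have 2: "(\<lambda>j. (LINT x|lborel. F (r j) x * \<phi> x) + t \<phi>') \<longlonglongrightarrow> 0"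
    proof (rule LIMSEQ_I)
      fix e :: real assume e: "e > 0"
      then have "e / 2 > 0" by simp
      from LIMSEQ_D[OF lim[OF T] this] obtain n0 where n0: "\<And>n. n \<ge> n0 \<Longrightarrow> \<bar>(LINT x|lborel. D n x * \<phi> x) + t \<phi>'\<bar> < e / 2" by auto
      have "norm ((LINT x|lborel. F (r j) x * \<phi> x) + t \<phi>' - 0) < e" if "j \<ge> n0" for j
      proof -
        have rj: "r j \<ge> n0" using seq_suble[OF r(1), of j] that by simp
        have "\<forall>k\<ge>r j. \<bar>(LINT x|lborel. D k x * \<phi> x) + t \<phi>'\<bar> \<le> e / 2" using n0 rj by (auto intro: less_imp_le)
        then have "\<bar>(LINT x|lborel. F (r j) x * \<phi> x) + t \<phi>'\<bar> \<le> e / 2"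
          using F(1)[of "r j"] T unfolding K_def by blast
        then show ?thesis using e by simp
      qed
      then show "\<exists>n0. \<forall>j\<ge>n0. norm ((LINT x|lborel. F (r j) x * \<phi> x) + t \<phi>' - 0) < e" by blast
    qed
    have "(\<lambda>j. (LINT x|lborel. F (r j) x * \<phi> x) + t \<phi>') \<longlonglongrightarrow> (LINT x|lborel. g x * \<phi> x) + t \<phi>'"
      by (intro tendsto_intros 1)
    from LIMSEQ_unique[OF this 2] show ?thesis unfolding t_def by simp
  qed
  then show ?thesis using gm gb by blast
qed

lemma complex_has_grad:
  fixes \<phi> :: "real ^ 'n::finite \<Rightarrow> complex"
  assumes "\<And>x. \<phi> differentiable (at x)"
  shows "has_grad (\<lambda>x. Re (\<phi> x)) (\<lambda>i x. Re (partial_deriv i \<phi> x))"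
    and "has_grad (\<lambda>x. Im (\<phi> x)) (\<lambda>i x. Im (partial_deriv i \<phi> x))"
proof -
  have d: "(\<phi> has_derivative frechet_derivative \<phi> (at x)) (at x)" for x
    using assms frechet_derivative_works by blast
  have e: "frechet_derivative \<phi> (at x) h = (\<Sum>i\<in>UNIV. h $ i *\<^sub>R partial_deriv i \<phi> x)" for x h
  proof -
    interpret l: linear "frechet_derivative \<phi> (at x)" using has_derivative_linear[OF d] .
    have "h = (\<Sum>i\<in>UNIV. h $ i *\<^sub>R axis i 1)"
      using basis_expansion[of h] by (simp add: scalar_mult_eq_scaleR)
    then have "frechet_derivative \<phi> (at x) h = frechet_derivative \<phi> (at x) (\<Sum>i\<in>UNIV. h $ i *\<^sub>R axis i 1)" by simp
    then show ?thesis unfolding partial_deriv_def by (simp add: l.sum l.scaleR)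
  qed
  show "has_grad (\<lambda>x. Re (\<phi> x)) (\<lambda>i x. Re (partial_deriv i \<phi> x))" unfolding has_grad_def
  proof
    fix x
    show "((\<lambda>x. Re (\<phi> x)) has_derivative (\<lambda>h. \<Sum>i\<in>UNIV. Re (partial_deriv i \<phi> x) * h $ i)) (at x)"
      by (rule has_derivative_eq_rhs[OF bounded_linear.has_derivative[OF bounded_linear_Re d]])
        (simp add: e fun_eq_iff mult.commute)
  qed
  show "has_grad (\<lambda>x. Im (\<phi> x)) (\<lambda>i x. Im (partial_deriv i \<phi> x))" unfolding has_grad_def
  proof
    fix x
    show "((\<lambda>x. Im (\<phi> x)) has_derivative (\<lambda>h. \<Sum>i\<in>UNIV. Im (partial_deriv i \<phi> x) * h $ i)) (at x)"
      by (rule has_derivative_eq_rhs[OF bounded_linear.has_derivative[OF bounded_linear_Im d]])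
        (simp add: e fun_eq_iff mult.commute)
  qed
qed

lemma test_function_pairs:
  fixes \<phi> :: "real ^ 'n::finite \<Rightarrow> complex"
  assumes "test_function \<Omega> \<phi>"
  defines "S \<equiv> closure {x. \<phi> x \<noteq> 0}"
  shows "test_pair i (\<lambda>x. Re (\<phi> x)) (\<lambda>x. Re (partial_deriv i \<phi> x))"
    and "test_pair i (\<lambda>x. Im (\<phi> x)) (\<lambda>x. Im (partial_deriv i \<phi> x))"
    and "x \<notin> S \<Longrightarrow> \<phi> x = 0" and "x \<notin> S \<Longrightarrow> partial_deriv i \<phi> x = 0"
    and "compact S" and "S \<subseteq> \<Omega>" and "continuous_on UNIV \<phi>" and "continuous_on UNIV (partial_deriv i \<phi>)"
proof -
  have sm: "smooth \<phi>" and c: "compact S" and s: "S \<subseteq> \<Omega>" using assms unfolding test_function_def by auto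
  show "compact S" "S \<subseteq> \<Omega>" by fact+
  have diff: "\<phi> differentiable (at x)" "partial_deriv i \<phi> differentiable (at x)" for x
    using sm smooth_partial_deriv smooth_differentiable by blast+
  show c1: "continuous_on UNIV \<phi>" and c2: "continuous_on UNIV (partial_deriv i \<phi>)"
    using diff by (auto intro!: continuous_at_imp_continuous_on differentiable_imp_continuous_within)
  have z: "\<phi> x = 0" if "x \<notin> S" for x using that closure_subset[of "{x. \<phi> x \<noteq> 0}"] unfolding S_def by blast
  show "x \<notin> S \<Longrightarrow> \<phi> x = 0" by (rule z)
  note g = complex_has_grad[OF diff(1)]
  have op: "open (- S)" unfolding S_def by (simp add: open_Compl)
  have z': "Re (partial_deriv i \<phi> x) = 0 \<and> Im (partial_deriv i \<phi> x) = 0" if "x \<notin> S" for x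
    using has_grad_zero_open[OF g(1) op, of x i] has_grad_zero_open[OF g(2) op, of x i] z that by simp
  then show "x \<notin> S \<Longrightarrow> partial_deriv i \<phi> x = 0" by (simp add: complex_eq_iff)
  obtain \<rho> where "\<forall>x\<in>S. norm x \<le> \<rho>" using compact_imp_bounded[OF c] bounded_iff by blast
  then have b: "\<phi> x = 0" if "norm x > \<rho>" for x using z[of x] that by fastforce
  have "continuous_on UNIV (\<lambda>x. Re (partial_deriv i \<phi> x))" "continuous_on UNIV (\<lambda>x. Im (partial_deriv i \<phi> x))"
    using c2 by (auto intro: continuous_intros)
  then show "test_pair i (\<lambda>x. Re (\<phi> x)) (\<lambda>x. Re (partial_deriv i \<phi> x))"
    "test_pair i (\<lambda>x. Im (\<phi> x)) (\<lambda>x. Im (partial_deriv i \<phi> x))"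
    unfolding test_pair_def using g b
    by (intro exI[of _ "\<lambda>i x. Re (partial_deriv i \<phi> x)"] exI[of _ "\<lambda>i x. Im (partial_deriv i \<phi> x)"] exI[of _ \<rho>]; simp)+
qed

lemma test_pair_bounded:
  fixes a :: "real ^ 'n::finite \<Rightarrow> real"
  assumes T: "test_pair i \<phi> \<phi>'" and a: "continuous_on UNIV a"
  obtains M where "\<And>x. \<bar>a x * \<phi> x\<bar> \<le> M" "\<And>x. \<bar>a x * \<phi>' x\<bar> \<le> M"
proof -
  obtain \<Phi> r where P: "has_grad \<phi> \<Phi>" "\<phi>' = \<Phi> i" "continuous_on UNIV (\<Phi> i)" "\<And>x. norm x > r \<Longrightarrow> \<phi> x = 0"
    using T unfolding test_pair_def by blast
  have z: "\<Phi> i x = 0" if "norm x > r" for x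
    using has_grad_zero_outside[OF P(1), where ctr=0 and r=r and x=x] P(4) that by simp
  have 1: "continuous_on UNIV (\<lambda>x. a x * \<phi> x)" by (intro continuous_intros a has_grad_continuous[OF P(1)])
  obtain M1 where M1: "\<And>x. \<bar>a x * \<phi> x\<bar> \<le> M1"
    by (rule compact_supp_bounded[OF 1, of r]) (use P(4) in auto)
  have 2: "continuous_on UNIV (\<lambda>x. a x * \<phi>' x)" using P by (auto intro!: continuous_intros a)
  obtain M2 where M2: "\<And>x. \<bar>a x * \<phi>' x\<bar> \<le> M2"
    by (rule compact_supp_bounded[OF 2, of r]) (use z P(2) in auto)
  show ?thesis by (rule that[of "max M1 M2"]) (use M1 M2 in \<open>auto simp: le_max_iff_disj\<close>)
qed

text \<open>A mollification \<open>u\<close> of \<open>f0\<close> is differentiable, so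
  \<open>u * \<phi>\<close> may be tested against the weak derivative \<open>g\<close> of
  \<open>a\<close>; where \<open>\<phi>\<close> lives, the derivative of \<open>u\<close> is the
  mollification of \<open>h0\<close>. Convergence of both mollifications in L1 gives the identity in
  the limit.\<close>

lemma product_rule_real:
  fixes a g f0 h0 \<phi> \<phi>' :: "real ^ 'n::finite \<Rightarrow> real"
  assumes ca: "continuous_on UNIV a"
    and g: "g \<in> borel_measurable borel" "\<And>x. \<bar>g x\<bar> \<le> L"
      "\<And>\<phi> \<phi>'. test_pair i \<phi> \<phi>' \<Longrightarrow> (LINT x|lborel. a x * \<phi>' x) = - (LINT x|lborel. g x * \<phi> x)"
    and f: "integrable lborel f0" "integrable lborel h0"
    and e: "e > 0"
    and H: "\<And>r \<epsilon> R x. mollifier \<epsilon> r \<Longrightarrow> \<epsilon> < e \<Longrightarrow> has_grad r R \<Longrightarrow> x \<in> S \<Longrightarrow> conv (R i) f0 x = conv r h0 x"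
    and T: "test_pair i \<phi> \<phi>'" and z: "\<And>x. x \<notin> S \<Longrightarrow> \<phi> x = 0"
  shows "integrable lborel (\<lambda>x. a x * f0 x * \<phi>' x)" "integrable lborel (\<lambda>x. (g x * f0 x + a x * h0 x) * \<phi> x)"
    "(LINT x|lborel. a x * f0 x * \<phi>' x) + (LINT x|lborel. (g x * f0 x + a x * h0 x) * \<phi> x) = 0"
proof -
  obtain \<Phi> \<rho> where P: "has_grad \<phi> \<Phi>" "\<phi>' = \<Phi> i" "continuous_on UNIV (\<Phi> i)" "\<And>x. norm x > \<rho> \<Longrightarrow> \<phi> x = 0"
    using T unfolding test_pair_def by blast
  obtain M1 where M1: "\<And>x. \<bar>a x * \<phi> x\<bar> \<le> M1" "\<And>x. \<bar>a x * \<phi>' x\<bar> \<le> M1" using test_pair_bounded[OF T ca] by blast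
  obtain M2 where M2: "\<And>x. \<bar>\<phi> x\<bar> \<le> M2" using test_pair_bounded[OF T continuous_on_const[of UNIV 1]] by (metis mult_1)
  have L0: "L \<ge> 0" using g(2)[of 0] by linarith
  have M20: "M2 \<ge> 0" using M2[of 0] by linarith
  define M where "M = M1 + L * M2"
  have b1: "\<bar>a x * \<phi> x\<bar> \<le> M" "\<bar>a x * \<phi>' x\<bar> \<le> M" "\<bar>g x * \<phi> x\<bar> \<le> M" for x
  proof -
    have "\<bar>g x * \<phi> x\<bar> \<le> L * M2" unfolding abs_mult by (intro mult_mono g(2) M2) (use L0 in auto)
    then show "\<bar>a x * \<phi> x\<bar> \<le> M" "\<bar>a x * \<phi>' x\<bar> \<le> M" "\<bar>g x * \<phi> x\<bar> \<le> M"
      using M1[of x] L0 M20 mult_nonneg_nonneg[OF L0 M20] unfolding M_def by linarith+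
  qed
  have M0: "M \<ge> 0" using b1(1)[of 0] by linarith
  have [measurable]: "a \<in> borel_measurable borel" "\<phi> \<in> borel_measurable borel" "\<phi>' \<in> borel_measurable borel" "g \<in> borel_measurable borel"
    using ca P g(1) has_grad_continuous[OF P(1)] by (auto intro: borel_measurable_continuous_onI)
  have m: "(\<lambda>x. a x * \<phi> x) \<in> borel_measurable borel" "(\<lambda>x. a x * \<phi>' x) \<in> borel_measurable borel" "(\<lambda>x. g x * \<phi> x) \<in> borel_measurable borel"
    by measurable
  have ib: "integrable lborel (\<lambda>x. a x * \<phi> x * u x)" "integrable lborel (\<lambda>x. a x * \<phi>' x * u x)" "integrable lborel (\<lambda>x. g x * \<phi> x * u x)"
    if "integrable lborel u" for u
    by (rule integrable_bounded_mult[OF that m(1) b1(1)] integrable_bounded_mult[OF that m(2) b1(2)] integrable_bounded_mult[OF that m(3) b1(3)])+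
  have e1: "a x * f0 x * \<phi>' x = a x * \<phi>' x * f0 x" for x by simp
  have e2: "(g x * f0 x + a x * h0 x) * \<phi> x = g x * \<phi> x * f0 x + a x * \<phi> x * h0 x" for x by (simp add: algebra_simps)
  show "integrable lborel (\<lambda>x. a x * f0 x * \<phi>' x)" unfolding e1 using ib f by auto
  show "integrable lborel (\<lambda>x. (g x * f0 x + a x * h0 x) * \<phi> x)" unfolding e2 using ib f by auto
  \<comment> \<open>The defect of the identity; mollification changes each of its three integrals by
    at most \<open>M * e'\<close>.\<close>
  define X where "X = (LINT x|lborel. a x * \<phi>' x * f0 x) + (LINT x|lborel. g x * \<phi> x * f0 x) + (LINT x|lborel. a x * \<phi> x * h0 x)"
  have Xle: "\<bar>X\<bar> \<le> 3 * M * e'" if e': "e' > 0" for e'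
  proof -
    from conv_L1_close[OF f(1) e'] obtain d1 where d1: "d1 > 0" "\<And>r \<epsilon>. mollifier \<epsilon> r \<Longrightarrow> \<epsilon> < d1 \<Longrightarrow> integrable lborel (\<lambda>x. \<bar>conv r f0 x - f0 x\<bar>) \<and> (LINT x|lborel. \<bar>conv r f0 x - f0 x\<bar>) \<le> e'" by blast
    from conv_L1_close[OF f(2) e'] obtain d2 where d2: "d2 > 0" "\<And>r \<epsilon>. mollifier \<epsilon> r \<Longrightarrow> \<epsilon> < d2 \<Longrightarrow> integrable lborel (\<lambda>x. \<bar>conv r h0 x - h0 x\<bar>) \<and> (LINT x|lborel. \<bar>conv r h0 x - h0 x\<bar>) \<le> e'" by blast
    define \<epsilon> where "\<epsilon> = min (min d1 d2) e / 2"
    have ep: "\<epsilon> > 0" "\<epsilon> < d1" "\<epsilon> < d2" "\<epsilon> < e" unfolding \<epsilon>_def using d1(1) d2(1) e by auto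
    obtain r :: "real ^ 'n \<Rightarrow> real" where r: "mollifier \<epsilon> r"
      using mollifier_exists[OF ep(1)] unfolding mollifier_def by blast
    obtain R where R: "has_grad r R" "\<And>i. bumpy (R i)" using bumpy_jet[OF mollifierD(1)[OF r]] by blast
    define u where "u = conv r f0"
    define w where "w = conv r h0"
    have [measurable]: "u \<in> borel_measurable borel" "w \<in> borel_measurable borel" unfolding u_def w_def
      using conv_measurable[OF r] f by auto
    have [measurable]: "f0 \<in> borel_measurable borel" "h0 \<in> borel_measurable borel" using f by auto
    have iu': "integrable lborel (\<lambda>x. u x - f0 x)" "integrable lborel (\<lambda>x. w x - h0 x)"
      using d1(2)[OF r ep(2)] d2(2)[OF r ep(3)] unfolding u_def[symmetric] w_def[symmetric]
      by (auto intro: integrable_norm_cancel[where f="\<lambda>x. u x - f0 x"] integrable_norm_cancel[where f="\<lambda>x. w x - h0 x"])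
    have iu: "integrable lborel u" "integrable lborel w"
      using Bochner_Integration.integrable_add[OF iu'(1) f(1)] Bochner_Integration.integrable_add[OF iu'(2) f(2)] by auto
    have gu: "has_grad u (\<lambda>i. conv (R i) f0)" unfolding u_def
      by (rule conv_has_grad[OF R(1) bumpy_continuous[OF R(2)] mollifierD(3)[OF r] f(1)])
    have gup: "has_grad (\<lambda>x. u x * \<phi> x) (\<lambda>j x. conv (R j) f0 x * \<phi> x + u x * \<Phi> j x)" by (intro has_grad_mult gu P)
    have cR: "continuous_on UNIV (conv (R i) f0)"
    proof (rule smooth_fn_continuous[OF conv_smooth_fn[OF R(2) _ f(1)]])
      show "R i x = 0" if "norm x > \<epsilon>" for x
        using has_grad_zero_outside[OF R(1), where ctr=0 and r=\<epsilon> and x=x] mollifierD(3)[OF r] that by simp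
    qed
    \<comment> \<open>Products of this kind are the reason why \<open>test_pair\<close> asks for a
      gradient with one continuous component, and not for smoothness.\<close>
    have T': "test_pair i (\<lambda>x. u x * \<phi> x) (\<lambda>x. conv (R i) f0 x * \<phi> x + u x * \<Phi> i x)"
      unfolding test_pair_def
      by (rule exI[of _ "\<lambda>j x. conv (R j) f0 x * \<phi> x + u x * \<Phi> j x"], rule exI[of _ \<rho>])
         (use gup P cR has_grad_continuous[OF gu] has_grad_continuous[OF P(1)] in \<open>auto intro!: continuous_intros\<close>)
    have eq: "conv (R i) f0 x * \<phi> x = w x * \<phi> x" for x
      using H[OF r ep(4) R(1), of x] z[of x] unfolding w_def by (cases "x \<in> S") auto
    have "(LINT x|lborel. a x * (w x * \<phi> x + u x * \<phi>' x)) = - (LINT x|lborel. g x * (u x * \<phi> x))"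
      using g(3)[OF T'] unfolding eq P(2) .
    also have "(LINT x|lborel. a x * (w x * \<phi> x + u x * \<phi>' x)) = (LINT x|lborel. a x * \<phi> x * w x + a x * \<phi>' x * u x)"
      by (intro Bochner_Integration.integral_cong refl) (simp add: algebra_simps)
    also have "\<dots> = (LINT x|lborel. a x * \<phi> x * w x) + (LINT x|lborel. a x * \<phi>' x * u x)"
      using ib iu by simp
    also have "(LINT x|lborel. g x * (u x * \<phi> x)) = (LINT x|lborel. g x * \<phi> x * u x)"
      by (intro Bochner_Integration.integral_cong refl) simp
    finally have 0: "(LINT x|lborel. a x * \<phi> x * w x) + (LINT x|lborel. a x * \<phi>' x * u x) + (LINT x|lborel. g x * \<phi> x * u x) = 0" by simp
    have bd: "\<bar>(LINT x|lborel. b x * p x) - (LINT x|lborel. b x * q x)\<bar> \<le> M * e'"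
      if "integrable lborel (\<lambda>x. b x * p x)" "integrable lborel (\<lambda>x. b x * q x)" "\<And>x. \<bar>b x\<bar> \<le> M"
        "integrable lborel (\<lambda>x. \<bar>q x - p x\<bar>)" "(LINT x|lborel. \<bar>q x - p x\<bar>) \<le> e'" for b p q :: "real ^ 'n \<Rightarrow> real"
    proof -
      have "(LINT x|lborel. b x * p x) - (LINT x|lborel. b x * q x) = (LINT x|lborel. b x * p x - b x * q x)" using that by simp
      also have "\<bar>\<dots>\<bar> \<le> (LINT x|lborel. \<bar>b x * p x - b x * q x\<bar>)" by (rule integral_abs_bound)
      also have "\<dots> \<le> (LINT x|lborel. M * \<bar>q x - p x\<bar>)"
      proof (rule integral_mono)
        show "integrable lborel (\<lambda>x. \<bar>b x * p x - b x * q x\<bar>)" using that by auto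
        show "integrable lborel (\<lambda>x. M * \<bar>q x - p x\<bar>)" using that by auto
        show "\<bar>b x * p x - b x * q x\<bar> \<le> M * \<bar>q x - p x\<bar>" for x
          unfolding right_diff_distrib[symmetric] abs_mult abs_minus_commute[of "p x"] by (intro mult_right_mono that) auto
      qed
      also have "\<dots> \<le> M * e'" using that M0 by (simp add: mult_left_mono)
      finally show ?thesis .
    qed
    have "\<bar>(LINT x|lborel. a x * \<phi>' x * f0 x) - (LINT x|lborel. a x * \<phi>' x * u x)\<bar> \<le> M * e'"
      by (rule bd) (use ib f iu b1 d1(2)[OF r ep(2)] in \<open>auto simp: u_def\<close>)
    moreover have "\<bar>(LINT x|lborel. g x * \<phi> x * f0 x) - (LINT x|lborel. g x * \<phi> x * u x)\<bar> \<le> M * e'"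
      by (rule bd) (use ib f iu b1 d1(2)[OF r ep(2)] in \<open>auto simp: u_def\<close>)
    moreover have "\<bar>(LINT x|lborel. a x * \<phi> x * h0 x) - (LINT x|lborel. a x * \<phi> x * w x)\<bar> \<le> M * e'"
      by (rule bd) (use ib f iu b1 d2(2)[OF r ep(3)] in \<open>auto simp: w_def\<close>)
    ultimately show ?thesis using 0 unfolding X_def by linarith
  qed
  have "\<bar>X\<bar> \<le> 0"
  proof (rule field_le_epsilon)
    fix d :: real assume d: "d > 0"
    have "\<bar>X\<bar> \<le> 3 * M * (d / (3 * M + 1))" by (rule Xle) (use d M0 in auto)
    also have "\<dots> = (3 * M / (3 * M + 1)) * d" by simp
    also have "\<dots> \<le> 1 * d" using M0 d by (intro mult_right_mono) auto
    finally show "\<bar>X\<bar> \<le> 0 + d" by simp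
  qed
  then show "(LINT x|lborel. a x * f0 x * \<phi>' x) + (LINT x|lborel. (g x * f0 x + a x * h0 x) * \<phi> x) = 0"
    unfolding e1 e2 using ib f unfolding X_def by simp
qed

lemma locally_integrable_bounded_mult:
  fixes f :: "'a::euclidean_space \<Rightarrow> complex"
  assumes f: "locally_integrable \<Omega> f" and g: "g \<in> borel_measurable borel"
    and b: "\<And>K. compact K \<Longrightarrow> \<exists>M. \<forall>x\<in>K. \<bar>g x\<bar> \<le> M"
  shows "locally_integrable \<Omega> (\<lambda>x. complex_of_real (g x) * f x)"
  unfolding locally_integrable_def
proof (intro allI impI)
  fix K assume K: "compact K" "K \<subseteq> \<Omega>"
  then have i: "integrable (lebesgue_on K) f" using f unfolding locally_integrable_def by blast
  obtain M where M: "\<forall>x\<in>K. \<bar>g x\<bar> \<le> M" using b K by blast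
  have [measurable]: "g \<in> borel_measurable (lebesgue_on K)"
    using g by (intro measurable_restrict_space1 measurable_completion) simp
  show "integrable (lebesgue_on K) (\<lambda>x. complex_of_real (g x) * f x)"
  proof (rule Bochner_Integration.integrable_bound[where f="\<lambda>x. M * norm (f x)"])
    show "integrable (lebesgue_on K) (\<lambda>x. M * norm (f x))" using i by auto
    show "(\<lambda>x. complex_of_real (g x) * f x) \<in> borel_measurable (lebesgue_on K)" using i by measurable
    show "AE x in lebesgue_on K. norm (complex_of_real (g x) * f x) \<le> norm (M * norm (f x))"
    proof (rule AE_I2)
      fix x assume "x \<in> space (lebesgue_on K)"
      then have "\<bar>g x\<bar> \<le> \<bar>M\<bar>" using M by (auto intro: order_trans[OF _ abs_ge_self])
      then show "norm (complex_of_real (g x) * f x) \<le> norm (M * norm (f x))"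
        by (simp add: norm_mult abs_mult mult_right_mono)
    qed
  qed
qed

lemma locally_integrable_add:
  "locally_integrable \<Omega> f \<Longrightarrow> locally_integrable \<Omega> g \<Longrightarrow> locally_integrable \<Omega> (\<lambda>x. f x + g x)"
  unfolding locally_integrable_def by auto

lemma continuous_locally_bounded:
  fixes a :: "'a::euclidean_space \<Rightarrow> real"
  assumes "continuous_on UNIV a" "compact K" shows "\<exists>M. \<forall>x\<in>K. \<bar>a x\<bar> \<le> M"
proof -
  have "compact (a ` K)" using assms by (auto intro: compact_continuous_image continuous_on_subset)
  then obtain B where "\<forall>y\<in>a ` K. \<bar>y\<bar> \<le> B" using compact_imp_bounded bounded_real by blast
  then show ?thesis by blast
qed

lemma borel_rep_product:
  assumes F: "borel_rep K F F0" and H: "borel_rep K H H0" and K: "compact K"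
    and ca: "continuous_on UNIV a" and g: "g \<in> borel_measurable borel" "\<And>x. \<bar>g x\<bar> \<le> L"
  shows "borel_rep K (\<lambda>x. complex_of_real (g x) * F x + complex_of_real (a x) * H x)
    (\<lambda>x. complex_of_real (g x) * F0 x + complex_of_real (a x) * H0 x)"
  unfolding borel_rep_def
proof (intro conjI allI impI)
  have i: "integrable lborel F0" "integrable lborel H0" and z: "\<And>x. x \<notin> K \<Longrightarrow> H0 x = 0" and zF: "\<And>x. x \<notin> K \<Longrightarrow> F0 x = 0"
    and ae: "AE x in lborel. x \<in> K \<longrightarrow> F0 x = F x" "AE x in lborel. x \<in> K \<longrightarrow> H0 x = H x"
    using F H unfolding borel_rep_def by auto
  have [measurable]: "F0 \<in> borel_measurable borel" "H0 \<in> borel_measurable borel" "a \<in> borel_measurable borel" "g \<in> borel_measurable borel"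
    using i ca g(1) by (auto intro: borel_measurable_continuous_onI)
  obtain M where M: "\<forall>x\<in>K. \<bar>a x\<bar> \<le> M" using continuous_locally_bounded[OF ca K] by blast
  have "integrable lborel (\<lambda>x. complex_of_real (g x) * F0 x)"
  proof (rule Bochner_Integration.integrable_bound[where f="\<lambda>x. L * norm (F0 x)"])
    show "integrable lborel (\<lambda>x. L * norm (F0 x))" using i by auto
    show "AE x in lborel. norm (complex_of_real (g x) * F0 x) \<le> norm (L * norm (F0 x))"
    proof (rule AE_I2)
      fix x
      have "\<bar>g x\<bar> \<le> \<bar>L\<bar>" using g(2)[of x] by linarith
      then show "norm (complex_of_real (g x) * F0 x) \<le> norm (L * norm (F0 x))"
        by (simp add: norm_mult abs_mult mult_right_mono)
    qed
  qed measurable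
  moreover have "integrable lborel (\<lambda>x. complex_of_real (a x) * H0 x)"
  proof (rule Bochner_Integration.integrable_bound[where f="\<lambda>x. M * norm (H0 x)"])
    show "integrable lborel (\<lambda>x. M * norm (H0 x))" using i by auto
    show "AE x in lborel. norm (complex_of_real (a x) * H0 x) \<le> norm (M * norm (H0 x))"
    proof (rule AE_I2)
      fix x
      show "norm (complex_of_real (a x) * H0 x) \<le> norm (M * norm (H0 x))"
      proof (cases "x \<in> K")
        case True
        then have "\<bar>a x\<bar> \<le> \<bar>M\<bar>" using M by (auto intro: order_trans[OF _ abs_ge_self])
        then show ?thesis by (simp add: norm_mult abs_mult mult_right_mono)
      qed (use z in simp)
    qed
  qed measurable
  ultimately show "integrable lborel (\<lambda>x. complex_of_real (g x) * F0 x + complex_of_real (a x) * H0 x)" by auto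
  show "AE x in lborel. x \<in> K \<longrightarrow> complex_of_real (g x) * F0 x + complex_of_real (a x) * H0 x = complex_of_real (g x) * F x + complex_of_real (a x) * H x"
    using ae by eventually_elim auto
  show "complex_of_real (g x) * F0 x + complex_of_real (a x) * H0 x = 0" if "x \<notin> K" for x using z[OF that] zF[OF that] by simp
qed

text \<open>\<open>g\<close> is the weak derivative of \<open>a\<close> on the whole space, hence
  chosen before \<open>\<Omega>\<close>, \<open>F\<close> and \<open>H\<close>. The complex identity
  is assembled from four real ones, pairing the real or imaginary part of \<open>F\<close> with that
  of the test function.\<close>

lemma lipschitz_product_rule:
  fixes a :: "real ^ 'n::finite \<Rightarrow> real"
  assumes lip: "\<And>x y. \<bar>a x - a y\<bar> \<le> L * norm (x - y)"
  shows "\<exists>g. (\<forall>x. \<bar>g x\<bar> \<le> L) \<and> (\<forall>\<Omega> F H. open \<Omega> \<longrightarrow> has_weak_deriv \<Omega> [i] F H \<longrightarrow>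
    has_weak_deriv \<Omega> [i] (\<lambda>x. complex_of_real (a x) * F x) (\<lambda>x. complex_of_real (g x) * F x + complex_of_real (a x) * H x))"
proof -
  obtain g where g: "g \<in> borel_measurable borel" "\<And>x. \<bar>g x\<bar> \<le> L"
     "\<And>\<phi> \<phi>'. test_pair i \<phi> \<phi>' \<Longrightarrow> (LINT x|lborel. a x * \<phi>' x) = - (LINT x|lborel. g x * \<phi> x)"
    using lipschitz_weak_deriv[OF lip, of i] by blast
  have L: "L \<ge> 0" using g(2)[of 0] by linarith
  have ca: "continuous_on UNIV a"
    by (rule lipschitz_on_continuous_on[of L]) (use lip L in \<open>auto intro!: lipschitz_onI simp: dist_norm\<close>)
  have am: "a \<in> borel_measurable borel" using ca by (rule borel_measurable_continuous_onI)
  have "has_weak_deriv \<Omega> [i] (\<lambda>x. complex_of_real (a x) * F x) (\<lambda>x. complex_of_real (g x) * F x + complex_of_real (a x) * H x)"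
    if O: "open \<Omega>" and w: "has_weak_deriv \<Omega> [i] F H" for \<Omega> F H
    unfolding has_weak_deriv_def
  proof (intro conjI allI impI)
    have li: "locally_integrable \<Omega> F" "locally_integrable \<Omega> H" using w unfolding has_weak_deriv_def by auto
    show liaF: "locally_integrable \<Omega> (\<lambda>x. complex_of_real (a x) * F x)"
      by (rule locally_integrable_bounded_mult[OF li(1) am continuous_locally_bounded[OF ca]])
    show liG: "locally_integrable \<Omega> (\<lambda>x. complex_of_real (g x) * F x + complex_of_real (a x) * H x)"
      by (intro locally_integrable_add locally_integrable_bounded_mult li am g(1) continuous_locally_bounded[OF ca])
        (use g(2) in blast)+
    fix \<phi> assume t: "test_function \<Omega> \<phi>"
    define S where "S = closure {x. \<phi> x \<noteq> 0}"
    note tf = test_function_pairs[OF t, folded S_def]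
    from compact_nbhd[OF O tf(5,6)] obtain K e where K: "compact K" "K \<subseteq> \<Omega>" "e > 0" "\<And>x. x \<in> S \<Longrightarrow> cball x e \<subseteq> K" by blast
    have SK: "S \<subseteq> K" using K(3,4) by (meson centre_in_cball less_imp_le subset_iff)
    obtain F0 where F0: "borel_rep K F F0" using locally_integrable_rep[OF li(1) K(1,2)] .
    obtain H0 where H0: "borel_rep K H H0" using locally_integrable_rep[OF li(2) K(1,2)] .
    have iF: "integrable lborel F0" "integrable lborel H0" using F0 H0 unfolding borel_rep_def by auto
    have [measurable]: "a \<in> borel_measurable borel" "g \<in> borel_measurable borel" "\<phi> \<in> borel_measurable borel" "partial_deriv i \<phi> \<in> borel_measurable borel"
      using am g(1) tf(7,8) by (auto intro: borel_measurable_continuous_onI)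
    have conv: "conv (R i) (\<lambda>y. Re (F0 y)) x = conv r (\<lambda>y. Re (H0 y)) x \<and> conv (R i) (\<lambda>y. Im (F0 y)) x = conv r (\<lambda>y. Im (H0 y)) x"
      if r: "mollifier \<epsilon> r" "\<epsilon> < e" "has_grad r R" "x \<in> S" for r \<epsilon> R x
    proof -
      have ball: "cball x \<epsilon> \<subseteq> K" using K(4)[OF r(4)] r(2) by (meson less_imp_le order_trans subset_cball)
      have z: "R i x = 0" if "norm x > \<epsilon>" for x
        using has_grad_zero_outside[OF r(3), where ctr=0 and r=\<epsilon> and x=x] mollifierD(3)[OF r(1)] that by simp
      obtain R' RR where J: "has_grad r R'" "\<And>i. bumpy (R' i)" "\<And>i. has_grad (R' i) (RR i)"
        using bumpy_jet[OF mollifierD(1)[OF r(1)]] by metis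
      have R': "R' = R" using has_grad_unique[OF J(1) r(3)] by blast
      have it: "iterated_partial [i] (\<lambda>y. complex_of_real (r (x - y))) = (\<lambda>y. (-1) ^ length [i] * complex_of_real (R i (x - y)))"
        using iterated_partial_reflect(2)[OF J(1,3)] unfolding R' by simp
      show ?thesis
        using weak_deriv_conv[OF w O K(1,2) F0 H0 mollifierD(1,3)[OF r(1)] ball bumpy_continuous[OF J(2)[unfolded R']] z it] by blast
    qed
    have X: "integrable lborel (\<lambda>x. a x * p x * q' x)" "integrable lborel (\<lambda>x. (g x * p x + a x * h x) * q x)"
        "(LINT x|lborel. a x * p x * q' x) + (LINT x|lborel. (g x * p x + a x * h x) * q x) = 0"
      if "(p, h) \<in> {(\<lambda>y. Re (F0 y), \<lambda>y. Re (H0 y)), (\<lambda>y. Im (F0 y), \<lambda>y. Im (H0 y))}"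
        "(q, q') \<in> {(\<lambda>x. Re (\<phi> x), \<lambda>x. Re (partial_deriv i \<phi> x)), (\<lambda>x. Im (\<phi> x), \<lambda>x. Im (partial_deriv i \<phi> x))}" for p h q q'
    proof -
      have ip: "integrable lborel p" "integrable lborel h" using that(1) iF by auto
      have c: "conv (R i) p x = conv r h x" if "mollifier \<epsilon> r" "\<epsilon> < e" "has_grad r R" "x \<in> S" for r \<epsilon> R x
        using conv[OF that] \<open>(p, h) \<in> _\<close> by auto
      have tp: "test_pair i q q'" using that(2) tf(1,2) by auto
      have z: "q x = 0" if "x \<notin> S" for x using tf(3)[OF that] \<open>(q, q') \<in> _\<close> by auto
      show "integrable lborel (\<lambda>x. a x * p x * q' x)"
        by (rule product_rule_real(1)[where S=S, OF ca g ip K(3) _ tp z]) (assumption | rule c)+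
      show "integrable lborel (\<lambda>x. (g x * p x + a x * h x) * q x)"
        by (rule product_rule_real(2)[where S=S, OF ca g ip K(3) _ tp z]) (assumption | rule c)+
      show "(LINT x|lborel. a x * p x * q' x) + (LINT x|lborel. (g x * p x + a x * h x) * q x) = 0"
        by (rule product_rule_real(3)[where S=S, OF ca g ip K(3) _ tp z]) (assumption | rule c)+
    qed
    have it: "iterated_partial [i] \<phi> = partial_deriv i \<phi>" by (simp add: iterated_partial_def)
    have L1: "(LINT x|lebesgue_on \<Omega>. complex_of_real (a x) * F x * iterated_partial [i] \<phi> x) = (LINT x|lborel. F0 x * (complex_of_real (a x) * partial_deriv i \<phi> x))"
    proof -
      have "(LINT x|lebesgue_on \<Omega>. complex_of_real (a x) * F x * iterated_partial [i] \<phi> x) = (LINT x|lebesgue_on \<Omega>. F x * (complex_of_real (a x) * partial_deriv i \<phi> x))"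
        unfolding it by (intro Bochner_Integration.integral_cong refl) (simp add: ac_simps)
      also have "\<dots> = (LINT x|lborel. F0 x * (complex_of_real (a x) * partial_deriv i \<phi> x))"
        by (rule borel_rep_integral[OF F0 K(1,2) O li(1)]) (use tf(4) SK in auto)
      finally show ?thesis .
    qed
    have L2: "(LINT x|lebesgue_on \<Omega>. (complex_of_real (g x) * F x + complex_of_real (a x) * H x) * \<phi> x)
      = (LINT x|lborel. (complex_of_real (g x) * F0 x + complex_of_real (a x) * H0 x) * \<phi> x)"
      by (rule borel_rep_integral[OF borel_rep_product[OF F0 H0 K(1) ca g(1,2)] K(1,2) O liG]) (use tf(3) SK in auto)
    define Z1 where "Z1 x = F0 x * (complex_of_real (a x) * partial_deriv i \<phi> x)" for x
    define Z2 where "Z2 x = (complex_of_real (g x) * F0 x + complex_of_real (a x) * H0 x) * \<phi> x" for x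
    have Z1: "Re (Z1 x) = a x * Re (F0 x) * Re (partial_deriv i \<phi> x) - a x * Im (F0 x) * Im (partial_deriv i \<phi> x)"
       "Im (Z1 x) = a x * Re (F0 x) * Im (partial_deriv i \<phi> x) + a x * Im (F0 x) * Re (partial_deriv i \<phi> x)" for x
      unfolding Z1_def by (simp_all add: algebra_simps)
    have Z2: "Re (Z2 x) = (g x * Re (F0 x) + a x * Re (H0 x)) * Re (\<phi> x) - (g x * Im (F0 x) + a x * Im (H0 x)) * Im (\<phi> x)"
       "Im (Z2 x) = (g x * Re (F0 x) + a x * Re (H0 x)) * Im (\<phi> x) + (g x * Im (F0 x) + a x * Im (H0 x)) * Re (\<phi> x)" for x
      unfolding Z2_def by (simp_all add: algebra_simps)
    note x11 = X[of "\<lambda>y. Re (F0 y)" "\<lambda>y. Re (H0 y)" "\<lambda>x. Re (\<phi> x)" "\<lambda>x. Re (partial_deriv i \<phi> x)", simplified]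
    note x12 = X[of "\<lambda>y. Re (F0 y)" "\<lambda>y. Re (H0 y)" "\<lambda>x. Im (\<phi> x)" "\<lambda>x. Im (partial_deriv i \<phi> x)", simplified]
    note x21 = X[of "\<lambda>y. Im (F0 y)" "\<lambda>y. Im (H0 y)" "\<lambda>x. Re (\<phi> x)" "\<lambda>x. Re (partial_deriv i \<phi> x)", simplified]
    note x22 = X[of "\<lambda>y. Im (F0 y)" "\<lambda>y. Im (H0 y)" "\<lambda>x. Im (\<phi> x)" "\<lambda>x. Im (partial_deriv i \<phi> x)", simplified]
    have ri: "integrable lborel (\<lambda>x. Re (Z1 x))" "integrable lborel (\<lambda>x. Im (Z1 x))" "integrable lborel (\<lambda>x. Re (Z2 x))" "integrable lborel (\<lambda>x. Im (Z2 x))"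
      unfolding Z1 Z2 using x11(1,2) x12(1,2) x21(1,2) x22(1,2) by auto
    have iZ: "integrable lborel Z1" "integrable lborel Z2"
    proof -
      have "integrable lborel (\<lambda>x. complex_of_real (Re (Z x)) + \<i> * complex_of_real (Im (Z x)))"
        if "integrable lborel (\<lambda>x. Re (Z x))" "integrable lborel (\<lambda>x. Im (Z x))" for Z :: "real ^ 'n \<Rightarrow> complex"
        using that by (intro Bochner_Integration.integrable_add integrable_mult_right integrable_of_real)
      then show "integrable lborel Z1" "integrable lborel Z2" using ri unfolding complex_eq[symmetric] by blast+
    qed
    have "(LINT x|lborel. Re (Z1 x)) + (LINT x|lborel. Re (Z2 x)) = 0" "(LINT x|lborel. Im (Z1 x)) + (LINT x|lborel. Im (Z2 x)) = 0"
      unfolding Z1 Z2 using x11 x12 x21 x22 by simp_all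
    then have "(LINT x|lborel. Z1 x) + (LINT x|lborel. Z2 x) = 0"
      using iZ by (simp add: complex_eq_iff integral_Re integral_Im)
    then show "(LINT x|lebesgue_on \<Omega>. complex_of_real (a x) * F x * iterated_partial [i] \<phi> x)
      = (-1) ^ length [i] * (LINT x|lebesgue_on \<Omega>. (complex_of_real (g x) * F x + complex_of_real (a x) * H x) * \<phi> x)"
      unfolding L1 L2 Z1_def[symmetric] Z2_def[symmetric] by (simp add: eq_neg_iff_add_eq_0)
  qed
  then show ?thesis using g(2) by blast
qed

section \<open>Passage from smooth functions to weak derivatives\<close>

text \<open>Integrability is part of the definition because the integral of a non-integrable
  function is 0 by convention, which would make the limit meaningless.\<close>

definition l2conv :: "(real ^ 'n::finite) set \<Rightarrow> (nat \<Rightarrow> real ^ 'n \<Rightarrow> real) \<Rightarrow> (real ^ 'n \<Rightarrow> real) \<Rightarrow> bool" where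
  "l2conv S u v \<longleftrightarrow> S \<in> sets borel \<and> v \<in> borel_measurable borel \<and> (\<forall>n. u n \<in> borel_measurable borel)
    \<and> integrable lborel (\<lambda>x. indicator S x * (v x)\<^sup>2) \<and> (\<forall>n. integrable lborel (\<lambda>x. indicator S x * (u n x - v x)\<^sup>2))
    \<and> (\<lambda>n. LINT x|lborel. indicator S x * (u n x - v x)\<^sup>2) \<longlonglongrightarrow> 0"

text \<open>With \<open>d = u n x - v x\<close>, the difference of the squares is at most
  \<open>(1 + 1 / \<eta>) * d\<^sup>2 + \<eta> * (v x)\<^sup>2\<close>: the first part tends to zero
  for fixed \<open>\<eta>\<close>, the second is small with \<open>\<eta>\<close>. The weight may
  change sign, as it does in an inequality written as one integral.\<close>

lemma l2conv_weighted:
  fixes u :: "nat \<Rightarrow> real ^ 'n::finite \<Rightarrow> real"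
  assumes l: "l2conv S u v" and w: "w \<in> borel_measurable borel" "\<And>x. \<bar>w x\<bar> \<le> M" "\<And>x. x \<notin> S \<Longrightarrow> w x = 0"
  shows "integrable lborel (\<lambda>x. w x * (u n x)\<^sup>2)" "integrable lborel (\<lambda>x. w x * (v x)\<^sup>2)"
    "(\<lambda>n. LINT x|lborel. w x * (u n x)\<^sup>2) \<longlonglongrightarrow> (LINT x|lborel. w x * (v x)\<^sup>2)"
proof -
  have [measurable]: "S \<in> sets borel" "v \<in> borel_measurable borel" "u n \<in> borel_measurable borel" "w \<in> borel_measurable borel" for n
    using l w unfolding l2conv_def by auto
  have iv: "integrable lborel (\<lambda>x. indicator S x * (v x)\<^sup>2)" and id: "integrable lborel (\<lambda>x. indicator S x * (u n x - v x)\<^sup>2)" for n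
    using l unfolding l2conv_def by auto
  have M: "M \<ge> 0" using w(2)[of 0] by linarith
  have wb: "\<bar>w x\<bar> \<le> M * indicator S x" for x using w(2)[of x] w(3)[of x] by (cases "x \<in> S") auto
  show i1: "integrable lborel (\<lambda>x. w x * (v x)\<^sup>2)"
  proof (rule Bochner_Integration.integrable_bound[where f="\<lambda>x. M * (indicator S x * (v x)\<^sup>2)"])
    show "integrable lborel (\<lambda>x. M * (indicator S x * (v x)\<^sup>2))" using iv by simp
    show "AE x in lborel. norm (w x * (v x)\<^sup>2) \<le> norm (M * (indicator S x * (v x)\<^sup>2))"
    proof (rule AE_I2)
      fix x
      have "\<bar>w x\<bar> * (v x)\<^sup>2 \<le> M * indicator S x * (v x)\<^sup>2" by (intro mult_right_mono wb) auto
      then show "norm (w x * (v x)\<^sup>2) \<le> norm (M * (indicator S x * (v x)\<^sup>2))" using M by (simp add: abs_mult mult.assoc)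
    qed
  qed measurable
  show i2: "integrable lborel (\<lambda>x. w x * (u n x)\<^sup>2)" for n
  proof (rule Bochner_Integration.integrable_bound[where f="\<lambda>x. M * (2 * (indicator S x * (v x)\<^sup>2) + 2 * (indicator S x * (u n x - v x)\<^sup>2))"])
    show "integrable lborel (\<lambda>x. M * (2 * (indicator S x * (v x)\<^sup>2) + 2 * (indicator S x * (u n x - v x)\<^sup>2)))" using iv id[of n] by auto
    show "AE x in lborel. norm (w x * (u n x)\<^sup>2) \<le> norm (M * (2 * (indicator S x * (v x)\<^sup>2) + 2 * (indicator S x * (u n x - v x)\<^sup>2)))"
    proof (rule AE_I2)
      fix x
      have "(u n x)\<^sup>2 = (v x + (u n x - v x))\<^sup>2" by simp
      also have "\<dots> \<le> 2 * (v x)\<^sup>2 + 2 * (u n x - v x)\<^sup>2"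
        using sum_squares_bound[of "v x" "u n x - v x"] by (simp only: power2_sum)
      finally have "\<bar>w x\<bar> * (u n x)\<^sup>2 \<le> (M * indicator S x) * (2 * (v x)\<^sup>2 + 2 * (u n x - v x)\<^sup>2)"
        by (intro mult_mono wb) (use M in auto)
      also have "\<dots> = M * (2 * (indicator S x * (v x)\<^sup>2) + 2 * (indicator S x * (u n x - v x)\<^sup>2))" by (simp add: algebra_simps)
      finally show "norm (w x * (u n x)\<^sup>2) \<le> norm (M * (2 * (indicator S x * (v x)\<^sup>2) + 2 * (indicator S x * (u n x - v x)\<^sup>2)))"
        unfolding real_norm_def abs_mult abs_of_nonneg[OF M] by simp
    qed
  qed measurable
  define U where "U = (LINT x|lborel. indicator S x * (v x)\<^sup>2)"
  have U: "U \<ge> 0" unfolding U_def by simp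
  have main: "\<bar>(LINT x|lborel. w x * (u n x)\<^sup>2) - (LINT x|lborel. w x * (v x)\<^sup>2)\<bar> \<le> M * (1 + 1 / \<eta>) * (LINT x|lborel. indicator S x * (u n x - v x)\<^sup>2) + M * \<eta> * U"
    if \<eta>: "\<eta> > 0" for n \<eta>
  proof -
    have "(LINT x|lborel. w x * (u n x)\<^sup>2) - (LINT x|lborel. w x * (v x)\<^sup>2) = (LINT x|lborel. w x * (u n x)\<^sup>2 - w x * (v x)\<^sup>2)"
      using i1 i2 by simp
    also have "\<bar>\<dots>\<bar> \<le> (LINT x|lborel. \<bar>w x * (u n x)\<^sup>2 - w x * (v x)\<^sup>2\<bar>)" by (rule integral_abs_bound)
    also have "\<dots> \<le> (LINT x|lborel. M * (1 + 1 / \<eta>) * (indicator S x * (u n x - v x)\<^sup>2) + M * \<eta> * (indicator S x * (v x)\<^sup>2))"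
    proof (rule integral_mono)
      show "integrable lborel (\<lambda>x. \<bar>w x * (u n x)\<^sup>2 - w x * (v x)\<^sup>2\<bar>)" using i1 i2[of n] by auto
      show "integrable lborel (\<lambda>x. M * (1 + 1 / \<eta>) * (indicator S x * (u n x - v x)\<^sup>2) + M * \<eta> * (indicator S x * (v x)\<^sup>2))"
        using iv id[of n] by auto
      fix x
      define d where "d = u n x - v x"
      have "(u n x)\<^sup>2 - (v x)\<^sup>2 = d\<^sup>2 + 2 * v x * d" unfolding d_def by (simp add: power2_eq_square algebra_simps)
      moreover have "\<bar>2 * v x * d\<bar> \<le> d\<^sup>2 / \<eta> + \<eta> * (v x)\<^sup>2"
      proof -
        have "0 \<le> (\<bar>d\<bar> - \<eta> * \<bar>v x\<bar>)\<^sup>2 / \<eta>" using \<eta> by simp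
        also have "\<dots> = d\<^sup>2 / \<eta> + \<eta> * (v x)\<^sup>2 - \<bar>2 * v x * d\<bar>"
          using \<eta> by (simp add: power2_diff abs_mult field_simps power2_eq_square)
        finally show ?thesis by simp
      qed
      ultimately have "\<bar>(u n x)\<^sup>2 - (v x)\<^sup>2\<bar> \<le> d\<^sup>2 + (d\<^sup>2 / \<eta> + \<eta> * (v x)\<^sup>2)"
        using abs_triangle_ineq[of "d\<^sup>2" "2 * v x * d"] by simp
      also have "\<dots> = (1 + 1 / \<eta>) * d\<^sup>2 + \<eta> * (v x)\<^sup>2" by (simp add: field_simps)
      finally have "\<bar>w x\<bar> * \<bar>(u n x)\<^sup>2 - (v x)\<^sup>2\<bar> \<le> (M * indicator S x) * ((1 + 1 / \<eta>) * d\<^sup>2 + \<eta> * (v x)\<^sup>2)"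
        by (intro mult_mono wb) (use M in auto)
      then show "\<bar>w x * (u n x)\<^sup>2 - w x * (v x)\<^sup>2\<bar> \<le> M * (1 + 1 / \<eta>) * (indicator S x * (u n x - v x)\<^sup>2) + M * \<eta> * (indicator S x * (v x)\<^sup>2)"
        unfolding right_diff_distrib[symmetric] abs_mult d_def by (simp add: algebra_simps)
    qed
    also have "\<dots> = M * (1 + 1 / \<eta>) * (LINT x|lborel. indicator S x * (u n x - v x)\<^sup>2) + M * \<eta> * U"
      unfolding U_def using iv id[of n] by simp
    finally show ?thesis .
  qed
  show "(\<lambda>n. LINT x|lborel. w x * (u n x)\<^sup>2) \<longlonglongrightarrow> (LINT x|lborel. w x * (v x)\<^sup>2)"
  proof (rule LIMSEQ_I)
    fix e :: real assume e: "e > 0"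
    define \<eta> where "\<eta> = e / (2 * (M * U + 1))"
    have MU: "M * U \<ge> 0" using M U by simp
    have \<eta>: "\<eta> > 0" unfolding \<eta>_def using e MU by simp
    have "M * \<eta> * U = (M * U / (M * U + 1)) * (e / 2)" unfolding \<eta>_def by (simp add: ac_simps)
    also have "\<dots> \<le> 1 * (e / 2)" using MU e by (intro mult_right_mono) auto
    finally have s: "M * \<eta> * U \<le> e / 2" by simp
    have "(\<lambda>n. M * (1 + 1 / \<eta>) * (LINT x|lborel. indicator S x * (u n x - v x)\<^sup>2)) \<longlonglongrightarrow> M * (1 + 1 / \<eta>) * 0"
      using l unfolding l2conv_def by (intro tendsto_intros) auto
    then have "(\<lambda>n. M * (1 + 1 / \<eta>) * (LINT x|lborel. indicator S x * (u n x - v x)\<^sup>2)) \<longlonglongrightarrow> 0" by simp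
    from LIMSEQ_D[OF this, of "e / 2"] e obtain n0 where
      n0: "\<And>n. n \<ge> n0 \<Longrightarrow> norm (M * (1 + 1 / \<eta>) * (LINT x|lborel. indicator S x * (u n x - v x)\<^sup>2) - 0) < e / 2" by auto
    have "norm ((LINT x|lborel. w x * (u n x)\<^sup>2) - (LINT x|lborel. w x * (v x)\<^sup>2)) < e" if "n \<ge> n0" for n
    proof -
      have "M * (1 + 1 / \<eta>) * (LINT x|lborel. indicator S x * (u n x - v x)\<^sup>2) < e / 2"
        using n0[OF that] unfolding real_norm_def diff_0_right by (rule le_less_trans[OF abs_ge_self])
      then have "M * (1 + 1 / \<eta>) * (LINT x|lborel. indicator S x * (u n x - v x)\<^sup>2) + M * \<eta> * U < e / 2 + e / 2"
        using s by (rule add_less_le_mono)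
      then show ?thesis using main[OF \<eta>, of n] by (simp only: real_norm_def field_sum_of_halves)
    qed
    then show "\<exists>n0. \<forall>n\<ge>n0. norm ((LINT x|lborel. w x * (u n x)\<^sup>2) - (LINT x|lborel. w x * (v x)\<^sup>2)) < e" by blast
  qed
qed

lemma l2conv_add:
  assumes "l2conv S u v" "l2conv S u' v'"
  shows "l2conv S (\<lambda>n x. u n x + u' n x) (\<lambda>x. v x + v' x)"
proof -
  have [measurable]: "S \<in> sets borel" "v \<in> borel_measurable borel" "u n \<in> borel_measurable borel" "v' \<in> borel_measurable borel" "u' n \<in> borel_measurable borel" for n
    using assms unfolding l2conv_def by auto
  have i: "integrable lborel (\<lambda>x. indicator S x * (v x)\<^sup>2)" "integrable lborel (\<lambda>x. indicator S x * (u n x - v x)\<^sup>2)"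
    "integrable lborel (\<lambda>x. indicator S x * (v' x)\<^sup>2)" "integrable lborel (\<lambda>x. indicator S x * (u' n x - v' x)\<^sup>2)" for n
    using assms unfolding l2conv_def by auto
  have b: "(p + q)\<^sup>2 \<le> 2 * p\<^sup>2 + 2 * q\<^sup>2" for p q :: real
    using sum_squares_bound[of p q] by (simp only: power2_sum)
  have le: "indicator S x * (p + q)\<^sup>2 \<le> 2 * (indicator S x * p\<^sup>2) + 2 * (indicator S x * q\<^sup>2)" for x and p q :: real
    using b[of p q] by (simp add: indicator_def)
  have I: "integrable lborel (\<lambda>x. indicator S x * (p x + q x)\<^sup>2)"
    if "integrable lborel (\<lambda>x. indicator S x * (p x)\<^sup>2)" "integrable lborel (\<lambda>x. indicator S x * (q x)\<^sup>2)"
       and [measurable]: "p \<in> borel_measurable borel" "q \<in> borel_measurable borel" for p q :: "real ^ 'a \<Rightarrow> real"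
  proof (rule Bochner_Integration.integrable_bound[where f="\<lambda>x. 2 * (indicator S x * (p x)\<^sup>2) + 2 * (indicator S x * (q x)\<^sup>2)"])
    show "integrable lborel (\<lambda>x. 2 * (indicator S x * (p x)\<^sup>2) + 2 * (indicator S x * (q x)\<^sup>2))" using that by auto
    show "AE x in lborel. norm (indicator S x * (p x + q x)\<^sup>2) \<le> norm (2 * (indicator S x * (p x)\<^sup>2) + 2 * (indicator S x * (q x)\<^sup>2))"
      using le by (intro AE_I2) (simp add: abs_mult)
  qed measurable
  have eq: "(u n x + u' n x) - (v x + v' x) = (u n x - v x) + (u' n x - v' x)" for n x by simp
  have i3: "integrable lborel (\<lambda>x. indicator S x * ((u n x + u' n x) - (v x + v' x))\<^sup>2)" for n
    unfolding eq by (rule I) (use i in auto)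
  have "(\<lambda>n. LINT x|lborel. indicator S x * ((u n x + u' n x) - (v x + v' x))\<^sup>2) \<longlonglongrightarrow> 0"
  proof (rule real_tendsto_sandwich[of "\<lambda>n. 0" _ _ "\<lambda>n. 2 * (LINT x|lborel. indicator S x * (u n x - v x)\<^sup>2) + 2 * (LINT x|lborel. indicator S x * (u' n x - v' x)\<^sup>2)"])
    show "\<forall>\<^sub>F n in sequentially. (LINT x|lborel. indicator S x * ((u n x + u' n x) - (v x + v' x))\<^sup>2) \<le> 2 * (LINT x|lborel. indicator S x * (u n x - v x)\<^sup>2) + 2 * (LINT x|lborel. indicator S x * (u' n x - v' x)\<^sup>2)"
    proof (intro always_eventually allI)
      fix n
      have "(LINT x|lborel. indicator S x * ((u n x + u' n x) - (v x + v' x))\<^sup>2) \<le> (LINT x|lborel. 2 * (indicator S x * (u n x - v x)\<^sup>2) + 2 * (indicator S x * (u' n x - v' x)\<^sup>2))"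
        by (rule integral_mono[OF i3]) (use i in \<open>auto simp: eq intro: le\<close>)
      then show "(LINT x|lborel. indicator S x * ((u n x + u' n x) - (v x + v' x))\<^sup>2) \<le> 2 * (LINT x|lborel. indicator S x * (u n x - v x)\<^sup>2) + 2 * (LINT x|lborel. indicator S x * (u' n x - v' x)\<^sup>2)"
        using i by simp
    qed
    have "(\<lambda>n. 2 * (LINT x|lborel. indicator S x * (u n x - v x)\<^sup>2) + 2 * (LINT x|lborel. indicator S x * (u' n x - v' x)\<^sup>2)) \<longlonglongrightarrow> 2 * 0 + 2 * 0"
      using assms unfolding l2conv_def by (intro tendsto_intros) auto
    then show "(\<lambda>n. 2 * (LINT x|lborel. indicator S x * (u n x - v x)\<^sup>2) + 2 * (LINT x|lborel. indicator S x * (u' n x - v' x)\<^sup>2)) \<longlonglongrightarrow> 0" by simp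
  qed auto
  then show ?thesis unfolding l2conv_def using i3 I[OF i(1,3)] by auto
qed

lemma l2conv_zero: "S \<in> sets borel \<Longrightarrow> l2conv S (\<lambda>n x. 0) (\<lambda>x. 0)"
  unfolding l2conv_def by simp

lemma l2conv_sum:
  assumes "S \<in> sets borel" "\<And>i. i \<in> I \<Longrightarrow> l2conv S (u i) (v i)"
  shows "l2conv S (\<lambda>n x. \<Sum>i\<in>I. u i n x) (\<lambda>x. \<Sum>i\<in>I. v i x)"
  using assms by (induction I rule: infinite_finite_induct) (auto intro!: l2conv_zero l2conv_add)

text \<open>\<open>b u - c v\<close> equals \<open>b (u - v) + (b - c) v\<close>; boundedness of
  \<open>b\<close> treats the first summand, uniform closeness on \<open>S\<close> the second. The
  intended \<open>b n\<close> are mollified coefficients.\<close>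

lemma l2conv_mult:
  assumes l: "l2conv S u v" and b: "\<And>n. b n \<in> borel_measurable borel" "c \<in> borel_measurable borel"
    "\<And>n x. x \<in> S \<Longrightarrow> \<bar>b n x\<bar> \<le> B" "\<And>x. x \<in> S \<Longrightarrow> \<bar>c x\<bar> \<le> B" "\<And>n x. x \<in> S \<Longrightarrow> \<bar>b n x - c x\<bar> \<le> \<epsilon> n" "\<epsilon> \<longlonglongrightarrow> 0"
  shows "l2conv S (\<lambda>n x. b n x * u n x) (\<lambda>x. c x * v x)"
proof -
  note [measurable] = b(1,2)
  have [measurable]: "S \<in> sets borel" "v \<in> borel_measurable borel" "u n \<in> borel_measurable borel" for n
    using l unfolding l2conv_def by auto
  have i: "integrable lborel (\<lambda>x. indicator S x * (v x)\<^sup>2)" "integrable lborel (\<lambda>x. indicator S x * (u n x - v x)\<^sup>2)" for n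
    using l unfolding l2conv_def by auto
  have sq: "p\<^sup>2 \<le> q\<^sup>2" if "\<bar>p\<bar> \<le> q" for p q :: real using that by (metis abs_ge_zero power2_abs power_mono)
  have i1: "integrable lborel (\<lambda>x. indicator S x * (c x * v x)\<^sup>2)"
  proof (rule Bochner_Integration.integrable_bound[where f="\<lambda>x. B\<^sup>2 * (indicator S x * (v x)\<^sup>2)"])
    show "integrable lborel (\<lambda>x. B\<^sup>2 * (indicator S x * (v x)\<^sup>2))" using i by simp
    show "AE x in lborel. norm (indicator S x * (c x * v x)\<^sup>2) \<le> norm (B\<^sup>2 * (indicator S x * (v x)\<^sup>2))"
    proof (rule AE_I2)
      fix x
      show "norm (indicator S x * (c x * v x)\<^sup>2) \<le> norm (B\<^sup>2 * (indicator S x * (v x)\<^sup>2))"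
        using sq[OF b(4)[of x]] by (cases "x \<in> S") (auto simp: power_mult_distrib abs_mult intro!: mult_right_mono)
    qed
  qed measurable
  have le: "indicator S x * (b n x * u n x - c x * v x)\<^sup>2 \<le> 2 * B\<^sup>2 * (indicator S x * (u n x - v x)\<^sup>2) + 2 * (\<epsilon> n)\<^sup>2 * (indicator S x * (v x)\<^sup>2)" for n x
  proof (cases "x \<in> S")
    case True
    have "b n x * u n x - c x * v x = b n x * (u n x - v x) + (b n x - c x) * v x" by (simp add: algebra_simps)
    then have "(b n x * u n x - c x * v x)\<^sup>2 \<le> 2 * (b n x * (u n x - v x))\<^sup>2 + 2 * ((b n x - c x) * v x)\<^sup>2"
      using sum_squares_bound[of "b n x * (u n x - v x)" "(b n x - c x) * v x"] by (simp only: power2_sum)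
    also have "\<dots> \<le> 2 * (B\<^sup>2 * (u n x - v x)\<^sup>2) + 2 * ((\<epsilon> n)\<^sup>2 * (v x)\<^sup>2)"
      unfolding power_mult_distrib using sq[OF b(3)[OF True, of n]] sq[OF b(5)[OF True, of n]]
      by (intro add_mono mult_left_mono mult_right_mono) auto
    finally show ?thesis using True by simp
  qed simp
  have i2: "integrable lborel (\<lambda>x. indicator S x * (b n x * u n x - c x * v x)\<^sup>2)" for n
  proof (rule Bochner_Integration.integrable_bound[where f="\<lambda>x. 2 * B\<^sup>2 * (indicator S x * (u n x - v x)\<^sup>2) + 2 * (\<epsilon> n)\<^sup>2 * (indicator S x * (v x)\<^sup>2)"])
    show "integrable lborel (\<lambda>x. 2 * B\<^sup>2 * (indicator S x * (u n x - v x)\<^sup>2) + 2 * (\<epsilon> n)\<^sup>2 * (indicator S x * (v x)\<^sup>2))"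
      using i by auto
    show "AE x in lborel. norm (indicator S x * (b n x * u n x - c x * v x)\<^sup>2) \<le> norm (2 * B\<^sup>2 * (indicator S x * (u n x - v x)\<^sup>2) + 2 * (\<epsilon> n)\<^sup>2 * (indicator S x * (v x)\<^sup>2))"
      using le[of _ n] by (intro AE_I2) (auto intro: order_trans[OF _ abs_ge_self])
  qed measurable
  have "(\<lambda>n. LINT x|lborel. indicator S x * (b n x * u n x - c x * v x)\<^sup>2) \<longlonglongrightarrow> 0"
  proof (rule real_tendsto_sandwich[of "\<lambda>n. 0" _ _ "\<lambda>n. 2 * B\<^sup>2 * (LINT x|lborel. indicator S x * (u n x - v x)\<^sup>2) + 2 * (\<epsilon> n)\<^sup>2 * (LINT x|lborel. indicator S x * (v x)\<^sup>2)"])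
    show "\<forall>\<^sub>F n in sequentially. (LINT x|lborel. indicator S x * (b n x * u n x - c x * v x)\<^sup>2) \<le> 2 * B\<^sup>2 * (LINT x|lborel. indicator S x * (u n x - v x)\<^sup>2) + 2 * (\<epsilon> n)\<^sup>2 * (LINT x|lborel. indicator S x * (v x)\<^sup>2)"
    proof (intro always_eventually allI)
      fix n
      have "(LINT x|lborel. indicator S x * (b n x * u n x - c x * v x)\<^sup>2) \<le> (LINT x|lborel. 2 * B\<^sup>2 * (indicator S x * (u n x - v x)\<^sup>2) + 2 * (\<epsilon> n)\<^sup>2 * (indicator S x * (v x)\<^sup>2))"
        by (rule integral_mono[OF i2 _ le]) (use i in auto)
      then show "(LINT x|lborel. indicator S x * (b n x * u n x - c x * v x)\<^sup>2) \<le> 2 * B\<^sup>2 * (LINT x|lborel. indicator S x * (u n x - v x)\<^sup>2) + 2 * (\<epsilon> n)\<^sup>2 * (LINT x|lborel. indicator S x * (v x)\<^sup>2)"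
        using i by simp
    qed
    have "(\<lambda>n. 2 * B\<^sup>2 * (LINT x|lborel. indicator S x * (u n x - v x)\<^sup>2) + 2 * (\<epsilon> n)\<^sup>2 * (LINT x|lborel. indicator S x * (v x)\<^sup>2)) \<longlonglongrightarrow> 2 * B\<^sup>2 * 0 + 2 * 0\<^sup>2 * (LINT x|lborel. indicator S x * (v x)\<^sup>2)"
      using l b(6) unfolding l2conv_def by (intro tendsto_intros) auto
    then show "(\<lambda>n. 2 * B\<^sup>2 * (LINT x|lborel. indicator S x * (u n x - v x)\<^sup>2) + 2 * (\<epsilon> n)\<^sup>2 * (LINT x|lborel. indicator S x * (v x)\<^sup>2)) \<longlonglongrightarrow> 0" by simp
  qed auto
  then show ?thesis unfolding l2conv_def using i1 i2 by simp
qed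

text \<open>\<open>l2conv\<close> requires every difference to be square integrable, which
  \<open>conv_L2_close\<close> grants only for small radii. Hence the index shift beyond
  \<open>n0\<close>, a number depending on \<open>f\<close> but not on the kernels.\<close>

lemma l2conv_conv:
  fixes f :: "real ^ 'n::finite \<Rightarrow> real"
  assumes f: "integrable lborel f" "integrable lborel (\<lambda>x. (f x)\<^sup>2)" and S: "S \<in> sets borel"
  obtains n0 where "\<And>r N. (\<And>n. mollifier (inverse (real (Suc n))) (r n)) \<Longrightarrow> N \<ge> n0 \<Longrightarrow> l2conv S (\<lambda>n. conv (r (n + N)) f) f"
proof -
  have [measurable]: "f \<in> borel_measurable borel" using f by auto
  note [measurable] = S
  from conv_L2_close[OF f zero_less_one] obtain d where d: "d > 0" "\<And>r \<epsilon>. mollifier \<epsilon> r \<Longrightarrow> \<epsilon> < d \<Longrightarrow> integrable lborel (\<lambda>x. (conv r f x - f x)\<^sup>2) \<and> (LINT x|lborel. (conv r f x - f x)\<^sup>2) \<le> 1" by blast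
  from LIMSEQ_D[OF LIMSEQ_inverse_real_of_nat d(1)] obtain n0 where n0: "\<And>n. n \<ge> n0 \<Longrightarrow> inverse (real (Suc n)) < d" by auto
  have "l2conv S (\<lambda>n. conv (r (n + N)) f) f" if r: "\<And>n. mollifier (inverse (real (Suc n))) (r n)" and N: "N \<ge> n0" for r N
  proof -
    have [measurable]: "conv (r n) f \<in> borel_measurable borel" for n using conv_measurable[OF r f(1)] .
    have i0: "integrable lborel (\<lambda>x. (conv (r (n + N)) f x - f x)\<^sup>2)" for n
      using d(2)[OF r[of "n + N"] n0[of "n + N"]] N by simp
    have ind: "integrable lborel (\<lambda>x. indicator S x * p x)" if "integrable lborel p" for p :: "real ^ 'n \<Rightarrow> real"
      by (rule integrable_bounded_mult[OF that, where M=1]) (auto simp: indicator_def)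
    have "(\<lambda>n. LINT x|lborel. indicator S x * (conv (r (n + N)) f x - f x)\<^sup>2) \<longlonglongrightarrow> 0"
    proof (rule LIMSEQ_I)
      fix e :: real assume e: "e > 0"
      then have "e / 2 > 0" by simp
      from conv_L2_close[OF f this] obtain d' where d': "d' > 0" "\<And>r \<epsilon>. mollifier \<epsilon> r \<Longrightarrow> \<epsilon> < d' \<Longrightarrow> integrable lborel (\<lambda>x. (conv r f x - f x)\<^sup>2) \<and> (LINT x|lborel. (conv r f x - f x)\<^sup>2) \<le> e / 2" by blast
      from LIMSEQ_D[OF LIMSEQ_inverse_real_of_nat d'(1)] obtain n1 where n1: "\<And>n. n \<ge> n1 \<Longrightarrow> inverse (real (Suc n)) < d'" by auto
      have "norm ((LINT x|lborel. indicator S x * (conv (r (n + N)) f x - f x)\<^sup>2) - 0) < e" if "n \<ge> n1" for n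
      proof -
        have "(LINT x|lborel. indicator S x * (conv (r (n + N)) f x - f x)\<^sup>2) \<le> (LINT x|lborel. (conv (r (n + N)) f x - f x)\<^sup>2)"
          by (rule integral_mono[OF ind[OF i0] i0]) (simp add: indicator_def)
        also have "\<dots> \<le> e / 2" using d'(2)[OF r[of "n + N"] n1[of "n + N"]] that by simp
        finally show ?thesis using e by simp
      qed
      then show "\<exists>n0'. \<forall>n\<ge>n0'. norm ((LINT x|lborel. indicator S x * (conv (r (n + N)) f x - f x)\<^sup>2) - 0) < e" by blast
    qed
    then show ?thesis unfolding l2conv_def using ind[OF f(2)] ind[OF i0] by simp
  qed
  then show ?thesis using that by blast
qed

section \<open>Mollified coefficients and the transfer of quadratic inequalities\<close>

lemma elliptic_coeffsD:
  assumes "elliptic_coeffs th t S a da"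
  shows "has_grad (a i j) (da i j)" and "x \<in> S \<Longrightarrow> \<bar>a i j x\<bar> \<le> th"
  using assms unfolding elliptic_coeffs_def by auto

text \<open>Near the ball the mollified matrix is an average of matrices \<open>a (x + z)\<close>,
  and symmetry, ellipticity and bounds survive averaging with the same constants. The indicator
  makes the entries integrable; \<open>gap\<close> exceeds the radius of the kernel, so the cut is
  not felt on the ball of radius \<open>\<rho>\<close>.\<close>

lemma elliptic_coeffs_mollify:
  fixes a :: "'n::finite \<Rightarrow> 'n \<Rightarrow> real ^ 'n \<Rightarrow> real" and ctr :: "real ^ 'n" and \<rho> :: real
  assumes r: "mollifier \<epsilon> r" and R: "has_grad r R" and eg: "\<epsilon> < gap" and t: "t \<ge> 0"
    and sym: "\<And>i j x. a i j x = a j i x"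
    and lip: "\<And>i j x y. \<bar>a i j x - a i j y\<bar> \<le> t * norm (x - y)"
    and bd: "\<And>i j x. \<bar>a i j x\<bar> \<le> th"
    and ell: "\<And>x \<xi>. (\<Sum>i\<in>UNIV. (\<xi> i)\<^sup>2) / th \<le> (\<Sum>i\<in>UNIV. \<Sum>j\<in>UNIV. \<xi> i * a i j x * \<xi> j)"
  defines "am \<equiv> \<lambda>i j. conv r (\<lambda>y. indicator (cball ctr (\<rho> + gap)) y * a i j y)"
  shows "elliptic_coeffs th t (cball ctr \<rho>) am (\<lambda>i j k. conv (R k) (\<lambda>y. indicator (cball ctr (\<rho> + gap)) y * a i j y))"
    and "x \<in> cball ctr \<rho> \<Longrightarrow> \<bar>am i j x - a i j x\<bar> \<le> t * \<epsilon>"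
proof -
  have ca: "continuous_on UNIV (a i j)" for i j
    by (rule lipschitz_on_continuous_on[of t]) (use lip t in \<open>auto intro!: lipschitz_onI simp: dist_norm\<close>)
  have ia: "integrable lborel (\<lambda>y. indicator (cball ctr (\<rho> + gap)) y * a i j y)" for i j
    by (rule integrable_indicator_continuous[OF ca]) simp
  obtain R' where R': "has_grad r R'" "\<And>i. bumpy (R' i)" using bumpy_jet[OF mollifierD(1)[OF r]] by blast
  have bR: "bumpy (R i)" for i using bumpy_grad[OF mollifierD(1)[OF r] R] .
  have z: "norm x > \<epsilon> \<Longrightarrow> r x = 0" for x using mollifierD(3)[OF r] .
  have zR: "R i x = 0" if "norm x > \<epsilon>" for i x
    using has_grad_zero_outside[OF R, where ctr=0 and r=\<epsilon> and x=x] z that by simp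
  have g: "has_grad (am i j) (\<lambda>k. conv (R k) (\<lambda>y. indicator (cball ctr (\<rho> + gap)) y * a i j y))" for i j
    unfolding am_def by (rule conv_has_grad[OF R bumpy_continuous[OF bR] z ia])
  have c: "continuous_on UNIV (conv (R k) (\<lambda>y. indicator (cball ctr (\<rho> + gap)) y * a i j y))" for i j k
    by (rule smooth_fn_continuous[OF conv_smooth_fn[OF bR zR ia]])
  have ir: "integrable lborel (\<lambda>z. r z * a i j (x + z))" for i j x
  proof (rule integrable_compact_supp[where ctr=0 and r=\<epsilon>])
    show "continuous_on UNIV (\<lambda>z. r z * a i j (x + z))"
      by (intro continuous_intros mollifierD(6)[OF r] continuous_on_compose2[OF ca]) auto
  qed (use z in auto)
  \<comment> \<open>Valid slightly beyond the ball, so that difference quotients at its boundary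
    points are covered too.\<close>
  have rep: "am i j x = (LINT z|lborel. r z * a i j (x + z))" if x: "norm (x - ctr) \<le> \<rho> + (gap - \<epsilon>)" for i j x
    unfolding am_def conv_shift[OF r]
  proof (intro Bochner_Integration.integral_cong refl)
    fix y
    show "r y * (indicator (cball ctr (\<rho> + gap)) (x + y) * a i j (x + y)) = r y * a i j (x + y)"
    proof (cases "norm y > \<epsilon>")
      case False
      have "norm (x + y - ctr) \<le> norm (x - ctr) + norm y"
        using norm_triangle_ineq[of "x - ctr" y] by (simp add: algebra_simps)
      then have "x + y \<in> cball ctr (\<rho> + gap)" using False x by (simp add: dist_norm norm_minus_commute)
      then show ?thesis by simp
    qed (use z in simp)
  qed
  have irr: "integrable lborel r" "(LINT x|lborel. r x) = 1" "r y \<ge> 0" for y using mollifierD[OF r] by auto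
  have nb: "norm (x - ctr) \<le> \<rho>" if "x \<in> cball ctr \<rho>" for x using that by (simp add: dist_norm norm_minus_commute)
  have avg: "\<bar>LINT z|lborel. r z * p z\<bar> \<le> B" if "integrable lborel (\<lambda>z. r z * p z)" "\<And>z. norm z \<le> \<epsilon> \<Longrightarrow> \<bar>p z\<bar> \<le> B" for p B
  proof -
    have "\<bar>LINT z|lborel. r z * p z\<bar> \<le> (LINT z|lborel. \<bar>r z * p z\<bar>)" by (rule integral_abs_bound)
    also have "\<dots> \<le> (LINT z|lborel. B * r z)"
    proof (rule integral_mono)
      show "integrable lborel (\<lambda>z. \<bar>r z * p z\<bar>)" using that by auto
      show "integrable lborel (\<lambda>z. B * r z)" using irr by auto
      show "\<bar>r y * p y\<bar> \<le> B * r y" for y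
      proof (cases "norm y > \<epsilon>")
        case False
        then show ?thesis using that(2)[of y] irr(3)[of y] mult_right_mono[of "\<bar>p y\<bar>" B "r y"] by (simp add: abs_mult mult.commute)
      qed (use z in simp)
    qed
    also have "\<dots> = B" using irr by simp
    finally show ?thesis .
  qed
  show close: "\<bar>am i j x - a i j x\<bar> \<le> t * \<epsilon>" if "x \<in> cball ctr \<rho>" for i j x
  proof -
    have "am i j x - a i j x = (LINT z|lborel. r z * a i j (x + z)) - (LINT z|lborel. r z * a i j x)"
      using rep[of x] nb[OF that] eg irr by simp
    also have "\<dots> = (LINT z|lborel. r z * (a i j (x + z) - a i j x))"
      unfolding right_diff_distrib using ir irr by simp
    finally have e: "am i j x - a i j x = (LINT z|lborel. r z * (a i j (x + z) - a i j x))" .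
    show ?thesis unfolding e
    proof (rule avg)
      show "integrable lborel (\<lambda>z. r z * (a i j (x + z) - a i j x))" unfolding right_diff_distrib using ir irr by auto
      fix y :: "real ^ 'n" assume "norm y \<le> \<epsilon>"
      then have "t * norm (x + y - x) \<le> t * \<epsilon>" using t by (simp add: mult_left_mono)
      then show "\<bar>a i j (x + y) - a i j x\<bar> \<le> t * \<epsilon>" using lip[of i j "x + y" x] by linarith
    qed
  qed
  show "elliptic_coeffs th t (cball ctr \<rho>) am (\<lambda>i j k. conv (R k) (\<lambda>y. indicator (cball ctr (\<rho> + gap)) y * a i j y))"
    unfolding elliptic_coeffs_def
  proof (intro conjI allI ballI)
    show "has_grad (am i j) (\<lambda>k. conv (R k) (\<lambda>y. indicator (cball ctr (\<rho> + gap)) y * a i j y))" for i j by (rule g)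
    show "continuous_on UNIV (conv (R k) (\<lambda>y. indicator (cball ctr (\<rho> + gap)) y * a i j y))" for i j k by (rule c)
    show "am i j x = am j i x" for i j x unfolding am_def by (simp add: sym[of i j])
    fix x assume x: "x \<in> cball ctr \<rho>"
    have repx: "am i j x = (LINT z|lborel. r z * a i j (x + z))" for i j using rep[of x] nb[OF x] eg by simp
    show "\<bar>am i j x\<bar> \<le> th" for i j unfolding repx by (rule avg[OF ir bd])
    show "(\<Sum>i\<in>UNIV. (\<xi> i)\<^sup>2) / th \<le> (\<Sum>i\<in>UNIV. \<Sum>j\<in>UNIV. \<xi> i * am i j x * \<xi> j)" for \<xi>
    proof -
      have "(\<Sum>i\<in>UNIV. \<Sum>j\<in>UNIV. \<xi> i * am i j x * \<xi> j) = (\<Sum>i\<in>UNIV. \<Sum>j\<in>UNIV. (LINT z|lborel. \<xi> i * (r z * a i j (x + z)) * \<xi> j))"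
        unfolding repx by simp
      also have "\<dots> = (LINT z|lborel. (\<Sum>i\<in>UNIV. \<Sum>j\<in>UNIV. \<xi> i * (r z * a i j (x + z)) * \<xi> j))"
        using ir by (simp add: Bochner_Integration.integral_sum)
      also have "\<dots> \<ge> (LINT z|lborel. (\<Sum>i\<in>UNIV. (\<xi> i)\<^sup>2) / th * r z)"
      proof (rule integral_mono)
        show "integrable lborel (\<lambda>z. (\<Sum>i\<in>UNIV. (\<xi> i)\<^sup>2) / th * r z)" using irr by auto
        show "integrable lborel (\<lambda>z. (\<Sum>i\<in>UNIV. \<Sum>j\<in>UNIV. \<xi> i * (r z * a i j (x + z)) * \<xi> j))"
          by (intro Bochner_Integration.integrable_sum integrable_mult_left integrable_mult_right ir)
        fix y
        have "(\<Sum>i\<in>UNIV. (\<xi> i)\<^sup>2) / th * r y \<le> (\<Sum>i\<in>UNIV. \<Sum>j\<in>UNIV. \<xi> i * a i j (x + y) * \<xi> j) * r y"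
          by (intro mult_right_mono ell irr)
        also have "\<dots> = (\<Sum>i\<in>UNIV. \<Sum>j\<in>UNIV. \<xi> i * (r y * a i j (x + y)) * \<xi> j)"
          by (simp add: sum_distrib_left sum_distrib_right ac_simps)
        finally show "(\<Sum>i\<in>UNIV. (\<xi> i)\<^sup>2) / th * r y \<le> (\<Sum>i\<in>UNIV. \<Sum>j\<in>UNIV. \<xi> i * (r y * a i j (x + y)) * \<xi> j)" .
      qed
      finally show ?thesis using irr by simp
    qed
    fix i j k
    let ?D = "conv (R k) (\<lambda>y. indicator (cball ctr (\<rho> + gap)) y * a i j y)"
    have "((\<lambda>s. am i j (x + s *\<^sub>R axis k 1)) has_real_derivative ?D (x + 0 *\<^sub>R axis k 1)) (at 0)"
      by (rule has_grad_axis[OF g])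
    then have l: "((\<lambda>s. (am i j (x + s *\<^sub>R axis k 1) - am i j x) / s) \<longlongrightarrow> ?D x) (at 0)" by (simp add: DERIV_def)
    have lipm: "\<bar>am i j (x + s *\<^sub>R axis k 1) - am i j x\<bar> \<le> t * \<bar>s\<bar>" if s: "\<bar>s\<bar> < gap - \<epsilon>" for s
    proof -
      define y where "y = x + s *\<^sub>R axis k 1"
      have "norm (y - ctr) \<le> norm (x - ctr) + norm (s *\<^sub>R axis k (1::real) :: real ^ 'n)"
        using norm_triangle_ineq[of "x - ctr" "s *\<^sub>R axis k 1"] unfolding y_def by (simp add: algebra_simps)
      then have ny: "norm (y - ctr) \<le> \<rho> + (gap - \<epsilon>)" using nb[OF x] s by (simp add: norm_axis_1)
      have "am i j y - am i j x = (LINT z|lborel. r z * (a i j (y + z) - a i j (x + z)))"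
        unfolding repx rep[OF ny] right_diff_distrib using ir by simp
      also have "\<bar>\<dots>\<bar> \<le> t * \<bar>s\<bar>"
      proof (rule avg)
        show "integrable lborel (\<lambda>z. r z * (a i j (y + z) - a i j (x + z)))" unfolding right_diff_distrib using ir by auto
        show "\<bar>a i j (y + z) - a i j (x + z)\<bar> \<le> t * \<bar>s\<bar>" for z
          using lip[of i j "y + z" "x + z"] unfolding y_def by (simp add: norm_axis_1)
      qed
      finally show ?thesis unfolding y_def .
    qed
    \<comment> \<open>The derivative is a limit of quotients of a function that is Lipschitz with
      constant \<open>t\<close> near \<open>x\<close>, averaging having preserved the Lipschitz
      constant.\<close>
    have "norm (?D x) \<le> t"
    proof (rule Lim_norm_ubound[OF _ l])
      show "\<forall>\<^sub>F s in at 0. norm ((am i j (x + s *\<^sub>R axis k 1) - am i j x) / s) \<le> t"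
        unfolding eventually_at
        by (rule exI[of _ "gap - \<epsilon>"]) (use eg lipm in \<open>auto simp: abs_divide divide_le_eq\<close>)
    qed simp
    then show "\<bar>?D x\<bar> \<le> t" by simp
  qed
qed

text \<open>The second-order weak jet on a ball, phrased by what a mollifier sees, so that real and imaginary parts
  can be treated separately.\<close>

definition wjet :: "real ^ 'n::finite \<Rightarrow> real \<Rightarrow> real \<Rightarrow> (real ^ 'n \<Rightarrow> real) \<Rightarrow> ('n \<Rightarrow> real ^ 'n \<Rightarrow> real) \<Rightarrow> ('n \<Rightarrow> 'n \<Rightarrow> real ^ 'n \<Rightarrow> real) \<Rightarrow> bool" where
  "wjet ctr \<rho> e f F FF \<longleftrightarrow> integrable lborel f \<and> integrable lborel (\<lambda>x. (f x)\<^sup>2)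
    \<and> (\<forall>i. integrable lborel (F i) \<and> integrable lborel (\<lambda>x. (F i x)\<^sup>2))
    \<and> (\<forall>i j. integrable lborel (FF i j) \<and> integrable lborel (\<lambda>x. (FF i j x)\<^sup>2))
    \<and> (\<forall>r \<epsilon> R RR x. mollifier \<epsilon> r \<longrightarrow> \<epsilon> < e \<longrightarrow> has_grad r R \<longrightarrow> (\<forall>i. has_grad (R i) (RR i)) \<longrightarrow> x \<in> cball ctr \<rho> \<longrightarrow>
       (\<forall>i j. conv (R i) f x = conv r (F i) x \<and> conv (RR i j) f x = conv r (FF i j) x))"

lemma wjetD:
  assumes "wjet ctr \<rho> e f F FF" "mollifier \<epsilon> r" "\<epsilon> < e" "has_grad r R" "\<And>i. has_grad (R i) (RR i)" "x \<in> cball ctr \<rho>"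
  shows "conv (R i) f x = conv r (F i) x \<and> conv (RR i j) f x = conv r (FF i j) x"
proof -
  have w: "\<forall>r \<epsilon> R RR x. mollifier \<epsilon> r \<longrightarrow> \<epsilon> < e \<longrightarrow> has_grad r R \<longrightarrow> (\<forall>i. has_grad (R i) (RR i)) \<longrightarrow> x \<in> cball ctr \<rho> \<longrightarrow>
       (\<forall>i j. conv (R i) f x = conv r (F i) x \<and> conv (RR i j) f x = conv r (FF i j) x)"
    using assms(1) unfolding wjet_def by (elim conjE)
  show ?thesis by (rule w[rule_format, OF assms(2-6)])
qed

text \<open>Both smooth estimates can be written as nonnegativity of such an integral with bounded
  weights supported in a ball. The inequality holds for the mollified function with the mollified
  coefficients; order zero, gradient and second-order expression converge in L2 of the ball, so the
  integral converges as well.\<close>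

lemma transfer_to_weak:
  fixes a :: "'n::finite \<Rightarrow> 'n \<Rightarrow> real ^ 'n \<Rightarrow> real"
  assumes ineq: "\<forall>a da f F FF. elliptic_coeffs th t (cball ctr \<rho>) a da \<longrightarrow> jet f F FF \<longrightarrow>
      0 \<le> (LINT x|lborel. \<alpha> x * (f x)\<^sup>2 + \<beta> x * (\<Sum>i\<in>UNIV. (F i x)\<^sup>2) + \<gamma> x * (\<Sum>i\<in>UNIV. \<Sum>j\<in>UNIV. a i j x * FF i j x)\<^sup>2)"
    and w: "\<alpha> \<in> borel_measurable borel" "\<beta> \<in> borel_measurable borel" "\<gamma> \<in> borel_measurable borel"
      "\<And>x. \<bar>\<alpha> x\<bar> \<le> M" "\<And>x. \<bar>\<beta> x\<bar> \<le> M" "\<And>x. \<bar>\<gamma> x\<bar> \<le> M"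
      "\<And>x. x \<notin> cball ctr \<rho> \<Longrightarrow> \<alpha> x = 0" "\<And>x. x \<notin> cball ctr \<rho> \<Longrightarrow> \<beta> x = 0" "\<And>x. x \<notin> cball ctr \<rho> \<Longrightarrow> \<gamma> x = 0"
    and t: "t \<ge> 0"
    and sym: "\<And>i j x. a i j x = a j i x"
    and lip: "\<And>i j x y. \<bar>a i j x - a i j y\<bar> \<le> t * norm (x - y)"
    and bd: "\<And>i j x. \<bar>a i j x\<bar> \<le> th"
    and ell: "\<And>x \<xi>. (\<Sum>i\<in>UNIV. (\<xi> i)\<^sup>2) / th \<le> (\<Sum>i\<in>UNIV. \<Sum>j\<in>UNIV. \<xi> i * a i j x * \<xi> j)"
    and wj: "wjet ctr \<rho> e f F FF" and e: "e > 0"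
  shows "0 \<le> (LINT x|lborel. \<alpha> x * (f x)\<^sup>2 + \<beta> x * (\<Sum>i\<in>UNIV. (F i x)\<^sup>2) + \<gamma> x * (\<Sum>i\<in>UNIV. \<Sum>j\<in>UNIV. a i j x * FF i j x)\<^sup>2)"
    and "integrable lborel (\<lambda>x. \<alpha> x * (f x)\<^sup>2 + \<beta> x * (\<Sum>i\<in>UNIV. (F i x)\<^sup>2) + \<gamma> x * (\<Sum>i\<in>UNIV. \<Sum>j\<in>UNIV. a i j x * FF i j x)\<^sup>2)"
proof -
  define S where "S = cball ctr \<rho>"
  have S: "S \<in> sets borel" unfolding S_def by simp
  have fi: "integrable lborel f" "integrable lborel (\<lambda>x. (f x)\<^sup>2)"
    and Fi: "integrable lborel (F i)" "integrable lborel (\<lambda>x. (F i x)\<^sup>2)"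
    and FFi: "integrable lborel (FF i j)" "integrable lborel (\<lambda>x. (FF i j x)\<^sup>2)" for i j using wj unfolding wjet_def by auto
  have "\<forall>n. \<exists>r :: real ^ 'n \<Rightarrow> real. mollifier (inverse (real (Suc n))) r"
    unfolding mollifier_def by (intro allI mollifier_exists) simp
  from choice[OF this] obtain r :: "nat \<Rightarrow> real ^ 'n \<Rightarrow> real"
    where "\<forall>n. mollifier (inverse (real (Suc n))) (r n)" by blast
  then have r: "\<And>n. mollifier (inverse (real (Suc n))) (r n)" by blast
  define good where "good N u \<longleftrightarrow> l2conv S (\<lambda>n. conv (r (n + N)) u) u" for N u
  have gd: "\<exists>n0. \<forall>N\<ge>n0. good N u" if "integrable lborel u" "integrable lborel (\<lambda>x. (u x)\<^sup>2)" for u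
    using l2conv_conv[OF that S] r unfolding good_def by metis
  obtain n1 where n1: "\<And>N. N \<ge> n1 \<Longrightarrow> good N f" using gd[OF fi] by blast
  obtain n2 where n2: "\<And>i N. N \<ge> n2 i \<Longrightarrow> good N (F i)" using gd[OF Fi] by metis
  obtain n3 where n3: "\<And>i j N. N \<ge> n3 i j \<Longrightarrow> good N (FF i j)" using gd[OF FFi] by metis
  obtain n4 where n4: "\<And>n. n \<ge> n4 \<Longrightarrow> inverse (real (Suc n)) < e" using LIMSEQ_D[OF LIMSEQ_inverse_real_of_nat e] by auto
  \<comment> \<open>A sum as a common upper bound of the finitely many thresholds.\<close>
  define N where "N = n1 + (\<Sum>i\<in>UNIV. n2 i) + (\<Sum>i\<in>UNIV. \<Sum>j\<in>UNIV. n3 i j) + n4"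
  have N: "N \<ge> n1" "N \<ge> n2 i" "N \<ge> n3 i j" "N \<ge> n4" for i j
  proof -
    have "n2 i \<le> (\<Sum>i\<in>UNIV. n2 i)" by (rule member_le_sum) auto
    moreover have "n3 i j \<le> (\<Sum>j\<in>UNIV. n3 i j)" by (rule member_le_sum) auto
    moreover have "(\<Sum>j\<in>UNIV. n3 i j) \<le> (\<Sum>i\<in>UNIV. \<Sum>j\<in>UNIV. n3 i j)" by (rule member_le_sum) auto
    ultimately show "N \<ge> n1" "N \<ge> n2 i" "N \<ge> n3 i j" "N \<ge> n4" unfolding N_def by linarith+
  qed
  have lf: "l2conv S (\<lambda>n. conv (r (n + N)) f) f" using n1[OF N(1)] unfolding good_def .
  have lF: "l2conv S (\<lambda>n. conv (r (n + N)) (F i)) (F i)" for i using n2[OF N(2)] unfolding good_def .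
  have lFF: "l2conv S (\<lambda>n. conv (r (n + N)) (FF i j)) (FF i j)" for i j using n3[OF N(3)] unfolding good_def .
  define \<epsilon> where "\<epsilon> n = inverse (real (Suc (n + N)))" for n
  have ep: "mollifier (\<epsilon> n) (r (n + N))" "\<epsilon> n < e" "\<epsilon> n \<le> 1" for n
  proof -
    show "mollifier (\<epsilon> n) (r (n + N))" unfolding \<epsilon>_def by (rule r)
    show "\<epsilon> n < e" unfolding \<epsilon>_def by (rule n4) (use N(4) in simp)
    show "\<epsilon> n \<le> 1" unfolding \<epsilon>_def by (simp add: inverse_le_1_iff)
  qed
  have eplim: "(\<lambda>n. t * \<epsilon> n) \<longlonglongrightarrow> 0"
  proof -
    have "\<epsilon> \<longlonglongrightarrow> 0" unfolding \<epsilon>_def by (rule LIMSEQ_ignore_initial_segment[OF LIMSEQ_inverse_real_of_nat])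
    then have "(\<lambda>n. t * \<epsilon> n) \<longlonglongrightarrow> t * 0" by (intro tendsto_intros)
    then show ?thesis by simp
  qed
  have "\<forall>n. \<exists>R RR. has_grad (r (n + N)) R \<and> (\<forall>i. has_grad (R i) (RR i))"
    using bumpy_jet[OF mollifierD(1)[OF r]] by metis
  then obtain R RR where R: "\<And>n. has_grad (r (n + N)) (R n)" "\<And>n i. has_grad (R n i) (RR n i)" by metis
  \<comment> \<open>The margin 2 exceeds every radius \<open>\<epsilon> n\<close>, which is at most
    1.\<close>
  define am where "am n i j = conv (r (n + N)) (\<lambda>y. indicator (cball ctr (\<rho> + 2)) y * a i j y)" for n i j
  have e2: "\<epsilon> n < 2" for n using ep(3)[of n] by linarith
  note cm = elliptic_coeffs_mollify[OF ep(1) R(1) e2 t sym lip bd ell, where ctr=ctr and \<rho>=\<rho>, folded am_def]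
  have J: "jet (conv (r (n + N)) f) (\<lambda>i. conv (R n i) f) (\<lambda>i j. conv (RR n i j) f)" for n
    by (rule conv_jet[OF mollifierD(1)[OF ep(1)] mollifierD(3)[OF ep(1)] fi(1) R])
  have wc: "conv (R n i) f x = conv (r (n + N)) (F i) x" "conv (RR n i j) f x = conv (r (n + N)) (FF i j) x"
    if "x \<in> cball ctr \<rho>" for n i j x
    using wjetD[OF wj ep(1,2) R that] by blast+
  define P where "P n x = (\<Sum>i\<in>UNIV. \<Sum>j\<in>UNIV. am n i j x * conv (r (n + N)) (FF i j) x)" for n x
  define Q where "Q x = (\<Sum>i\<in>UNIV. \<Sum>j\<in>UNIV. a i j x * FF i j x)" for x
  have ca: "continuous_on UNIV (a i j)" for i j
    by (rule lipschitz_on_continuous_on[of t]) (use lip t in \<open>auto intro!: lipschitz_onI simp: dist_norm\<close>)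
  have lP: "l2conv S P Q"
    unfolding P_def[abs_def] Q_def[abs_def]
  proof (intro l2conv_sum S l2conv_mult[OF lFF])
    show "am n i j \<in> borel_measurable borel" for n i j
      by (rule has_grad_measurable[OF elliptic_coeffsD(1)[OF cm(1)]])
    show "a i j \<in> borel_measurable borel" for i j using ca by (rule borel_measurable_continuous_onI)
    show "\<bar>am n i j x\<bar> \<le> th" if "x \<in> S" for n i j x
      using that unfolding S_def by (rule elliptic_coeffsD(2)[OF cm(1)])
    show "\<bar>a i j x\<bar> \<le> th" for i j x by (rule bd)
    show "\<bar>am n i j x - a i j x\<bar> \<le> t * \<epsilon> n" if "x \<in> S" for n i j x
      using that unfolding S_def by (rule cm(2))
    show "(\<lambda>n. t * \<epsilon> n) \<longlonglongrightarrow> 0" by (rule eplim)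
  qed
  have w': "\<And>x. x \<notin> S \<Longrightarrow> \<alpha> x = 0" "\<And>x. x \<notin> S \<Longrightarrow> \<beta> x = 0" "\<And>x. x \<notin> S \<Longrightarrow> \<gamma> x = 0" using w unfolding S_def by auto
  note cf = l2conv_weighted[OF lf w(1,4) w'(1)]
  note cF = l2conv_weighted[OF lF w(2,5) w'(2)]
  note cP = l2conv_weighted[OF lP w(3,6) w'(3)]
  define X where "X n = (LINT x|lborel. \<alpha> x * (conv (r (n + N)) f x)\<^sup>2) + (\<Sum>i\<in>UNIV. (LINT x|lborel. \<beta> x * (conv (r (n + N)) (F i) x)\<^sup>2)) + (LINT x|lborel. \<gamma> x * (P n x)\<^sup>2)" for n
  define Y where "Y = (LINT x|lborel. \<alpha> x * (f x)\<^sup>2) + (\<Sum>i\<in>UNIV. (LINT x|lborel. \<beta> x * (F i x)\<^sup>2)) + (LINT x|lborel. \<gamma> x * (Q x)\<^sup>2)"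
  have XY: "X \<longlonglongrightarrow> Y" unfolding X_def[abs_def] Y_def by (intro tendsto_intros cf cF cP)
  have X0: "0 \<le> X n" for n
  proof -
    have "0 \<le> (LINT x|lborel. \<alpha> x * (conv (r (n + N)) f x)\<^sup>2 + \<beta> x * (\<Sum>i\<in>UNIV. (conv (R n i) f x)\<^sup>2) + \<gamma> x * (\<Sum>i\<in>UNIV. \<Sum>j\<in>UNIV. am n i j x * conv (RR n i j) f x)\<^sup>2)"
      by (rule ineq[rule_format, OF cm(1) J])
    \<comment> \<open>On the ball, derivatives of the mollified function are the mollified weak
      derivatives; off the ball \<open>\<beta>\<close> and \<open>\<gamma>\<close> vanish.\<close>
    also have "\<dots> = (LINT x|lborel. \<alpha> x * (conv (r (n + N)) f x)\<^sup>2 + (\<Sum>i\<in>UNIV. \<beta> x * (conv (r (n + N)) (F i) x)\<^sup>2) + \<gamma> x * (P n x)\<^sup>2)"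
    proof (intro Bochner_Integration.integral_cong refl)
      fix x
      show "\<alpha> x * (conv (r (n + N)) f x)\<^sup>2 + \<beta> x * (\<Sum>i\<in>UNIV. (conv (R n i) f x)\<^sup>2) + \<gamma> x * (\<Sum>i\<in>UNIV. \<Sum>j\<in>UNIV. am n i j x * conv (RR n i j) f x)\<^sup>2
        = \<alpha> x * (conv (r (n + N)) f x)\<^sup>2 + (\<Sum>i\<in>UNIV. \<beta> x * (conv (r (n + N)) (F i) x)\<^sup>2) + \<gamma> x * (P n x)\<^sup>2"
        using w(8,9)[of x] wc[of x n] unfolding P_def by (cases "x \<in> cball ctr \<rho>") (simp_all add: sum_distrib_left)
    qed
    also have "\<dots> = X n" unfolding X_def using cf(1) cF(1) cP(1) by simp
    finally show ?thesis .
  qed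
  have "0 \<le> Y" by (rule LIMSEQ_le_const[OF XY]) (use X0 in auto)
  also have "Y = (LINT x|lborel. \<alpha> x * (f x)\<^sup>2 + \<beta> x * (\<Sum>i\<in>UNIV. (F i x)\<^sup>2) + \<gamma> x * (Q x)\<^sup>2)"
    unfolding Y_def sum_distrib_left using cf(2) cF(2) cP(2) by simp
  finally show "0 \<le> (LINT x|lborel. \<alpha> x * (f x)\<^sup>2 + \<beta> x * (\<Sum>i\<in>UNIV. (F i x)\<^sup>2) + \<gamma> x * (\<Sum>i\<in>UNIV. \<Sum>j\<in>UNIV. a i j x * FF i j x)\<^sup>2)"
    unfolding Q_def .
  have "integrable lborel (\<lambda>x. \<alpha> x * (f x)\<^sup>2 + \<beta> x * (\<Sum>i\<in>UNIV. (F i x)\<^sup>2) + \<gamma> x * (Q x)\<^sup>2)"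
    unfolding sum_distrib_left by (intro Bochner_Integration.integrable_add Bochner_Integration.integrable_sum cf(2) cF(2) cP(2))
  then show "integrable lborel (\<lambda>x. \<alpha> x * (f x)\<^sup>2 + \<beta> x * (\<Sum>i\<in>UNIV. (F i x)\<^sup>2) + \<gamma> x * (\<Sum>i\<in>UNIV. \<Sum>j\<in>UNIV. a i j x * FF i j x)\<^sup>2)"
    unfolding Q_def .
qed

section \<open>Complex-valued functions: gradient bound and core estimate\<close>

lemma elliptic_coeffs_subset: "elliptic_coeffs th t S a da \<Longrightarrow> T \<subseteq> S \<Longrightarrow> elliptic_coeffs th t T a da"
  unfolding elliptic_coeffs_def by blast

definition wjet_complex :: "real ^ 'n::finite \<Rightarrow> real \<Rightarrow> real \<Rightarrow> (real ^ 'n \<Rightarrow> complex) \<Rightarrow> ('n \<Rightarrow> real ^ 'n \<Rightarrow> complex) \<Rightarrow> ('n \<Rightarrow> 'n \<Rightarrow> real ^ 'n \<Rightarrow> complex) \<Rightarrow> bool" where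
  "wjet_complex ctr \<rho> e f F FF \<longleftrightarrow>
     wjet ctr \<rho> e (\<lambda>x. Re (f x)) (\<lambda>i x. Re (F i x)) (\<lambda>i j x. Re (FF i j x)) \<and>
     wjet ctr \<rho> e (\<lambda>x. Im (f x)) (\<lambda>i x. Im (F i x)) (\<lambda>i j x. Im (FF i j x))"

definition lip_elliptic :: "real \<Rightarrow> real \<Rightarrow> ('n::finite \<Rightarrow> 'n \<Rightarrow> real ^ 'n \<Rightarrow> real) \<Rightarrow> bool" where
  "lip_elliptic th t a \<longleftrightarrow> (\<forall>i j x. a i j x = a j i x) \<and> (\<forall>i j x y. \<bar>a i j x - a i j y\<bar> \<le> t * norm (x - y))
    \<and> (\<forall>i j x. \<bar>a i j x\<bar> \<le> th) \<and> (\<forall>x \<xi>. (\<Sum>i\<in>UNIV. (\<xi> i)\<^sup>2) / th \<le> (\<Sum>i\<in>UNIV. \<Sum>j\<in>UNIV. \<xi> i * a i j x * \<xi> j))"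

text \<open>The coefficients are real and the integrand is quadratic, so it splits into the
  integrands of the real and the imaginary part.\<close>

lemma transfer_to_weak_complex:
  fixes a :: "'n::finite \<Rightarrow> 'n \<Rightarrow> real ^ 'n \<Rightarrow> real"
  assumes ineq: "\<forall>a da f F FF. elliptic_coeffs th t (cball ctr \<rho>) a da \<longrightarrow> jet f F FF \<longrightarrow>
      0 \<le> (LINT x|lborel. \<alpha> x * (f x)\<^sup>2 + \<beta> x * (\<Sum>i\<in>UNIV. (F i x)\<^sup>2) + \<gamma> x * (\<Sum>i\<in>UNIV. \<Sum>j\<in>UNIV. a i j x * FF i j x)\<^sup>2)"
    and w: "\<alpha> \<in> borel_measurable borel" "\<beta> \<in> borel_measurable borel" "\<gamma> \<in> borel_measurable borel"
      "\<And>x. \<bar>\<alpha> x\<bar> \<le> M" "\<And>x. \<bar>\<beta> x\<bar> \<le> M" "\<And>x. \<bar>\<gamma> x\<bar> \<le> M"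
      "\<And>x. x \<notin> cball ctr \<rho> \<Longrightarrow> \<alpha> x = 0" "\<And>x. x \<notin> cball ctr \<rho> \<Longrightarrow> \<beta> x = 0" "\<And>x. x \<notin> cball ctr \<rho> \<Longrightarrow> \<gamma> x = 0"
    and t: "t \<ge> 0" and a: "lip_elliptic th t a"
    and wj: "wjet_complex ctr \<rho> e f F FF" and e: "e > 0"
  defines "X \<equiv> \<lambda>x. \<alpha> x * (cmod (f x))\<^sup>2 + \<beta> x * (\<Sum>i\<in>UNIV. (cmod (F i x))\<^sup>2) + \<gamma> x * (cmod (\<Sum>i\<in>UNIV. \<Sum>j\<in>UNIV. complex_of_real (a i j x) * FF i j x))\<^sup>2"
  shows "0 \<le> (LINT x|lborel. X x)" "integrable lborel X"
proof -
  have a': "\<And>i j x. a i j x = a j i x" "\<And>i j x y. \<bar>a i j x - a i j y\<bar> \<le> t * norm (x - y)" "\<And>i j x. \<bar>a i j x\<bar> \<le> th"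
    "\<And>x \<xi>. (\<Sum>i\<in>UNIV. (\<xi> i)\<^sup>2) / th \<le> (\<Sum>i\<in>UNIV. \<Sum>j\<in>UNIV. \<xi> i * a i j x * \<xi> j)"
    using a unfolding lip_elliptic_def by auto
  have wj': "wjet ctr \<rho> e (\<lambda>x. Re (f x)) (\<lambda>i x. Re (F i x)) (\<lambda>i j x. Re (FF i j x))"
     "wjet ctr \<rho> e (\<lambda>x. Im (f x)) (\<lambda>i x. Im (F i x)) (\<lambda>i j x. Im (FF i j x))" using wj unfolding wjet_complex_def by auto
  note tr = transfer_to_weak[OF ineq w t a' wj'(1) e]
  note ti = transfer_to_weak[OF ineq w t a' wj'(2) e]
  have eq: "X x = (\<alpha> x * (Re (f x))\<^sup>2 + \<beta> x * (\<Sum>i\<in>UNIV. (Re (F i x))\<^sup>2) + \<gamma> x * (\<Sum>i\<in>UNIV. \<Sum>j\<in>UNIV. a i j x * Re (FF i j x))\<^sup>2)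
    + (\<alpha> x * (Im (f x))\<^sup>2 + \<beta> x * (\<Sum>i\<in>UNIV. (Im (F i x))\<^sup>2) + \<gamma> x * (\<Sum>i\<in>UNIV. \<Sum>j\<in>UNIV. a i j x * Im (FF i j x))\<^sup>2)" for x
    unfolding X_def cmod_power2 by (simp add: sum.distrib algebra_simps)
  show "integrable lborel X" unfolding eq[abs_def] using tr(2) ti(2) by (rule Bochner_Integration.integrable_add)
  have "(LINT x|lborel. X x) = (LINT x|lborel. \<alpha> x * (Re (f x))\<^sup>2 + \<beta> x * (\<Sum>i\<in>UNIV. (Re (F i x))\<^sup>2) + \<gamma> x * (\<Sum>i\<in>UNIV. \<Sum>j\<in>UNIV. a i j x * Re (FF i j x))\<^sup>2)
    + (LINT x|lborel. \<alpha> x * (Im (f x))\<^sup>2 + \<beta> x * (\<Sum>i\<in>UNIV. (Im (F i x))\<^sup>2) + \<gamma> x * (\<Sum>i\<in>UNIV. \<Sum>j\<in>UNIV. a i j x * Im (FF i j x))\<^sup>2)"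
    unfolding eq using tr(2) ti(2) by (rule Bochner_Integration.integral_add)
  then show "0 \<le> (LINT x|lborel. X x)" using tr(1) ti(1) by linarith
qed

lemma wjet_complex_integrable:
  assumes "wjet_complex ctr \<rho> e f F FF"
  shows "integrable lborel (\<lambda>x. (cmod (f x))\<^sup>2)" "integrable lborel (\<lambda>x. (\<Sum>i\<in>UNIV. (cmod (F i x))\<^sup>2))"
  using assms unfolding wjet_complex_def wjet_def cmod_power2 by auto

lemma integrable_indicator_times:
  fixes p :: "'a::euclidean_space \<Rightarrow> real"
  assumes "integrable lborel p" "S \<in> sets borel"
  shows "integrable lborel (\<lambda>x. indicator S x * p x)"
  using integrable_mult_indicator[OF _ assms(1), of S] assms(2) by simp

text \<open>The differential inequality, with \<open>z\<close> in the role of the squared modulus of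
  \<open>\<zeta>\<close>, bounds the second-order term by \<open>Kc\<close> times lower-order ones.
  With \<open>\<kappa> = 1 / (2 * Kc)\<close> half of the gradient term, under the same cutoff, pays
  for it.\<close>

lemma caccioppoli_weak:
  fixes th t r r' \<rho> Kc :: real
  assumes th: "th \<ge> 1" and t: "t \<ge> 0" and r: "0 < r" "r < r'" "r' \<le> \<rho>" and Kc: "Kc > 0"
  shows "\<exists>C>0. \<forall>(ctr :: real ^ 'n::finite) a f F FF z e. lip_elliptic th t a \<longrightarrow> wjet_complex ctr \<rho> e f F FF \<longrightarrow> e > 0 \<longrightarrow>
    integrable lborel z \<longrightarrow> (\<forall>x. z x \<ge> 0) \<longrightarrow>
    (AE x in lborel. x \<in> cball ctr \<rho> \<longrightarrow> (cmod (\<Sum>i\<in>UNIV. \<Sum>j\<in>UNIV. complex_of_real (a i j x) * FF i j x))\<^sup>2 \<le> Kc * ((cmod (f x))\<^sup>2 + (\<Sum>i\<in>UNIV. (cmod (F i x))\<^sup>2) + z x)) \<longrightarrow>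
    (LINT x|lborel. indicator (cball ctr r) x * (\<Sum>i\<in>UNIV. (cmod (F i x))\<^sup>2))
      \<le> C * ((LINT x|lborel. indicator (cball ctr r') x * (cmod (f x))\<^sup>2) + (LINT x|lborel. z x))"
proof -
  define \<kappa> where "\<kappa> = 1 / (2 * Kc)"
  have k: "\<kappa> > 0" unfolding \<kappa>_def using Kc by simp
  obtain C where C: "C > 0" and cac: "\<forall>ctr :: real ^ 'n::finite. \<exists>\<eta>. continuous_on UNIV \<eta> \<and> (\<forall>x. 0 \<le> \<eta> x \<and> \<eta> x \<le> 1)
     \<and> (\<forall>x. norm (x - ctr) \<le> r \<longrightarrow> \<eta> x = 1) \<and> (\<forall>x. norm (x - ctr) \<ge> r' \<longrightarrow> \<eta> x = 0) \<and>
     (\<forall>(a :: 'n \<Rightarrow> 'n \<Rightarrow> real ^ 'n \<Rightarrow> real) da f F FF. elliptic_coeffs th t (cball ctr r') a da \<longrightarrow> jet f F FF \<longrightarrow>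
      (LINT x|lborel. (\<eta> x)\<^sup>2 * (\<Sum>i\<in>UNIV. (F i x)\<^sup>2))
       \<le> C * (LINT x|lborel. indicator (cball ctr r') x * (f x)\<^sup>2)
         + \<kappa> * (LINT x|lborel. (\<eta> x)\<^sup>2 * (\<Sum>i\<in>UNIV. \<Sum>j\<in>UNIV. a i j x * FF i j x)\<^sup>2))"
    using caccioppoli[OF th t r(1,2) k, where ?'n='n] by (elim exE conjE) (rule that)
  have main: "(LINT x|lborel. indicator (cball ctr r) x * (\<Sum>i\<in>UNIV. (cmod (F i x))\<^sup>2))
      \<le> (2 * C + 1) * ((LINT x|lborel. indicator (cball ctr r') x * (cmod (f x))\<^sup>2) + (LINT x|lborel. z x))"
    if a: "lip_elliptic th t a" and wj: "wjet_complex ctr \<rho> e f F FF" and e: "e > 0" and z: "integrable lborel z" "\<forall>x. z x \<ge> 0"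
      and ae: "AE x in lborel. x \<in> cball ctr \<rho> \<longrightarrow> (cmod (\<Sum>i\<in>UNIV. \<Sum>j\<in>UNIV. complex_of_real (a i j x) * FF i j x))\<^sup>2 \<le> Kc * ((cmod (f x))\<^sup>2 + (\<Sum>i\<in>UNIV. (cmod (F i x))\<^sup>2) + z x)"
    for ctr :: "real ^ 'n" and a f F FF z e
  proof -
    from cac[rule_format, of ctr] obtain \<eta> where h: "continuous_on UNIV \<eta>" "\<And>x. 0 \<le> \<eta> x" "\<And>x. \<eta> x \<le> 1"
      "\<And>x. norm (x - ctr) \<le> r \<Longrightarrow> \<eta> x = 1" "\<And>x. norm (x - ctr) \<ge> r' \<Longrightarrow> \<eta> x = 0"
      and main: "\<forall>(a :: 'n \<Rightarrow> 'n \<Rightarrow> real ^ 'n \<Rightarrow> real) da f F FF. elliptic_coeffs th t (cball ctr r') a da \<longrightarrow> jet f F FF \<longrightarrow>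
      (LINT x|lborel. (\<eta> x)\<^sup>2 * (\<Sum>i\<in>UNIV. (F i x)\<^sup>2))
       \<le> C * (LINT x|lborel. indicator (cball ctr r') x * (f x)\<^sup>2)
         + \<kappa> * (LINT x|lborel. (\<eta> x)\<^sup>2 * (\<Sum>i\<in>UNIV. \<Sum>j\<in>UNIV. a i j x * FF i j x)\<^sup>2)" by blast
    have [measurable]: "\<eta> \<in> borel_measurable borel" using h(1) by (rule borel_measurable_continuous_onI)
    have h2: "0 \<le> (\<eta> x)\<^sup>2" "(\<eta> x)\<^sup>2 \<le> 1" for x using h(2,3)[of x] by (auto simp: power_le_one)
    have hz: "\<eta> x = 0" if "x \<notin> cball ctr r'" for x using h(5)[of x] that by (simp add: dist_norm norm_minus_commute)
    have sub: "cball ctr r' \<subseteq> cball ctr \<rho>" using r by auto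
    \<comment> \<open>The signs turn the Caccioppoli inequality into nonnegativity of one integral,
      the form accepted by \<open>transfer_to_weak_complex\<close>.\<close>
    define \<alpha> where "\<alpha> x = C * indicator (cball ctr r') x" for x
    define \<beta> where "\<beta> x = - ((\<eta> x)\<^sup>2)" for x
    define \<gamma> where "\<gamma> x = \<kappa> * (\<eta> x)\<^sup>2" for x
    define X where "X x = \<alpha> x * (cmod (f x))\<^sup>2 + \<beta> x * (\<Sum>i\<in>UNIV. (cmod (F i x))\<^sup>2) + \<gamma> x * (cmod (\<Sum>i\<in>UNIV. \<Sum>j\<in>UNIV. complex_of_real (a i j x) * FF i j x))\<^sup>2" for x
    have ineq: "0 \<le> (LINT x|lborel. \<alpha> x * (f x)\<^sup>2 + \<beta> x * (\<Sum>i\<in>UNIV. (F i x)\<^sup>2) + \<gamma> x * (\<Sum>i\<in>UNIV. \<Sum>j\<in>UNIV. a i j x * FF i j x)\<^sup>2)"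
      if co: "elliptic_coeffs th t (cball ctr \<rho>) a da" and J: "jet f F FF" for a da f F FF
    proof -
      have ca: "continuous_on UNIV (a i j)" for i j using elliptic_coeffsD(1)[OF co] by (rule has_grad_continuous)
      have i1: "integrable lborel (\<lambda>x. indicator (cball ctr r') x * (f x)\<^sup>2)"
        by (intro integrable_indicator_continuous continuous_intros jetD[OF J]) simp
      have i2: "integrable lborel (\<lambda>x. (\<eta> x)\<^sup>2 * (\<Sum>i\<in>UNIV. (F i x)\<^sup>2))" "integrable lborel (\<lambda>x. (\<eta> x)\<^sup>2 * (\<Sum>i\<in>UNIV. \<Sum>j\<in>UNIV. a i j x * FF i j x)\<^sup>2)"
        by (rule integrable_compact_supp[where ctr=ctr and r=r']; use h(5) in \<open>auto intro!: continuous_intros h(1) ca jetD[OF J]\<close>)+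
      have "(LINT x|lborel. (\<eta> x)\<^sup>2 * (\<Sum>i\<in>UNIV. (F i x)\<^sup>2))
       \<le> C * (LINT x|lborel. indicator (cball ctr r') x * (f x)\<^sup>2)
         + \<kappa> * (LINT x|lborel. (\<eta> x)\<^sup>2 * (\<Sum>i\<in>UNIV. \<Sum>j\<in>UNIV. a i j x * FF i j x)\<^sup>2)"
        by (rule main[rule_format, OF elliptic_coeffs_subset[OF co sub] J])
      also have "\<dots> = (LINT x|lborel. C * (indicator (cball ctr r') x * (f x)\<^sup>2) + \<kappa> * ((\<eta> x)\<^sup>2 * (\<Sum>i\<in>UNIV. \<Sum>j\<in>UNIV. a i j x * FF i j x)\<^sup>2))"
        using i1 i2 by simp
      finally have "0 \<le> (LINT x|lborel. C * (indicator (cball ctr r') x * (f x)\<^sup>2) + \<kappa> * ((\<eta> x)\<^sup>2 * (\<Sum>i\<in>UNIV. \<Sum>j\<in>UNIV. a i j x * FF i j x)\<^sup>2)) - (LINT x|lborel. (\<eta> x)\<^sup>2 * (\<Sum>i\<in>UNIV. (F i x)\<^sup>2))"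
        by simp
      also have "\<dots> = (LINT x|lborel. (C * (indicator (cball ctr r') x * (f x)\<^sup>2) + \<kappa> * ((\<eta> x)\<^sup>2 * (\<Sum>i\<in>UNIV. \<Sum>j\<in>UNIV. a i j x * FF i j x)\<^sup>2)) - (\<eta> x)\<^sup>2 * (\<Sum>i\<in>UNIV. (F i x)\<^sup>2))"
        by (rule Bochner_Integration.integral_diff[symmetric]) (use i1 i2 in auto)
      also have "\<dots> = (LINT x|lborel. \<alpha> x * (f x)\<^sup>2 + \<beta> x * (\<Sum>i\<in>UNIV. (F i x)\<^sup>2) + \<gamma> x * (\<Sum>i\<in>UNIV. \<Sum>j\<in>UNIV. a i j x * FF i j x)\<^sup>2)"
        unfolding \<alpha>_def \<beta>_def \<gamma>_def by (intro Bochner_Integration.integral_cong refl) (simp add: algebra_simps)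
      finally show ?thesis .
    qed
    define M where "M = C + 1 + \<kappa>"
    have X: "0 \<le> (LINT x|lborel. X x)" "integrable lborel X"
    proof -
      have m: "\<alpha> \<in> borel_measurable borel" "\<beta> \<in> borel_measurable borel" "\<gamma> \<in> borel_measurable borel"
      proof -
        show "\<alpha> \<in> borel_measurable borel" unfolding \<alpha>_def[abs_def]
          by (intro borel_measurable_times borel_measurable_const borel_measurable_indicator) simp
        show "\<beta> \<in> borel_measurable borel" "\<gamma> \<in> borel_measurable borel"
          unfolding \<beta>_def[abs_def] \<gamma>_def[abs_def]
          by (intro borel_measurable_continuous_onI continuous_intros h(1))+
      qed
      have b: "\<bar>\<alpha> x\<bar> \<le> M" "\<bar>\<beta> x\<bar> \<le> M" "\<bar>\<gamma> x\<bar> \<le> M" for x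
      proof -
        show "\<bar>\<alpha> x\<bar> \<le> M" unfolding \<alpha>_def M_def using C k by (simp add: indicator_def)
        show "\<bar>\<beta> x\<bar> \<le> M" unfolding \<beta>_def M_def using C k h2[of x] by simp
        have "\<kappa> * (\<eta> x)\<^sup>2 \<le> \<kappa> * 1" using k h2[of x] by (intro mult_left_mono) auto
        moreover have "\<bar>\<gamma> x\<bar> = \<kappa> * (\<eta> x)\<^sup>2" unfolding \<gamma>_def using k by simp
        ultimately show "\<bar>\<gamma> x\<bar> \<le> M" unfolding M_def using C by linarith
      qed
      have zz: "\<alpha> x = 0" "\<beta> x = 0" "\<gamma> x = 0" if "x \<notin> cball ctr \<rho>" for x
      proof -
        have nx: "x \<notin> cball ctr r'" using that sub by blast
        then show "\<alpha> x = 0" "\<beta> x = 0" "\<gamma> x = 0" unfolding \<alpha>_def \<beta>_def \<gamma>_def using hz[OF nx] by simp_all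
      qed
      note T = transfer_to_weak_complex[OF _ m b zz t a wj e]
      show "0 \<le> (LINT x|lborel. X x)" unfolding X_def by (rule T(1)) (use ineq in blast)+
      show "integrable lborel X" unfolding X_def[abs_def] by (rule T(2)) (use ineq in blast)+
    qed
    note ip = wjet_complex_integrable[OF wj]
    \<comment> \<open>What is left of \<open>X\<close> once half of the gradient term has been
      spent; \<open>\<kappa> * Kc = 1/2\<close> explains the halves in front of \<open>f\<close> and
      \<open>z\<close>.\<close>
    define Y where "Y x = (C + 1/2) * (indicator (cball ctr r') x * (cmod (f x))\<^sup>2) - 1/2 * (indicator (cball ctr r) x * (\<Sum>i\<in>UNIV. (cmod (F i x))\<^sup>2)) + 1/2 * z x" for x
    have iY: "integrable lborel Y" unfolding Y_def[abs_def]
      using integrable_indicator_times[OF ip(1)] integrable_indicator_times[OF ip(2)] z(1) by auto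
    have XY: "AE x in lborel. X x \<le> Y x" using ae
    proof eventually_elim
      case (elim x)
      define q where "q = (\<Sum>i\<in>UNIV. (cmod (F i x))\<^sup>2)"
      define p where "p = (cmod (f x))\<^sup>2"
      define P where "P = (cmod (\<Sum>i\<in>UNIV. \<Sum>j\<in>UNIV. complex_of_real (a i j x) * FF i j x))\<^sup>2"
      have q0: "q \<ge> 0" and p0: "p \<ge> 0" unfolding q_def p_def by (simp_all add: sum_nonneg)
      show ?case
      proof (cases "x \<in> cball ctr r'")
        case False
        then have "x \<notin> cball ctr r" using r by auto
        then show ?thesis unfolding X_def Y_def \<alpha>_def \<beta>_def \<gamma>_def using False hz[OF False] z(2) by simp
      next
        case True
        then have "P \<le> Kc * (p + q + z x)" using elim sub unfolding P_def p_def q_def by blast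
        then have "\<kappa> * P \<le> \<kappa> * (Kc * (p + q + z x))" using k by (intro mult_left_mono) auto
        also have "\<dots> = (p + q + z x) / 2" unfolding \<kappa>_def using Kc by simp
        finally have "(\<eta> x)\<^sup>2 * (\<kappa> * P) \<le> (\<eta> x)\<^sup>2 * ((p + q + z x) / 2)" by (intro mult_left_mono) auto
        moreover have "(\<eta> x)\<^sup>2 * (p / 2) \<le> 1 * (p / 2)" "(\<eta> x)\<^sup>2 * (z x / 2) \<le> 1 * (z x / 2)"
          using h2[of x] p0 z(2) by (intro mult_right_mono; simp)+
        moreover have "indicator (cball ctr r) x * (q / 2) \<le> (\<eta> x)\<^sup>2 * (q / 2)"
        proof (cases "x \<in> cball ctr r")
          case True
          then have "\<eta> x = 1" by (intro h(4)) (simp add: dist_norm norm_minus_commute)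
          then show ?thesis using True by simp
        qed (use q0 in simp)
        ultimately have "C * p - (\<eta> x)\<^sup>2 * q + (\<eta> x)\<^sup>2 * (\<kappa> * P) \<le> C * p + p / 2 - indicator (cball ctr r) x * (q / 2) + z x / 2"
          by (simp add: algebra_simps)
        then show ?thesis using True unfolding X_def Y_def \<alpha>_def \<beta>_def \<gamma>_def p_def[symmetric] q_def[symmetric] P_def[symmetric]
          by (simp add: algebra_simps)
      qed
    qed
    have "0 \<le> (LINT x|lborel. Y x)" using X integral_mono_AE[OF X(2) iY XY] by linarith
    also have "\<dots> = (C + 1/2) * (LINT x|lborel. indicator (cball ctr r') x * (cmod (f x))\<^sup>2) - 1/2 * (LINT x|lborel. indicator (cball ctr r) x * (\<Sum>i\<in>UNIV. (cmod (F i x))\<^sup>2)) + 1/2 * (LINT x|lborel. z x)"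
      unfolding Y_def using integrable_indicator_times[OF ip(1)] integrable_indicator_times[OF ip(2)] z(1) by simp
    finally have "(LINT x|lborel. indicator (cball ctr r) x * (\<Sum>i\<in>UNIV. (cmod (F i x))\<^sup>2)) \<le> (2 * C + 1) * (LINT x|lborel. indicator (cball ctr r') x * (cmod (f x))\<^sup>2) + (LINT x|lborel. z x)"
      by (simp add: algebra_simps)
    moreover have "0 \<le> 2 * C * (LINT x|lborel. z x)" using C z(2) by simp
    ultimately show ?thesis by (simp add: distrib_left distrib_right)
  qed
  show ?thesis
    by (rule exI[of _ "2 * C + 1"], intro conjI allI impI main) (use C in auto)
qed


text \<open>\<open>y\<close> and \<open>Om\<close> stand for the squared norms of
  \<open>\<psi>\<close> over \<open>\<Theta>\<close> and \<open>\<Omega>\<close>, and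
  \<open>z\<close> for the squared modulus of \<open>\<zeta>\<close>. The ball of radius
  \<open>3 * \<delta> / 4\<close> leaves room for a Caccioppoli estimate starting from
  \<open>\<delta> / 2\<close> and still fits into radius \<open>\<delta>\<close>; likewise
  \<open>3 * R\<close> is the room taken by the estimate on the outer shell.\<close>

lemma ucp_core:
  fixes th t \<delta> R Kc \<beta> :: real
  assumes th: "th \<ge> 1" and t: "t \<ge> 0" and d: "0 < \<delta>" "\<delta> < 2 * R" and Kc: "Kc > 0" and b: "\<beta> \<ge> 0"
  shows "\<exists>c>0. \<forall>(ctr :: real ^ 'n::finite) a f F FF z e y Om. lip_elliptic th t a \<longrightarrow> wjet_complex ctr (3 * R) e f F FF \<longrightarrow> e > 0 \<longrightarrow>
    integrable lborel z \<longrightarrow> (\<forall>x. z x \<ge> 0) \<longrightarrow>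
    (AE x in lborel. x \<in> cball ctr (3 * R) \<longrightarrow> (cmod (\<Sum>i\<in>UNIV. \<Sum>j\<in>UNIV. complex_of_real (a i j x) * FF i j x))\<^sup>2 \<le> Kc * ((cmod (f x))\<^sup>2 + (\<Sum>i\<in>UNIV. (cmod (F i x))\<^sup>2) + z x)) \<longrightarrow>
    0 \<le> y \<longrightarrow> y \<le> (LINT x|lborel. indicator (ann ctr (\<delta> / 2) R) x * (cmod (f x))\<^sup>2) \<longrightarrow>
    (LINT x|lborel. indicator (cball ctr (3 * R)) x * (cmod (f x))\<^sup>2) \<le> Om \<longrightarrow> Om \<le> \<beta> * y \<longrightarrow>
    c * y \<le> (LINT x|lborel. indicator (cball ctr (3 * \<delta> / 4)) x * (cmod (f x))\<^sup>2) + (LINT x|lborel. z x)"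
proof -
  have R: "R > 0" using d by simp
  \<comment> \<open>The shells are \<open>\<delta> / 4\<close> to \<open>\<delta> / 2\<close> and
    \<open>3 * R / 2\<close> to \<open>2 * R\<close>. The distance between \<open>R\<close>, which
    bounds the region of \<open>y\<close>, and \<open>r2\<close> is what makes the weight
    drop.\<close>
  define r0 where "r0 = \<delta> / 4"
  define r1 where "r1 = \<delta> / 2"
  define r2 where "r2 = 3 * R / 2"
  define r3 where "r3 = 2 * R"
  have r: "0 < r0" "r0 < r1" "r1 < r2" "r2 < r3" and rR: "r1 < R" "R < r2" unfolding r0_def r1_def r2_def r3_def using d R by auto
  obtain l C s0 where lC: "l > 0" "C > 0" "s0 \<ge> 1" and Ca: "\<forall>ctr (a :: 'n::finite \<Rightarrow> 'n \<Rightarrow> real ^ 'n \<Rightarrow> real) da f F FF s.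
     elliptic_coeffs th t (cball ctr r3) a da \<longrightarrow> jet f F FF \<longrightarrow> s \<ge> s0 \<longrightarrow>
     s * (LINT x|lborel. indicator (ann ctr r1 r2) x * (((f x)\<^sup>2 + (\<Sum>i\<in>UNIV. (F i x)\<^sup>2)) * wt l s ctr x))
       \<le> C * (LINT x|lborel. indicator (ann ctr r1 r2) x * ((\<Sum>i\<in>UNIV. \<Sum>j\<in>UNIV. a i j x * FF i j x)\<^sup>2 * wt l s ctr x)
          + (indicator (ann ctr r0 r1) x + indicator (ann ctr r2 r3) x) *
             (((f x)\<^sup>2 + (\<Sum>i\<in>UNIV. (F i x)\<^sup>2) + (\<Sum>i\<in>UNIV. \<Sum>j\<in>UNIV. a i j x * FF i j x)\<^sup>2) * wt l s ctr x))"
    using carleman_cutoff[OF th t r, where ?'n='n] by (elim exE conjE) (rule that)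
  have q1: "0 < \<delta> / 2" "\<delta> / 2 < 3 * \<delta> / 4" "3 * \<delta> / 4 \<le> 3 * R" and q2: "0 < 2 * R" "2 * R < 3 * R" "3 * R \<le> 3 * R" using d R by auto
  obtain C1 where C1: "C1 > 0" and cac1: "\<forall>(ctr :: real ^ 'n::finite) a f F FF z e. lip_elliptic th t a \<longrightarrow> wjet_complex ctr (3 * R) e f F FF \<longrightarrow> e > 0 \<longrightarrow>
    integrable lborel z \<longrightarrow> (\<forall>x. z x \<ge> 0) \<longrightarrow>
    (AE x in lborel. x \<in> cball ctr (3 * R) \<longrightarrow> (cmod (\<Sum>i\<in>UNIV. \<Sum>j\<in>UNIV. complex_of_real (a i j x) * FF i j x))\<^sup>2 \<le> Kc * ((cmod (f x))\<^sup>2 + (\<Sum>i\<in>UNIV. (cmod (F i x))\<^sup>2) + z x)) \<longrightarrow>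
    (LINT x|lborel. indicator (cball ctr (\<delta> / 2)) x * (\<Sum>i\<in>UNIV. (cmod (F i x))\<^sup>2))
      \<le> C1 * ((LINT x|lborel. indicator (cball ctr (3 * \<delta> / 4)) x * (cmod (f x))\<^sup>2) + (LINT x|lborel. z x))"
    using caccioppoli_weak[OF th t q1 Kc, where ?'n='n] by (elim exE conjE) (rule that)
  obtain C2 where C2: "C2 > 0" and cac2: "\<forall>(ctr :: real ^ 'n::finite) a f F FF z e. lip_elliptic th t a \<longrightarrow> wjet_complex ctr (3 * R) e f F FF \<longrightarrow> e > 0 \<longrightarrow>
    integrable lborel z \<longrightarrow> (\<forall>x. z x \<ge> 0) \<longrightarrow>
    (AE x in lborel. x \<in> cball ctr (3 * R) \<longrightarrow> (cmod (\<Sum>i\<in>UNIV. \<Sum>j\<in>UNIV. complex_of_real (a i j x) * FF i j x))\<^sup>2 \<le> Kc * ((cmod (f x))\<^sup>2 + (\<Sum>i\<in>UNIV. (cmod (F i x))\<^sup>2) + z x)) \<longrightarrow>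
    (LINT x|lborel. indicator (cball ctr (2 * R)) x * (\<Sum>i\<in>UNIV. (cmod (F i x))\<^sup>2))
      \<le> C2 * ((LINT x|lborel. indicator (cball ctr (3 * R)) x * (cmod (f x))\<^sup>2) + (LINT x|lborel. z x))"
    using caccioppoli_weak[OF th t q2 Kc, where ?'n='n] by (elim exE conjE) (rule that)
  \<comment> \<open>On the shells, terms of order zero and one occur once by themselves and
    \<open>Kc\<close> times through the second-order term.\<close>
  define D where "D = C * (1 + Kc)"
  have D: "D > 0" "C * Kc > 0" unfolding D_def using lC Kc by auto
  \<comment> \<open>\<open>A1\<close> collects the factors of the data, the inner ball and
    \<open>z\<close>, under the weight \<open>m0\<close>; \<open>A2\<close> collects those of
    \<open>f\<close> on the ball of radius \<open>3 * R\<close> under the weight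
    \<open>M2\<close>.\<close>
  define A1 where "A1 = D * (3 + C1 + C2) + C * Kc"
  define A2 where "A2 = D * (1 + C2)"
  have A: "A1 > 0" "A2 > 0" unfolding A1_def A2_def using D C1 C2 by (auto intro!: add_pos_pos)
  \<comment> \<open>The drop of \<open>h / s\<close> from radius \<open>R\<close> to the outer
    shell: the weights at these radii have ratio \<open>exp (2 * s * \<kappa>)\<close>, which grows
    with \<open>s\<close>.\<close>
  define \<kappa> where "\<kappa> = exp (- l * R\<^sup>2) - exp (- l * r2\<^sup>2)"
  have k: "\<kappa> > 0"
  proof -
    have "R\<^sup>2 < r2\<^sup>2" using rR R by (intro power_strict_mono) auto
    then show ?thesis unfolding \<kappa>_def using lC by simp
  qed
  \<comment> \<open>the last summand makes the weight on the outer shell \<open>A2 \<beta>\<close> times smaller than on the annulus\<close>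
  define s where "s = s0 + C * Kc + 1 + A2 * \<beta> / \<kappa>"
  have s: "s \<ge> s0" "s \<ge> C * Kc + 1" "s \<ge> A2 * \<beta> / \<kappa>" "s > 0"
  proof -
    have "A2 * \<beta> / \<kappa> \<ge> 0" using A b k by simp
    then show "s \<ge> s0" "s \<ge> C * Kc + 1" "s \<ge> A2 * \<beta> / \<kappa>" "s > 0" unfolding s_def using lC D by linarith+
  qed
  \<comment> \<open>\<open>m0\<close> bounds the weight from above everywhere, \<open>M1\<close>
    from below up to radius \<open>R\<close>, and \<open>M2\<close> from above beyond
    \<open>r2\<close>.\<close>
  define m0 where "m0 = exp (2 * s)"
  define M1 where "M1 = exp (2 * (s * exp (- l * R\<^sup>2)))"
  define M2 where "M2 = exp (2 * (s * exp (- l * r2\<^sup>2)))"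
  have mp: "m0 > 0" "M1 > 0" "M2 > 0" unfolding m0_def M1_def M2_def by auto
  have M2m: "M2 \<le> m0" unfolding M2_def m0_def using s lC by simp
  have ratio: "A2 * \<beta> * M2 \<le> M1 / 2"
  proof -
    have "A2 * \<beta> \<le> s * \<kappa>" using s(3) k by (simp add: pos_divide_le_eq)
    then have "2 * (A2 * \<beta>) \<le> 1 + 2 * (s * \<kappa>)" by simp
    also have "\<dots> \<le> exp (2 * (s * \<kappa>))" by (rule exp_ge_add_one_self)
    finally have "2 * (A2 * \<beta>) * M2 \<le> exp (2 * (s * \<kappa>)) * M2" using mp by (intro mult_right_mono) auto
    also have "\<dots> = M1" unfolding M1_def M2_def \<kappa>_def exp_add[symmetric] by (simp add: algebra_simps)
    finally show ?thesis by simp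
  qed
  define c where "c = M1 / (2 * A1 * m0)"
  have c: "c > 0" unfolding c_def using mp A by simp
  have main: "c * y \<le> (LINT x|lborel. indicator (cball ctr (3 * \<delta> / 4)) x * (cmod (f x))\<^sup>2) + (LINT x|lborel. z x)"
    if a: "lip_elliptic th t a" and wj: "wjet_complex ctr (3 * R) e f F FF" and e: "e > 0" and z: "integrable lborel z" "\<forall>x. z x \<ge> 0"
      and ae: "AE x in lborel. x \<in> cball ctr (3 * R) \<longrightarrow> (cmod (\<Sum>i\<in>UNIV. \<Sum>j\<in>UNIV. complex_of_real (a i j x) * FF i j x))\<^sup>2 \<le> Kc * ((cmod (f x))\<^sup>2 + (\<Sum>i\<in>UNIV. (cmod (F i x))\<^sup>2) + z x)"
      and y: "0 \<le> y" "y \<le> (LINT x|lborel. indicator (ann ctr (\<delta> / 2) R) x * (cmod (f x))\<^sup>2)"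
      and Om: "(LINT x|lborel. indicator (cball ctr (3 * R)) x * (cmod (f x))\<^sup>2) \<le> Om" "Om \<le> \<beta> * y"
    for ctr :: "real ^ 'n" and a f F FF z e y Om
  proof -
    define w1 where "w1 x = indicator (ann ctr r1 r2) x * wt l s ctr x" for x
    define w2 where "w2 x = (indicator (ann ctr r0 r1) x + indicator (ann ctr r2 r3) x) * wt l s ctr x" for x
    \<comment> \<open>The Carleman inequality with all terms on one side: \<open>- s * w1\<close> is
      its gain on the annulus, the rest its cost.\<close>
    define \<alpha> where "\<alpha> x = C * w2 x - s * w1 x" for x
    define \<gamma> where "\<gamma> x = C * (w1 x + w2 x)" for x
    define X where "X x = \<alpha> x * (cmod (f x))\<^sup>2 + \<alpha> x * (\<Sum>i\<in>UNIV. (cmod (F i x))\<^sup>2) + \<gamma> x * (cmod (\<Sum>i\<in>UNIV. \<Sum>j\<in>UNIV. complex_of_real (a i j x) * FF i j x))\<^sup>2" for x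
    have annS: "ann ctr p q \<in> sets borel" for p q using ann_compact[of ctr p q] by (simp add: compact_imp_closed)
    have wtm: "wt l s ctr x \<le> m0" for x
    proof -
      have "exp (- l * (norm (x - ctr))\<^sup>2) \<le> 1" using lC by simp
      then have "s * exp (- l * (norm (x - ctr))\<^sup>2) \<le> s * 1" using s by (intro mult_left_mono) auto
      then show ?thesis unfolding wt_def m0_def by simp
    qed
    have wt0: "0 \<le> wt l s ctr x" for x using wt_pos[of l s ctr x] by simp
    have w0: "0 \<le> w1 x" "0 \<le> w2 x" "w1 x \<le> m0" "w2 x \<le> 2 * m0" for x
      using wtm[of x] wt0[of x] mp unfolding w1_def w2_def by (auto simp: indicator_def)
    have ineq: "0 \<le> (LINT x|lborel. \<alpha> x * (f x)\<^sup>2 + \<alpha> x * (\<Sum>i\<in>UNIV. (F i x)\<^sup>2) + \<gamma> x * (\<Sum>i\<in>UNIV. \<Sum>j\<in>UNIV. a i j x * FF i j x)\<^sup>2)"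
      if co: "elliptic_coeffs th t (cball ctr (3 * R)) a da" and J: "jet f F FF" for a da f F FF
    proof -
      have ca: "continuous_on UNIV (a i j)" for i j using elliptic_coeffsD(1)[OF co] by (rule has_grad_continuous)
      have sub: "cball ctr r3 \<subseteq> cball ctr (3 * R)" unfolding r3_def using R by auto
      define P where "P x = (\<Sum>i\<in>UNIV. \<Sum>j\<in>UNIV. a i j x * FF i j x)" for x
      define T where "T x = (f x)\<^sup>2 + (\<Sum>i\<in>UNIV. (F i x)\<^sup>2)" for x
      have cP: "continuous_on UNIV P" "continuous_on UNIV T"
        unfolding P_def[abs_def] T_def[abs_def] by (intro continuous_intros ca jetD[OF J])+
      have ii: "integrable lborel (\<lambda>x. indicator (ann ctr p q) x * (u x * wt l s ctr x))" if "continuous_on UNIV u" for p q u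
        by (intro integrable_indicator_continuous ann_compact continuous_intros that wt_continuous)
      have i1: "integrable lborel (\<lambda>x. indicator (ann ctr r1 r2) x * (T x * wt l s ctr x))" by (rule ii[OF cP(2)])
      have i2: "integrable lborel (\<lambda>x. indicator (ann ctr r1 r2) x * ((P x)\<^sup>2 * wt l s ctr x)
          + (indicator (ann ctr r0 r1) x + indicator (ann ctr r2 r3) x) * ((T x + (P x)\<^sup>2) * wt l s ctr x))"
        unfolding distrib_right[of "indicator _ _ :: real"]
        by (intro Bochner_Integration.integrable_add ii continuous_intros cP)
      have "s * (LINT x|lborel. indicator (ann ctr r1 r2) x * (T x * wt l s ctr x))
       \<le> C * (LINT x|lborel. indicator (ann ctr r1 r2) x * ((P x)\<^sup>2 * wt l s ctr x)
          + (indicator (ann ctr r0 r1) x + indicator (ann ctr r2 r3) x) * ((T x + (P x)\<^sup>2) * wt l s ctr x))"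
        unfolding P_def T_def by (rule Ca[rule_format, OF elliptic_coeffs_subset[OF co sub] J s(1)])
      then have "0 \<le> (LINT x|lborel. C * (indicator (ann ctr r1 r2) x * ((P x)\<^sup>2 * wt l s ctr x)
          + (indicator (ann ctr r0 r1) x + indicator (ann ctr r2 r3) x) * ((T x + (P x)\<^sup>2) * wt l s ctr x)) - s * (indicator (ann ctr r1 r2) x * (T x * wt l s ctr x)))"
        using i1 i2 by simp
      also have "\<dots> = (LINT x|lborel. \<alpha> x * (f x)\<^sup>2 + \<alpha> x * (\<Sum>i\<in>UNIV. (F i x)\<^sup>2) + \<gamma> x * (P x)\<^sup>2)"
        unfolding \<alpha>_def \<gamma>_def w1_def w2_def T_def by (intro Bochner_Integration.integral_cong refl) (simp add: algebra_simps)
      finally show ?thesis unfolding P_def .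
    qed
    have X: "0 \<le> (LINT x|lborel. X x)" "integrable lborel X"
    proof -
      have wm: "w1 \<in> borel_measurable borel" "w2 \<in> borel_measurable borel"
        unfolding w1_def[abs_def] w2_def[abs_def]
        by (intro borel_measurable_times borel_measurable_add borel_measurable_indicator annS borel_measurable_continuous_onI wt_continuous)+
      have m: "\<alpha> \<in> borel_measurable borel" "\<gamma> \<in> borel_measurable borel"
        unfolding \<alpha>_def[abs_def] \<gamma>_def[abs_def]
        by (intro borel_measurable_diff borel_measurable_times borel_measurable_add borel_measurable_const wm)+
      define M where "M = C * (3 * m0) + s * m0"
      have bb: "\<bar>\<alpha> x\<bar> \<le> M" "\<bar>\<gamma> x\<bar> \<le> M" for x
      proof -
        have 1: "0 \<le> C * w2 x" "0 \<le> s * w1 x" "0 \<le> C * w1 x" using lC s w0[of x] by simp_all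
        have 2: "C * w2 x \<le> C * (2 * m0)" "s * w1 x \<le> s * m0" "C * w1 x \<le> C * m0" using lC s w0[of x] by (auto intro: mult_left_mono)
        have 3: "0 \<le> s * m0" "0 \<le> C * m0" using s mp lC by simp_all
        show "\<bar>\<alpha> x\<bar> \<le> M" unfolding \<alpha>_def M_def using 1 2 3 by (simp only: abs_le_iff) linarith
        have "\<gamma> x = C * w1 x + C * w2 x" unfolding \<gamma>_def by (simp add: distrib_left)
        then show "\<bar>\<gamma> x\<bar> \<le> M" unfolding M_def using 1 2 3 by (simp only: abs_le_iff) linarith
      qed
      have zz: "\<alpha> x = 0" "\<gamma> x = 0" if "x \<notin> cball ctr (3 * R)" for x
      proof -
        have "x \<notin> ann ctr r1 r2" "x \<notin> ann ctr r0 r1" "x \<notin> ann ctr r2 r3"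
          using that R r rR unfolding ann_def r3_def by (auto simp: dist_norm norm_minus_commute)
        then show "\<alpha> x = 0" "\<gamma> x = 0" unfolding \<alpha>_def \<gamma>_def w1_def w2_def by simp_all
      qed
      note T = transfer_to_weak_complex[OF _ m(1,1,2) bb(1,1,2) zz(1,1,2) t a wj e]
      show "0 \<le> (LINT x|lborel. X x)" unfolding X_def by (rule T(1)) (use ineq in blast)+
      show "integrable lborel X" unfolding X_def[abs_def] by (rule T(2)) (use ineq in blast)+
    qed
    note ip = wjet_complex_integrable[OF wj]
    define p where "p x = (cmod (f x))\<^sup>2" for x
    define q where "q x = (\<Sum>i\<in>UNIV. (cmod (F i x))\<^sup>2)" for x
    have p0: "p x \<ge> 0" and q0: "q x \<ge> 0" for x unfolding p_def q_def by (simp_all add: sum_nonneg)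
    have ipq: "integrable lborel p" "integrable lborel q" using ip unfolding p_def[abs_def] q_def[abs_def] by auto
    let ?I1 = "indicator (cball ctr (\<delta> / 2)) :: real ^ 'n \<Rightarrow> real"
    let ?I2 = "indicator (cball ctr (2 * R)) :: real ^ 'n \<Rightarrow> real"
    let ?I3 = "indicator (ann ctr (\<delta> / 2) R) :: real ^ 'n \<Rightarrow> real"
    have iI: "integrable lborel (\<lambda>x. ?I1 x * u x)" "integrable lborel (\<lambda>x. ?I2 x * u x)" "integrable lborel (\<lambda>x. ?I3 x * u x)" if "integrable lborel u" for u
      by (intro integrable_indicator_times[OF that] annS; simp)+
    define Y where "Y x = D * (m0 * (?I1 x * p x) + m0 * (?I1 x * q x) + M2 * (?I2 x * p x) + M2 * (?I2 x * q x) + 2 * m0 * z x)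
       + C * Kc * m0 * z x - M1 * (?I3 x * p x)" for x
    have iY: "integrable lborel Y" unfolding Y_def[abs_def]
      by (intro Bochner_Integration.integrable_add Bochner_Integration.integrable_diff integrable_mult_right iI ipq z(1))
    have XY: "AE x in lborel. X x \<le> Y x" using ae
    proof eventually_elim
      case (elim x)
      define P where "P = (cmod (\<Sum>i\<in>UNIV. \<Sum>j\<in>UNIV. complex_of_real (a i j x) * FF i j x))\<^sup>2"
      have z0: "z x \<ge> 0" using z by simp
      have Xx: "X x = \<alpha> x * p x + \<alpha> x * q x + \<gamma> x * P" unfolding X_def p_def q_def P_def ..
      have n1: "M1 * (?I3 x * p x) \<le> w1 x * p x"
      proof (cases "x \<in> ann ctr (\<delta> / 2) R")
        case True
        then have x: "x \<in> ann ctr r1 r2" "norm (x - ctr) \<le> R" using rR unfolding ann_def r1_def by auto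
        have "(norm (x - ctr))\<^sup>2 \<le> R\<^sup>2" using x by (simp add: power_mono)
        then have "M1 \<le> wt l s ctr x" unfolding M1_def wt_def using lC s by simp
        then show ?thesis using True x(1) p0[of x] unfolding w1_def by (simp add: mult_right_mono)
      qed (use w0 p0 in simp)
      have n2: "w2 x * u \<le> m0 * (?I1 x * u) + M2 * (?I2 x * u)" if u: "u \<ge> 0" for u
      proof -
        have "indicator (ann ctr r0 r1) x * wt l s ctr x \<le> m0 * ?I1 x"
        proof (cases "x \<in> ann ctr r0 r1")
          case True
          then have "x \<in> cball ctr (\<delta> / 2)" unfolding ann_def r1_def by (simp add: dist_norm norm_minus_commute)
          then show ?thesis using wtm[of x] True by simp
        qed (use mp in simp)
        moreover have "indicator (ann ctr r2 r3) x * wt l s ctr x \<le> M2 * ?I2 x"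
        proof (cases "x \<in> ann ctr r2 r3")
          case True
          then have x: "x \<in> cball ctr (2 * R)" "r2 \<le> norm (x - ctr)" unfolding ann_def r3_def by (simp_all add: dist_norm norm_minus_commute)
          have "r2\<^sup>2 \<le> (norm (x - ctr))\<^sup>2" using x R unfolding r2_def by (intro power_mono) auto
          then have "wt l s ctr x \<le> M2" unfolding M2_def wt_def using lC s by simp
          then show ?thesis using True x(1) by simp
        qed (use mp in simp)
        ultimately have "w2 x \<le> m0 * ?I1 x + M2 * ?I2 x" unfolding w2_def distrib_right by linarith
        then have "w2 x * u \<le> (m0 * ?I1 x + M2 * ?I2 x) * u" using u by (rule mult_right_mono)
        then show ?thesis by (simp add: distrib_right mult.assoc)
      qed
      have gz: "\<gamma> x * P \<le> \<gamma> x * (Kc * (p x + q x + z x))"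
      proof (cases "x \<in> cball ctr (3 * R)")
        case True
        then have "P \<le> Kc * (p x + q x + z x)" using elim unfolding P_def p_def q_def by blast
        moreover have "\<gamma> x \<ge> 0" unfolding \<gamma>_def using lC w0[of x] by simp
        ultimately show ?thesis by (rule mult_left_mono)
      next
        case False
        have "x \<notin> ann ctr r1 r2" "x \<notin> ann ctr r0 r1" "x \<notin> ann ctr r2 r3"
          using False R r rR unfolding ann_def r3_def by (auto simp: dist_norm norm_minus_commute)
        then show ?thesis unfolding \<gamma>_def w1_def w2_def by simp
      qed
      \<comment> \<open>The differential inequality replaces the second-order term. On the annulus
        this costs \<open>C * Kc\<close> against the gain \<open>s\<close>, and
        \<open>s \<ge> C * Kc + 1\<close> leaves a coefficient of at least 1.\<close>
      have "X x \<le> \<alpha> x * (p x + q x) + \<gamma> x * (Kc * (p x + q x + z x))" unfolding Xx using gz by (simp add: distrib_left)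
      also have "\<dots> = D * (w2 x * p x + w2 x * q x) + C * Kc * (w2 x * z x) + C * Kc * (w1 x * z x) - (s - C * Kc) * (w1 x * (p x + q x))"
        unfolding \<alpha>_def \<gamma>_def D_def by (simp add: algebra_simps)
      also have "\<dots> \<le> D * (w2 x * p x + w2 x * q x) + D * (2 * m0 * z x) + C * Kc * (m0 * z x) - 1 * (w1 x * p x)"
      proof -
        have "C * Kc * (w2 x * z x) \<le> D * (2 * m0 * z x)"
          proof -
          have "0 \<le> z x * m0" using z0 mp by simp
          have "C * Kc \<le> D" using lC unfolding D_def by simp
          have "w2 x * z x \<le> 2 * m0 * z x" using w0[of x] z0 by (intro mult_right_mono) auto
          then show ?thesis using w0[of x] z0 D \<open>C * Kc \<le> D\<close> by (intro mult_mono) auto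
        qed
        moreover have "C * Kc * (w1 x * z x) \<le> C * Kc * (m0 * z x)"
          using w0[of x] z0 D by (intro mult_left_mono mult_right_mono) auto
        moreover have "1 * (w1 x * p x) \<le> (s - C * Kc) * (w1 x * (p x + q x))"
          using w0[of x] p0[of x] q0[of x] s(2) by (intro mult_mono mult_left_mono) auto
        ultimately show ?thesis by linarith
      qed
      also have "\<dots> \<le> Y x"
      proof -
        have "D * (w2 x * p x + w2 x * q x) \<le> D * ((m0 * (?I1 x * p x) + M2 * (?I2 x * p x)) + (m0 * (?I1 x * q x) + M2 * (?I2 x * q x)))"
          using D by (intro mult_left_mono add_mono n2 p0 q0) auto
        then show ?thesis unfolding Y_def using n1 by (simp add: algebra_simps)
      qed
      finally show ?case .
    qed
    define P1 where "P1 = (LINT x|lborel. ?I1 x * p x)"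
    define Q1 where "Q1 = (LINT x|lborel. ?I1 x * q x)"
    define P2 where "P2 = (LINT x|lborel. ?I2 x * p x)"
    define Q2 where "Q2 = (LINT x|lborel. ?I2 x * q x)"
    define Z where "Z = (LINT x|lborel. z x)"
    define P3 where "P3 = (LINT x|lborel. ?I3 x * p x)"
    define B where "B = (LINT x|lborel. indicator (cball ctr (3 * \<delta> / 4)) x * p x)"
    define O' where "O' = (LINT x|lborel. indicator (cball ctr (3 * R)) x * p x)"
    have "0 \<le> (LINT x|lborel. Y x)" using X integral_mono_AE[OF X(2) iY XY] by linarith
    also have "(LINT x|lborel. Y x) = D * (m0 * P1 + m0 * Q1 + M2 * P2 + M2 * Q2 + 2 * m0 * Z) + C * Kc * m0 * Z - M1 * P3"
      unfolding Y_def P1_def Q1_def P2_def Q2_def Z_def P3_def using iI ipq z(1) by simp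
    finally have main1: "M1 * P3 \<le> D * (m0 * P1 + m0 * Q1 + M2 * P2 + M2 * Q2 + 2 * m0 * Z) + C * Kc * m0 * Z" by simp
    have imono: "(LINT x|lborel. indicator S x * p x) \<le> (LINT x|lborel. indicator T x * p x)" if "S \<subseteq> T" "S \<in> sets borel" "T \<in> sets borel" for S T
      by (rule integral_mono[OF integrable_indicator_times[OF ipq(1) that(2)] integrable_indicator_times[OF ipq(1) that(3)]])
         (use that(1) p0 in \<open>auto simp: indicator_def\<close>)
    have "P1 \<le> B" unfolding P1_def B_def by (rule imono) (use d in auto)
    have "P2 \<le> O'" unfolding P2_def O'_def by (rule imono) (use R in auto)
    have Q1: "Q1 \<le> C1 * (B + Z)" unfolding Q1_def q_def B_def p_def Z_def
      by (rule cac1[rule_format, OF a wj e z(1)]) (use z(2) ae in auto)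
    have Q2: "Q2 \<le> C2 * (O' + Z)" unfolding Q2_def q_def O'_def p_def Z_def
      by (rule cac2[rule_format, OF a wj e z(1)]) (use z(2) ae in auto)
    have B0: "B \<ge> 0" unfolding B_def using p0 by simp
    have Z0: "Z \<ge> 0" unfolding Z_def using z(2) by simp
    have O0: "O' \<ge> 0" unfolding O'_def using p0 by simp
    have yO: "O' \<le> \<beta> * y" using Om unfolding O'_def p_def by linarith
    have "M1 * y \<le> M1 * P3" using y(2) mp unfolding P3_def p_def by (intro mult_left_mono) auto
    also have "\<dots> \<le> D * (m0 * B + m0 * (C1 * (B + Z)) + M2 * O' + M2 * (C2 * (O' + Z)) + 2 * m0 * Z) + C * Kc * m0 * Z"
    proof -
      have "m0 * P1 + m0 * Q1 + M2 * P2 + M2 * Q2 + 2 * m0 * Z \<le> m0 * B + m0 * (C1 * (B + Z)) + M2 * O' + M2 * (C2 * (O' + Z)) + 2 * m0 * Z"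
        using \<open>P1 \<le> B\<close> \<open>P2 \<le> O'\<close> Q1 Q2 mp by (intro add_mono mult_left_mono) auto
      then have "D * (m0 * P1 + m0 * Q1 + M2 * P2 + M2 * Q2 + 2 * m0 * Z) \<le> D * (m0 * B + m0 * (C1 * (B + Z)) + M2 * O' + M2 * (C2 * (O' + Z)) + 2 * m0 * Z)"
        using D by (intro mult_left_mono) auto
      then show ?thesis using main1 by linarith
    qed
    also have "\<dots> \<le> A1 * m0 * (B + Z) + A2 * M2 * O'"
    proof -
      have 1: "D * (M2 * (C2 * Z)) \<le> D * (m0 * (C2 * Z))" using D C2 Z0 M2m by (intro mult_left_mono mult_right_mono) auto
      have 2: "0 \<le> D * (m0 * B)" "0 \<le> D * (m0 * (C2 * B))" "0 \<le> C * Kc * m0 * B" "0 \<le> D * (m0 * Z)" using D C2 B0 Z0 mp by simp_all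
      have "A1 * m0 * (B + Z) + A2 * M2 * O' - (D * (m0 * B + m0 * (C1 * (B + Z)) + M2 * O' + M2 * (C2 * (O' + Z)) + 2 * m0 * Z) + C * Kc * m0 * Z)
        = 2 * (D * (m0 * B)) + D * (m0 * (C2 * B)) + D * (m0 * Z) + C * Kc * m0 * B + (D * (m0 * (C2 * Z)) - D * (M2 * (C2 * Z)))"
        unfolding A1_def A2_def by (simp add: algebra_simps)
      then show ?thesis using 1 2 by linarith
    qed
    \<comment> \<open>The outer contribution is at most \<open>\<beta> * y\<close> under a weight so
      small that half of the left-hand side absorbs it.\<close>
    also have "A2 * M2 * O' \<le> M1 / 2 * y"
    proof -
      have "A2 * M2 * O' \<le> A2 * M2 * (\<beta> * y)" using yO A mp by (intro mult_left_mono) auto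
      also have "\<dots> = A2 * \<beta> * M2 * y" by simp
      also have "\<dots> \<le> M1 / 2 * y" using ratio y by (intro mult_right_mono)
      finally show ?thesis .
    qed
    finally have "M1 / 2 * y \<le> A1 * m0 * (B + Z)" by simp
    then have "c * y \<le> B + Z" unfolding c_def using A mp by (simp add: field_simps)
    then show ?thesis unfolding B_def Z_def p_def .
  qed
  show ?thesis
    by (rule exI[of _ c], intro conjI allI impI c main; (elim allE)?; assumption)
qed

section \<open>Quantitative unique continuation\<close>

text \<open>The partial derivative of a test function is a test function, so \<open>F\<close> can be
  tested through it. Lists are folded from the right: \<open>[j, i]\<close> applies \<open>i\<close>
  first, which matches inserting the \<open>i\<close>-th derivative of the test function into the
  identity for \<open>[j]\<close>.\<close>

lemma weak_deriv_iterate: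
  assumes F: "has_weak_deriv \<Omega> [j] \<psi> F" and G: "has_weak_deriv \<Omega> [j, i] \<psi> G"
  shows "has_weak_deriv \<Omega> [i] F G"
  unfolding has_weak_deriv_def
proof (intro conjI allI impI)
  show "locally_integrable \<Omega> F" "locally_integrable \<Omega> G" using F G unfolding has_weak_deriv_def by auto
  fix \<phi> assume t: "test_function \<Omega> \<phi>"
  define S where "S = closure {x. \<phi> x \<noteq> 0}"
  have S: "compact S" "S \<subseteq> \<Omega>" "closed S" using t unfolding S_def test_function_def by auto
  have "{x. partial_deriv i \<phi> x \<noteq> 0} \<subseteq> S" using test_function_pairs(4)[OF t, of _ i] unfolding S_def by blast
  then have cl: "closure {x. partial_deriv i \<phi> x \<noteq> 0} \<subseteq> S" by (rule closure_minimal) (rule S)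
  have "smooth (partial_deriv i \<phi>)" using t smooth_partial_deriv unfolding test_function_def by blast
  moreover have "compact (closure {x. partial_deriv i \<phi> x \<noteq> 0})"
    using compact_Int_closed[OF S(1) closed_closure, of "{x. partial_deriv i \<phi> x \<noteq> 0}"] cl by (simp add: inf_absorb2)
  ultimately have t': "test_function \<Omega> (partial_deriv i \<phi>)" unfolding test_function_def using cl S(2) by blast
  have "- (LINT x|lebesgue_on \<Omega>. F x * partial_deriv i \<phi> x) = (LINT x|lebesgue_on \<Omega>. G x * \<phi> x)"
    using has_weak_derivD[OF F t'] has_weak_derivD[OF G t] by (simp add: iterated_partial_def)
  then show "(LINT x|lebesgue_on \<Omega>. F x * iterated_partial [i] \<phi> x) = (-1) ^ length [i] * (LINT x|lebesgue_on \<Omega>. G x * \<phi> x)"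
    by (simp add: iterated_partial_def minus_equation_iff)
qed

section \<open>From the differential expression to its second-order part\<close>

lemma abs_entry_le_row_sum_norm:
  fixes M :: "real ^ 'n::finite ^ 'm::finite"
  shows "\<bar>M $ i $ j\<bar> \<le> row_sum_norm M"
proof -
  have "\<bar>M $ i $ j\<bar> \<le> (\<Sum>j\<in>UNIV. \<bar>M $ i $ j\<bar>)" by (rule member_le_sum) auto
  also have "\<dots> \<le> row_sum_norm M" unfolding row_sum_norm_def by (intro Max_ge) auto
  finally show ?thesis .
qed

lemma quadratic_form_sum:
  fixes M :: "real ^ 'n::finite ^ 'n"
  shows "\<xi> \<bullet> (M *v \<xi>) = (\<Sum>i\<in>UNIV. \<Sum>j\<in>UNIV. \<xi> $ i * M $ i $ j * \<xi> $ j)"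
  by (simp add: inner_vec_def matrix_vector_mult_def sum_distrib_left mult.assoc)

text \<open>Testing the form with the sum and the difference of two basis vectors bounds twice the
  absolute value of the entry by the sum of two diagonal entries, each at most
  \<open>th\<close>.\<close>

lemma symmetric_entry_le:
  fixes M :: "real ^ 'n::finite ^ 'n"
  assumes sym: "\<And>i j. M $ i $ j = M $ j $ i" and pos: "\<And>\<xi>. 0 \<le> \<xi> \<bullet> (M *v \<xi>)" and le: "\<And>\<xi>. \<xi> \<bullet> (M *v \<xi>) \<le> th * (norm \<xi>)\<^sup>2"
  shows "\<bar>M $ i $ j\<bar> \<le> th"
proof -
  have ax: "axis k 1 \<bullet> (M *v axis l 1) = M $ k $ l" for k l
    by (simp add: inner_axis' matrix_vector_mult_basis column_def)
  have d: "M $ k $ k \<le> th" for k using le[of "axis k 1"] ax[of k k] by simp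
  have 1: "0 \<le> M $ i $ i + M $ j $ j + 2 * M $ i $ j" using pos[of "axis i 1 + axis j 1"] sym[of j i]
    by (simp add: inner_add_left inner_add_right matrix_vector_right_distrib ax)
  have 2: "0 \<le> M $ i $ i + M $ j $ j - 2 * M $ i $ j" using pos[of "axis i 1 - axis j 1"] sym[of j i]
    by (simp add: inner_diff_left inner_diff_right matrix_vector_mult_diff_distrib ax)
  show ?thesis using 1 2 d[of i] d[of j] by linarith
qed

lemma admissible_lip_elliptic:
  assumes "admissible_coeffs th t A b c" "th \<ge> 1"
  shows "lip_elliptic th t (\<lambda>i j x. A x $ i $ j)"
proof -
  have sym: "A x $ i $ j = A x $ j $ i" and el: "inverse th * (norm \<xi>)\<^sup>2 \<le> \<xi> \<bullet> (A x *v \<xi>)" "\<xi> \<bullet> (A x *v \<xi>) \<le> th * (norm \<xi>)\<^sup>2"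
    and lip: "row_sum_norm (A x - A y) \<le> t * norm (x - y)" for x y i j \<xi>
    using assms(1) unfolding admissible_coeffs_def by blast+
  have pos: "0 \<le> \<xi> \<bullet> (A x *v \<xi>)" for x \<xi> using el(1)[of \<xi> x] assms(2) by (smt (verit) inverse_nonnegative_iff_nonnegative mult_nonneg_nonneg zero_le_power2)
  have "\<bar>A x $ i $ j - A y $ i $ j\<bar> \<le> t * norm (x - y)" for x y i j
    using abs_entry_le_row_sum_norm[of "A x - A y" i j] lip[of x y] by simp
  moreover have "\<bar>A x $ i $ j\<bar> \<le> th" for x i j by (rule symmetric_entry_le[OF sym pos el(2)])
  moreover have "(\<Sum>i\<in>UNIV. (\<xi> i)\<^sup>2) / th \<le> (\<Sum>i\<in>UNIV. \<Sum>j\<in>UNIV. \<xi> i * A x $ i $ j * \<xi> j)" for x and \<xi> :: "'a \<Rightarrow> real"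
    using el(1)[of "vec_lambda \<xi>" x] unfolding quadratic_form_sum norm_sq_vec by (simp add: divide_inverse mult.commute)
  ultimately show ?thesis unfolding lip_elliptic_def using sym by blast
qed

lemma in_Linf_AE_le:
  fixes b :: "'a::euclidean_space \<Rightarrow> 'b::real_normed_vector"
  assumes "in_Linf b"
  shows "AE x in lborel. norm (b x) \<le> Linf_norm b"
proof -
  define e where "e = esssup lebesgue (\<lambda>x. ereal (norm (b x)))"
  have m: "b \<in> borel_measurable lebesgue" and fin: "e < \<infinity>" using assms unfolding in_Linf_def e_def by auto
  have ae: "AE x in lebesgue. ereal (norm (b x)) \<le> e" unfolding e_def by (rule esssup_AE)
  \<comment> \<open>\<open>real_of_ereal\<close> maps both infinities to 0, so the value minus
    infinity has to be excluded as well; it would make the space a null set.\<close>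
  have "\<exists>x. ereal (norm (b x)) \<le> e"
  proof (rule ccontr)
    assume "\<not> ?thesis"
    then have "AE x in (lebesgue :: 'a measure). False" using ae by (auto elim: eventually_mono)
    then have "emeasure lebesgue (UNIV :: 'a set) = 0" by (subst (asm) AE_iff_null) (auto simp: null_sets_def)
    then show False by simp
  qed
  then have "e \<noteq> -\<infinity>" by (metis MInfty_neq_ereal(2) ereal_infty_less_eq(2))
  then have "ereal (Linf_norm b) = e" unfolding Linf_norm_def e_def[symmetric] using fin by (cases e) auto
  then have "AE x in lebesgue. ereal (norm (b x)) \<le> ereal (Linf_norm b)" using ae by (simp only:)
  then have "AE x in lebesgue. norm (b x) \<le> Linf_norm b" by (simp only: ereal_less_eq)
  then show ?thesis by (simp only: AE_completion_iff)
qed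


text \<open>By the product rule the divergence is \<open>A\<close> against the second derivatives
  plus terms in which the entries of \<open>A\<close> are differentiated, with factors at most
  \<open>t\<close>. Since \<open>diff_expr\<close> uses representatives picked by choice, each is
  first identified almost everywhere with an L2 derivative.\<close>

lemma diff_expr_bound:
  fixes A :: "real ^ 'n::finite \<Rightarrow> real ^ 'n ^ 'n"
  assumes ac: "admissible_coeffs th t A b c" and O: "open \<Omega>" and w: "in_W2 2 \<Omega> \<psi>"
  obtains G1 G2 where "\<forall>i. in_L2 \<Omega> (G1 i)" "\<forall>i. has_weak_deriv \<Omega> [i] \<psi> (G1 i)"
    "\<forall>i j. in_L2 \<Omega> (G2 i j)" "\<forall>i j. has_weak_deriv \<Omega> [i, j] \<psi> (G2 i j)"
    "AE x in lborel. x \<in> \<Omega> \<longrightarrow> cmod (\<Sum>i\<in>UNIV. \<Sum>j\<in>UNIV. complex_of_real (A x $ i $ j) * G2 i j x)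
       \<le> cmod (diff_expr \<Omega> A b c \<psi> x) + (real CARD('n) * t + Linf_norm b) * (\<Sum>i\<in>UNIV. cmod (G1 i x)) + Linf_norm c * cmod (\<psi> x)"
proof -
  have sym: "A x $ i $ j = A x $ j $ i" and lip: "row_sum_norm (A x - A y) \<le> t * norm (x - y)"
    and bc: "in_Linf b" "in_Linf c" for x y i j
    using ac unfolding admissible_coeffs_def by blast+
  have ex: "\<exists>g. in_L2 \<Omega> g \<and> has_weak_deriv \<Omega> \<alpha> \<psi> g" if "length \<alpha> \<le> 2" for \<alpha>
    using w that unfolding in_W2_def by blast
  have "\<forall>i. \<exists>g. in_L2 \<Omega> g \<and> has_weak_deriv \<Omega> [i] \<psi> g" using ex by simp
  then obtain G1 where G1: "\<And>i. in_L2 \<Omega> (G1 i)" "\<And>i. has_weak_deriv \<Omega> [i] \<psi> (G1 i)" by metis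
  have "\<forall>i j. \<exists>g. in_L2 \<Omega> g \<and> has_weak_deriv \<Omega> [i, j] \<psi> g" using ex by simp
  then obtain G2 where G2: "\<And>i j. in_L2 \<Omega> (G2 i j)" "\<And>i j. has_weak_deriv \<Omega> [i, j] \<psi> (G2 i j)" by metis
  define W where "W j = weak_partial \<Omega> j \<psi>" for j
  \<comment> \<open>Existence of \<open>G1 j\<close> makes the choice operator return a genuine weak
    derivative.\<close>
  have W: "has_weak_deriv \<Omega> [j] \<psi> (W j)" for j
    unfolding W_def weak_partial_def by (rule someI[of _ "G1 j"]) (rule G1)
  have WG: "AE x in lborel. x \<in> \<Omega> \<longrightarrow> W j x = G1 j x" for j by (rule weak_deriv_unique[OF W G1(2) O])
  have lipA: "\<bar>A x $ i $ j - A y $ i $ j\<bar> \<le> t * norm (x - y)" for x y i j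
    using abs_entry_le_row_sum_norm[of "A x - A y" i j] lip[of x y] by simp
  have "\<exists>g. (\<forall>x. \<bar>g x\<bar> \<le> t) \<and> (\<forall>\<Omega> F H. open \<Omega> \<longrightarrow> has_weak_deriv \<Omega> [i] F H \<longrightarrow>
    has_weak_deriv \<Omega> [i] (\<lambda>x. complex_of_real (A x $ i $ j) * F x) (\<lambda>x. complex_of_real (g x) * F x + complex_of_real (A x $ i $ j) * H x))" for i j
    by (rule lipschitz_product_rule) (rule lipA)
  then have "\<forall>i. \<exists>g. \<forall>j. (\<forall>x. \<bar>g j x\<bar> \<le> t) \<and> (\<forall>\<Omega> F H. open \<Omega> \<longrightarrow> has_weak_deriv \<Omega> [i] F H \<longrightarrow>
    has_weak_deriv \<Omega> [i] (\<lambda>x. complex_of_real (A x $ i $ j) * F x) (\<lambda>x. complex_of_real (g j x) * F x + complex_of_real (A x $ i $ j) * H x))"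
    by (intro allI choice)
  from choice[OF this] obtain g where gg: "\<forall>i j. (\<forall>x. \<bar>g i j x\<bar> \<le> t) \<and> (\<forall>\<Omega> F H. open \<Omega> \<longrightarrow> has_weak_deriv \<Omega> [i] F H \<longrightarrow>
    has_weak_deriv \<Omega> [i] (\<lambda>x. complex_of_real (A x $ i $ j) * F x) (\<lambda>x. complex_of_real (g i j x) * F x + complex_of_real (A x $ i $ j) * H x))"
    by (rule exE)
  have g: "\<bar>g i j x\<bar> \<le> t" for i j x by (rule gg[THEN spec, THEN spec, THEN conjunct1, THEN spec])
  have g': "has_weak_deriv \<Omega> [i] (\<lambda>x. complex_of_real (A x $ i $ j) * F x) (\<lambda>x. complex_of_real (g i j x) * F x + complex_of_real (A x $ i $ j) * H x)"
    if "open \<Omega>" "has_weak_deriv \<Omega> [i] F H" for i j \<Omega> F H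
    by (rule gg[THEN spec, THEN spec, THEN conjunct2, rule_format, OF that])
  have P: "AE x in lborel. x \<in> \<Omega> \<longrightarrow> weak_partial \<Omega> i (\<lambda>y. complex_of_real (A y $ i $ j) * W j y) x
     = complex_of_real (g i j x) * W j x + complex_of_real (A x $ i $ j) * G2 j i x" for i j
  proof -
    have h: "has_weak_deriv \<Omega> [i] (\<lambda>y. complex_of_real (A y $ i $ j) * W j y) (\<lambda>x. complex_of_real (g i j x) * W j x + complex_of_real (A x $ i $ j) * G2 j i x)"
      by (rule g'[OF O weak_deriv_iterate[OF W G2(2)]])
    show ?thesis unfolding weak_partial_def by (rule weak_deriv_unique[OF someI[of "has_weak_deriv \<Omega> [i] _", OF h] h O])
  qed
  have "AE x in lborel. \<forall>i. x \<in> \<Omega> \<longrightarrow> W i x = G1 i x" unfolding AE_all_countable using WG by (rule allI)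
  moreover have "AE x in lborel. \<forall>i j. x \<in> \<Omega> \<longrightarrow> weak_partial \<Omega> i (\<lambda>y. complex_of_real (A y $ i $ j) * W j y) x
     = complex_of_real (g i j x) * W j x + complex_of_real (A x $ i $ j) * G2 j i x"
    unfolding AE_all_countable using P by (intro allI)
  ultimately have "AE x in lborel. x \<in> \<Omega> \<longrightarrow> cmod (\<Sum>i\<in>UNIV. \<Sum>j\<in>UNIV. complex_of_real (A x $ i $ j) * G2 i j x)
       \<le> cmod (diff_expr \<Omega> A b c \<psi> x) + (real CARD('n) * t + Linf_norm b) * (\<Sum>i\<in>UNIV. cmod (G1 i x)) + Linf_norm c * cmod (\<psi> x)"
    using in_Linf_AE_le[OF bc(1)] in_Linf_AE_le[OF bc(2)]
  proof eventually_elim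
    case (elim x)
    show ?case
    proof
      assume x: "x \<in> \<Omega>"
      have wg: "W i x = G1 i x" for i using elim(1) x by blast
      define S1 where "S1 = (\<Sum>i\<in>UNIV. cmod (G1 i x))"
      define Q where "Q = (\<Sum>i\<in>UNIV. \<Sum>j\<in>UNIV. complex_of_real (A x $ i $ j) * G2 i j x)"
      define E where "E = (\<Sum>i\<in>UNIV. \<Sum>j\<in>UNIV. complex_of_real (g i j x) * G1 j x)"
      define Bx where "Bx = (\<Sum>i\<in>UNIV. b x $ i * G1 i x)"
      \<comment> \<open>The divergence delivers \<open>G2 j i\<close>; exchanging the sums and the
        symmetry of \<open>A\<close> restore the index order.\<close>
      have "Q = (\<Sum>i\<in>UNIV. \<Sum>j\<in>UNIV. complex_of_real (A x $ i $ j) * G2 j i x)"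
        unfolding Q_def by (subst sum.swap) (simp add: sym[of x])
      moreover have "(\<Sum>i\<in>UNIV. \<Sum>j\<in>UNIV. weak_partial \<Omega> i (\<lambda>y. complex_of_real (A y $ i $ j) * weak_partial \<Omega> j \<psi> y) x)
        = (\<Sum>i\<in>UNIV. \<Sum>j\<in>UNIV. complex_of_real (g i j x) * G1 j x + complex_of_real (A x $ i $ j) * G2 j i x)"
        using elim(2) x wg unfolding W_def by (intro sum.cong refl) simp
      moreover have "(\<Sum>i\<in>UNIV. b x $ i * weak_partial \<Omega> i \<psi> x) = Bx" unfolding Bx_def using wg unfolding W_def by simp
      ultimately have "diff_expr \<Omega> A b c \<psi> x = - (E + Q) + Bx + c x * \<psi> x"
        unfolding diff_expr_def E_def by (simp add: sum.distrib)
      then have "Q = - diff_expr \<Omega> A b c \<psi> x - E + Bx + c x * \<psi> x" by (simp add: algebra_simps)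
      then have "cmod Q \<le> cmod (diff_expr \<Omega> A b c \<psi> x) + cmod E + cmod Bx + cmod (c x * \<psi> x)"
        using norm_triangle_ineq[of "- diff_expr \<Omega> A b c \<psi> x - E + Bx" "c x * \<psi> x"] norm_triangle_ineq[of "- diff_expr \<Omega> A b c \<psi> x - E" Bx]
          norm_triangle_ineq4[of "- diff_expr \<Omega> A b c \<psi> x" E] by simp
      moreover have "cmod E \<le> real CARD('n) * t * S1"
      proof -
        have "cmod E \<le> (\<Sum>i\<in>(UNIV::'n set). \<Sum>j\<in>UNIV. cmod (complex_of_real (g i j x) * G1 j x))"
          unfolding E_def by (rule order_trans[OF norm_sum]) (intro sum_mono norm_sum)
        also have "\<dots> \<le> (\<Sum>i\<in>(UNIV::'n set). \<Sum>j\<in>UNIV. t * cmod (G1 j x))"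
          using g by (intro sum_mono) (simp add: norm_mult mult_right_mono)
        also have "\<dots> = real CARD('n) * t * S1" unfolding S1_def by (simp add: sum_distrib_left mult.assoc)
        finally show ?thesis .
      qed
      moreover have "cmod Bx \<le> Linf_norm b * S1"
      proof -
        have "cmod (b x $ i) \<le> Linf_norm b" for i using Finite_Cartesian_Product.norm_nth_le[of "b x" i] elim(3) by linarith
        then have "cmod Bx \<le> (\<Sum>i\<in>UNIV. Linf_norm b * cmod (G1 i x))"
          unfolding Bx_def by (intro order_trans[OF norm_sum] sum_mono) (simp add: norm_mult mult_right_mono)
        then show ?thesis unfolding S1_def by (simp add: sum_distrib_left)
      qed
      moreover have "cmod (c x * \<psi> x) \<le> Linf_norm c * cmod (\<psi> x)" using elim(4) by (simp add: norm_mult mult_right_mono)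
      ultimately show "cmod (\<Sum>i\<in>UNIV. \<Sum>j\<in>UNIV. complex_of_real (A x $ i $ j) * G2 i j x)
       \<le> cmod (diff_expr \<Omega> A b c \<psi> x) + (real CARD('n) * t + Linf_norm b) * (\<Sum>i\<in>UNIV. cmod (G1 i x)) + Linf_norm c * cmod (\<psi> x)"
        unfolding Q_def[symmetric] S1_def[symmetric] by (simp add: algebra_simps)
    qed
  qed
  then show ?thesis using G1 G2 by (intro that allI)
qed


section \<open>L2 norms, Borel representatives and weak jets\<close>

lemma L2_norm_sq:
  assumes "S \<in> sets lebesgue"
  shows "(L2_norm S f)\<^sup>2 = (LINT x|lebesgue. indicator S x * (cmod (f x))\<^sup>2)"
proof -
  have "0 \<le> (LINT x|lebesgue_on S. (cmod (f x))\<^sup>2)" by simp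
  then show ?thesis unfolding L2_norm_def using assms by (simp add: integral_restrict_space)
qed

lemma in_L2_integrable:
  assumes f: "in_L2 \<Omega> f" and S: "S \<in> sets lebesgue" "\<Omega> \<in> sets lebesgue" "S \<subseteq> \<Omega>"
  shows "integrable lebesgue (\<lambda>x. indicator S x * (cmod (f x))\<^sup>2)"
proof -
  have "integrable lebesgue (\<lambda>x. indicator \<Omega> x *\<^sub>R (cmod (f x))\<^sup>2)"
    using f S(2) unfolding in_L2_def by (simp add: integrable_restrict_space)
  from integrable_mult_indicator[OF S(1) this] show ?thesis
    by (rule Bochner_Integration.integrable_cong[THEN iffD1, rotated 2]) (use S(3) in \<open>auto simp: indicator_def\<close>)
qed

lemma L2_norm_sq_mono:
  assumes "in_L2 \<Omega> f" "S \<in> sets lebesgue" "T \<in> sets lebesgue" "\<Omega> \<in> sets lebesgue" "S \<subseteq> T" "T \<subseteq> \<Omega>"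
  shows "(L2_norm S f)\<^sup>2 \<le> (L2_norm T f)\<^sup>2"
  unfolding L2_norm_sq[OF assms(2)] L2_norm_sq[OF assms(3)]
proof (rule integral_mono)
  show "integrable lebesgue (\<lambda>x. indicator S x * (cmod (f x))\<^sup>2)" "integrable lebesgue (\<lambda>x. indicator T x * (cmod (f x))\<^sup>2)"
    using assms by (auto intro!: in_L2_integrable[OF assms(1)])
qed (use assms(5) in \<open>auto simp: indicator_def\<close>)

lemma borel_rep_L2:
  assumes f: "in_L2 \<Omega> f" and r: "borel_rep K f f0" and K: "compact K" "K \<subseteq> \<Omega>" and O: "open \<Omega>"
  shows "integrable lborel (\<lambda>x. (cmod (f0 x))\<^sup>2)"
    and "S \<in> sets borel \<Longrightarrow> S \<subseteq> K \<Longrightarrow> (LINT x|lborel. indicator S x * (cmod (f0 x))\<^sup>2) = (L2_norm S f)\<^sup>2"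
proof -
  have KO: "K \<in> sets lebesgue" "\<Omega> \<in> sets lebesgue" using K O by (auto simp: compact_imp_closed)
  have [measurable]: "f0 \<in> borel_measurable borel" using r unfolding borel_rep_def by auto
  have ae: "AE x in lebesgue. x \<in> K \<longrightarrow> f0 x = f x" and z: "x \<notin> K \<Longrightarrow> f0 x = 0" for x
    using r unfolding borel_rep_def by (auto simp: AE_completion)
  have m: "(\<lambda>x. (cmod (f0 x))\<^sup>2) \<in> borel_measurable lborel" by measurable
  have "integrable lebesgue (\<lambda>x. (cmod (f0 x))\<^sup>2)"
    by (rule integrable_cong_AE_imp[OF in_L2_integrable[OF f KO K(2)] measurable_completion[OF m]])
       (use ae in eventually_elim, auto simp: z indicator_def)
  then show "integrable lborel (\<lambda>x. (cmod (f0 x))\<^sup>2)" using integrable_completion[OF m] by simp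
  assume S: "S \<in> sets borel" "S \<subseteq> K"
  have m: "(\<lambda>x. indicator S x * (cmod (f0 x))\<^sup>2) \<in> borel_measurable lborel" using S(1) by measurable
  have "(LINT x|lborel. indicator S x * (cmod (f0 x))\<^sup>2) = (LINT x|lebesgue. indicator S x * (cmod (f0 x))\<^sup>2)"
    using integral_completion[OF m] by simp
  also have "\<dots> = (LINT x|lebesgue. indicator S x * (cmod (f x))\<^sup>2)"
  proof (rule integral_cong_AE[OF measurable_completion[OF m]])
    show "(\<lambda>x. indicator S x * (cmod (f x))\<^sup>2) \<in> borel_measurable lebesgue"
      using in_L2_integrable[OF f _ KO(2), of S] S K by (intro borel_measurable_integrable) auto
    show "AE x in lebesgue. indicator S x * (cmod (f0 x))\<^sup>2 = indicator S x * (cmod (f x))\<^sup>2"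
      using ae by eventually_elim (use S(2) in \<open>auto simp: indicator_def\<close>)
  qed
  also have "\<dots> = (L2_norm S f)\<^sup>2" using L2_norm_sq[of S f] S(1) by simp
  finally show "(LINT x|lborel. indicator S x * (cmod (f0 x))\<^sup>2) = (L2_norm S f)\<^sup>2" .
qed

text \<open>A Borel version of the squared modulus, extended by zero. Taking its absolute value
  makes it nonnegative at every point, as the core estimate demands of \<open>z\<close>.\<close>

lemma L2_norm_sq_density:
  assumes f: "in_L2 \<Omega> f" and O: "open \<Omega>"
  obtains z where "integrable lborel z" "\<forall>x. z x \<ge> 0" "AE x in lborel. x \<in> \<Omega> \<longrightarrow> z x = (cmod (f x))\<^sup>2"
    "(LINT x|lborel. z x) = (L2_norm \<Omega> f)\<^sup>2"
proof -
  have Om: "\<Omega> \<in> sets lebesgue" using O by simp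
  have i: "integrable lebesgue (\<lambda>x. indicator \<Omega> x * (cmod (f x))\<^sup>2)" by (rule in_L2_integrable[OF f Om Om]) simp
  obtain p where p: "p \<in> borel_measurable lborel" "AE x in lborel. indicator \<Omega> x * (cmod (f x))\<^sup>2 = p x"
    using completion_ex_borel_measurable_real[OF borel_measurable_integrable[OF i]] by blast
  have m: "(\<lambda>x. \<bar>p x\<bar>) \<in> borel_measurable lborel" using p(1) by measurable
  have ae: "AE x in lborel. indicator \<Omega> x * (cmod (f x))\<^sup>2 = \<bar>p x\<bar>" using p(2) by eventually_elim (metis abs_of_nonneg indicator_pos_le mult_nonneg_nonneg zero_le_power2)
  then have ae': "AE x in lebesgue. indicator \<Omega> x * (cmod (f x))\<^sup>2 = \<bar>p x\<bar>" by (rule AE_completion)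
  show ?thesis
  proof (rule that[of "\<lambda>x. \<bar>p x\<bar>"])
    have "integrable lebesgue (\<lambda>x. \<bar>p x\<bar>)" by (rule integrable_cong_AE_imp[OF i measurable_completion[OF m]]) (use ae' in eventually_elim, simp)
    then show "integrable lborel (\<lambda>x. \<bar>p x\<bar>)" using integrable_completion[OF m] by simp
    show "AE x in lborel. x \<in> \<Omega> \<longrightarrow> \<bar>p x\<bar> = (cmod (f x))\<^sup>2" using ae by eventually_elim (auto simp: indicator_def)
    show "(LINT x|lborel. \<bar>p x\<bar>) = (L2_norm \<Omega> f)\<^sup>2"
      unfolding L2_norm_sq[OF Om] integral_completion[OF m, symmetric]
      by (rule integral_cong_AE[OF measurable_completion[OF m] borel_measurable_integrable[OF i]]) (use ae' in eventually_elim, simp)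
  qed simp
qed

text \<open>The margin \<open>e\<close> keeps the support of each small kernel centred in the
  smaller ball inside the larger one. There the representatives agree almost everywhere with the
  originals, and the translated kernel is a test function on \<open>\<Omega>\<close>.\<close>

lemma weak_deriv_wjet:
  fixes \<psi> :: "real ^ 'n::finite \<Rightarrow> complex"
  assumes O: "open \<Omega>" and K: "cball ctr (\<rho> + e) \<subseteq> \<Omega>" and e: "e > 0"
    and l: "in_L2 \<Omega> \<psi>" "\<And>i. in_L2 \<Omega> (G1 i)" "\<And>i j. in_L2 \<Omega> (G2 i j)"
    and G: "\<And>i. has_weak_deriv \<Omega> [i] \<psi> (G1 i)" "\<And>i j. has_weak_deriv \<Omega> [i, j] \<psi> (G2 i j)"
    and r: "borel_rep (cball ctr (\<rho> + e)) \<psi> f" "\<And>i. borel_rep (cball ctr (\<rho> + e)) (G1 i) (F i)"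
      "\<And>i j. borel_rep (cball ctr (\<rho> + e)) (G2 i j) (FF i j)"
  shows "wjet_complex ctr \<rho> e f F FF"
proof -
  let ?K = "cball ctr (\<rho> + e)"
  have KK: "compact ?K" by simp
  have int: "integrable lborel (\<lambda>x. Re (u0 x))" "integrable lborel (\<lambda>x. Im (u0 x))"
    "integrable lborel (\<lambda>x. (Re (u0 x))\<^sup>2)" "integrable lborel (\<lambda>x. (Im (u0 x))\<^sup>2)"
    if u: "in_L2 \<Omega> u" "borel_rep ?K u u0" for u u0
  proof -
    have i: "integrable lborel u0" using u(2) unfolding borel_rep_def by simp
    then have [measurable]: "u0 \<in> borel_measurable borel" by auto
    show "integrable lborel (\<lambda>x. Re (u0 x))" "integrable lborel (\<lambda>x. Im (u0 x))" using i by auto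
    have sq: "integrable lborel (\<lambda>x. (cmod (u0 x))\<^sup>2)" by (rule borel_rep_L2(1)[OF u KK K O])
    show "integrable lborel (\<lambda>x. (Re (u0 x))\<^sup>2)" "integrable lborel (\<lambda>x. (Im (u0 x))\<^sup>2)"
      by (rule Bochner_Integration.integrable_bound[OF sq]; simp add: cmod_power2)+
  qed
  have conv: "(conv (R i) (\<lambda>x. Re (f x)) x = conv r (\<lambda>x. Re (F i x)) x \<and> conv (RR i j) (\<lambda>x. Re (f x)) x = conv r (\<lambda>x. Re (FF i j x)) x)
     \<and> (conv (R i) (\<lambda>x. Im (f x)) x = conv r (\<lambda>x. Im (F i x)) x \<and> conv (RR i j) (\<lambda>x. Im (f x)) x = conv r (\<lambda>x. Im (FF i j x)) x)"
    if m: "mollifier \<epsilon> r" "\<epsilon> < e" "has_grad r R" "\<forall>i. has_grad (R i) (RR i)" "x \<in> cball ctr \<rho>" for r \<epsilon> R RR x i j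
  proof -
    note md = mollifierD[OF m(1)]
    have gi: "has_grad (R i) (RR i)" for i using m(4) by blast
    obtain P PP where P: "has_grad r P" "\<And>i. has_grad (P i) (PP i)" "\<And>i j. bumpy (PP i j)" "\<And>i j x. PP i j x = PP j i x"
      using bumpy_jet[OF md(1)] by blast
    have RP: "R i = P i" for i by (rule ext) (rule has_grad_unique[OF m(3) P(1)])
    have RRP: "RR i j = PP i j" for i j
      by (rule ext) (rule has_grad_unique[OF gi P(2)[of i, folded RP]])
    have op: "open (- cball (0::real^'n) \<epsilon>)" by (simp add: open_Compl)
    have z1: "R i z = 0" if "norm z > \<epsilon>" for i z
      by (rule has_grad_zero_open[OF m(3) op]) (use md(3) that in auto)
    have z2: "RR i j z = 0" if "norm z > \<epsilon>" for i j z
      by (rule has_grad_zero_open[OF gi op]) (use z1 that in auto)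
    have sub: "cball x \<epsilon> \<subseteq> ?K" using m(2,5) cball_subset_cball_iff[of x \<epsilon> ctr "\<rho> + e"] by (auto simp: dist_commute)
    have c1: "continuous_on UNIV (R i)" by (rule has_grad_continuous[OF gi])
    have c2: "continuous_on UNIV (RR i j)" unfolding RRP by (rule bumpy_continuous[OF P(3)])
    have e1: "iterated_partial [i] (\<lambda>y. complex_of_real (r (x - y))) = (\<lambda>y. (-1) ^ length [i] * complex_of_real (R i (x - y)))"
      using iterated_partial_reflect(2)[OF m(3) gi] by simp
    \<comment> \<open>\<open>iterated_partial_reflect\<close> returns the indices exchanged; the
      symmetric Hessian of the kernel puts them back.\<close>
    have e2: "iterated_partial [i, j] (\<lambda>y. complex_of_real (r (x - y))) = (\<lambda>y. (-1) ^ length [i, j] * complex_of_real (RR i j (x - y)))"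
      using iterated_partial_reflect(3)[OF m(3) gi] P(4)[of j i] unfolding RRP by simp
    show ?thesis
      using weak_deriv_conv[OF G(1) O KK K r(1) r(2) md(1) md(3) sub c1 z1 e1]
        weak_deriv_conv[OF G(2) O KK K r(1) r(3) md(1) md(3) sub c2 z2 e2] by simp
  qed
  show ?thesis unfolding wjet_complex_def wjet_def
    by (intro conjI allI impI int[OF l(1) r(1)] int[OF l(2) r(2)] int[OF l(3) r(3)];
        rule conv[THEN conjunct1, THEN conjunct1] conv[THEN conjunct1, THEN conjunct2] conv[THEN conjunct2, THEN conjunct1] conv[THEN conjunct2, THEN conjunct2]; assumption)
qed


text \<open>Three summands are squared at the cost of a factor 3, and Cauchy-Schwarz on the sum of
  the \<open>s i\<close> contributes the dimension.\<close>

lemma square_le_weighted_squares: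
  fixes s :: "'n::finite \<Rightarrow> real"
  assumes "0 \<le> Q" "Q \<le> K2 * p + q + K1 * (\<Sum>i\<in>UNIV. s i)"
  shows "Q\<^sup>2 \<le> 3 * (K2\<^sup>2 + 1 + real CARD('n) * K1\<^sup>2) * (p\<^sup>2 + (\<Sum>i\<in>UNIV. (s i)\<^sup>2) + q\<^sup>2)"
proof -
  define S where "S = (\<Sum>i\<in>UNIV. (s i)\<^sup>2)"
  have S0: "S \<ge> 0" unfolding S_def by (simp add: sum_nonneg)
  have three: "(u + v + w)\<^sup>2 \<le> 3 * (u\<^sup>2 + v\<^sup>2 + w\<^sup>2)" for u v w :: real
    using zero_le_power2[of "u - v"] zero_le_power2[of "v - w"] zero_le_power2[of "u - w"] by (simp add: power2_eq_square algebra_simps)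
  have "Q\<^sup>2 \<le> (K2 * p + q + K1 * (\<Sum>i\<in>UNIV. s i))\<^sup>2" using assms by (simp add: power_mono)
  also have "\<dots> \<le> 3 * ((K2 * p)\<^sup>2 + q\<^sup>2 + (K1 * (\<Sum>i\<in>UNIV. s i))\<^sup>2)" by (rule three)
  also have "\<dots> \<le> 3 * (K2\<^sup>2 * p\<^sup>2 + q\<^sup>2 + K1\<^sup>2 * (real CARD('n) * S))"
  proof -
    have "(\<Sum>i\<in>UNIV. 1 * s i)\<^sup>2 \<le> (\<Sum>i\<in>(UNIV::'n set). 1\<^sup>2) * (\<Sum>i\<in>UNIV. (s i)\<^sup>2)" by (rule Cauchy_Schwarz_ineq_sum)
    then have "(\<Sum>i\<in>UNIV. s i)\<^sup>2 \<le> real CARD('n) * S" unfolding S_def by simp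
    then have "K1\<^sup>2 * (\<Sum>i\<in>UNIV. s i)\<^sup>2 \<le> K1\<^sup>2 * (real CARD('n) * S)" by (rule mult_left_mono) simp
    then show ?thesis by (simp add: power_mult_distrib)
  qed
  also have "\<dots> \<le> 3 * (K2\<^sup>2 + 1 + real CARD('n) * K1\<^sup>2) * (p\<^sup>2 + S + q\<^sup>2)"
  proof -
    have "0 \<le> K2\<^sup>2 * S" "0 \<le> K2\<^sup>2 * q\<^sup>2" "0 \<le> p\<^sup>2" "0 \<le> real CARD('n) * K1\<^sup>2 * p\<^sup>2" "0 \<le> real CARD('n) * K1\<^sup>2 * q\<^sup>2" using S0 by simp_all
    then show ?thesis using S0 by (simp add: algebra_simps)
  qed
  finally show ?thesis unfolding S_def .
qed

theorem theorem17:
  fixes \<theta>\<^sub>1 \<theta>\<^sub>2 D\<^sub>0 R \<delta> K\<^sub>V \<beta> b_norm c_norm :: real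
  assumes "\<theta>\<^sub>1 \<ge> 1" and "\<theta>\<^sub>2 \<ge> 0"
    and "D\<^sub>0 > 0" and "R > 0" and "0 < \<delta>" and "\<delta> < 2 * R" and "K\<^sub>V \<ge> 0" and "\<beta> \<ge> 0"
    and "1 - 33 * exp 1 * real CARD('n::finite) * R * \<theta>\<^sub>1 ^ 6 * \<theta>\<^sub>2 > 0"
  shows "\<exists>C>0. \<forall>(A :: real ^ 'n \<Rightarrow> real ^ 'n ^ 'n) (b :: real ^ 'n \<Rightarrow> complex ^ 'n)
      (c :: real ^ 'n \<Rightarrow> complex).
    admissible_coeffs \<theta>\<^sub>1 \<theta>\<^sub>2 A b c \<longrightarrow> Linf_norm b = b_norm \<longrightarrow> Linf_norm c = c_norm \<longrightarrow>
    (\<forall>(\<Omega> :: (real ^ 'n) set) x \<Theta> (V :: real ^ 'n \<Rightarrow> real) (\<zeta> :: real ^ 'n \<Rightarrow> complex)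
        (\<psi> :: real ^ 'n \<Rightarrow> complex).
      open \<Omega> \<longrightarrow> x \<in> \<Omega> \<longrightarrow>
      \<Theta> \<in> sets lebesgue \<longrightarrow> \<Theta> \<subseteq> \<Omega> \<longrightarrow> \<Theta> \<subseteq> closure (ball x R) - ball x (\<delta> / 2) \<longrightarrow>
      ball x (2 * exp 1 * \<theta>\<^sub>1 * R + 2 * D\<^sub>0) \<subseteq> \<Omega> \<longrightarrow>
      V \<in> borel_measurable (lebesgue_on \<Omega>) \<longrightarrow> (\<forall>y\<in>\<Omega>. V y \<in> {- K\<^sub>V .. K\<^sub>V}) \<longrightarrow>
      in_L2 \<Omega> \<zeta> \<longrightarrow> in_W2 2 \<Omega> \<psi> \<longrightarrow>
      (AE y in lebesgue_on \<Omega>.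
        cmod (diff_expr \<Omega> A b c \<psi> y) \<le> cmod (complex_of_real (V y) * \<psi> y) + cmod (\<zeta> y)) \<longrightarrow>
      (L2_norm \<Omega> \<psi>)\<^sup>2 / (L2_norm \<Theta> \<psi>)\<^sup>2 \<le> \<beta> \<longrightarrow>
      (L2_norm (ball x \<delta>) \<psi>)\<^sup>2 + \<delta>\<^sup>2 * (L2_norm \<Omega> \<zeta>)\<^sup>2 \<ge> C * (L2_norm \<Theta> \<psi>)\<^sup>2)"
proof -
  define N where "N = real CARD('n)"
  \<comment> \<open>The factor of \<open>square_le_weighted_squares\<close> for the pointwise bound.
    The coefficients enter only through \<open>\<theta>\<^sub>2\<close> and the two norms, so
    \<open>C\<close> can be fixed before \<open>A\<close>, \<open>b\<close> and
    \<open>c\<close>.\<close>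
  define Kc where "Kc = 3 * ((K\<^sub>V + c_norm)\<^sup>2 + 1 + N * (N * \<theta>\<^sub>2 + b_norm)\<^sup>2)"
  have Kc: "Kc > 0" unfolding Kc_def N_def by (intro mult_pos_pos add_nonneg_pos add_pos_nonneg) auto
  obtain k where k: "k > 0" and core: "\<forall>(ctr :: real ^ 'n) a f F FF z e y Om. lip_elliptic \<theta>\<^sub>1 \<theta>\<^sub>2 a \<longrightarrow> wjet_complex ctr (3 * R) e f F FF \<longrightarrow> e > 0 \<longrightarrow>
    integrable lborel z \<longrightarrow> (\<forall>x. z x \<ge> 0) \<longrightarrow>
    (AE x in lborel. x \<in> cball ctr (3 * R) \<longrightarrow> (cmod (\<Sum>i\<in>UNIV. \<Sum>j\<in>UNIV. complex_of_real (a i j x) * FF i j x))\<^sup>2 \<le> Kc * ((cmod (f x))\<^sup>2 + (\<Sum>i\<in>UNIV. (cmod (F i x))\<^sup>2) + z x)) \<longrightarrow>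
    0 \<le> y \<longrightarrow> y \<le> (LINT x|lborel. indicator (ann ctr (\<delta> / 2) R) x * (cmod (f x))\<^sup>2) \<longrightarrow>
    (LINT x|lborel. indicator (cball ctr (3 * R)) x * (cmod (f x))\<^sup>2) \<le> Om \<longrightarrow> Om \<le> \<beta> * y \<longrightarrow>
    k * y \<le> (LINT x|lborel. indicator (cball ctr (3 * \<delta> / 4)) x * (cmod (f x))\<^sup>2) + (LINT x|lborel. z x)"
    using ucp_core[OF assms(1,2,5,6) Kc assms(8), where ?'n='n] by (elim exE conjE) (rule that)
  \<comment> \<open>The core estimate has the norm of \<open>\<zeta>\<close> without a power of
    \<open>\<delta>\<close>; multiplying by the minimum makes the factor
    \<open>\<delta>\<^sup>2\<close> admissible and leaves at most 1 in front of the norm of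
    \<open>\<psi>\<close>.\<close>
  define C where "C = k * min 1 (\<delta>\<^sup>2)"
  have C: "C > 0" unfolding C_def using k assms(5) by simp
  have main: "C * (L2_norm \<Theta> \<psi>)\<^sup>2 \<le> (L2_norm (ball x \<delta>) \<psi>)\<^sup>2 + \<delta>\<^sup>2 * (L2_norm \<Omega> \<zeta>)\<^sup>2"
    if ac: "admissible_coeffs \<theta>\<^sub>1 \<theta>\<^sub>2 A b c" and bn: "Linf_norm b = b_norm" and cn: "Linf_norm c = c_norm"
      and O: "open \<Omega>" and T: "\<Theta> \<in> sets lebesgue" "\<Theta> \<subseteq> closure (ball x R) - ball x (\<delta> / 2)"
      and B: "ball x (2 * exp 1 * \<theta>\<^sub>1 * R + 2 * D\<^sub>0) \<subseteq> \<Omega>"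
      and V: "\<forall>y\<in>\<Omega>. V y \<in> {- K\<^sub>V .. K\<^sub>V}" and zeta: "in_L2 \<Omega> \<zeta>" and psi: "in_W2 2 \<Omega> \<psi>"
      and ineq: "AE y in lebesgue_on \<Omega>. cmod (diff_expr \<Omega> A b c \<psi> y) \<le> cmod (complex_of_real (V y) * \<psi> y) + cmod (\<zeta> y)"
      and ratio: "(L2_norm \<Omega> \<psi>)\<^sup>2 / (L2_norm \<Theta> \<psi>)\<^sup>2 \<le> \<beta>"
    for A :: "real ^ 'n \<Rightarrow> real ^ 'n ^ 'n" and b c \<Omega> x \<Theta> and V :: "real ^ 'n \<Rightarrow> real" and \<zeta> \<psi>
  \<comment> \<open>For norm zero the ratio hypothesis is void, division by 0 giving 0, but the
    claim is trivial. Otherwise the hypothesis can be multiplied out.\<close>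
  proof (cases "L2_norm \<Theta> \<psi> = 0")
    case False
    let ?y = "(L2_norm \<Theta> \<psi>)\<^sup>2"
    have R: "R > 0" by fact
    \<comment> \<open>Radius \<open>3 * R\<close> is used by the estimates and a further
      \<open>R\<close> is the margin for mollification; \<open>exp 1 \<ge> 2\<close> makes both fit
      into the given ball.\<close>
    have "4 * R < 2 * exp 1 * \<theta>\<^sub>1 * R + 2 * D\<^sub>0"
    proof -
      have "2 * 1 \<le> exp 1 * \<theta>\<^sub>1" using assms(1) exp_ge_add_one_self[of "1::real"] by (intro mult_mono) auto
      then have "2 * R \<le> exp 1 * \<theta>\<^sub>1 * R" using R by (intro mult_right_mono) auto
      then show ?thesis using assms(3) by linarith
    qed
    then have K: "cball x (3 * R + R) \<subseteq> \<Omega>" using B by (auto simp: subset_eq)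
    have KK: "compact (cball x (3 * R + R))" by simp
    obtain G1 G2 where G: "\<forall>i. in_L2 \<Omega> (G1 i)" "\<forall>i. has_weak_deriv \<Omega> [i] \<psi> (G1 i)"
      "\<forall>i j. in_L2 \<Omega> (G2 i j)" "\<forall>i j. has_weak_deriv \<Omega> [i, j] \<psi> (G2 i j)"
      and dx: "AE y in lborel. y \<in> \<Omega> \<longrightarrow> cmod (\<Sum>i\<in>UNIV. \<Sum>j\<in>UNIV. complex_of_real (A y $ i $ j) * G2 i j y)
        \<le> cmod (diff_expr \<Omega> A b c \<psi> y) + (real CARD('n) * \<theta>\<^sub>2 + Linf_norm b) * (\<Sum>i\<in>UNIV. cmod (G1 i y)) + Linf_norm c * cmod (\<psi> y)"
      by (rule diff_expr_bound[OF ac O psi]) (rule that)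
    note G1 = G(1,2)[rule_format] and G2 = G(3,4)[rule_format] and dx = dx[folded N_def, unfolded bn cn]
    have p2: "in_L2 \<Omega> \<psi>" using psi unfolding in_W2_def by blast
    have li: "locally_integrable \<Omega> \<psi>" "locally_integrable \<Omega> (G1 i)" "locally_integrable \<Omega> (G2 i j)" for i j
      using G1(2)[of i] G2(2)[of i j] unfolding has_weak_deriv_def by auto
    obtain f where f: "borel_rep (cball x (3 * R + R)) \<psi> f" by (rule locally_integrable_rep[OF li(1) KK K])
    have "\<exists>u. borel_rep (cball x (3 * R + R)) (G1 i) u" for i
      by (rule locally_integrable_rep[OF li(2) KK K]) (rule exI)
    then obtain F where F: "\<And>i. borel_rep (cball x (3 * R + R)) (G1 i) (F i)" by metis
    have "\<exists>u. borel_rep (cball x (3 * R + R)) (G2 i j) u" for i j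
      by (rule locally_integrable_rep[OF li(3) KK K]) (rule exI)
    then obtain FF where FF: "\<And>i j. borel_rep (cball x (3 * R + R)) (G2 i j) (FF i j)" by metis
    note wj = weak_deriv_wjet[OF O K R p2 G1(1) G2(1) G1(2) G2(2) f F FF]
    obtain z where z: "integrable lborel z" "\<forall>y. z y \<ge> 0" "AE y in lborel. y \<in> \<Omega> \<longrightarrow> z y = (cmod (\<zeta> y))\<^sup>2"
      "(LINT y|lborel. z y) = (L2_norm \<Omega> \<zeta>)\<^sup>2"
      by (rule L2_norm_sq_density[OF zeta O])
    have ae: "AE y in lborel. y \<in> cball x (3 * R) \<longrightarrow> (cmod (\<Sum>i\<in>UNIV. \<Sum>j\<in>UNIV. complex_of_real (A y $ i $ j) * FF i j y))\<^sup>2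
      \<le> Kc * ((cmod (f y))\<^sup>2 + (\<Sum>i\<in>UNIV. (cmod (F i y))\<^sup>2) + z y)"
    proof -
      have "AE y in lebesgue. y \<in> \<Omega> \<longrightarrow> cmod (diff_expr \<Omega> A b c \<psi> y) \<le> cmod (complex_of_real (V y) * \<psi> y) + cmod (\<zeta> y)"
        using ineq O by (subst (asm) AE_restrict_space_iff) auto
      then have "AE y in lborel. y \<in> \<Omega> \<longrightarrow> cmod (diff_expr \<Omega> A b c \<psi> y) \<le> cmod (complex_of_real (V y) * \<psi> y) + cmod (\<zeta> y)"
        by (simp only: AE_completion_iff)
      moreover have "AE y in lborel. y \<in> cball x (3 * R + R) \<longrightarrow> f y = \<psi> y" using f unfolding borel_rep_def by blast
      moreover have "AE y in lborel. \<forall>i. y \<in> cball x (3 * R + R) \<longrightarrow> F i y = G1 i y"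
        unfolding AE_all_countable using F unfolding borel_rep_def by blast
      moreover have "AE y in lborel. \<forall>i j. y \<in> cball x (3 * R + R) \<longrightarrow> FF i j y = G2 i j y"
        unfolding AE_all_countable using FF unfolding borel_rep_def by blast
      ultimately show ?thesis using dx z(3)
      proof eventually_elim
        case (elim y)
        show ?case
        proof
          assume "y \<in> cball x (3 * R)"
          then have y: "y \<in> cball x (3 * R + R)" "y \<in> \<Omega>" using K R by auto
          have eq: "f y = \<psi> y" "F i y = G1 i y" "FF i j y = G2 i j y" "z y = (cmod (\<zeta> y))\<^sup>2" for i j
            using elim y by blast+
          have "cmod (complex_of_real (V y) * \<psi> y) \<le> K\<^sub>V * cmod (\<psi> y)"
            using V y(2) by (auto simp: norm_mult abs_le_iff intro!: mult_right_mono)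
          then have "cmod (\<Sum>i\<in>UNIV. \<Sum>j\<in>UNIV. complex_of_real (A y $ i $ j) * G2 i j y)
            \<le> (K\<^sub>V + c_norm) * cmod (\<psi> y) + cmod (\<zeta> y) + (N * \<theta>\<^sub>2 + b_norm) * (\<Sum>i\<in>UNIV. cmod (G1 i y))"
            using elim(1)[rule_format, OF y(2)] elim(5)[rule_format, OF y(2)] unfolding distrib_right[of "K\<^sub>V"] by linarith
          from square_le_weighted_squares[OF norm_ge_zero this]
          show "(cmod (\<Sum>i\<in>UNIV. \<Sum>j\<in>UNIV. complex_of_real (A y $ i $ j) * FF i j y))\<^sup>2
            \<le> Kc * ((cmod (f y))\<^sup>2 + (\<Sum>i\<in>UNIV. (cmod (F i y))\<^sup>2) + z y)"
            unfolding eq Kc_def N_def .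
        qed
      qed
    qed
    note rep = borel_rep_L2(2)[OF p2 f KK K O]
    note mono = L2_norm_sq_mono[OF p2, where ?T=\<Omega>]
    have Om: "\<Omega> \<in> sets lebesgue" using O by simp
    have sub: "ann x (\<delta> / 2) R \<subseteq> cball x (3 * R + R)" "cball x (3 * R) \<subseteq> cball x (3 * R + R)" "cball x (3 * \<delta> / 4) \<subseteq> cball x (3 * R + R)"
      "cball x (3 * \<delta> / 4) \<subseteq> ball x \<delta>" "ball x \<delta> \<subseteq> cball x (3 * R + R)"
      using R assms(5,6) unfolding ann_def by (auto simp: dist_norm norm_minus_commute)
    have annm: "ann x (\<delta> / 2) R \<in> sets borel" by (simp add: ann_compact compact_imp_closed)
    have "\<Theta> \<subseteq> ann x (\<delta> / 2) R" using T(2) R unfolding ann_def by (auto simp: dist_norm norm_minus_commute not_less)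
    then have y1: "?y \<le> (LINT y|lborel. indicator (ann x (\<delta> / 2) R) y * (cmod (f y))\<^sup>2)"
      unfolding rep[OF annm sub(1)] using annm sub(1) K by (intro L2_norm_sq_mono[OF p2 T(1) _ Om]) auto
    have y2: "(LINT y|lborel. indicator (cball x (3 * R)) y * (cmod (f y))\<^sup>2) \<le> (L2_norm \<Omega> \<psi>)\<^sup>2"
      using sub(2) K Om by (subst rep[OF _ sub(2)]) (auto intro!: L2_norm_sq_mono[OF p2])
    have y3: "(LINT y|lborel. indicator (cball x (3 * \<delta> / 4)) y * (cmod (f y))\<^sup>2) \<le> (L2_norm (ball x \<delta>) \<psi>)\<^sup>2"
      using sub(4,5) K Om by (subst rep[OF _ sub(3)]) (auto intro!: L2_norm_sq_mono[OF p2])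
    have y4: "(L2_norm \<Omega> \<psi>)\<^sup>2 \<le> \<beta> * ?y" using ratio False by (simp add: divide_le_eq)
    have "k * ?y \<le> (LINT y|lborel. indicator (cball x (3 * \<delta> / 4)) y * (cmod (f y))\<^sup>2) + (LINT y|lborel. z y)"
      by (rule core[rule_format, OF admissible_lip_elliptic[OF ac assms(1)] wj R z(1) _ _ _ y1 y2 y4])
         (use z(2) ae in \<open>auto\<close>)
    then have ky: "k * ?y \<le> (L2_norm (ball x \<delta>) \<psi>)\<^sup>2 + (L2_norm \<Omega> \<zeta>)\<^sup>2" using y3 z(4) by simp
    define m where "m = min 1 (\<delta>\<^sup>2)"
    have m: "0 \<le> m" "m \<le> 1" "m \<le> \<delta>\<^sup>2" unfolding m_def by auto
    have "C * ?y = m * (k * ?y)" unfolding C_def m_def by simp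
    also have "\<dots> \<le> m * ((L2_norm (ball x \<delta>) \<psi>)\<^sup>2 + (L2_norm \<Omega> \<zeta>)\<^sup>2)" using ky m(1) by (rule mult_left_mono)
    also have "\<dots> \<le> 1 * (L2_norm (ball x \<delta>) \<psi>)\<^sup>2 + \<delta>\<^sup>2 * (L2_norm \<Omega> \<zeta>)\<^sup>2"
      unfolding distrib_left using m by (intro add_mono mult_right_mono) auto
    finally show ?thesis by simp
  qed simp
  show ?thesis
    by (rule exI[of _ C], intro conjI allI impI C main; assumption)
qed

end
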